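(* Let $A\in\{0,1\}^{m\times n}$ be generated by the bipartite stochastic block model described in the context, with $k$ left clusters, $k$ right clusters $V_1,\dots,V_k$, edge probabilities $p,q\in[0,0.5]$, $\sigma^2=2\max\{p(1-p),q(1-q)\}$, $\Delta_V=\min_{r\ne s}|V_r\bigtriangleup V_s|$, and $w_{\min}$ the minimum relative size of a left cluster. If $$\frac{(p-q)^2}{\sigma^2}\ge\tilde\Omega\Big(\frac{k(m+n)}{w_{\min}\,m\,\Delta_V}\Big)\qquad\text{and}\qquad \sigma^2\ge\frac{\log^6 n}{n}+\frac1m,$$ then the algorithm Clustering (defined in the context), run on input $A$, achieves exact clustering of the $m$ rows (left vertices) with high probability; that is, its output $\hat{\mathcal C}:[m]\to[k]$ equals the true labeling $\mathcal C$ of the left vertices up to a permutation of the label set $[k]$. Explicitly: for every constant $C>0$ there is a constant $K=K(C)$ such that whenever $\frac{(p-q)^2}{\sigma^2}\ge K\log^K(m+n+1)\,\frac{k(m+n)}{w_{\min}m\Delta_V}$ and $\sigma^2\ge\frac{\log^6 n}{n}+\frac1m$, exact clustering holds with probability at least $1-Km^{-C}$.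
   Context: Model (B-SBM). There are $m$ left vertices, partitioned into clusters $U_1,\dots,U_k$ with $|U_r|=w_r m$, $w_r>0$, $\sum_r w_r=1$, $w_{\min}=\min_r w_r$, and $n$ right vertices with right clusters $V_1,\dots,V_k\subseteq[n]$. Write $\mathcal C:[m]\to[k]$ for the true labeling, $\mathcal C(i)=r$ iff $i\in U_r$. $A\in\{0,1\}^{m\times n}$ is the biadjacency matrix; its entries are independent, and for $i\in U_r$, $A_{i,j}\sim\mathrm{Bernoulli}(\mu_{r,j})$ with $\mu_{r,j}=p$ if $j\in V_r$ and $\mu_{r,j}=q$ otherwise. The notation $\tilde\Omega$ hides factors polylogarithmic in $m,n$, and "with high probability" means with probability at least $1-O(m^{-C})$ for a large constant $C$. Procedure Centers. Input: a binary matrix $B$ with $n$ columns. Let $B^{(k)}$ be its best rank-$k$ approximation (truncated $k$-SVD). Apply $k$-means to the rows of $B^{(k)}$, i.e. find a partition of the row indices into clusters $\hat U_1,\dots,\hat U_k$ minimizing the sum of squared Euclidean distances of the rows of $B^{(k)}$ to the mean of the rows of $B^{(k)}$ in their cluster. Output $\hat\mu_r=\frac{1}{|\hat U_r|}\sum_{i\in\hat U_r}B(i)$, $1\le r\le k$ (averages of rows of the original matrix $B$). Procedure Assignment. Input: a binary matrix $B$ with $n$ columns and vectors $\hat\mu_1,\dots,\hat\mu_k$. Output: the labeling $i\mapsto\arg\min_{r\in[k]}\|B(i)-\hat\mu_r\|_2$. Algorithm Clustering. Input: $A\in\{0,1\}^{m\times n}$. (1) Split (the rows of) $A$ into two subsets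 $A_1,A_2$ of the same size. (2) Run Centers on $A_1$ and use the resulting centers in Assignment to label the rows of $A_2$. (3) Run Centers on $A_2$ and use the resulting centers in Assignment to label the rows of $A_1$. (4) Match the labels used for $A_2$ and $A_1$ by matching the two sets of estimated centers (each center of one set with the nearest center of the other). (5) Output the combined labeling $\hat{\mathcal C}:[m]\to[k]$. *)

theory Defs
  imports
    "HOL-Probability.Probability"
    "Jordan_Normal_Form.DL_Rank_Submatrix"
    "Jordan_Normal_Form.Gram_Schmidt"
begin

unbundle no vec_syntax
unbundle no inner_syntax

section \<open>Euclidean and Frobenius norms\<close>

definition vnorm :: "real vec \<Rightarrow> real" where
  "vnorm v = sqrt (v \<bullet> v)"

definition frob_norm :: "real mat \<Rightarrow> real" where
  "frob_norm X = sqrt (\<Sum>i<dim_row X. \<Sum>j<dim_col X. (X $$ (i, j))\<^sup>2)"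


section \<open>The bipartite stochastic block model\<close>

text \<open>
  Vertices and labels are numbered from 0. The left clusters are given by the labeling
  \<open>c\<close>, so that \<open>U\<^sub>r\<close> is \<open>left_cluster m c r\<close>; the right clusters
  \<open>V 0, \<dots>, V (k - 1)\<close> are arbitrary subsets of \<open>{..<n}\<close>.
\<close>

definition left_cluster :: "nat \<Rightarrow> (nat \<Rightarrow> nat) \<Rightarrow> nat \<Rightarrow> nat set" where
  "left_cluster m c r = {i. i < m \<and> c i = r}"

definition rel_size :: "nat \<Rightarrow> (nat \<Rightarrow> nat) \<Rightarrow> nat \<Rightarrow> real" where
  "rel_size m c r = real (card (left_cluster m c r)) / real m"

definition w_min :: "nat \<Rightarrow> nat \<Rightarrow> (nat \<Rightarrow> nat) \<Rightarrow> real" where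
  "w_min k m c = Min (rel_size m c ` {..<k})"

definition sigma2 :: "real \<Rightarrow> real \<Rightarrow> real" where
  "sigma2 p q = 2 * max (p * (1 - p)) (q * (1 - q))"

text \<open>
  As a minimum in \<open>ennreal\<close>, the separation is \<open>\<infinity>\<close> when \<open>k = 1\<close> (no pair
  \<open>r \<noteq> s\<close>); dividing a positive number by it gives \<open>0\<close> in that case and
  \<open>\<infinity>\<close> when two right clusters coincide.
\<close>

definition Delta_V :: "nat \<Rightarrow> (nat \<Rightarrow> nat set) \<Rightarrow> ennreal" where
  "Delta_V k V = (INF (r, s) \<in> {(r, s). r < k \<and> s < k \<and> r \<noteq> s}. of_nat (card (sym_diff (V r) (V s))))"

definition edge_prob :: "(nat \<Rightarrow> nat) \<Rightarrow> (nat \<Rightarrow> nat set) \<Rightarrow> real \<Rightarrow> real \<Rightarrow> nat \<Rightarrow> nat \<Rightarrow> real" where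
  "edge_prob c V p q i j = (if j \<in> V (c i) then p else q)"

definition bsbm ::
  "nat \<Rightarrow> nat \<Rightarrow> (nat \<Rightarrow> nat) \<Rightarrow> (nat \<Rightarrow> nat set) \<Rightarrow> real \<Rightarrow> real \<Rightarrow> real mat pmf" where
  "bsbm m n c V p q =
     map_pmf (\<lambda>e. mat m n (\<lambda>ij. of_bool (e ij)))
       (Pi_pmf ({..<m} \<times> {..<n}) False (\<lambda>(i, j). bernoulli_pmf (edge_prob c V p q i j)))"


section \<open>The clustering algorithm\<close>

text \<open>
  Each procedure is a relation between input and possible output: every way of breaking ties in
  the minimizations is allowed.
\<close>

text \<open>By Eckart--Young, the best rank-\<open>k\<close> approximations in Frobenius norm are exactly
  the \<open>k\<close>-truncated singular value decompositions.\<close>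

definition best_rank_approx :: "nat \<Rightarrow> real mat \<Rightarrow> real mat \<Rightarrow> bool" where
  "best_rank_approx k B X \<longleftrightarrow>
     is_arg_min (\<lambda>Y. frob_norm (B - Y))
       (\<lambda>Y. Y \<in> carrier_mat (dim_row B) (dim_col B) \<and> vec_space.rank (dim_row B) Y \<le> k) X"

text \<open>A partition of the row indices into \<open>k\<close> clusters is a labeling by
  \<open>{..<k}\<close>; clusters may be empty, and the mean of an empty cluster is the zero vector.\<close>

definition row_mean :: "real mat \<Rightarrow> nat set \<Rightarrow> real vec" where
  "row_mean B I = vec (dim_col B) (\<lambda>j. (\<Sum>i\<in>I. B $$ (i, j)) / real (card I))"

definition label_mean :: "real mat \<Rightarrow> (nat \<Rightarrow> nat) \<Rightarrow> nat \<Rightarrow> real vec" where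
  "label_mean B l r = row_mean B {i. i < dim_row B \<and> l i = r}"

definition kmeans_cost :: "real mat \<Rightarrow> (nat \<Rightarrow> nat) \<Rightarrow> real" where
  "kmeans_cost X l = (\<Sum>i<dim_row X. (vnorm (row X i - label_mean X l (l i)))\<^sup>2)"

definition kmeans :: "nat \<Rightarrow> real mat \<Rightarrow> (nat \<Rightarrow> nat) \<Rightarrow> bool" where
  "kmeans k X l \<longleftrightarrow> is_arg_min (kmeans_cost X) (\<lambda>l. \<forall>i<dim_row X. l i < k) l"

definition centers :: "nat \<Rightarrow> real mat \<Rightarrow> (nat \<Rightarrow> real vec) \<Rightarrow> bool" where
  "centers k B \<mu> \<longleftrightarrow> (\<exists>X l. best_rank_approx k B X \<and> kmeans k X l \<and> (\<forall>r<k. \<mu> r = label_mean B l r))"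

definition nearest :: "nat \<Rightarrow> (nat \<Rightarrow> real vec) \<Rightarrow> real vec \<Rightarrow> nat \<Rightarrow> bool" where
  "nearest k \<mu> v r \<longleftrightarrow> is_arg_min (\<lambda>s. vnorm (v - \<mu> s)) (\<lambda>s. s < k) r"

definition assignment :: "nat \<Rightarrow> real mat \<Rightarrow> (nat \<Rightarrow> real vec) \<Rightarrow> (nat \<Rightarrow> nat) \<Rightarrow> bool" where
  "assignment k B \<mu> l \<longleftrightarrow> (\<forall>i<dim_row B. nearest k \<mu> (row B i) (l i))"

text \<open>
  The rows in \<open>S\<close> form \<open>A1\<close>, the others \<open>A2\<close>; row \<open>t\<close> of
  \<open>submatrix A S UNIV\<close> is row \<open>pick S t\<close> of \<open>A\<close>. The map \<open>\<pi>\<close>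
  sends each center of \<open>A2\<close> to the nearest center of \<open>A1\<close>; it translates the labels of
  the rows of \<open>A1\<close>, which refer to the centers of \<open>A2\<close>, into the labels used
  for \<open>A2\<close>. It is not required to be a bijection.
\<close>

definition clustering :: "nat \<Rightarrow> real mat \<Rightarrow> nat set \<Rightarrow> (nat \<Rightarrow> nat) \<Rightarrow> bool" where
  "clustering k A S c \<longleftrightarrow>
     (let S' = {..<dim_row A} - S; A1 = submatrix A S UNIV; A2 = submatrix A S' UNIV in
      \<exists>\<mu>1 \<mu>2 l1 l2 \<pi>.
        centers k A1 \<mu>1 \<and> assignment k A2 \<mu>1 l2 \<and>
        centers k A2 \<mu>2 \<and> assignment k A1 \<mu>2 l1 \<and>
        (\<forall>s<k. nearest k \<mu>1 (\<mu>2 s) (\<pi> s)) \<and>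
        (\<forall>t<dim_row A1. c (pick S t) = \<pi> (l1 t)) \<and>
        (\<forall>t<dim_row A2. c (pick S' t) = l2 t))"

text \<open>The split is uniformly random; for odd \<open>m\<close> the two parts differ by one row.\<close>

definition random_split :: "nat \<Rightarrow> nat set pmf" where
  "random_split m = pmf_of_set {S. S \<subseteq> {..<m} \<and> card S = m div 2}"

definition exact_clustering :: "nat \<Rightarrow> nat \<Rightarrow> (nat \<Rightarrow> nat) \<Rightarrow> (nat \<Rightarrow> nat) \<Rightarrow> bool" where
  "exact_clustering k m c c' \<longleftrightarrow> (\<exists>\<pi>. \<pi> permutes {..<k} \<and> (\<forall>i<m. c' i = \<pi> (c i)))"


section \<open>Every input has an output\<close>

lemma ex_min_finite:
  fixes f :: "'a \<Rightarrow> real"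
  assumes "finite F" "F \<noteq> {}"
  obtains x where "x \<in> F" "\<And>y. y \<in> F \<Longrightarrow> f x \<le> f y"
  using ex_is_arg_min_if_finite[OF assms, of f] by (auto simp: is_arg_min_linorder)

lemma rank_le_sum_outer:
  fixes f g :: "nat \<Rightarrow> nat \<Rightarrow> real"
  shows "vec_space.rank N (mat N n (\<lambda>(i, j). \<Sum>l<k. f l i * g l j)) \<le> k"
proof (induction k)
  case 0
  have "mat N n (\<lambda>(i, j). \<Sum>l<0. f l i * g l j) = 0\<^sub>m N n" by auto
  then show ?case using vec_space.rank_0I by (metis le_refl)
next
  case (Suc k)
  let ?Y = "mat N n (\<lambda>(i, j). \<Sum>l<k. f l i * g l j)"
  let ?Z = "mat N n (\<lambda>(i, j). f k i * g k j)"
  have "mat N n (\<lambda>(i, j). \<Sum>l<Suc k. f l i * g l j) = ?Y + ?Z" by auto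
  moreover have "vec_space.rank N ?Z \<le> 1"
    by (rule vec_space.rank_le_1_product_entries[of _ N n "f k" "g k"]) auto
  moreover have "vec_space.rank N (?Y + ?Z) \<le> vec_space.rank N ?Y + vec_space.rank N ?Z"
    by (rule vec_space.rank_subadditive[of _ N n]) auto
  ultimately show ?case using Suc by simp
qed

lemma low_rank_factorization:
  assumes Y: "Y \<in> carrier_mat N n" and r: "vec_space.rank N Y \<le> k"
  obtains f g :: "nat \<Rightarrow> nat \<Rightarrow> real"
  where "\<And>i j. i < N \<Longrightarrow> j < n \<Longrightarrow> Y $$ (i, j) = (\<Sum>l<k. f l i * g l j)"
    and "\<And>l i. i < N \<Longrightarrow> \<bar>f l i\<bar> \<le> 1"
    and "\<And>l j. \<bar>g l j\<bar> \<le> (\<Sum>i<N. \<bar>Y $$ (i, j)\<bar>)"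
proof -
  interpret cof_vec_space N "TYPE(real)" .
  have cY: "set (cols Y) \<subseteq> carrier_vec N" using cols_dim Y by blast
  obtain S where S: "finite S" "maximal S (\<lambda>T. T \<subseteq> set (cols Y) \<and> lin_indpt T)"
    using maximal_exists_superset[of "set (cols Y)" "\<lambda>T. T \<subseteq> set (cols Y) \<and> lin_indpt T" "{}"]
      finite_lin_indpt2 by force
  have Ss: "S \<subseteq> set (cols Y)" and Si: "lin_indpt S" using S(2) by (auto simp: maximal_def)
  have cS: "S \<subseteq> carrier_vec N" using Ss cY by blast
  have card: "card S \<le> k" using rank_card_indpt[OF Y S(2)] r by simp
  have span: "v \<in> span S" if v: "v \<in> set (cols Y)" for v
  proof (rule ccontr)
    assume n: "v \<notin> span S"
    have vc: "v \<in> carrier_vec N" using v cY by blast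
    have vS: "v \<notin> S" using n cS span_mem by auto
    have "lin_indpt (insert v S)"
      using lin_dep_iff_in_span[of S v] cS Si vc vS n by auto
    then show False using S(2) v Ss vS by (auto simp: maximal_def)
  qed
  obtain ws where ws: "set ws = S" "distinct ws" using finite_distinct_list[OF S(1)] by blast
  define us where "us = gram_schmidt N ws"
  note gs = gram_schmidt_result[of ws us, unfolded ws(1), OF cS ws(2) Si us_def]
  have len: "length us \<le> k" using gs(4) ws card distinct_card by metis
  let ?R = "length us"
  define nn where "nn l = sqrt (us ! l \<bullet> us ! l)" for l
  have dimu: "dim_vec (us ! l) = N" if "l < ?R" for l
    using gs(3) that nth_mem by (metis carrier_vecD subsetD)
  have ip: "us ! l \<bullet> us ! l' = (\<Sum>i<N. us ! l $ i * us ! l' $ i)" if "l' < ?R" for l l'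
    using dimu[OF that] by (simp add: scalar_prod_def atLeast0LessThan)
  have orth: "us ! l \<bullet> us ! l' = 0 \<longleftrightarrow> l \<noteq> l'" if "l < ?R" "l' < ?R" for l l'
    using corthogonalD[OF gs(2) that] by (simp add: conjugate_vec_def scalar_prod_def)
  have pos: "us ! l \<bullet> us ! l > 0" if "l < ?R" for l
  proof -
    have "us ! l \<bullet> us ! l \<ge> 0" using ip[OF that] by (simp add: sum_nonneg)
    with orth[OF that that] show ?thesis by simp
  qed
  have nn2: "nn l * nn l = us ! l \<bullet> us ! l" and nnpos: "nn l > 0" if "l < ?R" for l
    using pos[OF that] by (auto simp: nn_def)
  define f where "f l i = (if l < ?R then us ! l $ i / nn l else 0)" for l i
  define g where "g l j = (\<Sum>i<N. f l i * Y $$ (i, j))" for l j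
  have f1: "\<bar>f l i\<bar> \<le> 1" if i: "i < N" for l i
  proof (cases "l < ?R")
    case True
    have "(us ! l $ i)\<^sup>2 \<le> (\<Sum>i<N. (us ! l $ i)\<^sup>2)"
      by (rule member_le_sum) (use i in auto)
    then have "(us ! l $ i)\<^sup>2 \<le> (nn l)\<^sup>2"
      using ip[OF True, of l] nn2[OF True] by (simp add: power2_eq_square)
    then have "\<bar>us ! l $ i\<bar> \<le> nn l" using nnpos[OF True] by (simp add: abs_le_square_iff[symmetric])
    then show ?thesis using nnpos[OF True] True by (simp add: f_def)
  qed (simp add: f_def)
  have g1: "\<bar>g l j\<bar> \<le> (\<Sum>i<N. \<bar>Y $$ (i, j)\<bar>)" for l j
  proof -
    have "\<bar>g l j\<bar> \<le> (\<Sum>i<N. \<bar>f l i * Y $$ (i, j)\<bar>)" unfolding g_def by (rule sum_abs)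
    also have "\<dots> \<le> (\<Sum>i<N. \<bar>Y $$ (i, j)\<bar>)"
      by (rule sum_mono) (use f1 in \<open>auto simp: abs_mult intro!: mult_left_le_one_le\<close>)
    finally show ?thesis .
  qed
  have rep: "Y $$ (i, j) = (\<Sum>l<k. f l i * g l j)" if i: "i < N" and j: "j < n" for i j
  proof -
    have "col Y j \<in> set (cols Y)" using j Y by (simp add: cols_def)
    then have "col Y j \<in> span (set us)" using span gs(1) by simp
    then obtain a where "lincomb a (set us) = col Y j"
      using finite_in_span[OF finite_set, of us "col Y j"] gs(3) by auto
    note a = this[symmetric]
    have ent: "Y $$ (i', j) = (\<Sum>l<?R. a (us ! l) * us ! l $ i')" if i': "i' < N" for i'
    proof -
      have "Y $$ (i', j) = col Y j $ i'" using Y i' j by simp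
      also have "\<dots> = (\<Sum>x\<in>set us. a x * x $ i')" unfolding a using i' gs(3) by (rule lincomb_index)
      also have "\<dots> = (\<Sum>l<?R. a (us ! l) * us ! l $ i')"
        by (rule sum.reindex_bij_betw[symmetric]) (rule bij_betw_nth[OF gs(5)], auto)
      finally show ?thesis .
    qed
    have gl: "g l j = a (us ! l) * nn l" if l: "l < ?R" for l
    proof -
      have "g l j = (\<Sum>i<N. \<Sum>l'<?R. a (us ! l') * (us ! l $ i * us ! l' $ i) / nn l)"
        unfolding g_def f_def using l by (simp add: ent sum_distrib_left mult_ac)
      also have "\<dots> = (\<Sum>l'<?R. a (us ! l') * (\<Sum>i<N. us ! l $ i * us ! l' $ i) / nn l)"
        by (subst sum.swap) (simp add: sum_distrib_left sum_divide_distrib)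
      also have "\<dots> = (\<Sum>l'<?R. a (us ! l') * (us ! l \<bullet> us ! l') / nn l)"
        by (rule sum.cong) (auto simp: ip)
      also have "\<dots> = (\<Sum>l'<?R. if l' = l then a (us ! l) * (us ! l \<bullet> us ! l) / nn l else 0)"
        by (rule sum.cong) (use orth l in auto)
      also have "\<dots> = a (us ! l) * (us ! l \<bullet> us ! l) / nn l" using l by simp
      also have "\<dots> = a (us ! l) * nn l" using nn2[OF l] nnpos[OF l] by (simp add: field_simps)
      finally show ?thesis .
    qed
    have "(\<Sum>l<k. f l i * g l j) = (\<Sum>l<?R. f l i * g l j)"
      by (rule sum.mono_neutral_right) (use len in \<open>auto simp: f_def\<close>)
    also have "\<dots> = (\<Sum>l<?R. a (us ! l) * us ! l $ i)"
      by (rule sum.cong) (use nnpos in \<open>auto simp: gl f_def less_imp_neq[symmetric]\<close>)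
    finally show ?thesis using ent[OF i] by simp
  qed
  show thesis using that[OF rep f1 g1] .
qed

lemma best_rank_approx_exists: "\<exists>X. best_rank_approx k B X"
proof -
  define N where "N = dim_row B"
  define n where "n = dim_col B"
  define P where "P Y \<longleftrightarrow> Y \<in> carrier_mat N n \<and> vec_space.rank N Y \<le> k" for Y :: "real mat"
  define M where "M fg = mat N n (\<lambda>(i, j). \<Sum>l<k. fg (l, i, True) * fg (l, j, False))"
    for fg :: "nat \<times> nat \<times> bool \<Rightarrow> real"
  define R where "R = 1 + real N * (2 * frob_norm B)"
  define box where "box = PiE UNIV (\<lambda>_ :: nat \<times> nat \<times> bool. {-R..R})"
  have PM: "P (M fg)" for fg
    unfolding P_def M_def
    using rank_le_sum_outer[of N n "\<lambda>l i. fg (l, i, True)" "\<lambda>l j. fg (l, j, False)" k] by simp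
  have fro: "frob_norm (B - Y) = sqrt (\<Sum>i<N. \<Sum>j<n. (B $$ (i, j) - Y $$ (i, j))\<^sup>2)"
    if "Y \<in> carrier_mat N n" for Y
    using that by (simp add: frob_norm_def N_def n_def)
  have froB: "frob_norm B = sqrt (\<Sum>i<N. \<Sum>j<n. (B $$ (i, j))\<^sup>2)"
    by (simp add: frob_norm_def N_def n_def)
  have entry: "\<bar>Z i j\<bar> \<le> sqrt (\<Sum>i<N. \<Sum>j<n. (Z i j)\<^sup>2)" if "i < N" "j < n" for Z :: "nat \<Rightarrow> nat \<Rightarrow> real" and i j
  proof -
    have "(Z i j)\<^sup>2 \<le> (\<Sum>j<n. (Z i j)\<^sup>2)" by (rule member_le_sum) (use that in auto)
    also have "\<dots> \<le> (\<Sum>i<N. \<Sum>j<n. (Z i j)\<^sup>2)"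
      by (rule member_le_sum[of _ _ "\<lambda>i. \<Sum>j<n. (Z i j)\<^sup>2"]) (use that in \<open>auto intro: sum_nonneg\<close>)
    finally show ?thesis by (simp add: real_le_rsqrt)
  qed
  have nnB: "frob_norm B \<ge> 0" by (simp add: froB sum_nonneg)
  have R0: "R \<ge> 1" using nnB by (simp add: R_def)
  have "compact box"
    unfolding box_def
    using compactin_PiE[of "\<lambda>_. euclidean :: real topology" UNIV "\<lambda>_ :: nat \<times> nat \<times> bool. {-R..R}"]
    by (simp add: euclidean_product_topology)
  moreover have z: "(\<lambda>_. 0) \<in> box" using R0 by (auto simp: box_def PiE_iff)
  moreover have "continuous_on box (\<lambda>fg. frob_norm (B - M fg))"
  proof -
    have "frob_norm (B - M fg) = sqrt (\<Sum>i<N. \<Sum>j<n. (B $$ (i, j) - (\<Sum>l<k. fg (l, i, True) * fg (l, j, False)))\<^sup>2)" for fg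
      using PM[of fg] by (subst fro) (auto simp: P_def M_def)
    then show ?thesis
      by (simp) (intro continuous_intros continuous_on_product_coordinates
          continuous_on_subset[OF continuous_on_product_coordinates], auto)
  qed
  ultimately obtain fg where fg: "fg \<in> box" "\<And>h. h \<in> box \<Longrightarrow> frob_norm (B - M fg) \<le> frob_norm (B - M h)"
    using continuous_attains_inf[of box "\<lambda>fg. frob_norm (B - M fg)"] by blast
  have "M (\<lambda>_. 0) = 0\<^sub>m N n" by (auto simp: M_def)
  then have fgB: "frob_norm (B - M fg) \<le> frob_norm B"
    using fg(2)[OF z] by (simp add: fro froB)
  have "frob_norm (B - M fg) \<le> frob_norm (B - Y)" if Y: "P Y" for Y
  proof (cases "frob_norm (B - Y) \<le> frob_norm B")
    case False
    then show ?thesis using fgB by simp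
  next
    case True
    have Yc: "Y \<in> carrier_mat N n" using Y by (simp add: P_def)
    have Yb: "\<bar>Y $$ (i, j)\<bar> \<le> 2 * frob_norm B" if "i < N" "j < n" for i j
      using entry[OF that, of "\<lambda>i j. B $$ (i, j)"] entry[OF that, of "\<lambda>i j. B $$ (i, j) - Y $$ (i, j)"]
        True fro[OF Yc] froB by linarith
    obtain f g where f: "\<And>i j. i < N \<Longrightarrow> j < n \<Longrightarrow> Y $$ (i, j) = (\<Sum>l<k. f l i * g l j)"
      "\<And>l i. i < N \<Longrightarrow> \<bar>f l i\<bar> \<le> 1" "\<And>l j. \<bar>g l j\<bar> \<le> (\<Sum>i<N. \<bar>Y $$ (i, j)\<bar>)"
      by (rule low_rank_factorization[OF Yc]) (use Y in \<open>auto simp: P_def\<close>)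
    define h where "h = (\<lambda>(l, i, b). if b then (if i < N then f l i else 0) else (if i < n then g l i else 0))"
    have gR: "\<bar>g l j\<bar> \<le> R" if "j < n" for l j
    proof -
      have "(\<Sum>i<N. \<bar>Y $$ (i, j)\<bar>) \<le> (\<Sum>i<N. 2 * frob_norm B)"
        by (rule sum_mono) (use Yb that in auto)
      then show ?thesis using f(3)[of l j] by (simp add: R_def)
    qed
    have "\<bar>h x\<bar> \<le> R" for x
      using R0 gR order_trans[OF f(2)] by (auto simp: h_def split: prod.splits)
    then have "h \<in> box" by (auto simp: box_def PiE_iff abs_le_iff minus_le_iff)
    moreover have "M h = Y" using Yc f(1) by (auto simp: M_def h_def)
    ultimately show ?thesis using fg(2) by blast
  qed
  then have "best_rank_approx k B (M fg)"
    using PM[of fg] unfolding best_rank_approx_def is_arg_min_linorder P_def N_def n_def by blast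
  then show ?thesis ..
qed

lemma kmeans_exists:
  assumes "k > 0" shows "\<exists>l. kmeans k X l"
proof -
  define F where "F = {..<dim_row X} \<rightarrow>\<^sub>E {..<k}"
  have F: "finite F" "F \<noteq> {}" using assms by (auto simp: F_def PiE_eq_empty_iff intro!: finite_PiE)
  have lm: "label_mean X l = label_mean X l'" if "\<And>i. i < dim_row X \<Longrightarrow> l i = l' i" for l l'
  proof -
    have "{i. i < dim_row X \<and> l i = r} = {i. i < dim_row X \<and> l' i = r}" for r using that by auto
    then show ?thesis by (auto simp: label_mean_def)
  qed
  have cong: "kmeans_cost X (restrict l {..<dim_row X}) = kmeans_cost X l" for l
    using lm[of "restrict l {..<dim_row X}" l] by (simp add: kmeans_cost_def)
  obtain l where l: "l \<in> F" "\<And>l'. l' \<in> F \<Longrightarrow> kmeans_cost X l \<le> kmeans_cost X l'"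
    using ex_min_finite[OF F] by blast
  have "kmeans_cost X l \<le> kmeans_cost X l'" if "\<forall>i<dim_row X. l' i < k" for l'
    using l(2)[of "restrict l' {..<dim_row X}"] that by (auto simp: cong F_def)
  then have "kmeans k X l"
    using l(1) unfolding kmeans_def is_arg_min_linorder F_def by (auto simp: PiE_iff)
  then show ?thesis by blast
qed

lemma nearest_exists:
  assumes "k > 0" shows "\<exists>r. nearest k \<mu> v r"
proof -
  have F: "finite {..<k}" "{..<k} \<noteq> {}" using assms by auto
  obtain r where "r < k" "\<And>s. s < k \<Longrightarrow> vnorm (v - \<mu> r) \<le> vnorm (v - \<mu> s)"
    using ex_min_finite[OF F, of "\<lambda>s. vnorm (v - \<mu> s)"] by auto
  then show ?thesis by (auto simp: nearest_def is_arg_min_linorder)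
qed

lemma centers_exists:
  assumes "k > 0" shows "\<exists>\<mu>. centers k B \<mu>"
  using best_rank_approx_exists[of k B] kmeans_exists[OF assms] unfolding centers_def by blast

lemma clustering_exists:
  assumes "k > 0" "S \<subseteq> {..<dim_row A}"
  shows "\<exists>c. clustering k A S c"
proof -
  define S' where "S' = {..<dim_row A} - S"
  define A1 where "A1 = submatrix A S UNIV"
  define A2 where "A2 = submatrix A S' UNIV"
  obtain \<mu>1 where 1: "centers k A1 \<mu>1" using centers_exists assms by blast
  obtain \<mu>2 where 2: "centers k A2 \<mu>2" using centers_exists assms by blast
  have near: "nearest k \<mu> v (SOME r. nearest k \<mu> v r)" for \<mu> v
    using nearest_exists[OF assms(1)] by (rule someI_ex)
  obtain l1 where 3: "assignment k A1 \<mu>2 l1"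
    unfolding assignment_def using near by fast
  obtain l2 where 4: "assignment k A2 \<mu>1 l2"
    unfolding assignment_def using near by fast
  obtain \<pi> where 5: "\<forall>s<k. nearest k \<mu>1 (\<mu>2 s) (\<pi> s)"
    using near by fast
  have "{i. i < dim_row A \<and> i \<in> S} = S" "{i. i < dim_row A \<and> i \<in> S'} = S'"
    using assms by (auto simp: S'_def)
  then have d: "dim_row A1 = card S" "dim_row A2 = card S'" by (simp_all add: A1_def A2_def dim_submatrix)
  define c where "c i = (if i \<in> S then \<pi> (l1 (card {a\<in>S. a < i})) else l2 (card {a\<in>S'. a < i}))" for i
  have "c (pick S t) = \<pi> (l1 t)" if "t < dim_row A1" for t
    using that pick_in_set_le[of t S] card_pick_le[of t S] by (simp add: c_def d)
  moreover have "c (pick S' t) = l2 t" if "t < dim_row A2" for t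
    using that pick_in_set_le[of t S'] card_pick_le[of t S'] by (auto simp: c_def d S'_def)
  ultimately show ?thesis
    using 1 2 3 4 5 unfolding clustering_def Let_def A1_def A2_def S'_def by blast
qed

end

theory Submission
  imports Defs
begin

text \<open>
  Write \<open>A = M + E\<close> with \<open>M\<close> the mean. Trace moments bound the operator norm of \<open>E\<close>, so the rank-\<open>k\<close>
  approximation of one half of the rows is close to \<open>M\<close> in Frobenius norm, every optimal
  \<open>k\<close>-means partition of it misplaces few rows, and the estimated centres are close to the true ones.

  A row of the other half is then classified correctly if its noise is almost orthogonal to the differences of
  the estimated centres. The row is independent of the first half, but the centres are not a function of the first
  half, since ties in the truncated SVD and in \<open>k\<close>-means may be broken with knowledge of everything. We
  therefore take a union bound over all partitions that can occur. By optimality, \<open>k\<close>-means cells are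
  intersections of halfspaces given by functions in the column space of the approximation. Outside a small set
  \<open>I\<close> of rows, this column space lies in a fixed space of dimension \<open>k\<close> up to logarithms, so there are few
  cells by the Sauer--Shelah--Pajor lemma.

  The dimension bound needs an argument only when the \<open>k\<close>-th eigenvalue of the Gram matrix is repeated
  often. Then deleting a few columns does not change this eigenvalue, and restoring them one by one can
  increase the number of larger eigenvalues fewer than \<open>k\<close> times. A random column is orthogonal to a given
  vector of large support with probability at most \<open>3 / 4\<close>; hence all eigenvectors orthogonal to the
  restored columns have small support.

  Finally, the noise term of a row is split into a clipped part, for which Bernstein's inequality survives the union
  bound, and the excess over the clipping level, which comes from the few rows on the wrong side of a single
  halfspace.
\<close>

section \<open>Independent bits and tail bounds\<close>

text \<open>The obstacle is the price of the union bound. There are about \<open>exp (k ^ 2)\<close>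
  possible cells, up to logarithms in the exponent, and Bernstein's inequality survives so many
  events only for weights below the squared gap of two means divided by this exponent. An average
  over a cell can exceed that level in single columns, hence the clipping. The excess is monotone in
  the cell, so each foreign cluster can be cut by one bisector instead of \<open>k\<close>; its
  union bound runs over single halfspaces and is cheaper by a factor \<open>k\<close> in the
  exponent.

  The rates \<open>\<rho> r\<close> are there because \<open>p\<close> and \<open>q\<close> may be
  of different order, and the smaller one may be 0. Either a cluster has enough dense columns to
  test eigenvectors at rate \<open>max p q\<close>, or its dense columns are so few that they can be
  set aside in \<open>H r\<close>, and the remaining ones are sparse at rate \<open>min p q\<close>.

  With \<open>x = (C + 10) * ln (m + n + 1)\<close> every failure probability is a multiple of
  \<open>exp (- x)\<close> and every logarithm is a power of \<open>x\<close>: the conditions for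
  one half need \<open>x ^ 3\<close>, and balancing the random split costs one more factor
  \<open>x\<close>.\<close>

definition bits :: "'a set \<Rightarrow> ('a \<Rightarrow> real) \<Rightarrow> ('a \<Rightarrow> bool) pmf" where
  "bits A \<mu> = Pi_pmf A False (\<lambda>e. bernoulli_pmf (\<mu> e))"

abbreviation bexp :: "'a set \<Rightarrow> ('a \<Rightarrow> real) \<Rightarrow> (('a \<Rightarrow> bool) \<Rightarrow> real) \<Rightarrow> real" where
  "bexp A \<mu> f \<equiv> measure_pmf.expectation (bits A \<mu>) f"

abbreviation bprob :: "'a set \<Rightarrow> ('a \<Rightarrow> real) \<Rightarrow> ('a \<Rightarrow> bool) set \<Rightarrow> real" where
  "bprob A \<mu> X \<equiv> measure_pmf.prob (bits A \<mu>) X"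

lemma finite_set_bits: "finite A \<Longrightarrow> finite (set_pmf (bits A \<mu>))"
  unfolding bits_def
  by (rule finite_subset[OF set_Pi_pmf_subset']) (auto intro!: finite_PiE_dflt)

lemma integrable_bits [simp]:
  fixes f :: "_ \<Rightarrow> real"
  shows "finite A \<Longrightarrow> integrable (measure_pmf (bits A \<mu>)) f"
  by (rule integrable_measure_pmf_finite) (rule finite_set_bits)

lemma set_bits_outside: "finite A \<Longrightarrow> g \<in> set_pmf (bits A \<mu>) \<Longrightarrow> x \<notin> A \<Longrightarrow> \<not> g x"
  using set_Pi_pmf_subset[of A False] unfolding bits_def by blast

lemma bexp_insert:
  fixes f :: "_ \<Rightarrow> real"
  assumes "finite A" "x \<notin> A" "0 \<le> \<mu> x" "\<mu> x \<le> 1"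
  shows "bexp (insert x A) \<mu> f =
    \<mu> x * bexp A \<mu> (\<lambda>g. f (g(x := True))) + (1 - \<mu> x) * bexp A \<mu> (\<lambda>g. f (g(x := False)))"
proof -
  have "bits (insert x A) \<mu> =
      bernoulli_pmf (\<mu> x) \<bind> (\<lambda>y. map_pmf (\<lambda>g. g(x := y)) (bits A \<mu>))"
    unfolding bits_def using assms(1,2) by (simp add: Pi_pmf_insert' map_pmf_def)
  then have "bexp (insert x A) \<mu> f = (\<Sum>y\<in>UNIV. pmf (bernoulli_pmf (\<mu> x)) y *\<^sub>R
      measure_pmf.expectation (map_pmf (\<lambda>g. g(x := y)) (bits A \<mu>)) f)"
    using assms(1) by (simp only:) (rule pmf_expectation_bind, auto intro: finite_set_bits)
  then show ?thesis using assms by (simp add: UNIV_bool add.commute)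
qed

text \<open>Fubini over disjoint blocks of bits. Conditioning on one half of the rows, or on all
  columns but a few, is done through this identity and its version for probabilities.\<close>

lemma bexp_union:
  fixes f :: "_ \<Rightarrow> real"
  assumes "finite A" "finite B" "A \<inter> B = {}"
  shows "bexp (A \<union> B) \<mu> f = bexp A \<mu> (\<lambda>g. bexp B \<mu> (\<lambda>h. f (\<lambda>x. if x \<in> A then g x else h x)))"
proof -
  have "bits (A \<union> B) \<mu> =
      bits A \<mu> \<bind> (\<lambda>g. map_pmf (\<lambda>h x. if x \<in> A then g x else h x) (bits B \<mu>))"
    unfolding bits_def
    by (subst Pi_pmf_union[OF assms]) (simp add: map_pmf_def pair_pmf_def bind_assoc_pmf bind_return_pmf)
  then have "bexp (A \<union> B) \<mu> f = (\<Sum>g\<in>set_pmf (bits A \<mu>). pmf (bits A \<mu>) g *\<^sub>R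
      measure_pmf.expectation (map_pmf (\<lambda>h x. if x \<in> A then g x else h x) (bits B \<mu>)) f)"
    using assms by (simp only:) (rule pmf_expectation_bind, auto intro: finite_set_bits)
  also have "\<dots> = bexp A \<mu> (\<lambda>g. bexp B \<mu> (\<lambda>h. f (\<lambda>x. if x \<in> A then g x else h x)))"
    using finite_set_bits[OF assms(1), of \<mu>]
    by (subst integral_measure_pmf_real[of "set_pmf (bits A \<mu>)"]) (auto simp: mult.commute)
  finally show ?thesis .
qed

lemma bprob_eq_bexp: "bprob A \<mu> X = bexp A \<mu> (\<lambda>g. of_bool (g \<in> X))"
proof -
  have "(\<lambda>g. of_bool (g \<in> X)) = (indicat_real X)" by (auto simp: indicator_def)
  then show ?thesis by simp
qed

lemma bprob_union:
  assumes "finite A" "finite B" "A \<inter> B = {}"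
  shows "bprob (A \<union> B) \<mu> X = bexp A \<mu> (\<lambda>g. bprob B \<mu> {h. (\<lambda>x. if x \<in> A then g x else h x) \<in> X})"
  unfolding bprob_eq_bexp by (subst bexp_union[OF assms]) simp

lemma bexp_mono:
  fixes f g :: "_ \<Rightarrow> real"
  assumes "finite A" "\<And>h. h \<in> set_pmf (bits A \<mu>) \<Longrightarrow> f h \<le> g h"
  shows "bexp A \<mu> f \<le> bexp A \<mu> g"
  by (rule integral_mono_AE) (use assms in \<open>auto simp: AE_measure_pmf_iff\<close>)

lemma bexp_cong:
  fixes f g :: "_ \<Rightarrow> real"
  assumes "finite A" "\<And>h. h \<in> set_pmf (bits A \<mu>) \<Longrightarrow> f h = g h"
  shows "bexp A \<mu> f = bexp A \<mu> g"
  using assms by (intro antisym bexp_mono) auto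

lemma bexp_prod:
  fixes \<phi> :: "'a \<Rightarrow> bool \<Rightarrow> real"
  assumes "finite A" "\<And>x. x \<in> A \<Longrightarrow> 0 \<le> \<mu> x \<and> \<mu> x \<le> 1"
  shows "bexp A \<mu> (\<lambda>g. \<Prod>x\<in>A. \<phi> x (g x)) = (\<Prod>x\<in>A. \<mu> x * \<phi> x True + (1 - \<mu> x) * \<phi> x False)"
  using assms
proof (induction A rule: finite_induct)
  case (insert x A)
  have "(\<Prod>z\<in>A. \<phi> z ((g(x := b)) z)) = (\<Prod>z\<in>A. \<phi> z (g z))" for g b
    by (rule prod.cong) (use insert.hyps in auto)
  then show ?case using insert by (subst bexp_insert) (auto simp: algebra_simps)
qed simp

lemma bprob_union_bound:
  assumes "finite J"
  shows "bprob A \<mu> (\<Union>j\<in>J. X j) \<le> (\<Sum>j\<in>J. bprob A \<mu> (X j))"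
  by (rule measure_pmf.finite_measure_subadditive_finite) (use assms in auto)

lemma bprob_mono: "X \<subseteq> Y \<Longrightarrow> bprob A \<mu> X \<le> bprob A \<mu> Y"
  by (rule measure_pmf.finite_measure_mono) auto

section \<open>Exponential tail bounds\<close>

lemma bprob_markov:
  fixes Z :: "_ \<Rightarrow> real"
  assumes "finite A" "\<And>g. Z g \<ge> 0" "t > 0"
  shows "bprob A \<mu> {g. Z g \<ge> t} \<le> bexp A \<mu> Z / t"
proof -
  have "bprob A \<mu> {g. Z g \<ge> t} \<le> bexp A \<mu> (\<lambda>g. Z g / t)"
    unfolding bprob_eq_bexp by (rule bexp_mono) (use assms in \<open>auto simp: of_bool_def\<close>)
  then show ?thesis by simp
qed

text \<open>Markov's inequality for the exponential of the sum, which factors by independence; a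
  tail estimate then only has to bound the contribution of a single bit.\<close>

lemma bprob_exp_bound:
  fixes \<phi> :: "'a \<Rightarrow> bool \<Rightarrow> real"
  assumes A: "finite A" "\<And>x. x \<in> A \<Longrightarrow> 0 \<le> \<mu> x \<and> \<mu> x \<le> 1"
    and b: "\<And>x. x \<in> A \<Longrightarrow> \<mu> x * exp (\<phi> x True) + (1 - \<mu> x) * exp (\<phi> x False) \<le> exp (\<beta> x)"
  shows "bprob A \<mu> {g. (\<Sum>x\<in>A. \<phi> x (g x)) \<ge> t} \<le> exp ((\<Sum>x\<in>A. \<beta> x) - t)"
proof -
  have "bprob A \<mu> {g. (\<Sum>x\<in>A. \<phi> x (g x)) \<ge> t} = bprob A \<mu> {g. exp (\<Sum>x\<in>A. \<phi> x (g x)) \<ge> exp t}"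
    by simp
  also have "\<dots> \<le> bexp A \<mu> (\<lambda>g. exp (\<Sum>x\<in>A. \<phi> x (g x))) / exp t"
    by (rule bprob_markov) (use A in auto)
  also have "bexp A \<mu> (\<lambda>g. exp (\<Sum>x\<in>A. \<phi> x (g x))) = bexp A \<mu> (\<lambda>g. \<Prod>x\<in>A. exp (\<phi> x (g x)))"
    using A by (simp add: exp_sum)
  also have "\<dots> = (\<Prod>x\<in>A. \<mu> x * exp (\<phi> x True) + (1 - \<mu> x) * exp (\<phi> x False))"
    by (rule bexp_prod[OF A, where \<phi> = "\<lambda>x b. exp (\<phi> x b)"])
  also have "\<dots> \<le> (\<Prod>x\<in>A. exp (\<beta> x))"
    by (rule prod_mono) (use A b in \<open>auto intro!: add_nonneg_nonneg mult_nonneg_nonneg\<close>)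
  also have "\<dots> = exp (\<Sum>x\<in>A. \<beta> x)" using A by (simp add: exp_sum)
  finally show ?thesis by (simp add: exp_diff divide_right_mono)
qed

text \<open>For \<open>x = - t\<close> negative the claim is
  \<open>exp t * (1 - t + t^2) >= 1\<close>. Multiplying \<open>1 - t + t^2\<close> by the quadratic
  Taylor polynomial of \<open>exp t\<close> leaves 1 plus nonnegative terms only.\<close>

lemma exp_le_quadratic: "exp x \<le> 1 + x + x\<^sup>2" if "x \<le> 1" for x :: real
proof (cases "x \<ge> 0")
  case True
  then show ?thesis using exp_bound that by simp
next
  case False
  define t where "t = - x"
  have t: "t > 0" using False by (simp add: t_def)
  have 1: "1 + t + t\<^sup>2 / 2 \<le> exp t" using t by (intro exp_lower_Taylor_quadratic) auto
  have 2: "(1 - t + t\<^sup>2) * (1 + t + t\<^sup>2 / 2) = 1 + t\<^sup>2/2 + t^3/2 + t^4/2"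
    by (simp add: power2_eq_square power3_eq_cube power4_eq_xxxx field_simps)
  have 0: "1 - t + t\<^sup>2 \<ge> 0"
    using sum_squares_ge_zero[of "t - 1/2" 0] by (simp add: power2_eq_square algebra_simps)
  have "1 \<le> (1 - t + t\<^sup>2) * (1 + t + t\<^sup>2 / 2)" unfolding 2 using t by simp
  also have "\<dots> \<le> (1 - t + t\<^sup>2) * exp t" using 0 1 by (rule mult_left_mono[rotated])
  finally have "exp (- t) \<le> (1 - t + t\<^sup>2)" by (simp add: exp_minus field_simps)
  then show ?thesis by (simp add: t_def)
qed

lemma scale_le_iff:
  fixes a b y F :: real
  assumes "F > 0"
  shows "b + F * y \<le> a \<longleftrightarrow> b / F + y \<le> a / F"
proof -
  have "b / F + y = (b + F * y) / F" using assms by (simp add: add_divide_distrib)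
  then show ?thesis using assms by (simp add: divide_le_cancel)
qed

text \<open>Doubling the mean buys a tail that involves no variance: on \<open>[0, 1]\<close> the
  exponential is at most \<open>1 + 2 * u\<close>, so each bit costs at most twice its scaled mean
  in the exponent.\<close>

lemma weighted_bits_upper_tail:
  assumes A: "finite A" "\<And>x. x \<in> A \<Longrightarrow> 0 \<le> \<mu> x \<and> \<mu> x \<le> 1"
    and f: "\<And>x. x \<in> A \<Longrightarrow> 0 \<le> f x \<and> f x \<le> F" and F: "F > 0"
  shows "bprob A \<mu> {g. (\<Sum>x\<in>A. of_bool (g x) * f x) \<ge> 2 * (\<Sum>x\<in>A. \<mu> x * f x) + F * y} \<le> exp (- y)"
proof -
  have "{g. (\<Sum>x\<in>A. of_bool (g x) * f x) \<ge> 2 * (\<Sum>x\<in>A. \<mu> x * f x) + F * y} =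
     {g. (\<Sum>x\<in>A. of_bool (g x) * f x / F) \<ge> 2 * (\<Sum>x\<in>A. \<mu> x * f x) / F + y}"
    unfolding sum_divide_distrib[symmetric] scale_le_iff[OF F] ..
  moreover have "bprob A \<mu> {g. (\<Sum>x\<in>A. of_bool (g x) * f x / F) \<ge> 2 * (\<Sum>x\<in>A. \<mu> x * f x) / F + y}
     \<le> exp ((\<Sum>x\<in>A. 2 * (\<mu> x * f x / F)) - (2 * (\<Sum>x\<in>A. \<mu> x * f x) / F + y))"
  proof (rule bprob_exp_bound[OF A])
    fix x assume x: "x \<in> A"
    define u where "u = f x / F"
    have u: "0 \<le> u" "u \<le> 1" using f[OF x] F by (auto simp: u_def)
    have "exp u \<le> 1 + 2 * u" using exp_le_quadratic[OF u(2)] u mult_left_le[of u u]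
      by (simp add: power2_eq_square)
    then have "\<mu> x * exp u \<le> \<mu> x * (1 + 2 * u)" using A(2)[OF x] by (intro mult_left_mono) auto
    then have "\<mu> x * exp u + (1 - \<mu> x) \<le> 1 + 2 * (\<mu> x * u)" by (simp add: algebra_simps)
    also have "\<dots> \<le> exp (2 * (\<mu> x * u))" by (rule exp_ge_add_one_self)
    finally show "\<mu> x * exp (of_bool True * f x / F) + (1 - \<mu> x) * exp (of_bool False * f x / F)
        \<le> exp (2 * (\<mu> x * f x / F))" by (simp add: u_def)
  qed auto
  ultimately show ?thesis by (simp add: sum_distrib_left sum_divide_distrib)
qed

text \<open>Bernstein's inequality with the level \<open>h\<close> bounding the weights from above
  only. A large negative weight enters the exponent through the factor \<open>- \<mu> x\<close>, and
  \<open>P \<le> h\<close> keeps that product below 1. This is why it suffices to clip one of the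
  two centres in a difference.\<close>

lemma centred_bits_upper_tail:
  assumes A: "finite A" "\<And>x. x \<in> A \<Longrightarrow> 0 \<le> \<mu> x \<and> \<mu> x \<le> P" and P: "P \<le> 1" "P \<le> h" "h > 0"
    and w: "\<And>x. x \<in> A \<Longrightarrow> w x \<le> h \<and> \<bar>w x\<bar> \<le> 1"
  shows "bprob A \<mu> {g. (\<Sum>x\<in>A. (of_bool (g x) - \<mu> x) * w x) \<ge> \<tau>}
    \<le> exp (P * (\<Sum>x\<in>A. (w x)\<^sup>2) / h\<^sup>2 - \<tau> / h)"
proof -
  have "{g. (\<Sum>x\<in>A. (of_bool (g x) - \<mu> x) * w x) \<ge> \<tau>} =
     {g. (\<Sum>x\<in>A. (of_bool (g x) - \<mu> x) * w x / h) \<ge> \<tau> / h}"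
    unfolding sum_divide_distrib[symmetric] using P by (auto simp: field_simps)
  moreover have "bprob A \<mu> {g. (\<Sum>x\<in>A. (of_bool (g x) - \<mu> x) * w x / h) \<ge> \<tau> / h}
     \<le> exp ((\<Sum>x\<in>A. P * (w x)\<^sup>2 / h\<^sup>2) - \<tau> / h)"
  proof (rule bprob_exp_bound[OF A(1)])
    show "0 \<le> \<mu> x \<and> \<mu> x \<le> 1" if "x \<in> A" for x using A(2)[OF that] P by auto
    fix x assume x: "x \<in> A"
    define v where "v = w x / h"
    have m: "0 \<le> \<mu> x" "\<mu> x \<le> P" "\<mu> x \<le> 1" using A(2)[OF x] P by auto
    have v1: "v \<le> 1" using w[OF x] P by (simp add: v_def)
    have a1: "(1 - \<mu> x) * v \<le> 1"
      using v1 m by (cases "v \<ge> 0") (auto intro: mult_le_one order_trans[OF mult_nonneg_nonpos])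
    have "\<mu> x * \<bar>v\<bar> \<le> P * (1 / h)" unfolding v_def abs_divide
      using m w[OF x] P by (intro mult_mono) (auto simp: divide_right_mono)
    also have "\<dots> \<le> 1" using P by simp
    finally have a2: "- \<mu> x * v \<le> 1" using m by (simp add: abs_if split: if_splits) (smt (verit) mult_nonneg_nonneg)
    have "\<mu> x * exp ((1 - \<mu> x) * v) + (1 - \<mu> x) * exp (- \<mu> x * v)
      \<le> \<mu> x * (1 + (1 - \<mu> x) * v + ((1 - \<mu> x) * v)\<^sup>2) + (1 - \<mu> x) * (1 + (- \<mu> x * v) + (- \<mu> x * v)\<^sup>2)"
      using m exp_le_quadratic[OF a1] exp_le_quadratic[OF a2] by (intro add_mono mult_left_mono) auto
    \<comment> \<open>Centring cancels the linear terms, and the variance of the bit is what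
      remains.\<close>
    also have "\<dots> = 1 + \<mu> x * (1 - \<mu> x) * v\<^sup>2" by (simp add: power2_eq_square algebra_simps)
    also have "\<dots> \<le> 1 + P * v\<^sup>2"
    proof -
      have "\<mu> x * (1 - \<mu> x) \<le> \<mu> x * 1" using m by (intro mult_left_mono) auto
      then show ?thesis using m by (intro add_left_mono mult_right_mono) auto
    qed
    also have "\<dots> \<le> exp (P * v\<^sup>2)" by (rule exp_ge_add_one_self)
    finally show "\<mu> x * exp ((of_bool True - \<mu> x) * w x / h) + (1 - \<mu> x) * exp ((of_bool False - \<mu> x) * w x / h)
        \<le> exp (P * (w x)\<^sup>2 / h\<^sup>2)" by (simp add: v_def power_divide)
  qed
  ultimately show ?thesis by (simp add: sum_distrib_left sum_divide_distrib)
qed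

section \<open>The operator norm of a centred bit matrix\<close>

definition ip :: "'a set \<Rightarrow> ('a \<Rightarrow> real) \<Rightarrow> ('a \<Rightarrow> real) \<Rightarrow> real" where
  "ip S x y = (\<Sum>i\<in>S. x i * y i)"

lemma ip_commute: "ip S x y = ip S y x" by (simp add: ip_def mult.commute)

lemma ip_add_left: "ip S (\<lambda>i. x i + y i) z = ip S x z + ip S y z"
  by (simp add: ip_def sum.distrib algebra_simps)

lemma ip_add_right: "ip S z (\<lambda>i. x i + y i) = ip S z x + ip S z y"
  by (simp add: ip_def sum.distrib algebra_simps)

lemma ip_diff_left: "ip S (\<lambda>i. x i - y i) z = ip S x z - ip S y z"
  by (simp add: ip_def sum_subtractf algebra_simps)

lemma ip_diff_right: "ip S z (\<lambda>i. x i - y i) = ip S z x - ip S z y"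
  by (simp add: ip_def sum_subtractf algebra_simps)

lemma ip_scale_left: "ip S (\<lambda>i. c * x i) z = c * ip S x z"
  by (simp add: ip_def sum_distrib_left algebra_simps)

lemma ip_scale_right: "ip S z (\<lambda>i. c * x i) = c * ip S z x"
  by (simp add: ip_def sum_distrib_left algebra_simps)

lemma ip_sum_left: "ip S (\<lambda>i. \<Sum>a\<in>A. x a i) z = (\<Sum>a\<in>A. ip S (x a) z)"
  unfolding ip_def sum_distrib_right by (rule sum.swap)

lemma ip_sum_right: "ip S z (\<lambda>i. \<Sum>a\<in>A. x a i) = (\<Sum>a\<in>A. ip S z (x a))"
  unfolding ip_def sum_distrib_left by (rule sum.swap)

lemma ip_ge_0 [simp]: "ip S x x \<ge> 0" by (simp add: ip_def sum_nonneg)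

lemma ip_cong: "(\<And>i. i \<in> S \<Longrightarrow> x i = x' i) \<Longrightarrow> (\<And>i. i \<in> S \<Longrightarrow> y i = y' i) \<Longrightarrow> ip S x y = ip S x' y'"
  by (simp add: ip_def)

lemma ip_eq_0_iff: "finite S \<Longrightarrow> ip S x x = 0 \<longleftrightarrow> (\<forall>i\<in>S. x i = 0)"
  by (simp add: ip_def sum_nonneg_eq_0_iff)

lemma Cauchy_Schwarz_ip: "(ip S x y)\<^sup>2 \<le> ip S x x * ip S y y"
  using Cauchy_Schwarz_ineq_sum[of x y S] by (simp add: ip_def power2_eq_square)

text \<open>\<open>R\<close> bounds the square of the operator norm. The bilinear form makes
  indicators of row sets admissible test vectors, which yields estimates valid for all row sets at
  once.\<close>

definition op_bound :: "real \<Rightarrow> 'a set \<Rightarrow> 'b set \<Rightarrow> ('a \<Rightarrow> 'b \<Rightarrow> real) \<Rightarrow> bool" where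
  "op_bound R I J E \<longleftrightarrow> R \<ge> 0 \<and> (\<forall>x y. (\<Sum>i\<in>I. \<Sum>j\<in>J. x i * E i j * y j)\<^sup>2 \<le> R * ip I x x * ip J y y)"

lemma op_boundD: "op_bound R I J E \<Longrightarrow> (\<Sum>i\<in>I. \<Sum>j\<in>J. x i * E i j * y j)\<^sup>2 \<le> R * ip I x x * ip J y y"
  by (simp add: op_bound_def)

text \<open>Test the form with the vector \<open>y\<close> that it produces from \<open>x\<close>,
  and cancel one factor \<open>ip J y y\<close>.\<close>

lemma op_bound_right:
  assumes "op_bound R I J E"
  shows "ip J (\<lambda>j. \<Sum>i\<in>I. x i * E i j) (\<lambda>j. \<Sum>i\<in>I. x i * E i j) \<le> R * ip I x x"
proof -
  define y where "y j = (\<Sum>i\<in>I. x i * E i j)" for j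
  have "(\<Sum>i\<in>I. \<Sum>j\<in>J. x i * E i j * y j) = ip J y y"
    unfolding ip_def by (subst sum.swap) (simp add: y_def sum_distrib_right)
  then have "ip J y y * ip J y y \<le> R * ip I x x * ip J y y"
    using op_boundD[OF assms, of x y] by (simp add: power2_eq_square)
  moreover have "0 \<le> R * ip I x x" using assms by (simp add: op_bound_def)
  ultimately show ?thesis unfolding y_def[symmetric]
    by (cases "ip J y y = 0") (auto simp: less_le)
qed

lemma op_bound_mono:
  assumes "op_bound R I J E" "R \<le> R'"
  shows "op_bound R' I J E"
  unfolding op_bound_def
proof (intro conjI allI)
  show "R' \<ge> 0" using assms by (simp add: op_bound_def)
  fix x y
  have "R * ip I x x * ip J y y \<le> R' * ip I x x * ip J y y"
    using assms(2) by (intro mult_right_mono) auto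
  then show "(\<Sum>i\<in>I. \<Sum>j\<in>J. x i * E i j * y j)\<^sup>2 \<le> R' * ip I x x * ip J y y"
    using op_boundD[OF assms(1), of x y] by linarith
qed

section \<open>Powers of symmetric arrays and their traces\<close>

definition app :: "'a set \<Rightarrow> ('a \<Rightarrow> 'a \<Rightarrow> real) \<Rightarrow> ('a \<Rightarrow> real) \<Rightarrow> 'a \<Rightarrow> real" where
  "app W Y x = (\<lambda>u. \<Sum>v\<in>W. Y u v * x v)"

fun mpow :: "'a set \<Rightarrow> ('a \<Rightarrow> 'a \<Rightarrow> real) \<Rightarrow> nat \<Rightarrow> 'a \<Rightarrow> 'a \<Rightarrow> real" where
  "mpow W Y 0 u v = of_bool (u = v)"
| "mpow W Y (Suc n) u v = (\<Sum>w\<in>W. Y u w * mpow W Y n w v)"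

lemma app_pow:
  assumes "finite W" "u \<in> W"
  shows "(app W Y ^^ n) x u = (\<Sum>v\<in>W. mpow W Y n u v * x v)"
  using assms(2)
proof (induction n arbitrary: u)
  case 0
  then show ?case using assms(1) by (simp add: of_bool_def if_distrib[of "\<lambda>z. z * _"] cong: if_cong)
next
  case (Suc n)
  have "(app W Y ^^ Suc n) x u = (\<Sum>w\<in>W. Y u w * (app W Y ^^ n) x w)"
    by (simp add: app_def)
  also have "\<dots> = (\<Sum>w\<in>W. Y u w * (\<Sum>v\<in>W. mpow W Y n w v * x v))"
    using Suc.IH by (intro sum.cong refl) simp
  also have "\<dots> = (\<Sum>v\<in>W. mpow W Y (Suc n) u v * x v)"
    unfolding mpow.simps sum_distrib_left sum_distrib_right
    by (subst sum.swap) (simp add: mult.assoc)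
  finally show ?case .
qed

lemma mpow_add:
  assumes "finite W" "u \<in> W"
  shows "mpow W Y (m + n) u v = (\<Sum>w\<in>W. mpow W Y m u w * mpow W Y n w v)"
  using assms(2)
proof (induction m arbitrary: u)
  case 0
  then show ?case using assms(1) by (simp add: of_bool_def if_distrib[of "\<lambda>z. z * _"] cong: if_cong)
next
  case (Suc m)
  have "mpow W Y (Suc m + n) u v = (\<Sum>a\<in>W. Y u a * (\<Sum>w\<in>W. mpow W Y m a w * mpow W Y n w v))"
    using Suc by simp
  also have "\<dots> = (\<Sum>w\<in>W. mpow W Y (Suc m) u w * mpow W Y n w v)"
    unfolding mpow.simps sum_distrib_left sum_distrib_right
    by (subst sum.swap) (simp add: mult.assoc)
  finally show ?case .
qed

lemma app_sym:
  assumes "\<And>u v. Y u v = Y v u"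
  shows "ip W (app W Y x) y = ip W x (app W Y y)"
proof -
  have "ip W (app W Y x) y = (\<Sum>u\<in>W. \<Sum>v\<in>W. Y u v * x v * y u)"
    by (simp add: ip_def app_def sum_distrib_right)
  also have "\<dots> = (\<Sum>v\<in>W. \<Sum>u\<in>W. Y u v * x v * y u)" by (rule sum.swap)
  also have "\<dots> = ip W x (app W Y y)"
    unfolding ip_def app_def sum_distrib_left by (intro sum.cong refl) (subst assms, simp)
  finally show ?thesis .
qed

lemma app_pow_sym:
  assumes "\<And>u v. Y u v = Y v u"
  shows "ip W ((app W Y ^^ n) x) y = ip W x ((app W Y ^^ n) y)"
proof (induction n arbitrary: y)
  case (Suc n)
  have "ip W ((app W Y ^^ Suc n) x) y = ip W x ((app W Y ^^ n) (app W Y y))"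
    using Suc by (simp add: app_sym[OF assms])
  then show ?case by (simp add: funpow_swap1)
qed simp

lemma mpow_sym:
  assumes "finite W" "\<And>u v. Y u v = Y v u" "u \<in> W" "v \<in> W"
  shows "mpow W Y n u v = mpow W Y n v u"
proof -
  have pick: "ip W (\<lambda>w. of_bool (w = a)) z = z a" if "a \<in> W" for a z
    using assms(1) that by (simp add: ip_def of_bool_def if_distrib[of "\<lambda>z. z * _"] cong: if_cong)
  have ent: "(app W Y ^^ n) (\<lambda>w. of_bool (w = b)) a = mpow W Y n a b" if "a \<in> W" "b \<in> W" for a b
    using that assms(1)
    by (simp add: app_pow of_bool_def if_distrib[of "\<lambda>z. _ * z"] cong: if_cong)
  show ?thesis
  proof -
    have "ip W ((app W Y ^^ n) (\<lambda>w. of_bool (w = u))) (\<lambda>w. of_bool (w = v)) =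
        ip W (\<lambda>w. of_bool (w = u)) ((app W Y ^^ n) (\<lambda>w. of_bool (w = v)))"
      by (rule app_pow_sym) (rule assms(2))
    then show ?thesis using assms(3,4)
      by (simp add: pick ent ip_commute[of W _ "\<lambda>w. of_bool (w = v)"])
  qed
qed

text \<open>Symmetry gives \<open>\<parallel>Y\<^sup>n x\<parallel>\<^sup>2 = \<langle>x, Y\<^sup>2\<^sup>n x\<rangle> \<le> \<parallel>x\<parallel> \<parallel>Y\<^sup>2\<^sup>n x\<parallel>\<close>; iterating bounds the operator norm by traces
  without any spectral theory.\<close>

lemma app_le_trace:
  assumes W: "finite W" and sym: "\<And>u v. Y u v = Y v u"
  shows "(ip W (app W Y x) (app W Y x)) ^ (2 ^ t) \<le> (ip W x x) ^ (2 ^ t) * (\<Sum>u\<in>W. mpow W Y (2 ^ (t + 1)) u u)"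
proof -
  let ?a = "\<lambda>n. ip W ((app W Y ^^ n) x) ((app W Y ^^ n) x)"
  have step: "(?a n)\<^sup>2 \<le> ip W x x * ?a (2 * n)" for n
  proof -
    have "?a n = ip W x ((app W Y ^^ (n + n)) x)"
      by (simp add: app_pow_sym[OF sym] funpow_add)
    then show ?thesis using Cauchy_Schwarz_ip[of W x "(app W Y ^^ (n + n)) x"] by (simp add: mult_2)
  qed
  have 1: "(?a 1) ^ (2 ^ t) * ip W x x \<le> (ip W x x) ^ (2 ^ t) * ?a (2 ^ t)" for t
  proof (induction t)
    case (Suc t)
    show ?case
    proof (cases "ip W x x = 0")
      case True then show ?thesis by simp
    next
      case False
      then have pos: "ip W x x > 0" by (simp add: less_le)
      have pw: "z ^ (2 ^ Suc t) = z ^ (2 ^ t) * z ^ (2 ^ t)" for z :: real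
        by (simp add: power_add[symmetric] mult_2)
      have e: "2 * 2 ^ t = (2 ^ Suc t :: nat)" by simp
      have "((?a 1) ^ (2 ^ t) * ip W x x)\<^sup>2 \<le> ((ip W x x) ^ (2 ^ t) * ?a (2 ^ t))\<^sup>2"
        using Suc by (intro power_mono) auto
      also have "\<dots> = (ip W x x) ^ (2 ^ Suc t) * (?a (2 ^ t))\<^sup>2"
        by (simp add: power_mult_distrib power_mult[symmetric] mult.commute)
      also have "\<dots> \<le> (ip W x x) ^ (2 ^ Suc t) * (ip W x x * ?a (2 ^ Suc t))"
        by (intro mult_left_mono step[of "2 ^ t", unfolded e]) auto
      finally have "((?a 1) ^ (2 ^ Suc t) * ip W x x) * ip W x x
          \<le> ((ip W x x) ^ (2 ^ Suc t) * ?a (2 ^ Suc t)) * ip W x x"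
        by (simp only: pw power2_eq_square mult_ac)
      then show ?thesis using pos by (simp only: mult_le_cancel_right_pos)
    qed
  qed simp
  \<comment> \<open>Cauchy-Schwarz in every row compares with the Frobenius norm of the
    \<open>n\<close>-th power; by symmetry its square is the trace of the power
    \<open>2 * n\<close>.\<close>
  have 2: "?a n \<le> (\<Sum>u\<in>W. mpow W Y (2 * n) u u) * ip W x x" for n
  proof -
    have "?a n = (\<Sum>u\<in>W. (ip W (mpow W Y n u) x)\<^sup>2)"
      unfolding ip_def power2_eq_square by (intro sum.cong refl) (simp add: app_pow[OF W])
    also have "\<dots> \<le> (\<Sum>u\<in>W. ip W (mpow W Y n u) (mpow W Y n u) * ip W x x)"
      by (intro sum_mono Cauchy_Schwarz_ip)
    also have "\<dots> = (\<Sum>u\<in>W. mpow W Y (2 * n) u u) * ip W x x"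
      unfolding sum_distrib_right mult_2
      by (intro sum.cong refl) (simp add: ip_def mpow_add[OF W] mpow_sym[OF W sym])
    finally show ?thesis .
  qed
  show ?thesis
  proof (cases "ip W x x = 0")
    case True
    then have "\<forall>i\<in>W. x i = 0" using W by (simp add: ip_eq_0_iff)
    then have "ip W (app W Y x) (app W Y x) = 0" by (simp add: ip_def app_def)
    then show ?thesis using True by (simp add: power_0_left)
  next
    case False
    then have pos: "ip W x x > 0" by (simp add: less_le)
    have "(?a 1) ^ (2 ^ t) * ip W x x \<le> (ip W x x) ^ (2 ^ t) * ((\<Sum>u\<in>W. mpow W Y (2 * 2 ^ t) u u) * ip W x x)"
      using 1[of t] by (rule order_trans) (intro mult_left_mono 2, simp)
    then show ?thesis using pos by (simp add: mult.assoc[symmetric])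
  qed
qed

section \<open>Walks in the bipartite graph of rows and columns\<close>

fun edge :: "nat + nat \<Rightarrow> nat + nat \<Rightarrow> (nat \<times> nat) option" where
  "edge (Inl i) (Inr j) = Some (i, j)"
| "edge (Inr j) (Inl i) = Some (i, j)"
| "edge _ _ = None"

fun trail :: "nat + nat \<Rightarrow> (nat + nat) list \<Rightarrow> (nat \<times> nat) option list" where
  "trail u [] = []"
| "trail u (w # ws) = edge u w # trail w ws"

definition walks :: "'a set \<Rightarrow> nat \<Rightarrow> 'a list set" where
  "walks W n = {ws. set ws \<subseteq> W \<and> length ws = n}"

lemma finite_walks [simp]: "finite W \<Longrightarrow> finite (walks W n)"
  unfolding walks_def by (rule finite_lists_length_eq)

lemma walks_0: "walks W 0 = {[]}" by (auto simp: walks_def)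

lemma sum_walks_Suc:
  fixes f :: "_ \<Rightarrow> real"
  assumes "finite W"
  shows "(\<Sum>ws\<in>walks W (Suc n). f ws) = (\<Sum>w\<in>W. \<Sum>ws\<in>walks W n. f (w # ws))"
proof -
  have "walks W (Suc n) = (\<lambda>(w, ws). w # ws) ` (W \<times> walks W n)"
    by (auto simp: walks_def length_Suc_conv image_iff)
  then have "(\<Sum>ws\<in>walks W (Suc n). f ws) = (\<Sum>(w, ws)\<in>W \<times> walks W n. f (w # ws))"
    by (simp add: sum.reindex inj_on_def case_prod_beta comp_def prod_eq_iff)
  then show ?thesis by (simp add: sum.cartesian_product)
qed

text \<open>The symmetric dilation of a rectangular array, with rows on the \<open>Inl\<close> side
  and columns on the \<open>Inr\<close> side; it makes trace moments of symmetric arrays available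
  for rectangular noise. Since \<open>edge\<close> forgets the direction of a step, both traversals
  of an entry count as the same bit.\<close>

definition dil :: "(nat \<times> nat \<Rightarrow> real) \<Rightarrow> nat + nat \<Rightarrow> nat + nat \<Rightarrow> real" where
  "dil X u v = (case edge u v of None \<Rightarrow> 0 | Some e \<Rightarrow> X e)"

lemma edge_sym: "edge u v = edge v u" by (cases u; cases v) auto

lemma dil_sym: "dil X u v = dil X v u" by (simp add: dil_def edge_sym)

lemma mpow_walks:
  assumes "finite W"
  shows "mpow W (dil X) n u v =
    (\<Sum>ws\<in>walks W n. of_bool (last (u # ws) = v) * prod_list (map (case_option 0 X) (trail u ws)))"
proof (induction n arbitrary: u)
  case 0
  show ?case by (simp add: walks_0)
next
  case (Suc n)
  show ?case
    unfolding mpow.simps Suc sum_walks_Suc[OF assms] sum_distrib_left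
    by (intro sum.cong refl) (simp add: dil_def)
qed

lemma edge_endpoints: "edge a b = Some e \<Longrightarrow> edge a' b' = Some e \<Longrightarrow> {a, b} = {a', b'}"
  by (cases a; cases b; cases a'; cases b') auto

lemma trail_endpoints:
  "Some e \<in> set (trail u ws) \<Longrightarrow> \<exists>a b. edge a b = Some e \<and> {a, b} \<subseteq> set (u # ws)"
proof (induction ws arbitrary: u)
  case (Cons w ws)
  then consider "edge u w = Some e" | "Some e \<in> set (trail w ws)" by auto
  then show ?case using Cons.IH by cases fastforce+
qed simp

text \<open>A connected graph has at most one vertex more than it has edges. If the first vertex
  never recurs, then its edge does not recur either, so both counts grow by one.\<close>

lemma card_vertices_le_trail:
  assumes "None \<notin> set (trail u ws)"
  shows "card (set (u # ws)) \<le> card (set (trail u ws)) + 1"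
  using assms
proof (induction ws arbitrary: u)
  case (Cons w ws)
  have IH: "card (set (w # ws)) \<le> card (set (trail w ws)) + 1" using Cons by auto
  show ?case
  proof (cases "u \<in> set (w # ws)")
    case True
    then have "set (u # w # ws) = set (w # ws)" by auto
    moreover have "card (set (trail w ws)) \<le> card (set (trail u (w # ws)))" by (rule card_mono) auto
    ultimately show ?thesis using IH by simp
  next
    case False
    obtain e where e: "edge u w = Some e" using Cons.prems by (cases "edge u w") auto
    have "Some e \<notin> set (trail w ws)"
    proof
      assume "Some e \<in> set (trail w ws)"
      then obtain a b where ab: "edge a b = Some e" "{a, b} \<subseteq> set (w # ws)"
        using trail_endpoints by blast
      have "u \<in> {a, b}" using edge_endpoints[OF e ab(1)] by blast
      then show False using ab(2) False by blast
    qed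
    then have "card (set (trail u (w # ws))) = card (set (trail w ws)) + 1" by (simp add: e)
    moreover have "card (set (u # w # ws)) = card (set (w # ws)) + 1" using False by simp
    ultimately show ?thesis using IH by simp
  qed
qed simp

lemma length_trail [simp]: "length (trail u ws) = length ws"
  by (induction ws arbitrary: u) auto

lemma trail_in: "u \<in> I <+> J \<Longrightarrow> set ws \<subseteq> I <+> J \<Longrightarrow> Some e \<in> set (trail u ws) \<Longrightarrow> e \<in> I \<times> J"
proof (induction ws arbitrary: u)
  case (Cons w ws)
  then consider "edge u w = Some e" | "Some e \<in> set (trail w ws)" by auto
  then show ?case
  proof cases
    case 1 then show ?thesis using Cons.prems by (cases u; cases w) auto
  next
    case 2 then show ?thesis using Cons by (intro Cons.IH[of w]) auto
  qed
qed simp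

lemma card_set_le_half:
  assumes "\<And>x. count_list xs x \<noteq> 1"
  shows "2 * card (set xs) \<le> length xs"
proof -
  have "2 * card (set xs) = (\<Sum>x\<in>set xs. 2)" by simp
  also have "\<dots> \<le> (\<Sum>x\<in>set xs. count_list xs x)"
  proof (rule sum_mono)
    fix x assume "x \<in> set xs"
    then have "count_list xs x \<noteq> 0" by (simp add: count_list_0_iff)
    then show "2 \<le> count_list xs x" using assms[of x] by linarith
  qed
  also have "\<dots> = length xs" by (rule sum_count_set) auto
  finally show ?thesis .
qed

text \<open>Adding a vertex to a list of length \<open>n\<close> multiplies the sum by at most
  \<open>n + 1\<close>: each of the at most \<open>n\<close> vertices already present keeps the
  weight, and the at most \<open>N\<close> new ones, weighted by \<open>1 / N\<close>, count as
  one.\<close>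

lemma sum_walks_inverse_card:
  assumes "finite W" "card W \<le> N" "N > 0"
  shows "(\<Sum>ws\<in>walks W n. (1 / real N) ^ card (set ws)) \<le> fact n"
proof (induction n)
  case (Suc n)
  have "(\<Sum>w\<in>W. (1 / real N) ^ card (set (w # ws))) \<le> real (Suc n) * (1 / real N) ^ card (set ws)"
    if ws: "ws \<in> walks W n" for ws
  proof -
    define c where "c = card (set ws)"
    have sub: "set ws \<subseteq> W" and cn: "c \<le> n" using ws card_length[of ws] by (auto simp: walks_def c_def)
    have "(\<Sum>w\<in>W. (1 / real N) ^ card (set (w # ws))) =
        (\<Sum>w\<in>set ws. (1 / real N) ^ card (set (w # ws))) + (\<Sum>w\<in>W - set ws. (1 / real N) ^ card (set (w # ws)))"
      using sub assms(1) by (subst sum.subset_diff[of "set ws"]) (auto simp: finite_subset add.commute)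
    also have "(\<Sum>w\<in>set ws. (1 / real N) ^ card (set (w # ws))) = (\<Sum>w\<in>set ws. (1 / real N) ^ c)"
      by (intro sum.cong refl) (simp add: c_def insert_absorb)
    also have "(\<Sum>w\<in>W - set ws. (1 / real N) ^ card (set (w # ws))) = (\<Sum>w\<in>W - set ws. (1 / real N) ^ c * (1 / real N))"
      by (intro sum.cong refl) (simp add: c_def)
    also have "\<dots> \<le> (1 / real N) ^ c"
    proof -
      have "card (W - set ws) \<le> N" using card_mono[OF assms(1), of "W - set ws"] assms(2) by auto
      then have "real (card (W - set ws)) * (1 / real N) \<le> 1" using assms(3) by simp
      then show ?thesis using assms(3) by (simp add: mult_le_cancel_left1 field_simps)
    qed
    also have "(\<Sum>w\<in>set ws. (1 / real N) ^ c) = real c * (1 / real N) ^ c" by (simp add: c_def)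
    also have "real c * (1 / real N) ^ c + (1 / real N) ^ c = real (c + 1) * (1 / real N) ^ c"
      by (simp add: algebra_simps)
    also have "\<dots> \<le> real (Suc n) * (1 / real N) ^ c"
      using cn by (intro mult_right_mono) auto
    finally show ?thesis by (simp add: c_def)
  qed
  then have "(\<Sum>ws\<in>walks W (Suc n). (1 / real N) ^ card (set ws)) \<le>
      (\<Sum>ws\<in>walks W n. real (Suc n) * (1 / real N) ^ card (set ws))"
    unfolding sum_walks_Suc[OF assms(1)] by (subst sum.swap) (rule sum_mono)
  also have "\<dots> \<le> real (Suc n) * fact n"
    unfolding sum_distrib_left[symmetric] by (intro mult_left_mono Suc) auto
  finally show ?case by simp
qed (simp add: walks_0)

section \<open>Moments of centred bits along walks\<close>

abbreviation cbit :: "('a \<Rightarrow> real) \<Rightarrow> ('a \<Rightarrow> bool) \<Rightarrow> 'a \<Rightarrow> real" where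
  "cbit \<mu> g e \<equiv> of_bool (g e) - \<mu> e"

lemma pos_of_mult_ge_1: "x * y \<ge> 1 \<Longrightarrow> x \<ge> 0 \<Longrightarrow> y > 0" for x y :: real
  by (smt (verit) mult_nonneg_nonpos)

lemma prod_list_eq_prod_count:
  fixes f :: "'a \<Rightarrow> real"
  assumes "finite A" "set es \<subseteq> A"
  shows "prod_list (map f es) = (\<Prod>e\<in>A. f e ^ count_list es e)"
  using assms(2)
proof (induction es)
  case (Cons x es)
  have "(\<Prod>e\<in>A. f e ^ count_list (x # es) e) = (\<Prod>e\<in>A. (if e = x then f e else 1) * f e ^ count_list es e)"
    by (rule prod.cong) auto
  also have "\<dots> = (\<Prod>e\<in>A. if e = x then f e else 1) * (\<Prod>e\<in>A. f e ^ count_list es e)"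
    by (rule prod.distrib)
  also have "(\<Prod>e\<in>A. if e = x then f e else 1) = f x" using Cons.prems assms(1) by (simp add: prod.delta)
  finally show ?case using Cons by simp
qed simp

lemma centred_bit_moment:
  fixes \<mu> :: real
  assumes "0 \<le> \<mu>" "\<mu> \<le> P" "P \<le> 1" "c \<noteq> 1"
  shows "\<bar>\<mu> * (1 - \<mu>) ^ c + (1 - \<mu>) * (- \<mu>) ^ c\<bar> \<le> (if c = 0 then 1 else P)"
proof (cases "c = 0")
  case False
  then obtain d where d: "c = d + 2" using assms(4) by (metis One_nat_def Suc_pred add_2_eq_Suc' not0_implies_Suc)
  have m: "\<mu> \<le> 1" using assms by simp
  have "\<bar>\<mu> * (1 - \<mu>) ^ c + (1 - \<mu>) * (- \<mu>) ^ c\<bar> \<le> \<mu> * (1 - \<mu>) ^ c + (1 - \<mu>) * \<mu> ^ c"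
    using assms(1) m by (intro order_trans[OF abs_triangle_ineq]) (simp add: abs_mult power_abs)
  also have "\<dots> \<le> \<mu> * (1 - \<mu>) ^ 2 + (1 - \<mu>) * \<mu> ^ 2"
    unfolding d using assms(1) m by (intro add_mono mult_left_mono power_decreasing) auto
  also have "\<dots> = \<mu> * (1 - \<mu>)" by (simp add: power2_eq_square algebra_simps)
  also have "\<dots> \<le> P" using assms(1,2) m mult_left_le[of "1 - \<mu>" \<mu>] by simp
  finally show ?thesis using False by simp
qed simp

text \<open>Independence factors the expectation over the distinct edges. An edge used exactly once
  contributes its mean, which is zero; an edge used more often contributes at most its
  variance.\<close>

lemma bexp_prod_list:
  assumes A: "finite A" "\<And>e. e \<in> A \<Longrightarrow> 0 \<le> \<mu> e \<and> \<mu> e \<le> P" and P: "P \<le> 1" and es: "set es \<subseteq> A"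
  shows "\<bar>bexp A \<mu> (\<lambda>g. prod_list (map (cbit \<mu> g) es))\<bar>
    \<le> (if \<exists>e. count_list es e = 1 then 0 else P ^ card (set es))"
proof -
  let ?M = "\<lambda>e. \<mu> e * (1 - \<mu> e) ^ count_list es e + (1 - \<mu> e) * (- \<mu> e) ^ count_list es e"
  have "bexp A \<mu> (\<lambda>g. prod_list (map (cbit \<mu> g) es)) =
      bexp A \<mu> (\<lambda>g. \<Prod>e\<in>A. (of_bool (g e) - \<mu> e) ^ count_list es e)"
    by (simp add: prod_list_eq_prod_count[OF A(1) es])
  also have "\<dots> = (\<Prod>e\<in>A. ?M e)"
    using bexp_prod[where A = A and \<mu> = \<mu> and \<phi> = "\<lambda>e b. (of_bool b - \<mu> e) ^ count_list es e"] A P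
    by (smt (verit) bexp_cong of_bool_eq prod.cong)
  finally have eq: "bexp A \<mu> (\<lambda>g. prod_list (map (cbit \<mu> g) es)) = (\<Prod>e\<in>A. ?M e)" .
  show ?thesis
  proof (cases "\<exists>e. count_list es e = 1")
    case True
    then obtain e where e: "count_list es e = 1" by blast
    then have "e \<in> A" using es count_notin[of e es] by force
    moreover have "?M e = 0" by (simp add: e)
    ultimately have "(\<Prod>e\<in>A. ?M e) = 0" using A(1) by (meson prod_zero)
    then show ?thesis using eq by (subst if_P[OF True]) simp
  next
    case False
    have "\<bar>\<Prod>e\<in>A. ?M e\<bar> = (\<Prod>e\<in>A. \<bar>?M e\<bar>)" by (rule abs_prod)
    also have "\<dots> \<le> (\<Prod>e\<in>A. if count_list es e = 0 then 1 else P)"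
      by (intro prod_mono conjI centred_bit_moment) (use False A P in auto)
    also have "\<dots> = (\<Prod>e\<in>A. if e \<in> set es then P else 1)"
      by (intro prod.cong refl) (auto simp: count_list_0_iff)
    also have "\<dots> = (\<Prod>e\<in>set es. P)"
      by (rule prod.mono_neutral_cong_right) (use A es in auto)
    finally show ?thesis using eq False by simp
  qed
qed

text \<open>A closed walk contributes only if it uses each of its edges at least twice; it then has at most
  \<open>L / 2 + 1\<close> vertices. Writing \<open>P\<^sup>v\<^sup>-\<^sup>1 \<le> (N P)\<^sup>L\<^sup>/\<^sup>2 N\<^sup>1\<^sup>-\<^sup>v\<close> reduces the count to a sum of
  \<open>N\<^sup>-\<^sup>v\<close> over all walks.\<close>

lemma bexp_walk:
  assumes I: "finite I" "finite J" and \<mu>: "\<And>e. e \<in> I \<times> J \<Longrightarrow> 0 \<le> \<mu> e \<and> \<mu> e \<le> P" and P: "P \<le> 1"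
    and N: "N > 0" "real N * P \<ge> 1"
    and ws: "ws \<in> walks (I <+> J) (2 * h)" "last (u # ws) = u" "h > 0" "u \<in> I <+> J"
  shows "\<bar>bexp (I \<times> J) \<mu> (\<lambda>g. prod_list (map (case_option 0 (cbit \<mu> g)) (trail u ws)))\<bar>
    \<le> real N * (real N * P) ^ h * (1 / real N) ^ card (set ws)"
proof (cases "None \<in> set (trail u ws)")
  case True
  then have "prod_list (map (case_option 0 (cbit \<mu> g)) (trail u ws)) = 0" for g
    by (force simp: prod_list_zero_iff)
  then have eq0: "(\<lambda>g. prod_list (map (case_option 0 (cbit \<mu> g)) (trail u ws))) = (\<lambda>_. 0)" by (rule ext)
  have "P > 0" using pos_of_mult_ge_1[OF N(2)] by simp
  then show ?thesis unfolding eq0 by simp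
next
  case False
  define es where "es = map the (trail u ws)"
  have tr: "trail u ws = map Some es"
    unfolding es_def map_map by (rule map_idI[symmetric]) (metis False comp_apply option.collapse)
  have P0: "P > 0" using pos_of_mult_ge_1[OF N(2)] by simp
  have len: "length es = 2 * h" using ws(1) by (simp add: es_def walks_def)
  have wsne: "ws \<noteq> []" and wsW: "set ws \<subseteq> I <+> J" using ws by (auto simp: walks_def)
  have sub: "set es \<subseteq> I \<times> J"
  proof
    fix e assume "e \<in> set es"
    then have "Some e \<in> set (trail u ws)" unfolding tr by simp
    then show "e \<in> I \<times> J" using trail_in[OF ws(4) wsW] by blast
  qed
  have "set (u # ws) = set ws" using ws(2) wsne last_in_set[OF wsne] by (auto split: if_splits)
  moreover have "card (set (trail u ws)) = card (set es)"
    unfolding tr by (simp add: card_image)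
  ultimately have v: "card (set ws) \<le> card (set es) + 1"
    using card_vertices_le_trail[OF False] by simp
  have prodeq: "prod_list (map (case_option 0 (cbit \<mu> g)) (trail u ws)) = prod_list (map (cbit \<mu> g) es)" for g
    unfolding tr by (simp add: comp_def)
  have le: "\<bar>bexp (I \<times> J) \<mu> (\<lambda>g. prod_list (map (cbit \<mu> g) es))\<bar>
    \<le> (if \<exists>e. count_list es e = 1 then 0 else P ^ card (set es))"
    by (rule bexp_prod_list) (use I \<mu> P sub in auto)
  show ?thesis
  proof (cases "\<exists>e. count_list es e = 1")
    case True
    then show ?thesis using le P0 unfolding prodeq by auto
  next
    case F: False
    then have "2 * card (set es) \<le> 2 * h" using card_set_le_half[of es] len by auto
    then have ch: "card (set es) \<le> h" by simp
    define v where "v = card (set ws)"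
    have v1: "v \<ge> 1" using wsne by (simp add: v_def card_gt_0_iff Suc_le_eq)
    have "P ^ card (set es) \<le> P ^ (v - 1)"
      using P0 P v by (intro power_decreasing) (auto simp: v_def)
    also have "\<dots> = (real N * P) ^ (v - 1) * (1 / real N) ^ (v - 1)"
      using N(1) by (simp add: power_mult_distrib[symmetric])
    also have "\<dots> \<le> (real N * P) ^ h * (1 / real N) ^ (v - 1)"
      using N v ch by (intro mult_right_mono power_increasing) (auto simp: v_def)
    also have "(1 / real N) ^ (v - 1) = real N * (1 / real N) ^ v"
      using v1 N(1) by (cases v) auto
    finally show ?thesis using le F unfolding prodeq v_def by (simp add: mult_ac)
  qed
qed

lemma bexp_trace_le:
  assumes I: "finite I" "finite J" and \<mu>: "\<And>e. e \<in> I \<times> J \<Longrightarrow> 0 \<le> \<mu> e \<and> \<mu> e \<le> P" and P: "P \<le> 1"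
    and N: "N > 0" "real N * P \<ge> 1" "card I + card J \<le> N" and h: "h > 0"
  shows "bexp (I \<times> J) \<mu> (\<lambda>g. \<Sum>u\<in>I <+> J. mpow (I <+> J) (dil (cbit \<mu> g)) (2 * h) u u)
    \<le> real N * (real N * P) ^ h * fact (2 * h)"
proof -
  let ?W = "I <+> J"
  let ?\<pi> = "\<lambda>u ws g. prod_list (map (case_option 0 (cbit \<mu> g)) (trail u ws))"
  let ?B = "\<lambda>ws. real N * (real N * P) ^ h * (1 / real N) ^ card (set ws)"
  have W: "finite ?W" "card ?W \<le> N" using I N by (auto simp: card_Plus)
  have A: "finite (I \<times> J)" using I by simp
  have B0: "?B ws \<ge> 0" for ws using N by simp
  have "bexp (I \<times> J) \<mu> (\<lambda>g. \<Sum>u\<in>?W. mpow ?W (dil (cbit \<mu> g)) (2 * h) u u) =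
    (\<Sum>u\<in>?W. \<Sum>ws\<in>walks ?W (2 * h). of_bool (last (u # ws) = u) * bexp (I \<times> J) \<mu> (?\<pi> u ws))"
    using A by (simp add: mpow_walks[OF W(1)] Bochner_Integration.integral_sum)
  also have "\<dots> \<le> (\<Sum>u\<in>?W. \<Sum>ws\<in>walks ?W (2 * h). of_bool (last (u # ws) = u) * ?B ws)"
  proof (intro sum_mono)
    fix u ws assume "u \<in> ?W" "ws \<in> walks ?W (2 * h)"
    then show "of_bool (last (u # ws) = u) * bexp (I \<times> J) \<mu> (?\<pi> u ws) \<le> of_bool (last (u # ws) = u) * ?B ws"
    proof (cases "last (u # ws) = u")
      case True
      have "\<bar>bexp (I \<times> J) \<mu> (?\<pi> u ws)\<bar> \<le> ?B ws"
        by (rule bexp_walk[OF I _ P N(1,2) _ True h]) (fact \<open>u \<in> ?W\<close> \<open>ws \<in> walks ?W (2 * h)\<close> \<mu>)+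
      then show ?thesis using True by simp
    qed simp
  qed
  also have "\<dots> = (\<Sum>ws\<in>walks ?W (2 * h). \<Sum>u\<in>?W. of_bool (last (u # ws) = u) * ?B ws)"
    by (rule sum.swap)
  \<comment> \<open>A closed walk starts at its last vertex, so \<open>u\<close> is determined by
    \<open>ws\<close> and the sum over \<open>u\<close> costs nothing.\<close>
  also have "\<dots> \<le> (\<Sum>ws\<in>walks ?W (2 * h). ?B ws)"
  proof (rule sum_mono)
    fix ws assume ws: "ws \<in> walks ?W (2 * h)"
    then have ne: "ws \<noteq> []" using h by (auto simp: walks_def)
    have "(\<Sum>u\<in>?W. of_bool (last (u # ws) = u) * ?B ws) = (\<Sum>u\<in>?W. if u = last ws then ?B ws else 0)"
      by (rule sum.cong) (use ne in auto)
    also have "\<dots> \<le> ?B ws" using W(1) B0[of ws] by (simp add: sum.delta)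
    finally show "(\<Sum>u\<in>?W. of_bool (last (u # ws) = u) * ?B ws) \<le> ?B ws" .
  qed
  also have "\<dots> = real N * (real N * P) ^ h * (\<Sum>ws\<in>walks ?W (2 * h). (1 / real N) ^ card (set ws))"
    by (simp add: sum_distrib_left)
  also have "\<dots> \<le> real N * (real N * P) ^ h * fact (2 * h)"
    by (intro mult_left_mono sum_walks_inverse_card W N) (use N in auto)
  finally show ?thesis .
qed

lemma op_bound_of_trace:
  assumes I: "finite I" "finite J" and \<rho>: "\<rho> \<ge> 0"
    and tr: "(\<Sum>u\<in>I <+> J. mpow (I <+> J) (dil (\<lambda>(i, j). E i j)) (2 ^ (t + 1)) u u) \<le> \<rho> ^ (2 ^ t)"
  shows "op_bound \<rho> I J E"
  unfolding op_bound_def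
proof (intro conjI allI)
  fix x :: "nat \<Rightarrow> real" and y :: "nat \<Rightarrow> real"
  let ?W = "I <+> J"
  let ?Y = "dil (\<lambda>(i, j). E i j)"
  \<comment> \<open>The vector lives on the column side of the dilation; its image lives on the row
    side and is \<open>E y\<close> there.\<close>
  define z where "z = case_sum (\<lambda>i :: nat. 0) y"
  have W: "finite ?W" using I by simp
  have sumW: "(\<Sum>u\<in>?W. f u) = (\<Sum>i\<in>I. f (Inl i)) + (\<Sum>j\<in>J. f (Inr j))" for f :: "nat + nat \<Rightarrow> real"
    using I by (simp add: sum.Plus)
  have zz: "ip ?W z z = ip J y y" by (simp add: ip_def sumW z_def)
  define v where "v i = (\<Sum>j\<in>J. E i j * y j)" for i
  have Y: "app ?W ?Y z (Inl i) = v i" "app ?W ?Y z (Inr j) = 0" for i j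
    by (simp_all add: app_def sumW z_def dil_def v_def)
  have vv: "ip ?W (app ?W ?Y z) (app ?W ?Y z) = ip I v v" by (simp add: ip_def sumW Y)
  have "(ip I v v) ^ (2 ^ t) \<le> (ip J y y) ^ (2 ^ t) * (\<Sum>u\<in>?W. mpow ?W ?Y (2 ^ (t + 1)) u u)"
    using app_le_trace[where W = ?W and Y = ?Y and x = z and t = t, OF W] dil_sym unfolding zz vv by blast
  also have "\<dots> \<le> (ip J y y) ^ (2 ^ t) * \<rho> ^ (2 ^ t)" by (rule mult_left_mono[OF tr]) simp
  also have "\<dots> = (\<rho> * ip J y y) ^ (2 ^ t)" by (simp add: power_mult_distrib mult.commute)
  finally have *: "ip I v v \<le> \<rho> * ip J y y"
    using \<rho> by (subst (asm) power_mono_iff) auto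
  have "(\<Sum>i\<in>I. \<Sum>j\<in>J. x i * E i j * y j) = ip I x v"
    by (simp add: ip_def v_def sum_distrib_left mult.assoc)
  then have "(\<Sum>i\<in>I. \<Sum>j\<in>J. x i * E i j * y j)\<^sup>2 \<le> ip I x x * ip I v v"
    using Cauchy_Schwarz_ip by metis
  also have "\<dots> \<le> ip I x x * (\<rho> * ip J y y)" using * by (rule mult_left_mono) simp
  finally show "(\<Sum>i\<in>I. \<Sum>j\<in>J. x i * E i j * y j)\<^sup>2 \<le> \<rho> * ip I x x * ip J y y" by (simp add: mult_ac)
qed (fact \<rho>)

text \<open>Markov's inequality for the trace of order \<open>L\<close>, a power of two with
  \<open>y \<le> L \<le> 4 * y\<close>, because the passage from traces to norms proceeds by
  repeated squaring. Bounding \<open>fact L\<close> by \<open>L ^ L\<close> costs the factor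
  \<open>L^2\<close> in the squared norm. The extra 8 in \<open>\<rho>\<close> exceeds
  \<open>exp 2\<close>, so the probability drops below \<open>N * exp (- L)\<close>; and 128 is 8
  times the square of 4.\<close>

lemma prob_not_op_bound:
  fixes \<mu> :: "nat \<times> nat \<Rightarrow> real"
  assumes I: "finite I" "finite J" and \<mu>: "\<And>e. e \<in> I \<times> J \<Longrightarrow> 0 \<le> \<mu> e \<and> \<mu> e \<le> P" and P: "P \<le> 1"
    and N: "N > 0" "real N * P \<ge> 1" "card I + card J \<le> N" and y: "y \<ge> 1"
  shows "bprob (I \<times> J) \<mu> {g. \<not> op_bound (128 * y\<^sup>2 * (real N * P)) I J (\<lambda>i j. cbit \<mu> g (i, j))}
    \<le> real N * exp (- y)"
proof -
  define t where "t = nat \<lceil>log 2 (y / 2)\<rceil>"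
  define L where "L = (2 ^ (t + 1) :: nat)"
  have P0: "P > 0" using pos_of_mult_ge_1[OF N(2)] by simp
  have Ly: "real L \<ge> y"
  proof -
    have "y / 2 = 2 powr (log 2 (y / 2))" using y by simp
    also have "\<dots> \<le> 2 powr real t" by (rule powr_mono) (auto simp: t_def intro: order_trans[OF le_of_int_ceiling])
    finally show ?thesis by (simp add: L_def powr_realpow)
  qed
  have L4: "real L \<le> 4 * y"
  proof (cases "log 2 (y / 2) \<ge> 0")
    case True
    have "real t \<le> log 2 (y / 2) + 1" using True by (simp add: t_def)
    then have "2 powr real t \<le> 2 powr (log 2 (y / 2) + 1)" by (rule powr_mono) simp
    also have "\<dots> = y" using y by (simp add: powr_add)
    finally show ?thesis using y by (simp add: L_def powr_realpow)
  next
    case False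
    then have "\<lceil>log 2 (y / 2)\<rceil> \<le> 0" by (simp add: ceiling_le_zero)
    then have "t = 0" by (simp add: t_def)
    then show ?thesis using y by (simp add: L_def)
  qed
  define \<rho> where "\<rho> = 8 * (real L)\<^sup>2 * (real N * P)"
  have L0: "L > 0" "real L > 0" by (auto simp: L_def)
  have \<rho>0: "\<rho> > 0" using L0 N P0 by (simp add: \<rho>_def)
  have \<rho>le: "\<rho> \<le> 128 * y\<^sup>2 * (real N * P)"
  proof -
    have "(real L)\<^sup>2 \<le> (4 * y)\<^sup>2" using L4 y by (intro power_mono) auto
    then show ?thesis unfolding \<rho>_def using N by (intro mult_right_mono) (auto simp: power_mult_distrib)
  qed
  let ?T = "\<lambda>g. \<Sum>u\<in>I <+> J. mpow (I <+> J) (dil (cbit \<mu> g)) L u u"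
  have T0: "?T g \<ge> 0" for g
  proof -
    have W: "finite (I <+> J)" using I by simp
    have "?T g = (\<Sum>u\<in>I <+> J. ip (I <+> J) (mpow (I <+> J) (dil (cbit \<mu> g)) (2 ^ t) u) (mpow (I <+> J) (dil (cbit \<mu> g)) (2 ^ t) u))"
      unfolding L_def by (intro sum.cong refl)
        (simp add: ip_def mpow_add[OF W] mpow_sym[OF W dil_sym] mult_2)
    then show ?thesis by (simp add: sum_nonneg)
  qed
  have "{g. \<not> op_bound (128 * y\<^sup>2 * (real N * P)) I J (\<lambda>i j. cbit \<mu> g (i, j))} \<subseteq> {g. ?T g \<ge> \<rho> ^ (2 ^ t)}"
  proof (safe, rule ccontr)
    fix g :: "nat \<times> nat \<Rightarrow> bool" assume nb: "\<not> op_bound (128 * y\<^sup>2 * (real N * P)) I J (\<lambda>i j. cbit \<mu> g (i, j))"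
      and lt: "\<not> ?T g \<ge> \<rho> ^ (2 ^ t)"
    have "op_bound \<rho> I J (\<lambda>i j. cbit \<mu> g (i, j))"
      
    proof (rule op_bound_of_trace[OF I])
      have "(\<lambda>(i, j). cbit \<mu> g (i, j)) = cbit \<mu> g" by auto
      then show "(\<Sum>u\<in>I <+> J. mpow (I <+> J) (dil (\<lambda>(i, j). cbit \<mu> g (i, j))) (2 ^ (t + 1)) u u) \<le> \<rho> ^ (2 ^ t)"
        using lt by (simp add: L_def)
    qed (use \<rho>0 in simp)
    then have "op_bound (128 * y\<^sup>2 * (real N * P)) I J (\<lambda>i j. cbit \<mu> g (i, j))"
      using \<rho>le by (rule op_bound_mono)
    then show False using nb by blast
  qed
  then have "bprob (I \<times> J) \<mu> {g. \<not> op_bound (128 * y\<^sup>2 * (real N * P)) I J (\<lambda>i j. cbit \<mu> g (i, j))}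
    \<le> bprob (I \<times> J) \<mu> {g. ?T g \<ge> \<rho> ^ (2 ^ t)}" by (rule bprob_mono)
  also have "\<dots> \<le> bexp (I \<times> J) \<mu> ?T / \<rho> ^ (2 ^ t)"
  proof (rule bprob_markov)
    show "finite (I \<times> J)" using I by simp
    show "\<rho> ^ (2 ^ t) > 0" using \<rho>0 by simp
  qed (rule T0)
  also have "\<dots> \<le> (real N * (real N * P) ^ (2 ^ t) * fact L) / \<rho> ^ (2 ^ t)"
  proof (rule divide_right_mono)
    have L2: "L = 2 * 2 ^ t" by (simp add: L_def)
    show "bexp (I \<times> J) \<mu> ?T \<le> real N * (real N * P) ^ (2 ^ t) * fact L"
      unfolding L2 by (rule bexp_trace_le[OF I \<mu> P N]) auto
  qed (use \<rho>0 in simp)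
  also have "\<dots> \<le> (real N * (real N * P) ^ (2 ^ t) * ((real L)\<^sup>2) ^ (2 ^ t)) / \<rho> ^ (2 ^ t)"
  proof -
    have "fact L \<le> real L ^ L" using fact_le_power[of L] by (metis of_nat_fact of_nat_le_iff of_nat_power)
    also have "real L ^ L = ((real L)\<^sup>2) ^ (2 ^ t)"
    proof -
      have "2 * 2 ^ t = L" by (simp add: L_def)
      then show ?thesis by (simp only: power_mult[symmetric])
    qed
    finally show ?thesis using \<rho>0 N by (intro divide_right_mono mult_left_mono) auto
  qed
  also have "\<dots> = real N * (1 / 8) ^ (2 ^ t)"
    using L0 N P0 by (simp add: \<rho>_def power_mult_distrib power_divide)
  also have "(1 / 8 :: real) ^ (2 ^ t) \<le> exp (- y)"
  proof -
    have "exp 2 = exp 1 * exp (1 :: real)" by (simp add: exp_add[symmetric])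
    also have "\<dots> \<le> (272/100) * (272/100)" using e_less_272 by (intro mult_mono) auto
    finally have "exp 2 \<le> (8 :: real)" by simp
    then have "(1 / 8 :: real) \<le> exp (- 2)" by (simp add: exp_minus field_simps)
    then have "(1 / 8 :: real) ^ (2 ^ t) \<le> exp (- 2) ^ (2 ^ t)" by (intro power_mono) auto
    also have "\<dots> = exp (- real L)" by (simp add: exp_of_nat_mult[symmetric] L_def)
    also have "\<dots> \<le> exp (- y)" using Ly by simp
    finally show ?thesis .
  qed
  finally show ?thesis by (simp add: mult_left_mono)
qed

section \<open>Eigenvectors\<close>

text \<open>Gaussian elimination, one equation at a time. Dimension counts below are phrased through
  it: with more unknowns than equations some nonzero combination satisfies all of them.\<close>

lemma homogeneous_solution:
  fixes a :: "'e \<Rightarrow> 'v \<Rightarrow> real"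
  assumes "finite E" "finite V" "card E < card V"
  shows "\<exists>c. (\<exists>v\<in>V. c v \<noteq> 0) \<and> (\<forall>e\<in>E. (\<Sum>v\<in>V. a e v * c v) = 0)"
  using assms
proof (induction E arbitrary: V a rule: finite_induct)
  case empty
  then obtain v where "v \<in> V" by fastforce
  then show ?case by (intro exI[of _ "\<lambda>_. 1"]) auto
next
  case (insert e E)
  show ?case
  proof (cases "\<forall>v\<in>V. a e v = 0")
    case True
    have "card E < card V" using insert by simp
    then obtain c where "\<exists>v\<in>V. c v \<noteq> 0" "\<forall>e\<in>E. (\<Sum>v\<in>V. a e v * c v) = 0"
      using insert.IH[of V a] insert.prems by blast
    then show ?thesis using True by (intro exI[of _ c]) auto
  next
    case False
    then obtain v0 where v0: "v0 \<in> V" "a e v0 \<noteq> 0" by blast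
    define V' where "V' = V - {v0}"
    have V': "finite V'" "V = insert v0 V'" "v0 \<notin> V'" using insert.prems v0 by (auto simp: V'_def)
    have "card E < card V'" using insert V' by simp
    then obtain c where c: "\<exists>v\<in>V'. c v \<noteq> 0"
        "\<forall>e'\<in>E. (\<Sum>v\<in>V'. (a e' v - a e' v0 * a e v / a e v0) * c v) = 0"
      using insert.IH[of V' "\<lambda>e' v. a e' v - a e' v0 * a e v / a e v0"] V' by blast
    define s where "s = (\<Sum>v\<in>V'. a e v * c v)"
    define d where "d = c(v0 := - s / a e v0)"
    have dsum: "(\<Sum>v\<in>V. a e' v * d v) = a e' v0 * (- s / a e v0) + (\<Sum>v\<in>V'. a e' v * c v)" for e'
    proof -
      have "(\<Sum>v\<in>V'. a e' v * d v) = (\<Sum>v\<in>V'. a e' v * c v)"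
        by (rule sum.cong) (use V' in \<open>auto simp: d_def\<close>)
      then show ?thesis using V' by (simp add: d_def)
    qed
    have "(\<Sum>v\<in>V. a e' v * d v) = 0" if "e' \<in> E" for e'
    proof -
      have "0 = (\<Sum>v\<in>V'. a e' v * c v - a e' v0 / a e v0 * (a e v * c v))"
        using c(2) that by (simp add: algebra_simps)
      also have "\<dots> = (\<Sum>v\<in>V'. a e' v * c v) - a e' v0 / a e v0 * s"
        by (simp add: sum_subtractf sum_distrib_left s_def)
      finally show ?thesis using dsum[of e'] by simp
    qed
    moreover have "(\<Sum>v\<in>V. a e v * d v) = 0" using dsum[of e] v0 by (simp add: s_def)
    moreover have "\<exists>v\<in>V. d v \<noteq> 0" using c(1) V' by (auto simp: d_def)
    ultimately show ?thesis by blast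
  qed
qed

text \<open>A dependent input produces a zero vector rather than a shorter list, so the index range
  stays \<open>k\<close> and norms are 0 or 1. The code needs no case distinction for this:
  normalising by \<open>s = 0\<close> yields 0.\<close>

lemma gram_schmidt_ip:
  fixes f :: "nat \<Rightarrow> 'a \<Rightarrow> real"
  assumes S: "finite S"
  shows "\<exists>h. (\<forall>l<k. \<forall>l'<k. l \<noteq> l' \<longrightarrow> ip S (h l) (h l') = 0) \<and>
    (\<forall>l<k. ip S (h l) (h l) \<in> {0, 1}) \<and> (\<forall>l<k. \<exists>c. \<forall>i\<in>S. f l i = (\<Sum>l'<k. c l' * h l' i))"
proof (induction k)
  case (Suc k)
  then obtain h where h: "\<And>l l'. l < k \<Longrightarrow> l' < k \<Longrightarrow> l \<noteq> l' \<Longrightarrow> ip S (h l) (h l') = 0"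
    "\<And>l. l < k \<Longrightarrow> ip S (h l) (h l) = 0 \<or> ip S (h l) (h l) = 1"
    "\<And>l. l < k \<Longrightarrow> \<exists>c. \<forall>i\<in>S. f l i = (\<Sum>l'<k. c l' * h l' i)" by fastforce
  define r where "r i = f k i - (\<Sum>l<k. ip S (f k) (h l) * h l i)" for i
  define s where "s = sqrt (ip S r r)"
  define h' where "h' = h(k := (\<lambda>i. r i / s))"
  have r0: "ip S r (h l) = 0" if l: "l < k" for l
  proof -
    have "ip S r (h l) = ip S (f k) (h l) - (\<Sum>l'<k. ip S (f k) (h l') * ip S (h l') (h l))"
      unfolding r_def by (simp add: ip_diff_left ip_sum_left ip_scale_left)
    also have "(\<Sum>l'<k. ip S (f k) (h l') * ip S (h l') (h l)) =
        (\<Sum>l'<k. if l' = l then ip S (f k) (h l) * ip S (h l) (h l) else 0)"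
      by (rule sum.cong) (use h(1) l in auto)
    also have "\<dots> = ip S (f k) (h l) * ip S (h l) (h l)" using l by simp
    finally have eq: "ip S r (h l) = ip S (f k) (h l) - ip S (f k) (h l) * ip S (h l) (h l)" .
    show ?thesis
    proof (cases "ip S (h l) (h l) = 0")
      case True
      then have "ip S r (h l) = 0" using S by (simp add: ip_eq_0_iff) (simp add: ip_def)
      then show ?thesis .
    next
      case False
      then show ?thesis using h(2)[OF l] eq by simp
    qed
  qed
  have rs: "ip S (h' k) z = ip S r z / s" for z
    using ip_scale_left[of S "1 / s" r z] by (simp add: h'_def)
  have kk: "ip S (h' k) (h' k) = ip S r r / s / s"
    using rs[of "h' k"] rs[of r] by (simp add: ip_commute)
  have hl: "h' l = h l" if "l < k" for l using that by (simp add: h'_def)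
  have n1: "ip S (h' k) (h' k) \<in> {0, 1}"
    unfolding kk s_def by (cases "ip S r r = 0") (auto simp: divide_divide_eq_left)
  have n2: "ip S (h' k) (h' l) = 0" "ip S (h' l) (h' k) = 0" if "l < k" for l
    using rs[of "h' l"] r0[OF that] that by (auto simp: h'_def ip_commute)
  have n3: "\<exists>c. \<forall>i\<in>S. f l i = (\<Sum>l'<Suc k. c l' * h' l' i)" if "l < Suc k" for l
  proof (cases "l = k")
    case False
    then have "l < k" using that by simp
    then obtain c where c: "\<forall>i\<in>S. f l i = (\<Sum>l'<k. c l' * h l' i)" using h(3) by blast
    have "\<forall>i\<in>S. f l i = (\<Sum>l'<Suc k. (c(k := 0)) l' * h' l' i)" using c by (simp add: h'_def)
    then show ?thesis by blast
  next
    case True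
    have rr: "r i = s * h' k i" if "i \<in> S" for i
    proof (cases "s = 0")
      case True
      then have "ip S r r = 0" by (simp add: s_def)
      then show ?thesis using S that by (simp add: ip_eq_0_iff True)
    qed (simp add: h'_def)
    have "\<forall>i\<in>S. f k i = (\<Sum>l'<Suc k. ((\<lambda>l. ip S (f k) (h l))(k := s)) l' * h' l' i)"
    proof
      fix i assume i: "i \<in> S"
      have "f k i = (\<Sum>l<k. ip S (f k) (h l) * h l i) + s * h' k i"
        using rr[OF i] by (simp add: r_def)
      then show "f k i = (\<Sum>l'<Suc k. ((\<lambda>l. ip S (f k) (h l))(k := s)) l' * h' l' i)" by (simp add: h'_def)
    qed
    then show ?thesis using True by blast
  qed
  show ?case
  proof (intro exI[of _ h'] conjI allI impI)
    fix l l' assume "l < Suc k" "l' < Suc k" "l \<noteq> l'"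
    then show "ip S (h' l) (h' l') = 0"
      using n2 h(1) hl by (cases "l = k"; cases "l' = k") auto
  next
    fix l assume "l < Suc k"
    then show "ip S (h' l) (h' l) \<in> {0, 1}" using n1 h(2) hl by (cases "l = k") auto
  qed (rule n3)
qed simp

definition orthonormal :: "'a set \<Rightarrow> nat \<Rightarrow> (nat \<Rightarrow> 'a \<Rightarrow> real) \<Rightarrow> bool" where
  "orthonormal S n u \<longleftrightarrow> (\<forall>j<n. \<forall>j'<n. ip S (u j) (u j') = of_bool (j = j'))"

definition eigenbasis :: "'a set \<Rightarrow> ('a \<Rightarrow> 'a \<Rightarrow> real) \<Rightarrow> (nat \<Rightarrow> 'a \<Rightarrow> real) \<Rightarrow> (nat \<Rightarrow> real) \<Rightarrow> bool" where
  "eigenbasis S H u lam \<longleftrightarrow> orthonormal S (card S) u \<and>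
     (\<forall>j<card S. \<forall>i\<in>S. app S H (u j) i = lam j * u j i) \<and>
     (\<forall>j j'. j \<le> j' \<longrightarrow> j' < card S \<longrightarrow> lam j' \<le> lam j)"

text \<open>Pinning functions to 0 off \<open>S\<close> puts the constrained unit sphere into a
  compact product of intervals. It is nonempty since there are fewer than \<open>card S\<close>
  constraints, and homogeneity extends the maximum to all \<open>y\<close>.\<close>

lemma rayleigh_max:
  fixes H :: "'a \<Rightarrow> 'a \<Rightarrow> real"
  assumes S: "finite S" and m: "m < card S" and on: "orthonormal S m u"
  shows "\<exists>x. ip S x x = 1 \<and> (\<forall>j<m. ip S x (u j) = 0) \<and>
    (\<forall>y. (\<forall>j<m. ip S y (u j) = 0) \<longrightarrow> ip S y (app S H y) \<le> ip S x (app S H x) * ip S y y)"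
proof -
  define box where "box = PiE UNIV (\<lambda>i. if i \<in> S then {-1..1 :: real} else {0})"
  define K where "K = {x \<in> box. ip S x x = 1 \<and> (\<forall>j<m. ip S x (u j) = 0)}"
  have cb: "compact box"
    unfolding box_def
    using compactin_PiE[of "\<lambda>_. euclidean :: real topology" UNIV "\<lambda>i. if i \<in> S then {-1..1 :: real} else {0}"]
    by (simp add: euclidean_product_topology)
  have cont: "continuous_on UNIV (\<lambda>x. ip S x z)" "continuous_on UNIV (\<lambda>x. ip S x x)"
    "continuous_on UNIV (\<lambda>x. ip S x (app S H x))" for z :: "'a \<Rightarrow> real"
    unfolding ip_def app_def by (intro continuous_intros continuous_on_product_coordinates)+
  have "closed {x. ip S x x = 1 \<and> (\<forall>j<m. ip S x (u j) = 0)}"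
  proof -
    have "{x. ip S x x = 1 \<and> (\<forall>j<m. ip S x (u j) = 0)} =
        (\<lambda>x. ip S x x) -` {1} \<inter> (\<Inter>j\<in>{..<m}. (\<lambda>x. ip S x (u j)) -` {0})" by auto
    then show ?thesis
      by (simp only:) (intro closed_Int closed_INT closed_vimage closed_singleton cont ballI)
  qed
  then have cK: "compact K" unfolding K_def using cb by (simp add: compact_Int_closed Collect_conj_eq)
  have norm1: "\<exists>x\<in>K. \<exists>s>0. ip S y y = s\<^sup>2 \<and> (\<forall>i\<in>S. y i = s * x i)"
    if y: "\<forall>j<m. ip S y (u j) = 0" "ip S y y \<noteq> 0" for y
  proof -
    define s where "s = sqrt (ip S y y)"
    have pos: "ip S y y > 0" using y(2) by (simp add: less_le)
    then have s: "s > 0" "s\<^sup>2 = ip S y y" by (auto simp: s_def)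
    define x where "x i = (if i \<in> S then y i / s else 0)" for i
    have yx: "\<forall>i\<in>S. y i = s * x i" using s by (simp add: x_def)
    have xz: "ip S x z = ip S y z / s" for z
    proof -
      have "ip S y z = ip S (\<lambda>i. s * x i) z" by (rule ip_cong) (use yx in auto)
      then show ?thesis using s by (simp add: ip_scale_left)
    qed
    have xx: "ip S x x = 1" using xz[of x] xz[of y] s y(2) by (simp add: ip_commute power2_eq_square)
    have ax: "\<bar>x i\<bar> \<le> 1" if "i \<in> S" for i
    proof -
      have "x i * x i \<le> ip S x x" unfolding ip_def by (rule member_le_sum) (use S that in auto)
      then show ?thesis using xx by (simp add: abs_square_le_1[symmetric] power2_eq_square)
    qed
    have "x i \<in> (if i \<in> S then {-1..1} else {0})" for i
    proof (cases "i \<in> S")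
      case True
      have "-1 \<le> x i" "x i \<le> 1" using ax[OF True] by linarith+
      then show ?thesis using True by simp
    qed (simp add: x_def)
    then have "x \<in> box" by (simp add: box_def PiE_iff)
    then show ?thesis using xx xz y s yx by (intro bexI[of _ x]) (auto simp: K_def)
  qed
  have "K \<noteq> {}"
  proof -
    obtain c where c: "\<exists>v\<in>S. c v \<noteq> 0" "\<forall>j\<in>{..<m}. (\<Sum>v\<in>S. u j v * c v) = 0"
      using homogeneous_solution[of "{..<m}" S u] S m by auto
    then have "\<forall>j<m. ip S c (u j) = 0" by (simp add: ip_def mult.commute)
    moreover have "ip S c c \<noteq> 0" using c(1) S by (auto simp: ip_eq_0_iff)
    ultimately show ?thesis using norm1 by blast
  qed
  then obtain x where x: "x \<in> K" "\<And>y. y \<in> K \<Longrightarrow> ip S y (app S H y) \<le> ip S x (app S H x)"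
    using continuous_attains_sup[OF cK _ continuous_on_subset[OF cont(3) subset_UNIV]] by blast
  have "ip S y (app S H y) \<le> ip S x (app S H x) * ip S y y" if y: "\<forall>j<m. ip S y (u j) = 0" for y
  proof (cases "ip S y y = 0")
    case True
    then have "\<forall>i\<in>S. y i = 0" using S by (simp add: ip_eq_0_iff)
    then show ?thesis using True by (simp add: ip_def)
  next
    case False
    then obtain x' s where x': "x' \<in> K" "s > 0" "ip S y y = s\<^sup>2" "\<forall>i\<in>S. y i = s * x' i"
      using norm1[OF y] by blast
    have "app S H y = (\<lambda>i. s * app S H x' i)" using x'(4) by (auto simp: app_def sum_distrib_left mult_ac intro!: sum.cong)
    then have "ip S y (app S H y) = ip S (\<lambda>i. s * x' i) (\<lambda>i. s * app S H x' i)"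
      using x'(4) by (intro ip_cong) auto
    also have "\<dots> = s\<^sup>2 * ip S x' (app S H x')" by (simp add: ip_scale_left ip_scale_right power2_eq_square)
    also have "\<dots> \<le> s\<^sup>2 * ip S x (app S H x)" using x(2)[OF x'(1)] by (intro mult_left_mono) auto
    finally show ?thesis by (simp add: x'(3) mult.commute)
  qed
  then show ?thesis using x(1) by (auto simp: K_def)
qed

lemma app_add: "app S H (\<lambda>i. x i + y i) = (\<lambda>i. app S H x i + app S H y i)"
  by (simp add: app_def algebra_simps sum.distrib)

lemma app_scale: "app S H (\<lambda>i. c * x i) = (\<lambda>i. c * app S H x i)"
  by (auto simp: app_def sum_distrib_left algebra_simps)

lemma app_cong: "(\<And>i. i \<in> S \<Longrightarrow> x i = y i) \<Longrightarrow> app S H x = app S H y"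
  by (simp add: app_def)

lemma nonpos_of_quadratic:
  fixes a b :: real
  assumes "\<And>e. e > 0 \<Longrightarrow> 2 * e * a + e\<^sup>2 * b \<le> 0"
  shows "a \<le> 0"
proof (rule ccontr)
  assume "\<not> a \<le> 0"
  then have a: "a > 0" by simp
  define e where "e = a / (1 + \<bar>b\<bar>)"
  have e: "e > 0" using a by (simp add: e_def)
  have "e * \<bar>b\<bar> \<le> a" using a by (simp add: e_def field_simps)
  moreover have "e * (- \<bar>b\<bar>) \<le> e * b"  using e by (intro mult_left_mono) auto
  ultimately have "e * b \<ge> - a" by simp
  then have "0 < e * (2 * a + e * b)" using a e by (intro mult_pos_pos) auto
  then show False using assms[OF e] by (simp add: power2_eq_square algebra_simps)
qed

text \<open>Every new vector maximises the Rayleigh quotient on the orthogonal complement of its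
  predecessors. Its residual \<open>z\<close> lies in the same complement, and maximality against a
  small move towards \<open>z\<close> forces \<open>ip S z z \<le> 0\<close>. The induction also
  records that each earlier eigenvalue bounds the form on the complement, which gives the decreasing
  order.\<close>

theorem eigenbasis_exists:
  fixes H :: "'a \<Rightarrow> 'a \<Rightarrow> real"
  assumes S: "finite S" and sym: "\<And>u v. H u v = H v u"
  shows "\<exists>u lam. eigenbasis S H u lam"
proof -
  have "\<exists>u lam. orthonormal S m u \<and> (\<forall>j<m. \<forall>i\<in>S. app S H (u j) i = lam j * u j i) \<and>
     (\<forall>j j'. j \<le> j' \<longrightarrow> j' < m \<longrightarrow> lam j' \<le> lam j) \<and>
     (\<forall>j<m. \<forall>y. (\<forall>l<m. ip S y (u l) = 0) \<longrightarrow> ip S y (app S H y) \<le> lam j * ip S y y)"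
    if "m \<le> card S" for m
    using that
  proof (induction m)
    case 0
    then show ?case by (auto simp: orthonormal_def)
  next
    case (Suc m)
    then obtain u lam where IH: "orthonormal S m u" "\<forall>j<m. \<forall>i\<in>S. app S H (u j) i = lam j * u j i"
     "\<forall>j j'. j \<le> j' \<longrightarrow> j' < m \<longrightarrow> lam j' \<le> lam j"
     "\<forall>j<m. \<forall>y. (\<forall>l<m. ip S y (u l) = 0) \<longrightarrow> ip S y (app S H y) \<le> lam j * ip S y y" by auto
    obtain x where x: "ip S x x = 1" "\<forall>j<m. ip S x (u j) = 0"
      "\<And>y. \<forall>j<m. ip S y (u j) = 0 \<Longrightarrow> ip S y (app S H y) \<le> ip S x (app S H x) * ip S y y"
      using rayleigh_max[OF S _ IH(1), of H] Suc.prems by auto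
    define l where "l = ip S x (app S H x)"
    define z where "z i = app S H x i - l * x i" for i
    have sy: "ip S (app S H x) z = ip S x (app S H z)" for x z by (rule app_sym) (rule sym)
    have Hu: "ip S (app S H y) (u j) = lam j * ip S y (u j)" if "j < m" for j y
    proof -
      have "ip S (app S H y) (u j) = ip S y (app S H (u j))" by (rule sy)
      also have "\<dots> = ip S y (\<lambda>i. lam j * u j i)" using IH(2) that by (intro ip_cong) auto
      finally show ?thesis by (simp add: ip_scale_right)
    qed
    have zu: "\<forall>j<m. ip S z (u j) = 0"
      unfolding z_def using Hu x(2) by (simp add: ip_diff_left ip_scale_left)
    have "ip S z z \<le> 0"
    proof (rule nonpos_of_quadratic)
      fix e :: real assume "e > 0"
      let ?w = "\<lambda>i. x i + e * z i"
      have "\<forall>j<m. ip S ?w (u j) = 0" using x(2) zu by (simp add: ip_add_left ip_scale_left)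
      then have "ip S ?w (app S H ?w) \<le> l * ip S ?w ?w" unfolding l_def by (rule x(3))
      moreover have "ip S ?w (app S H ?w) = l + 2 * e * ip S z (app S H x) + e\<^sup>2 * ip S z (app S H z)"
        using sy[of x z]
        by (simp add: app_add app_scale ip_add_left ip_add_right ip_scale_left ip_scale_right l_def
            power2_eq_square algebra_simps ip_commute[of S _ z])
      moreover have "ip S ?w ?w = 1 + 2 * e * ip S z x + e\<^sup>2 * ip S z z"
        by (simp add: ip_add_left ip_add_right ip_scale_left ip_scale_right x(1)
            power2_eq_square algebra_simps ip_commute[of S x z])
      moreover have "ip S z (app S H x) = ip S z z + l * ip S z x"
      proof -
        have "ip S z (app S H x) = ip S z (\<lambda>i. z i + l * x i)" by (simp add: z_def)
        then show ?thesis by (simp add: ip_add_right ip_scale_right)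
      qed
      ultimately show "2 * e * ip S z z + e\<^sup>2 * (ip S z (app S H z) - l * ip S z z) \<le> 0"
        by (simp add: algebra_simps)
    qed
    then have "ip S z z = 0" using ip_ge_0[of S z] by linarith
    then have zz: "\<forall>i\<in>S. app S H x i = l * x i" using S by (simp add: ip_eq_0_iff z_def)
    define u' where "u' = u(m := x)"
    define lam' where "lam' = lam(m := l)"
    have u'[simp]: "u' m = x" "\<And>j. j < m \<Longrightarrow> u' j = u j" and lam'[simp]: "lam' m = l" "\<And>j. j < m \<Longrightarrow> lam' j = lam j"
      by (auto simp: u'_def lam'_def)
    have ll: "l \<le> lam j" if "j < m" for j
    proof -
      have "ip S x (app S H x) \<le> lam j * ip S x x" using IH(4) that x(2) by blast
      then show ?thesis by (simp add: l_def x(1))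
    qed
    have a1: "orthonormal S (Suc m) u'"
      unfolding orthonormal_def
    proof (intro allI impI)
      fix j j' assume "j < Suc m" "j' < Suc m"
      then show "ip S (u' j) (u' j') = of_bool (j = j')"
        using IH(1) x(1,2) ip_commute[of S "u j" x]
        by (cases "j = m"; cases "j' = m") (auto simp: orthonormal_def)
    qed
    have a2: "\<forall>j<Suc m. \<forall>i\<in>S. app S H (u' j) i = lam' j * u' j i"
      using IH(2) zz by (auto simp: less_Suc_eq)
    have a3: "\<forall>j j'. j \<le> j' \<longrightarrow> j' < Suc m \<longrightarrow> lam' j' \<le> lam' j"
    proof (intro allI impI)
      fix j j' assume "j \<le> j'" "j' < Suc m"
      then show "lam' j' \<le> lam' j" using IH(3) ll by (cases "j' = m"; cases "j = m") (auto simp: less_Suc_eq)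
    qed
    have a4: "ip S y (app S H y) \<le> lam' j * ip S y y" if "j < Suc m" "\<forall>l<Suc m. ip S y (u' l) = 0" for j y
    proof -
      have y: "\<forall>l<m. ip S y (u l) = 0"
      proof (intro allI impI)
        fix l assume "l < m"
        then show "ip S y (u l) = 0" using that(2)[rule_format, of l] by simp
      qed
      show ?thesis
      proof (cases "j = m")
        case True
        then show ?thesis using x(3)[OF y] by (simp add: l_def)
      next
        case False
        then have "j < m" using that(1) by simp
        then show ?thesis using IH(4) y by simp
      qed
    qed
    show ?case
    proof (intro exI[of _ u'] exI[of _ lam'] conjI)
      show "\<forall>j<Suc m. \<forall>y. (\<forall>l<Suc m. ip S y (u' l) = 0) \<longrightarrow> ip S y (app S H y) \<le> lam' j * ip S y y"
        using a4 by blast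
    qed (fact a1 a2 a3)+
  qed
  from this[OF order_refl] show ?thesis unfolding eigenbasis_def
    by (elim exE conjE) (intro exI conjI; assumption)
qed

text \<open>The remainder \<open>r\<close> and the \<open>card S\<close> orthonormal vectors are one
  vector too many for \<open>card S\<close> coordinates. In a dependence between them orthogonality
  kills all coefficients but that of \<open>r\<close>, so \<open>r\<close> vanishes on
  \<open>S\<close>.\<close>

lemma eigenbasis_expand:
  assumes S: "finite S" and on: "orthonormal S (card S) u" and i: "i \<in> S"
  shows "x i = (\<Sum>j<card S. ip S x (u j) * u j i)"
proof -
  let ?n = "card S"
  define r where "r i = x i - (\<Sum>j<?n. ip S x (u j) * u j i)" for i
  have ru: "ip S r (u j) = 0" if "j < ?n" for j
  proof -
    have "ip S r (u j) = ip S x (u j) - (\<Sum>l<?n. ip S x (u l) * ip S (u l) (u j))"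
      unfolding r_def by (simp add: ip_diff_left ip_sum_left ip_scale_left)
    also have "(\<Sum>l<?n. ip S x (u l) * ip S (u l) (u j)) = (\<Sum>l<?n. if l = j then ip S x (u j) else 0)"
      by (rule sum.cong) (use on that in \<open>auto simp: orthonormal_def\<close>)
    finally show ?thesis using that by simp
  qed
  define f where "f = u(?n := r)"
  obtain c where c: "\<exists>j\<in>{..?n}. c j \<noteq> 0" "\<forall>i\<in>S. (\<Sum>j\<in>{..?n}. f j i * c j) = 0"
    using homogeneous_solution[of S "{..?n}" "\<lambda>i j. f j i"] S by auto
  have fsum: "(\<Sum>j\<le>?n. c j * ip S (f j) z) = 0" for z
  proof -
    have "(\<Sum>j\<le>?n. c j * ip S (f j) z) = ip S (\<lambda>i. \<Sum>j\<le>?n. c j * f j i) z"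
      by (simp add: ip_sum_left ip_scale_left)
    also have "\<dots> = ip S (\<lambda>i. 0) z" using c(2) by (intro ip_cong) (auto simp: mult.commute)
    finally show ?thesis by (simp add: ip_def)
  qed
  have split: "(\<Sum>j\<le>?n. g j) = g ?n + (\<Sum>j<?n. g j)" for g :: "nat \<Rightarrow> real"
    by (simp add: lessThan_Suc_atMost[symmetric] add.commute)
  have cj: "c j = 0" if "j < ?n" for j
  proof -
    have "(\<Sum>l<?n. c l * ip S (f l) (u j)) = (\<Sum>l<?n. if l = j then c j else 0)"
      by (rule sum.cong) (use on that in \<open>auto simp: orthonormal_def f_def\<close>)
    then show ?thesis using fsum[of "u j"] that ru[OF that] unfolding split by (simp add: f_def)
  qed
  have "c ?n \<noteq> 0" using c(1) cj by (metis atMost_iff le_neq_implies_less)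
  moreover have "c ?n * ip S r r = 0" using fsum[of r] cj unfolding split by (simp add: f_def)
  ultimately have "ip S r r = 0" by simp
  then have "r i = 0" using S i by (simp add: ip_eq_0_iff)
  then show ?thesis by (simp add: r_def)
qed

lemma eigenbasis_forms:
  assumes S: "finite S" and eb: "eigenbasis S H u lam"
  shows "ip S x x = (\<Sum>j<card S. (ip S x (u j))\<^sup>2)"
    and "ip S x (app S H x) = (\<Sum>j<card S. lam j * (ip S x (u j))\<^sup>2)"
proof -
  have on: "orthonormal S (card S) u" and eig: "\<And>j i. j < card S \<Longrightarrow> i \<in> S \<Longrightarrow> app S H (u j) i = lam j * u j i"
    using eb by (auto simp: eigenbasis_def)
  let ?c = "\<lambda>j. ip S x (u j)"
  have ex: "ip S z x = (\<Sum>j<card S. ?c j * ip S z (u j))" for z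
  proof -
    have "ip S z x = ip S z (\<lambda>i. \<Sum>j<card S. ?c j * u j i)"
      by (rule ip_cong) (auto intro: eigenbasis_expand[OF S on])
    then show ?thesis by (simp add: ip_sum_right ip_scale_right)
  qed
  show "ip S x x = (\<Sum>j<card S. (?c j)\<^sup>2)" using ex[of x] by (simp add: power2_eq_square)
  have "app S H x = app S H (\<lambda>i. \<Sum>j<card S. ?c j * u j i)"
    by (rule app_cong) (rule eigenbasis_expand[OF S on])
  also have "\<dots> = (\<lambda>i. \<Sum>j<card S. ?c j * app S H (u j) i)"
    unfolding app_def sum_distrib_left by (subst sum.swap) (simp add: mult_ac)
  finally have "ip S x (app S H x) = (\<Sum>j<card S. ?c j * ip S x (app S H (u j)))"
    by (simp add: ip_sum_right ip_scale_right)
  also have "\<dots> = (\<Sum>j<card S. ?c j * ip S x (\<lambda>i. lam j * u j i))"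
    by (intro sum.cong refl arg_cong2[where f = times] ip_cong) (auto simp: eig)
  finally show "ip S x (app S H x) = (\<Sum>j<card S. lam j * (?c j)\<^sup>2)"
    by (simp add: ip_scale_right power2_eq_square algebra_simps)
qed

section \<open>Best approximations of bounded rank\<close>

definition fro :: "'a set \<Rightarrow> nat \<Rightarrow> ('a \<Rightarrow> nat \<Rightarrow> real) \<Rightarrow> real" where
  "fro S n A = (\<Sum>i\<in>S. \<Sum>j<n. (A i j)\<^sup>2)"

definition rank_le :: "'a set \<Rightarrow> nat \<Rightarrow> nat \<Rightarrow> ('a \<Rightarrow> nat \<Rightarrow> real) \<Rightarrow> bool" where
  "rank_le S n k X \<longleftrightarrow> (\<exists>f g. \<forall>i\<in>S. \<forall>j<n. X i j = (\<Sum>l<k. f l i * g l j))"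

definition best_approx :: "'a set \<Rightarrow> nat \<Rightarrow> nat \<Rightarrow> ('a \<Rightarrow> nat \<Rightarrow> real) \<Rightarrow> ('a \<Rightarrow> nat \<Rightarrow> real) \<Rightarrow> bool" where
  "best_approx S n k B X \<longleftrightarrow> rank_le S n k X \<and>
     (\<forall>Y. rank_le S n k Y \<longrightarrow> fro S n (\<lambda>i j. B i j - X i j) \<le> fro S n (\<lambda>i j. B i j - Y i j))"

definition onz :: "'a set \<Rightarrow> nat \<Rightarrow> (nat \<Rightarrow> 'a \<Rightarrow> real) \<Rightarrow> bool" where
  "onz S k h \<longleftrightarrow> (\<forall>l<k. \<forall>l'<k. l \<noteq> l' \<longrightarrow> ip S (h l) (h l') = 0) \<and> (\<forall>l<k. ip S (h l) (h l) \<in> {0, 1})"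

lemma fro_ge_0 [simp]: "fro S n A \<ge> 0" by (simp add: fro_def sum_nonneg)

lemma fro_cong: "(\<And>i j. i \<in> S \<Longrightarrow> j < n \<Longrightarrow> A i j = A' i j) \<Longrightarrow> fro S n A = fro S n A'"
  by (simp add: fro_def)

lemma fro_columns: "fro S n A = (\<Sum>j<n. ip S (\<lambda>i. A i j) (\<lambda>i. A i j))"
  unfolding fro_def ip_def by (subst sum.swap) (simp add: power2_eq_square)

lemma rank_le_onz:
  assumes "finite S" "rank_le S n k X"
  obtains h g where "onz S k h" "\<And>i j. i \<in> S \<Longrightarrow> j < n \<Longrightarrow> X i j = (\<Sum>l<k. g l j * h l i)"
proof -
  obtain f g where fg: "\<And>i j. i \<in> S \<Longrightarrow> j < n \<Longrightarrow> X i j = (\<Sum>l<k. f l i * g l j)"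
    using assms(2) unfolding rank_le_def by blast
  obtain h where h: "\<forall>l<k. \<forall>l'<k. l \<noteq> l' \<longrightarrow> ip S (h l) (h l') = 0"
    "\<forall>l<k. ip S (h l) (h l) \<in> {0, 1}" "\<forall>l<k. \<exists>c. \<forall>i\<in>S. f l i = (\<Sum>l'<k. c l' * h l' i)"
    using gram_schmidt_ip[OF assms(1), of k f] by blast
  from h(3) obtain c where c: "\<And>l i. l < k \<Longrightarrow> i \<in> S \<Longrightarrow> f l i = (\<Sum>l'<k. c l l' * h l' i)" by metis
  show thesis
  proof (rule that[of h "\<lambda>l' j. \<Sum>l<k. c l l' * g l j"])
    show "onz S k h" using h by (simp add: onz_def)
    fix i j assume ij: "i \<in> S" "j < n"
    have "X i j = (\<Sum>l<k. (\<Sum>l'<k. c l l' * h l' i) * g l j)" using fg ij c by simp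
    also have "\<dots> = (\<Sum>l'<k. (\<Sum>l<k. c l l' * g l j) * h l' i)"
      unfolding sum_distrib_right by (subst sum.swap) (simp add: mult_ac)
    finally show "X i j = (\<Sum>l'<k. (\<Sum>l<k. c l l' * g l j) * h l' i)" .
  qed
qed

lemma onz_ip_zero:
  assumes "finite S" "onz S k h" "l < k" "ip S (h l) (h l) \<noteq> 1"
  shows "ip S x (h l) = 0"
proof -
  have "ip S (h l) (h l) = 0" using assms by (auto simp: onz_def)
  then have "\<forall>i\<in>S. h l i = 0" using assms(1) by (simp add: ip_eq_0_iff)
  then show ?thesis by (simp add: ip_def)
qed

text \<open>Completing the square in each coefficient. The weight \<open>ip S (h l) (h l)\<close> is
  0 for a zero vector, whose coefficient then does not matter.\<close>

lemma onz_distance: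
  assumes S: "finite S" and h: "onz S k h"
  shows "ip S (\<lambda>i. x i - (\<Sum>l<k. c l * h l i)) (\<lambda>i. x i - (\<Sum>l<k. c l * h l i)) =
    ip S x x - (\<Sum>l<k. (ip S x (h l))\<^sup>2) + (\<Sum>l<k. ip S (h l) (h l) * (c l - ip S x (h l))\<^sup>2)"
proof -
  let ?y = "\<lambda>i. \<Sum>l<k. c l * h l i"
  have 1: "ip S x ?y = (\<Sum>l<k. c l * ip S x (h l))" by (simp add: ip_sum_right ip_scale_right)
  have "ip S ?y ?y = (\<Sum>l<k. c l * ip S (h l) ?y)" by (simp only: ip_sum_left ip_scale_left)
  also have "\<dots> = (\<Sum>l<k. c l * (\<Sum>l'<k. c l' * ip S (h l) (h l')))"
    by (simp only: ip_sum_right ip_scale_right)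
  also have "\<dots> = (\<Sum>l<k. c l * (\<Sum>l'<k. if l' = l then c l * ip S (h l) (h l) else 0))"
    by (intro sum.cong refl arg_cong2[where f = times]) (use h in \<open>auto simp: onz_def\<close>)
  finally have 2: "ip S ?y ?y = (\<Sum>l<k. c l * (c l * ip S (h l) (h l)))" by simp
  have "- 2 * (c l * ip S x (h l)) + c l * (c l * ip S (h l) (h l)) =
      - (ip S x (h l))\<^sup>2 + ip S (h l) (h l) * (c l - ip S x (h l))\<^sup>2" if l: "l < k" for l
    using onz_ip_zero[OF S h l, of x] h l
    by (cases "ip S (h l) (h l) = 1") (auto simp: onz_def power2_eq_square algebra_simps)
  then have "(\<Sum>l<k. - 2 * (c l * ip S x (h l)) + c l * (c l * ip S (h l) (h l))) =
      (\<Sum>l<k. - (ip S x (h l))\<^sup>2 + ip S (h l) (h l) * (c l - ip S x (h l))\<^sup>2)" by simp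
  moreover have "ip S (\<lambda>i. x i - ?y i) (\<lambda>i. x i - ?y i) = ip S x x - 2 * ip S x ?y + ip S ?y ?y"
    by (simp add: ip_diff_left ip_diff_right ip_commute[of S ?y x])
  ultimately show ?thesis unfolding 1 2
    by (simp add: sum.distrib sum_negf sum_distrib_left sum_subtractf mult_ac)
qed

lemma bessel:
  assumes "finite S" "onz S k h"
  shows "(\<Sum>l<k. (ip S x (h l))\<^sup>2) \<le> ip S x x"
  using onz_distance[OF assms, of x "\<lambda>l. ip S x (h l)"]
    ip_ge_0[of S "\<lambda>i. x i - (\<Sum>l<k. ip S x (h l) * h l i)"] by simp

lemma sum_square_le: "(\<Sum>l<(k::nat). t l)\<^sup>2 \<le> real k * (\<Sum>l<k. (t l)\<^sup>2)" for t :: "nat \<Rightarrow> real"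
  using Cauchy_Schwarz_ip[of "{..<k}" "\<lambda>_. 1" t] by (simp add: ip_def power2_eq_square)

text \<open>The duality between operator norm and nuclear norm: split \<open>Y\<close> into
  \<open>r\<close> dyads with orthogonal left factors, pair each of them with \<open>E\<close> by
  the operator bound, and pay a factor \<open>r\<close> for Cauchy-Schwarz over the dyads.\<close>

lemma low_rank_pairing:
  assumes S: "finite S" and r: "rank_le S n r Y" and E: "op_bound R S {..<n} E"
  shows "(\<Sum>i\<in>S. \<Sum>j<n. E i j * Y i j)\<^sup>2 \<le> real r * R * fro S n Y"
proof -
  obtain h g where h: "onz S r h" and Y: "\<And>i j. i \<in> S \<Longrightarrow> j < n \<Longrightarrow> Y i j = (\<Sum>l<r. g l j * h l i)"
    using rank_le_onz[OF S r] by blast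
  define t where "t l = (\<Sum>i\<in>S. \<Sum>j<n. h l i * E i j * g l j)" for l
  have "(\<Sum>i\<in>S. \<Sum>j<n. E i j * Y i j) = (\<Sum>i\<in>S. \<Sum>j<n. \<Sum>l<r. h l i * E i j * g l j)"
    by (intro sum.cong refl) (auto simp: Y sum_distrib_left mult_ac)
  also have "\<dots> = (\<Sum>i\<in>S. \<Sum>l<r. \<Sum>j<n. h l i * E i j * g l j)"
    by (intro sum.cong refl sum.swap)
  also have "\<dots> = (\<Sum>l<r. t l)" unfolding t_def by (rule sum.swap)
  finally have 1: "(\<Sum>i\<in>S. \<Sum>j<n. E i j * Y i j) = (\<Sum>l<r. t l)" .
  have f: "fro S n Y = (\<Sum>l<r. ip S (h l) (h l) * ip {..<n} (g l) (g l))"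
  proof -
    have "fro S n Y = (\<Sum>j<n. \<Sum>l<r. ip S (h l) (h l) * (g l j)\<^sup>2)"
      unfolding fro_columns
    proof (rule sum.cong[OF refl])
      fix j assume j: "j \<in> {..<n}"
      have "ip S (\<lambda>i. Y i j) (\<lambda>i. Y i j) =
          ip S (\<lambda>i. 0 - (\<Sum>l<r. g l j * h l i)) (\<lambda>i. 0 - (\<Sum>l<r. g l j * h l i))"
        unfolding ip_def by (rule sum.cong) (use j in \<open>auto simp: Y\<close>)
      also have "\<dots> = (\<Sum>l<r. ip S (h l) (h l) * (g l j)\<^sup>2)"
        by (subst onz_distance[OF S h]) (simp add: ip_def)
      finally show "ip S (\<lambda>i. Y i j) (\<lambda>i. Y i j) = (\<Sum>l<r. ip S (h l) (h l) * (g l j)\<^sup>2)" .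
    qed
    also have "\<dots> = (\<Sum>l<r. ip S (h l) (h l) * ip {..<n} (g l) (g l))"
      by (subst sum.swap) (simp add: sum_distrib_left[symmetric] ip_def power2_eq_square)
    finally show ?thesis .
  qed
  have "(\<Sum>l<r. t l)\<^sup>2 \<le> real r * (\<Sum>l<r. (t l)\<^sup>2)" by (rule sum_square_le)
  also have "\<dots> \<le> real r * (\<Sum>l<r. R * (ip S (h l) (h l) * ip {..<n} (g l) (g l)))"
    using op_boundD[OF E] unfolding t_def
    by (intro mult_left_mono sum_mono) (auto simp: mult.assoc)
  finally show ?thesis unfolding 1 f by (simp add: sum_distrib_left mult.assoc)
qed

lemma rank_le_diff:
  assumes "rank_le S n k X" "rank_le S n k M"
  shows "rank_le S n (2 * k) (\<lambda>i j. X i j - M i j)"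
proof -
  obtain f g where fg: "\<forall>i\<in>S. \<forall>j<n. X i j = (\<Sum>l<k. f l i * g l j)" using assms(1) unfolding rank_le_def by blast
  obtain f' g' where fg': "\<forall>i\<in>S. \<forall>j<n. M i j = (\<Sum>l<k. f' l i * g' l j)" using assms(2) unfolding rank_le_def by blast
  have split: "(\<Sum>l<2 * k. q l) = (\<Sum>l<k. q l) + (\<Sum>l<k. q (l + k))" for q :: "nat \<Rightarrow> real"
  proof -
    have "(\<Sum>l\<in>{k..<2 * k}. q l) = (\<Sum>l<k. q (l + k))"
      using sum.shift_bounds_nat_ivl[of q 0 k k] by (simp add: mult_2 atLeast0LessThan)
    then show ?thesis
      using sum.atLeastLessThan_concat[of 0 k "2 * k" q] by (simp add: atLeast0LessThan)
  qed
  show ?thesis unfolding rank_le_def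
    by (intro exI[of _ "\<lambda>l. if l < k then f l else (\<lambda>i. - f' (l - k) i)"] exI[of _ "\<lambda>l. if l < k then g l else g' (l - k)"])
      (simp add: split fg fg' sum_negf)
qed

text \<open>Comparing \<open>X\<close> with the competitor \<open>M\<close> bounds the squared error
  by twice the pairing of the noise with \<open>X - M\<close>. That difference has rank at most
  \<open>2 * k\<close>, so the pairing only sees the operator norm of the noise.\<close>

theorem best_approx_error:
  assumes S: "finite S" and X: "best_approx S n k B X" and M: "rank_le S n k M"
    and E: "op_bound R S {..<n} (\<lambda>i j. B i j - M i j)"
  shows "fro S n (\<lambda>i j. X i j - M i j) \<le> 8 * real k * R"
proof -
  let ?Y = "\<lambda>i j. X i j - M i j" and ?E = "\<lambda>i j. B i j - M i j"
  have rX: "rank_le S n k X" and opt: "fro S n (\<lambda>i j. B i j - X i j) \<le> fro S n ?E"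
    using X M by (auto simp: best_approx_def)
  define p where "p = (\<Sum>i\<in>S. \<Sum>j<n. ?E i j * ?Y i j)"
  have "fro S n (\<lambda>i j. B i j - X i j) = (\<Sum>i\<in>S. \<Sum>j<n. (?E i j)\<^sup>2 - 2 * (?E i j * ?Y i j) + (?Y i j)\<^sup>2)"
    unfolding fro_def by (intro sum.cong refl) (simp add: power2_eq_square algebra_simps)
  also have "\<dots> = fro S n ?E - 2 * p + fro S n ?Y"
    by (simp add: fro_def p_def sum.distrib sum_subtractf sum_distrib_left)
  finally have le: "fro S n ?Y \<le> 2 * p" using opt by simp
  have p2: "p\<^sup>2 \<le> real (2 * k) * R * fro S n ?Y"
    unfolding p_def by (rule low_rank_pairing[OF S rank_le_diff[OF rX M] E])
  have "(fro S n ?Y)\<^sup>2 \<le> (2 * p)\<^sup>2" using le by (intro power_mono) auto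
  also have "\<dots> \<le> 8 * real k * R * fro S n ?Y" using p2 by (simp add: power_mult_distrib algebra_simps)
  finally have "fro S n ?Y * fro S n ?Y \<le> (8 * real k * R) * fro S n ?Y" by (simp add: power2_eq_square)
  moreover have "R \<ge> 0" using E by (simp add: op_bound_def)
  ultimately show ?thesis by (cases "fro S n ?Y = 0") (auto simp: less_le)
qed

section \<open>Column spaces of best approximations through the Gram matrix\<close>

definition gram :: "nat set \<Rightarrow> ('a \<Rightarrow> nat \<Rightarrow> real) \<Rightarrow> 'a \<Rightarrow> 'a \<Rightarrow> real" where
  "gram J B i i' = (\<Sum>j\<in>J. B i j * B i' j)"

lemma gram_sym: "gram J B i i' = gram J B i' i" by (simp add: gram_def mult.commute)

lemma gram_form: "ip S x (app S (gram J B) y) = (\<Sum>j\<in>J. ip S (\<lambda>i. B i j) x * ip S (\<lambda>i. B i j) y)"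
proof -
  have "app S (gram J B) y = (\<lambda>i. \<Sum>j\<in>J. ip S (\<lambda>i. B i j) y * B i j)"
    unfolding app_def gram_def ip_def sum_distrib_right by (subst sum.swap) (simp add: mult_ac)
  then have "ip S x (app S (gram J B) y) = (\<Sum>j\<in>J. ip S (\<lambda>i. B i j) y * ip S x (\<lambda>i. B i j))"
    by (simp only: ip_sum_right ip_scale_right)
  then show ?thesis by (simp add: ip_commute mult.commute)
qed

lemma eigenvalue_form:
  assumes "finite S" "eigenbasis S H u lam" "b < card S"
  shows "ip S (u b) (app S H (u b)) = lam b"
proof -
  have "ip S (u b) (app S H (u b)) = ip S (u b) (\<lambda>i. lam b * u b i)"
    using assms by (intro ip_cong) (auto simp: eigenbasis_def)
  then show ?thesis using assms by (simp add: ip_scale_right eigenbasis_def orthonormal_def)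
qed

lemma gram_eigenvalue_nonneg:
  assumes "finite S" "eigenbasis S (gram J B) u lam" "b < card S"
  shows "lam b \<ge> 0"
proof -
  have "lam b = (\<Sum>j\<in>J. ip S (\<lambda>i. B i j) (u b) * ip S (\<lambda>i. B i j) (u b))"
    using eigenvalue_form[OF assms] by (simp only: gram_form)
  then show ?thesis by (simp add: sum_nonneg)
qed

text \<open>The energy captured by a column space is a sum of eigenvalues with weights in
  \<open>[0, 1]\<close> of total at most \<open>k\<close>. Optimality forces it up to the sum of the
  \<open>k\<close> largest, so no weight falls on an eigenvalue strictly below the
  \<open>k\<close>-th one. Eigenvectors at that value stay unconstrained: this is the freedom left
  by ties.\<close>

theorem best_approx_columns:
  assumes S: "finite S" and X: "best_approx S n k B X" and k: "0 < k" "k \<le> card S"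
    and eb: "eigenbasis S (gram {..<n} B) u lam" and b: "b < card S" "lam b < lam (k - 1)" and j: "j < n"
  shows "ip S (\<lambda>i. X i j) (u b) = 0"
proof -
  let ?N = "card S" and ?H = "gram {..<n} B"
  let ?c = "\<lambda>j i. B i j"
  have rX: "rank_le S n k X" using X by (simp add: best_approx_def)
  obtain h g where h: "onz S k h" and Xh: "\<And>i j. i \<in> S \<Longrightarrow> j < n \<Longrightarrow> X i j = (\<Sum>l<k. g l j * h l i)"
    using rank_le_onz[OF S rX] by blast
  have ou: "onz S k u" using eb k by (auto simp: onz_def eigenbasis_def orthonormal_def)
  have dist: "fro S n (\<lambda>i j. B i j - (\<Sum>l<k. q l j * v l i)) =
      fro S n B - (\<Sum>l<k. ip S (v l) (app S ?H (v l))) + (\<Sum>j<n. \<Sum>l<k. ip S (v l) (v l) * (q l j - ip S (?c j) (v l))\<^sup>2)"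
    if "onz S k v" for v q
  proof -
    have "(\<Sum>j<n. \<Sum>l<k. (ip S (?c j) (v l))\<^sup>2) = (\<Sum>l<k. ip S (v l) (app S ?H (v l)))"
      by (subst sum.swap) (simp add: gram_form power2_eq_square)
    moreover have "fro S n (\<lambda>i j. B i j - (\<Sum>l<k. q l j * v l i)) =
      (\<Sum>j<n. ip S (?c j) (?c j) - (\<Sum>l<k. (ip S (?c j) (v l))\<^sup>2) +
        (\<Sum>l<k. ip S (v l) (v l) * (q l j - ip S (?c j) (v l))\<^sup>2))"
      unfolding fro_columns by (intro sum.cong refl) (rule onz_distance[OF S that])
    ultimately show ?thesis by (simp add: sum.distrib sum_subtractf fro_columns[of S n B])
  qed
  define Y where "Y i j = (\<Sum>l<k. ip S (?c j) (u l) * u l i)" for i j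
  have "rank_le S n k Y" unfolding rank_le_def Y_def
    by (intro exI[of _ u] exI[of _ "\<lambda>l j. ip S (?c j) (u l)"]) (simp add: mult.commute)
  then have opt: "fro S n (\<lambda>i j. B i j - X i j) \<le> fro S n (\<lambda>i j. B i j - Y i j)"
    using X by (simp add: best_approx_def)
  have "fro S n (\<lambda>i j. B i j - X i j) = fro S n (\<lambda>i j. B i j - (\<Sum>l<k. g l j * h l i))"
    by (rule fro_cong) (simp add: Xh)
  then have 1: "fro S n (\<lambda>i j. B i j - X i j) \<ge> fro S n B - (\<Sum>l<k. ip S (h l) (app S ?H (h l)))"
    unfolding dist[OF h] by (simp add: sum_nonneg)
  have 2: "fro S n (\<lambda>i j. B i j - Y i j) = fro S n B - (\<Sum>l<k. lam l)"
    unfolding Y_def dist[OF ou] using eigenvalue_form[OF S eb] k by simp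
  \<comment> \<open>The squared length of the projection of \<open>u a\<close> to the span of the
    \<open>h l\<close>.\<close>
  define w where "w a = (\<Sum>l<k. (ip S (h l) (u a))\<^sup>2)" for a
  have 3: "(\<Sum>l<k. ip S (h l) (app S ?H (h l))) = (\<Sum>a<?N. lam a * w a)"
    unfolding eigenbasis_forms(2)[OF S eb] w_def sum_distrib_left by (rule sum.swap)
  have w1: "w a \<le> 1" if "a < ?N" for a
  proof -
    have "w a = (\<Sum>l<k. (ip S (u a) (h l))\<^sup>2)"
      unfolding w_def by (intro sum.cong refl) (subst ip_commute, rule refl)
    also have "\<dots> \<le> ip S (u a) (u a)" by (rule bessel[OF S h])
    also have "\<dots> = 1" using eb that by (simp add: eigenbasis_def orthonormal_def)
    finally show ?thesis .
  qed
  have w0: "w a \<ge> 0" for a by (simp add: w_def sum_nonneg)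
  have wk: "(\<Sum>a<?N. w a) \<le> real k"
  proof -
    have "(\<Sum>a<?N. w a) = (\<Sum>l<k. ip S (h l) (h l))"
      unfolding eigenbasis_forms(1)[OF S eb] w_def by (rule sum.swap)
    also have "\<dots> \<le> (\<Sum>l<k. 1)" by (rule sum_mono) (use h in \<open>auto simp: onz_def\<close>)
    finally show ?thesis by simp
  qed
  let ?L = "lam (k - 1)"
  have L0: "?L \<ge> 0" using gram_eigenvalue_nonneg[OF S eb] k by simp
  have mono: "lam a' \<le> lam a" if "a \<le> a'" "a' < ?N" for a a' using eb that by (auto simp: eigenbasis_def)
  have "(\<Sum>l<k. lam l) \<le> (\<Sum>a<?N. lam a * w a)" using 1 2 3 opt by linarith
  also have "\<dots> = (\<Sum>a<?N. (lam a - ?L) * w a) + ?L * (\<Sum>a<?N. w a)"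
    by (simp add: sum_distrib_left left_diff_distrib sum_subtractf)
  also have "\<dots> \<le> (\<Sum>a<?N. (lam a - ?L) * w a) + ?L * real k"
    using wk L0 by (intro add_left_mono mult_left_mono) auto
  finally have ge: "(\<Sum>l<k. lam l - ?L) \<le> (\<Sum>a<?N. (lam a - ?L) * w a)"
    by (simp add: sum_subtractf mult.commute)
  have ins: "(\<Sum>l<k. lam l - ?L) = (\<Sum>a<?N. if a < k then lam a - ?L else 0)"
    by (rule sum.mono_neutral_cong_left) (use k in auto)
  have le: "(lam a - ?L) * w a \<le> (if a < k then lam a - ?L else 0)" if "a < ?N" for a
  proof (cases "a < k")
    case True
    then have "lam a - ?L \<ge> 0" using mono[of a "k - 1"] k by simp
    then show ?thesis using True w1[OF that] by (simp add: mult_left_le)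
  next
    case False
    then have "lam a - ?L \<le> 0" using mono[of "k - 1" a] k that by simp
    then show ?thesis using False w0[of a] by (simp add: mult_nonpos_nonneg)
  qed
  have bk: "\<not> b < k"
  proof
    assume "b < k"
    then have "lam (k - 1) \<le> lam b" using k by (intro mono) auto
    then show False using b by simp
  qed
  have "(lam b - ?L) * w b = 0"
  proof (rule ccontr)
    assume "(lam b - ?L) * w b \<noteq> 0"
    moreover have "(lam b - ?L) * w b \<le> 0" using le[OF b(1)] bk by simp
    ultimately have lt: "(lam b - ?L) * w b < 0" by linarith
    have "(\<Sum>a<?N. (lam a - ?L) * w a) < (\<Sum>a<?N. if a < k then lam a - ?L else 0)"
    proof (rule sum_strict_mono_ex1)
      show "\<exists>a\<in>{..<?N}. (lam a - ?L) * w a < (if a < k then lam a - ?L else 0)"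
        using lt b(1) bk by (intro bexI[of _ b]) auto
    qed (use le in auto)
    then show False using ge ins by simp
  qed
  then have "w b = 0" using b(2) by simp
  then have "(\<Sum>l<k. (ip S (h l) (u b))\<^sup>2) = 0" by (simp only: w_def)
  then have "\<forall>l\<in>{..<k}. (ip S (h l) (u b))\<^sup>2 = 0"
    by (subst (asm) sum_nonneg_eq_0_iff) (rule finite_lessThan, rule zero_le_power2, assumption)
  then have hb: "ip S (h l) (u b) = 0" if "l < k" for l using that by simp
  have "ip S (\<lambda>i. X i j) (u b) = ip S (\<lambda>i. \<Sum>l<k. g l j * h l i) (u b)"
    unfolding ip_def
  proof (rule sum.cong[OF refl])
    fix i assume "i \<in> S"
    then show "X i j * u b i = (\<Sum>l<k. g l j * h l i) * u b i" by (simp only: Xh[OF _ j])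
  qed
  also have "\<dots> = (\<Sum>l<k. g l j * ip S (h l) (u b))" by (simp only: ip_sum_left ip_scale_left)
  also have "\<dots> = 0" using hb by (intro sum.neutral) simp
  finally show ?thesis .
qed

section \<open>Repeated eigenvalues\<close>

text \<open>A fixed choice of eigenvectors, so that a space built from them is a function of the
  columns that enter the Gram matrix and is not affected by conditioning on those columns.\<close>

definition evec :: "'a set \<Rightarrow> ('a \<Rightarrow> 'a \<Rightarrow> real) \<Rightarrow> nat \<Rightarrow> 'a \<Rightarrow> real" where
  "evec S H = fst (SOME p. eigenbasis S H (fst p) (snd p))"

definition evalue :: "'a set \<Rightarrow> ('a \<Rightarrow> 'a \<Rightarrow> real) \<Rightarrow> nat \<Rightarrow> real" where
  "evalue S H = snd (SOME p. eigenbasis S H (fst p) (snd p))"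

lemma eigenbasis_evec:
  assumes "finite S" "\<And>u v. H u v = H v u"
  shows "eigenbasis S H (evec S H) (evalue S H)"
proof -
  obtain u lam where "eigenbasis S H u lam" using eigenbasis_exists[of S H] assms by blast
  then have "\<exists>p. eigenbasis S H (fst p) (snd p)" by (intro exI[of _ "(u, lam)"]) simp
  then show ?thesis unfolding evec_def evalue_def by (rule someI_ex)
qed

lemma eigenbasis_gram: "finite S \<Longrightarrow> eigenbasis S (gram J B) (evec S (gram J B)) (evalue S (gram J B))"
  by (rule eigenbasis_evec) (auto simp: gram_sym)

text \<open>Together with the next two lemmas this gives the two sides of the Courant-Fischer
  principle: an upper bound of the form off the leading eigenvectors, and a lower bound on their
  span.\<close>

lemma eigen_form_le:
  assumes S: "finite S" and eb: "eigenbasis S H u lam" and r: "r < card S"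
    and x: "\<And>a. a < r \<Longrightarrow> ip S x (u a) = 0"
  shows "ip S x (app S H x) \<le> lam r * ip S x x"
proof -
  have "lam a * (ip S x (u a))\<^sup>2 \<le> lam r * (ip S x (u a))\<^sup>2" if "a < card S" for a
  proof (cases "a < r")
    case False
    then have "lam a \<le> lam r" using eb that by (auto simp: eigenbasis_def)
    then show ?thesis by (rule mult_right_mono) simp
  qed (simp add: x)
  then show ?thesis unfolding eigenbasis_forms[OF S eb] sum_distrib_left
    by (intro sum_mono) auto
qed

lemma eigen_form_ge:
  assumes S: "finite S" and eb: "eigenbasis S H u lam"
    and x: "\<And>a. a < card S \<Longrightarrow> lam a < l \<Longrightarrow> ip S x (u a) = 0"
  shows "l * ip S x x \<le> ip S x (app S H x)"
proof -
  have "l * (ip S x (u a))\<^sup>2 \<le> lam a * (ip S x (u a))\<^sup>2" if "a < card S" for a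
    by (cases "lam a < l") (auto simp: x that intro: mult_right_mono)
  then show ?thesis unfolding eigenbasis_forms[OF S eb] sum_distrib_left
    by (intro sum_mono) auto
qed

lemma eigen_comb:
  assumes S: "finite S" and eb: "eigenbasis S H u lam" and r: "r \<le> card S"
    and c: "\<exists>b<r. c b \<noteq> 0"
  shows "ip S (\<lambda>i. \<Sum>b<r. c b * u b i) (\<lambda>i. \<Sum>b<r. c b * u b i) > 0"
    and "lam (r - 1) * ip S (\<lambda>i. \<Sum>b<r. c b * u b i) (\<lambda>i. \<Sum>b<r. c b * u b i)
      \<le> ip S (\<lambda>i. \<Sum>b<r. c b * u b i) (app S H (\<lambda>i. \<Sum>b<r. c b * u b i))"
proof -
  let ?x = "\<lambda>i. \<Sum>b<r. c b * u b i"
  have co: "ip S ?x (u a) = (if a < r then c a else 0)" if "a < card S" for a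
  proof -
    have "ip S ?x (u a) = (\<Sum>b<r. c b * ip S (u b) (u a))" by (simp only: ip_sum_left ip_scale_left)
    also have "\<dots> = (\<Sum>b<r. if b = a then c a else 0)"
      by (rule sum.cong) (use eb r that in \<open>auto simp: eigenbasis_def orthonormal_def\<close>)
    finally show ?thesis by simp
  qed
  obtain b where b: "b < r" "c b \<noteq> 0" using c by blast
  have "0 < (ip S ?x (u b))\<^sup>2" using co[of b] b r by simp
  also have "\<dots> \<le> (\<Sum>j<card S. (ip S ?x (u j))\<^sup>2)"
    by (rule member_le_sum) (use b r in auto)
  finally show "ip S ?x ?x > 0" by (simp only: eigenbasis_forms(1)[OF S eb])
  show "lam (r - 1) * ip S ?x ?x \<le> ip S ?x (app S H ?x)"
  proof (rule eigen_form_ge[OF S eb])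
    fix a assume a: "a < card S" "lam a < lam (r - 1)"
    have "\<not> a < r"
    proof
      assume "a < r"
      then have "lam (r - 1) \<le> lam a" using eb r by (auto simp: eigenbasis_def)
      then show False using a by simp
    qed
    then show "ip S ?x (u a) = 0" using co[OF a(1)] by simp
  qed
qed

lemma gram_diff_form:
  assumes "finite J" "Q \<subseteq> J"
  shows "ip S x (app S (gram J B) x) = ip S x (app S (gram (J - Q) B) x) + (\<Sum>j\<in>Q. (ip S (\<lambda>i. B i j) x)\<^sup>2)"
  unfolding gram_form power2_eq_square using assms by (simp add: sum.subset_diff[of Q J])

text \<open>Interlacing: deleting \<open>|Q|\<close> columns cannot move an eigenvalue of multiplicity larger than \<open>|Q|\<close> past
  its last copy.\<close>

lemma tie_eigenvalue_unchanged:
  fixes B :: "'a \<Rightarrow> nat \<Rightarrow> real"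
  assumes S: "finite S" and J: "finite J" "Q \<subseteq> J" and k: "0 < k" "k + card Q \<le> card S"
    and tie: "evalue S (gram J B) (k - 1 + card Q) = evalue S (gram J B) (k - 1)"
  shows "evalue S (gram (J - Q) B) (k - 1) = evalue S (gram J B) (k - 1)"
proof (rule antisym)
  let ?H = "gram J B" and ?H' = "gram (J - Q) B"
  note eb = eigenbasis_gram[OF S, of J B] and eb' = eigenbasis_gram[OF S, of "J - Q" B]
  let ?u = "evec S ?H" and ?u' = "evec S ?H'"
  have fQ: "finite Q" using J finite_subset by blast
  note gd = gram_diff_form[OF J, of S _ B]
  show "evalue S ?H' (k - 1) \<le> evalue S ?H (k - 1)"
  proof -
    \<comment> \<open>Among the combinations of the top \<open>k\<close> eigenvectors of the smaller
      matrix, one is orthogonal to the top \<open>k - 1\<close> of the larger.\<close>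
    obtain c where c: "\<exists>b\<in>{..<k}. c b \<noteq> 0" "\<forall>a\<in>{..<k-1}. (\<Sum>b\<in>{..<k}. ip S (?u' b) (?u a) * c b) = 0"
      using homogeneous_solution[of "{..<k-1}" "{..<k}" "\<lambda>a b. ip S (?u' b) (?u a)"] k by auto
    define x where "x = (\<lambda>i. \<Sum>b<k. c b * ?u' b i)"
    have "ip S x (?u a) = 0" if "a < k - 1" for a
    proof -
      have "ip S x (?u a) = (\<Sum>b<k. c b * ip S (?u' b) (?u a))"
        unfolding x_def by (simp only: ip_sum_left ip_scale_left)
      then show ?thesis using c(2) that by (simp add: mult.commute)
    qed
    then have "ip S x (app S ?H x) \<le> evalue S ?H (k - 1) * ip S x x"
      using k by (intro eigen_form_le[OF S eb]) auto
    moreover have "ip S x (app S ?H' x) \<le> ip S x (app S ?H x)" unfolding gd by (simp add: sum_nonneg)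
    moreover have "evalue S ?H' (k - 1) * ip S x x \<le> ip S x (app S ?H' x)" and pos: "ip S x x > 0"
      unfolding x_def using eigen_comb[OF S eb', of k c] k c(1) by auto
    ultimately have "evalue S ?H' (k - 1) * ip S x x \<le> evalue S ?H (k - 1) * ip S x x" by linarith
    then show ?thesis using pos by simp
  qed
  show "evalue S ?H (k - 1) \<le> evalue S ?H' (k - 1)"
  proof -
    let ?r = "k + card Q"
    let ?a = "\<lambda>e b. case e of Inl a \<Rightarrow> ip S (?u b) (?u' a) | Inr j \<Rightarrow> ip S (\<lambda>i. B i j) (?u b)"
    \<comment> \<open>The \<open>k + card Q\<close> leading eigenvectors of the larger matrix share
      nearly one eigenvalue bound from below, namely the tied one, and face
      \<open>k - 1 + card Q\<close> conditions. Orthogonality to the deleted columns makes both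
      forms agree on the solution.\<close>
    have "card ({..<k-1} <+> Q) < card {..<?r}" using k fQ by (simp add: card_Plus)
    then obtain c where c: "\<exists>b\<in>{..<?r}. c b \<noteq> 0" "\<forall>e\<in>{..<k-1} <+> Q. (\<Sum>b\<in>{..<?r}. ?a e b * c b) = 0"
      using homogeneous_solution[of "{..<k-1} <+> Q" "{..<?r}" ?a] fQ by auto
    define x where "x = (\<lambda>i. \<Sum>b<?r. c b * ?u b i)"
    have xu: "ip S x (?u' a) = 0" if "a < k - 1" for a
    proof -
      have "ip S x (?u' a) = (\<Sum>b<?r. c b * ip S (?u b) (?u' a))"
        unfolding x_def by (simp only: ip_sum_left ip_scale_left)
      then show ?thesis using bspec[OF c(2) InlI, of a] that by (simp add: mult.commute)
    qed
    have xQ: "ip S (\<lambda>i. B i j) x = 0" if "j \<in> Q" for j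
    proof -
      have "ip S (\<lambda>i. B i j) x = (\<Sum>b<?r. c b * ip S (\<lambda>i. B i j) (?u b))"
        unfolding x_def by (simp only: ip_sum_right ip_scale_right)
      then show ?thesis using bspec[OF c(2) InrI, of j] that by (simp add: mult.commute)
    qed
    have "ip S x (app S ?H' x) \<le> evalue S ?H' (k - 1) * ip S x x"
      using k xu by (intro eigen_form_le[OF S eb']) auto
    moreover have "ip S x (app S ?H' x) = ip S x (app S ?H x)" unfolding gd by (simp add: xQ)
    moreover have "evalue S ?H (k - 1) * ip S x x \<le> ip S x (app S ?H x)" and pos: "ip S x x > 0"
    proof -
      have r: "?r - 1 = k - 1 + card Q" using k by simp
      have "evalue S ?H (?r - 1) = evalue S ?H (k - 1)" unfolding r by (rule tie)
      moreover have "evalue S ?H (?r - 1) * ip S x x \<le> ip S x (app S ?H x)" "ip S x x > 0"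
        unfolding x_def by (rule eigen_comb[OF S eb k(2)], use c(1) in blast)+
      ultimately show "evalue S ?H (k - 1) * ip S x x \<le> ip S x (app S ?H x)" "ip S x x > 0"
        by (simp_all only:)
    qed
    ultimately have "evalue S ?H (k - 1) * ip S x x \<le> evalue S ?H' (k - 1) * ip S x x" by linarith
    then show ?thesis using pos by simp
  qed
qed

text \<open>For a subspace \<open>K\<close> this is the codimension of the common kernel of the
  functionals. Computing it greedily allows the columns to be revealed one after the other.\<close>

fun drops :: "('a \<Rightarrow> real) set \<Rightarrow> (nat \<Rightarrow> ('a \<Rightarrow> real) \<Rightarrow> real) \<Rightarrow> nat list \<Rightarrow> nat" where
  "drops K \<beta> [] = 0"
| "drops K \<beta> (j # js) = (if \<exists>y\<in>K. \<beta> j y \<noteq> 0 then 1 else 0) + drops {y \<in> K. \<beta> j y = 0} \<beta> js"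

text \<open>Take a witness at every drop. Witnesses of later drops are annihilated by the functional
  of an earlier one, so the evaluation is triangular and no nontrivial combination of witnesses is
  killed by all functionals.\<close>

lemma drops_family:
  fixes K :: "('a \<Rightarrow> real) set"
  assumes lin: "\<And>j d c (x :: nat \<Rightarrow> 'a \<Rightarrow> real). \<beta> j (\<lambda>i. \<Sum>a<d. c a * x a i) = (\<Sum>a<d. c a * \<beta> j (x a))"
  shows "\<exists>x :: nat \<Rightarrow> 'a \<Rightarrow> real. (\<forall>a<drops K \<beta> js. x a \<in> K) \<and>
    (\<forall>c. (\<exists>a<drops K \<beta> js. c a \<noteq> 0) \<longrightarrow> (\<exists>j\<in>set js. \<beta> j (\<lambda>i. \<Sum>a<drops K \<beta> js. c a * x a i) \<noteq> 0))"
proof (induction js arbitrary: K)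
  case (Cons j js)
  let ?K' = "{y \<in> K. \<beta> j y = 0}"
  define d where "d = drops ?K' \<beta> js"
  obtain x where x: "\<And>a. a < d \<Longrightarrow> x a \<in> ?K'"
    "\<And>c. \<exists>a<d. c a \<noteq> 0 \<Longrightarrow> \<exists>j\<in>set js. \<beta> j (\<lambda>i. \<Sum>a<d. c a * x a i) \<noteq> 0"
    using Cons[of ?K'] unfolding d_def by blast
  show ?case
  proof (cases "\<exists>y\<in>K. \<beta> j y \<noteq> 0")
    case False
    then have eq: "drops K \<beta> (j # js) = d" by (simp add: d_def)
    show ?thesis unfolding eq
    proof (intro exI[of _ x] conjI allI impI)
      fix a assume "a < d" then show "x a \<in> K" using x(1) by blast
    next
      fix c :: "nat \<Rightarrow> real" assume "\<exists>a<d. c a \<noteq> 0"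
      then show "\<exists>j\<in>set (j # js). \<beta> j (\<lambda>i. \<Sum>a<d. c a * x a i) \<noteq> 0" using x(2) by fastforce
    qed
  next
    case True
    then obtain y where y: "y \<in> K" "\<beta> j y \<noteq> 0" by blast
    have eq: "drops K \<beta> (j # js) = Suc d" using True by (simp add: d_def)
    define x' where "x' = x(d := y)"
    have xa: "x' a = x a" if "a < d" for a using that by (simp add: x'_def)
    show ?thesis unfolding eq
    proof (intro exI[of _ x'] conjI allI impI)
      fix a assume "a < Suc d" then show "x' a \<in> K" using x(1) y(1) by (cases "a = d") (auto simp: x'_def)
    next
      fix c :: "nat \<Rightarrow> real" assume c: "\<exists>a<Suc d. c a \<noteq> 0"
      show "\<exists>j\<in>set (j # js). \<beta> j (\<lambda>i. \<Sum>a<Suc d. c a * x' a i) \<noteq> 0"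
      proof (cases "c d = 0")
        case True
        then have "\<exists>a<d. c a \<noteq> 0" using c less_Suc_eq by auto
        then obtain j' where j': "j' \<in> set js" "\<beta> j' (\<lambda>i. \<Sum>a<d. c a * x a i) \<noteq> 0" using x(2) by blast
        have "(\<lambda>i. \<Sum>a<Suc d. c a * x' a i) = (\<lambda>i. \<Sum>a<d. c a * x a i)"
          using True xa by auto
        then show ?thesis using j' by (intro bexI[of _ j']) auto
      next
        case False
        have "\<beta> j (\<lambda>i. \<Sum>a<Suc d. c a * x' a i) = (\<Sum>a<Suc d. c a * \<beta> j (x' a))" by (rule lin)
        also have "\<dots> = c d * \<beta> j y"
          using x(1) xa by (simp add: x'_def)
        finally show ?thesis using False y(2) by (intro bexI[of _ j]) auto
      qed
    qed
  qed
qed simp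

text \<open>Up to values off \<open>S\<close>, the span of all eigenvectors whose eigenvalue is at
  least the \<open>k\<close>-th largest one.\<close>

definition upper_space :: "'a set \<Rightarrow> ('a \<Rightarrow> 'a \<Rightarrow> real) \<Rightarrow> nat \<Rightarrow> ('a \<Rightarrow> real) set" where
  "upper_space S H k = {y. \<forall>a<card S. evalue S H a < evalue S H (k - 1) \<longrightarrow> ip S y (evec S H a) = 0}"

text \<open>Positions are counted from 0, so \<open>k - 1\<close> is the \<open>k\<close>-th
  eigenvalue; together with its position it fills at least \<open>q + 1\<close> places.\<close>

definition tied :: "'a set \<Rightarrow> nat set \<Rightarrow> ('a \<Rightarrow> nat \<Rightarrow> real) \<Rightarrow> nat \<Rightarrow> nat \<Rightarrow> bool" where
  "tied S J B k q \<longleftrightarrow> k + q \<le> card S \<and> evalue S (gram J B) (k - 1 + q) = evalue S (gram J B) (k - 1)"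

definition tie_space :: "'a set \<Rightarrow> nat set \<Rightarrow> ('a \<Rightarrow> nat \<Rightarrow> real) \<Rightarrow> nat \<Rightarrow> nat set \<Rightarrow> ('a \<Rightarrow> real) set" where
  "tie_space S J B k Q = {y. (\<forall>i\<in>S. app S (gram J B) y i = evalue S (gram J B) (k - 1) * y i) \<and>
     (\<forall>j\<in>Q. ip S (\<lambda>i. B i j) y = 0)}"

text \<open>With \<open>k\<close> drops some combination \<open>z\<close> of the witnesses would be
  orthogonal to the \<open>k - 1\<close> leading eigenvectors of the full matrix. Its form is then
  at most the tied eigenvalue, while already the smaller matrix attains that value on
  \<open>z\<close>; but some restored column is not orthogonal to \<open>z\<close> and adds a
  positive square.\<close>

lemma drops_lt:
  assumes S: "finite S" and J: "finite J" "set js \<subseteq> J" and k: "0 < k" and tie: "tied S J B k (card (set js))"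
  shows "drops (upper_space S (gram (J - set js) B) k) (\<lambda>j. ip S (\<lambda>i. B i j)) js < k"
proof (rule ccontr)
  let ?Q = "set js"
  let ?H = "gram J B" and ?H' = "gram (J - ?Q) B"
  let ?\<beta> = "\<lambda>j. ip S (\<lambda>i. B i j)"
  let ?U = "upper_space S ?H' k"
  define d where "d = drops ?U ?\<beta> js"
  assume "\<not> drops ?U ?\<beta> js < k"
  then have dk: "k \<le> d" by (simp add: d_def)
  have kS: "k \<le> card S" using tie by (simp add: tied_def)
  have eq: "evalue S ?H' (k - 1) = evalue S ?H (k - 1)"
    using tie_eigenvalue_unchanged[OF S J k] tie by (simp add: tied_def)
  have lin: "?\<beta> j (\<lambda>i. \<Sum>a<d. c a * x a i) = (\<Sum>a<d. c a * ?\<beta> j (x a))" for j d c and x :: "nat \<Rightarrow> 'a \<Rightarrow> real"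
    by (simp only: ip_sum_right ip_scale_right)
  obtain x where x: "\<And>a. a < d \<Longrightarrow> x a \<in> ?U"
    "\<And>c. \<exists>a<d. c a \<noteq> 0 \<Longrightarrow> \<exists>j\<in>?Q. ?\<beta> j (\<lambda>i. \<Sum>a<d. c a * x a i) \<noteq> 0"
    using drops_family[of ?\<beta> ?U js, OF lin] unfolding d_def by blast
  let ?u = "evec S ?H"
  have "k - 1 < d" using k dk by simp
  then obtain c where c: "\<exists>b\<in>{..<d}. c b \<noteq> 0" "\<forall>a\<in>{..<k-1}. (\<Sum>b\<in>{..<d}. ip S (x b) (?u a) * c b) = 0"
    using homogeneous_solution[of "{..<k-1}" "{..<d}" "\<lambda>a b. ip S (x b) (?u a)"] by auto
  define z where "z = (\<lambda>i. \<Sum>b<d. c b * x b i)"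
  have zip: "ip S z v = (\<Sum>b<d. c b * ip S (x b) v)" for v
    unfolding z_def by (simp only: ip_sum_left ip_scale_left)
  have "ip S z (?u a) = 0" if "a < k - 1" for a using c(2) that by (simp add: zip mult.commute)
  then have up: "ip S z (app S ?H z) \<le> evalue S ?H (k - 1) * ip S z z"
    using k kS by (intro eigen_form_le[OF S eigenbasis_gram[OF S]]) auto
  have lo: "evalue S ?H' (k - 1) * ip S z z \<le> ip S z (app S ?H' z)"
  proof (rule eigen_form_ge[OF S eigenbasis_gram[OF S]])
    fix a assume "a < card S" "evalue S ?H' a < evalue S ?H' (k - 1)"
    then show "ip S z (evec S ?H' a) = 0" using x(1) by (auto simp: zip upper_space_def intro!: sum.neutral)
  qed
  obtain j where j: "j \<in> ?Q" "?\<beta> j z \<noteq> 0" using x(2)[of c] c(1) by (auto simp: z_def)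
  have "0 < (?\<beta> j z)\<^sup>2" using j by simp
  also have "\<dots> \<le> (\<Sum>j\<in>?Q. (?\<beta> j z)\<^sup>2)" by (rule member_le_sum) (use j in auto)
  finally show False using up lo gram_diff_form[OF J, of S z B] eq by simp
qed

text \<open>An eigenvector orthogonal to the columns of \<open>Q\<close> does not notice their
  deletion, and the tied eigenvalue is unchanged. Symmetry then makes the vector orthogonal to the
  eigenvectors of the smaller matrix with smaller eigenvalues.\<close>

lemma tie_space_subset_upper:
  assumes S: "finite S" and J: "finite J" "Q \<subseteq> J" and k: "0 < k" and tie: "tied S J B k (card Q)"
  shows "tie_space S J B k Q \<subseteq> {y \<in> upper_space S (gram (J - Q) B) k. \<forall>j\<in>Q. ip S (\<lambda>i. B i j) y = 0}"
proof
  let ?H = "gram J B" and ?H' = "gram (J - Q) B"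
  fix y assume y: "y \<in> tie_space S J B k Q"
  let ?l = "evalue S ?H (k - 1)"
  have eq: "evalue S ?H' (k - 1) = ?l"
    using tie_eigenvalue_unchanged[OF S J k] tie by (simp add: tied_def)
  have Hy: "\<And>i. i \<in> S \<Longrightarrow> app S ?H y i = ?l * y i" and yQ: "\<And>j. j \<in> Q \<Longrightarrow> ip S (\<lambda>i. B i j) y = 0"
    using y by (auto simp: tie_space_def)
  have "ip S y (evec S ?H' a) = 0" if a: "a < card S" "evalue S ?H' a < ?l" for a
  proof -
    let ?v = "evec S ?H' a"
    have "evalue S ?H' a * ip S y ?v = ip S y (app S ?H' ?v)"
    proof -
      have "ip S y (app S ?H' ?v) = ip S y (\<lambda>i. evalue S ?H' a * ?v i)"
        using eigenbasis_gram[OF S, of "J - Q" B] a by (intro ip_cong) (auto simp: eigenbasis_def)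
      then show ?thesis by (simp only: ip_scale_right)
    qed
    also have "\<dots> = (\<Sum>j\<in>J - Q. ip S (\<lambda>i. B i j) y * ip S (\<lambda>i. B i j) ?v)" by (rule gram_form)
    also have "\<dots> = (\<Sum>j\<in>J. ip S (\<lambda>i. B i j) y * ip S (\<lambda>i. B i j) ?v)"
      by (rule sum.mono_neutral_left) (use J yQ in auto)
    also have "\<dots> = ip S (app S ?H y) ?v"
      using gram_form[of S y J B ?v] app_sym[of ?H S y ?v] by (simp add: gram_sym[of J B])
    also have "\<dots> = ip S (\<lambda>i. ?l * y i) ?v" using Hy by (intro ip_cong) auto
    also have "\<dots> = ?l * ip S y ?v" by (rule ip_scale_left)
    finally show ?thesis using a(2) by simp
  qed
  then show "y \<in> {y \<in> upper_space S ?H' k. \<forall>j\<in>Q. ip S (\<lambda>i. B i j) y = 0}"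
    using yQ unfolding upper_space_def eq by blast
qed

text \<open>A further bit of nonzero weight mixes the masses of two distinct atoms, which together
  have mass at most 1. Hence the bound on the excess of an atom over \<open>1 / 2\<close> shrinks by
  the factor \<open>1 - 2 * \<mu> x\<close>.\<close>

lemma weighted_bits_atom:
  fixes y :: "'a \<Rightarrow> real"
  assumes "finite A" "\<And>x. x \<in> A \<Longrightarrow> 0 \<le> \<mu> x \<and> \<mu> x \<le> 1 / 2"
  shows "bprob A \<mu> {g. (\<Sum>x\<in>A. of_bool (g x) * y x) = t} \<le> 1 / 2 + (1 / 2) * (\<Prod>x | x \<in> A \<and> y x \<noteq> 0. 1 - 2 * \<mu> x)"
  using assms
proof (induction A arbitrary: t rule: finite_induct)
  case empty
  then show ?case by simp
next
  case (insert x A)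
  let ?p = "\<lambda>t. bprob A \<mu> {g. (\<Sum>x\<in>A. of_bool (g x) * y x) = t}"
  let ?\<pi> = "\<lambda>A. \<Prod>x | x \<in> A \<and> y x \<noteq> 0. 1 - 2 * \<mu> x"
  have IH: "?p t \<le> 1 / 2 + (1 / 2) * ?\<pi> A" for t using insert by auto
  have m: "0 \<le> \<mu> x" "\<mu> x \<le> 1 / 2" using insert.prems by auto
  have s: "(\<Sum>z\<in>A. of_bool ((g(x := b)) z) * y z) = (\<Sum>z\<in>A. of_bool (g z) * y z)" for g b
    by (rule sum.cong) (use insert.hyps in auto)
  have eq: "bprob (insert x A) \<mu> {g. (\<Sum>x\<in>insert x A. of_bool (g x) * y x) = t} =
      \<mu> x * ?p (t - y x) + (1 - \<mu> x) * ?p t"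
  proof -
    have sb: "(\<Sum>z\<in>insert x A. of_bool ((g(x := b)) z) * y z) = of_bool b * y x + (\<Sum>z\<in>A. of_bool (g z) * y z)" for g b
      by (simp only: sum.insert[OF insert.hyps(1,2)] fun_upd_same s)
    have "(of_bool True * y x + S = t) = (S = t - y x)" "(of_bool False * y x + S = t) = (S = t)" for S by auto
    then have ev: "(g(x := True) \<in> {g. (\<Sum>x\<in>insert x A. of_bool (g x) * y x) = t}) =
        (g \<in> {g. (\<Sum>x\<in>A. of_bool (g x) * y x) = t - y x})"
      "(g(x := False) \<in> {g. (\<Sum>x\<in>insert x A. of_bool (g x) * y x) = t}) =
        (g \<in> {g. (\<Sum>x\<in>A. of_bool (g x) * y x) = t})" for g
      by (simp_all only: mem_Collect_eq sb)
    have "\<mu> x \<le> 1" using m by simp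
    then show ?thesis unfolding bprob_eq_bexp
      by (subst bexp_insert[where \<mu> = \<mu>, OF insert.hyps(1,2) m(1)]) (simp_all only: ev)
  qed
  show ?case
  proof (cases "y x = 0")
    case True
    then have "{z. z \<in> insert x A \<and> y z \<noteq> 0} = {z. z \<in> A \<and> y z \<noteq> 0}" by auto
    moreover have "\<mu> x * ?p (t - y x) + (1 - \<mu> x) * ?p t = ?p t" using True by (simp add: algebra_simps)
    ultimately show ?thesis using eq IH[of t] by simp
  next
    case False
    have "?p t + ?p (t - y x) \<le> 1"
    proof -
      have "?p t + ?p (t - y x) = bprob A \<mu> ({g. (\<Sum>x\<in>A. of_bool (g x) * y x) = t} \<union> {g. (\<Sum>x\<in>A. of_bool (g x) * y x) = t - y x})"
        by (rule measure_pmf.finite_measure_Union[symmetric]) (use False in auto)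
      then show ?thesis by simp
    qed
    then have "\<mu> x * (?p t + ?p (t - y x)) \<le> \<mu> x * 1" using m by (intro mult_left_mono) auto
    moreover have "(1 - 2 * \<mu> x) * ?p t \<le> (1 - 2 * \<mu> x) * (1 / 2 + (1 / 2) * ?\<pi> A)"
      using m by (intro mult_left_mono IH) auto
    moreover have "?\<pi> (insert x A) = (1 - 2 * \<mu> x) * ?\<pi> A"
    proof -
      have "{z. z \<in> insert x A \<and> y z \<noteq> 0} = insert x {z. z \<in> A \<and> y z \<noteq> 0}" using False by auto
      then show ?thesis using insert.hyps by simp
    qed
    moreover have "m * b + (1 - m) * a \<le> 1 / 2 + (1 / 2) * ((1 - 2 * m) * c)"
      if "m * (a + b) \<le> m * 1" "(1 - 2 * m) * a \<le> (1 - 2 * m) * (1 / 2 + (1 / 2) * c)" for a b c m :: real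
      using that by (simp add: algebra_simps)
    ultimately show ?thesis unfolding eq by simp
  qed
qed

text \<open>At rate \<open>\<rho>\<close> on \<open>1 / \<rho>\<close> coordinates the product of
  the factors \<open>1 - 2 * \<mu> x\<close> is at most \<open>exp (- 1)\<close>, hence at most
  \<open>1 / 2\<close>, and \<open>3 / 4\<close> is \<open>1 / 2\<close> plus half of that.\<close>

lemma weighted_bits_nonzero:
  fixes y :: "'a \<Rightarrow> real"
  assumes A: "finite A" "\<And>x. x \<in> A \<Longrightarrow> 0 \<le> \<mu> x \<and> \<mu> x \<le> 1 / 2" and U: "U \<subseteq> A" "\<And>x. x \<in> U \<Longrightarrow> \<rho> \<le> \<mu> x"
    and rich: "\<rho> * real (card {x \<in> U. y x \<noteq> 0}) \<ge> 1"
  shows "bprob A \<mu> {g. (\<Sum>x\<in>A. of_bool (g x) * y x) = 0} \<le> 3 / 4"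
proof -
  let ?V = "{x \<in> U. y x \<noteq> 0}"
  have fV: "finite ?V" using A U finite_subset by fastforce
  have "(\<Prod>x | x \<in> A \<and> y x \<noteq> 0. 1 - 2 * \<mu> x) \<le> (\<Prod>x\<in>?V. 1 - 2 * \<mu> x)"
  proof -
    have "(\<Prod>x | x \<in> A \<and> y x \<noteq> 0. 1 - 2 * \<mu> x) =
        (\<Prod>x\<in>{x. x \<in> A \<and> y x \<noteq> 0} - ?V. 1 - 2 * \<mu> x) * (\<Prod>x\<in>?V. 1 - 2 * \<mu> x)"
      by (rule prod.subset_diff) (use A U in auto)
    also have "\<dots> \<le> 1 * (\<Prod>x\<in>?V. 1 - 2 * \<mu> x)"
    proof (intro mult_right_mono prod_le_1 prod_nonneg)
      fix i assume "i \<in> {x. x \<in> A \<and> y x \<noteq> 0} - ?V"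
      then show "0 \<le> 1 - 2 * \<mu> i \<and> 1 - 2 * \<mu> i \<le> 1" using A(2)[of i] by auto
    next
      fix i assume "i \<in> ?V" then show "0 \<le> 1 - 2 * \<mu> i" using A(2)[of i] U by auto
    qed
    finally show ?thesis by simp
  qed
  also have "\<dots> \<le> (\<Prod>x\<in>?V. exp (- 2 * \<rho>))"
  proof (intro prod_mono conjI)
    fix i assume i: "i \<in> ?V"
    then show "0 \<le> 1 - 2 * \<mu> i" using A(2)[of i] U by auto
    show "1 - 2 * \<mu> i \<le> exp (- 2 * \<rho>)"
      using exp_ge_add_one_self[of "- 2 * \<rho>"] U(2)[of i] i by simp
  qed
  also have "\<dots> = exp (- 2 * (\<rho> * real (card ?V)))" by (simp add: exp_of_nat_mult[symmetric] mult_ac)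
  also have "\<dots> \<le> exp (- 1)" using rich by simp
  also have "\<dots> \<le> 1 / 2" using exp_ge_add_one_self[of "1 :: real"] by (simp add: exp_minus field_simps)
  finally show ?thesis using weighted_bits_atom[where \<mu> = \<mu> and y = y and t = 0, OF A] by simp
qed

definition rich :: "real \<Rightarrow> 'a set \<Rightarrow> ('a \<Rightarrow> real) set \<Rightarrow> bool" where
  "rich \<rho> U K \<longleftrightarrow> (\<exists>y\<in>K. \<rho> * real (card {i \<in> U. y i \<noteq> 0}) \<ge> 1)"

lemma rich_mono: "rich \<rho> U K \<Longrightarrow> K \<subseteq> K' \<Longrightarrow> rich \<rho> U K'"
  by (auto simp: rich_def)

abbreviation bmat :: "(nat \<times> nat \<Rightarrow> bool) \<Rightarrow> nat \<Rightarrow> nat \<Rightarrow> real" where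
  "bmat g i j \<equiv> of_bool (g (i, j))"

lemma drops_cong:
  "(\<And>j y. j \<in> set js \<Longrightarrow> \<beta> j y = \<beta>' j y) \<Longrightarrow> drops K \<beta> js = drops K \<beta>' js"
  by (induction js arbitrary: K) auto

text \<open>Adding the columns one at a time, every designated column that meets a rich space drops with
  probability at least \<open>1/4\<close>, so few drops are exponentially unlikely.\<close>

lemma prob_few_drops:
  fixes U :: "nat \<Rightarrow> nat set" and \<mu> :: "nat \<times> nat \<Rightarrow> real"
  assumes S: "finite S" and \<mu>: "\<And>e. 0 \<le> \<mu> e \<and> \<mu> e \<le> 1 / 2"
    and U: "\<And>j. j \<in> D \<Longrightarrow> U j \<subseteq> S \<and> (\<forall>i\<in>U j. \<rho> j \<le> \<mu> (i, j))" and js: "distinct js"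
  shows "bprob (S \<times> set js) \<mu> {g. drops K (\<lambda>j. ip S (\<lambda>i. bmat g i j)) js < k \<and>
      (\<forall>j\<in>D \<inter> set js. rich (\<rho> j) (U j) {y \<in> K. \<forall>j\<in>set js. ip S (\<lambda>i. bmat g i j) y = 0})}
    \<le> 2 ^ k * (7 / 8) ^ card (D \<inter> set js)"
  using js
proof (induction js arbitrary: K k)
  case Nil
  have "(1::real) \<le> 2 ^ k" by simp
  then show ?case by (simp add: indicator_def)
next
  case (Cons j js)
  let ?\<beta> = "\<lambda>g j. ip S (\<lambda>i. bmat g i j)"
  let ?L = "\<lambda>g js K. {y \<in> K. \<forall>j\<in>set js. ?\<beta> g j y = 0}"
  define ev where "ev js K k = {g. drops K (?\<beta> g) js < k \<and> (\<forall>j\<in>D \<inter> set js. rich (\<rho> j) (U j) (?L g js K))}" for js K k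
  let ?A = "S \<times> {j}" and ?B = "S \<times> set js"
  let ?c = "card (D \<inter> set js)" and ?e = "if j \<in> D then 1 else 0 :: nat"
  have fin: "finite ?A" "finite ?B" "?A \<inter> ?B = {}" using S Cons.prems by auto
  have un: "S \<times> set (j # js) = ?A \<union> ?B" by auto
  have card: "card (D \<inter> set (j # js)) = ?e + ?c"
    using Cons.prems by (simp add: Int_insert_right)
  have IH: "bprob ?B \<mu> (ev js K k) \<le> 2 ^ k * (7 / 8) ^ ?c" for K k
    using Cons.IH[of K k] Cons.prems by (simp add: ev_def)
  define glue where "glue g h = (\<lambda>x. if x \<in> ?A then g x else h x)" for g h :: "nat \<times> nat \<Rightarrow> bool"
  have bj: "?\<beta> (glue g h) j = ?\<beta> g j" for g h by (intro ext) (simp add: ip_def glue_def)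
  have bjs: "?\<beta> (glue g h) j' = ?\<beta> h j'" if "j' \<in> set js" for g h j'
  proof -
    have "j' \<noteq> j" using that Cons.prems by auto
    then show ?thesis by (intro ext) (simp add: ip_def glue_def)
  qed
  define dr where "dr g \<longleftrightarrow> (\<exists>y\<in>K. ?\<beta> g j y \<noteq> 0)" for g
  let ?q = "\<lambda>g. bprob ?B \<mu> {h. glue g h \<in> ev (j # js) K k}"
  have dcong: "drops K' (?\<beta> (glue g h)) js = drops K' (?\<beta> h) js" for K' g h
    by (rule drops_cong) (simp add: bjs)
  have Lc: "?L (glue g h) (j # js) K = ?L h js {y \<in> K. ?\<beta> g j y = 0}" for g h
  proof -
    have "(\<forall>j'\<in>set (j # js). ?\<beta> (glue g h) j' y = 0) \<longleftrightarrow> ?\<beta> g j y = 0 \<and> (\<forall>j'\<in>set js. ?\<beta> h j' y = 0)" for y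
    proof -
      have "?\<beta> (glue g h) j y = ?\<beta> g j y" by (simp only: bj)
      moreover have "(\<forall>j'\<in>set js. ?\<beta> (glue g h) j' y = 0) \<longleftrightarrow> (\<forall>j'\<in>set js. ?\<beta> h j' y = 0)"
        by (rule ball_cong[OF refl]) (simp only: bjs)
      ultimately show ?thesis unfolding list.set by (metis insert_iff)
    qed
    then show ?thesis by blast
  qed
  have q1: "?q g \<le> 2 ^ k * (7 / 8) ^ ?c * (if dr g then 1 / 2 else 1)" for g
  proof -
    let ?K' = "{y \<in> K. ?\<beta> g j y = 0}"
    show ?thesis
    proof (cases "dr g")
      case True
      have sub: "{h. glue g h \<in> ev (j # js) K k} \<subseteq> ev js ?K' (k - 1)"
      proof
        fix h assume h: "h \<in> {h. glue g h \<in> ev (j # js) K k}"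
        have "drops K (?\<beta> (glue g h)) (j # js) = 1 + drops ?K' (?\<beta> h) js"
          using True unfolding dr_def by (simp add: dcong bj)
        moreover have "drops K (?\<beta> (glue g h)) (j # js) < k" using h unfolding ev_def by blast
        moreover have "\<forall>j'\<in>D \<inter> set js. rich (\<rho> j') (U j') (?L h js ?K')"
        proof
          fix j' assume "j' \<in> D \<inter> set js"
          then have "rich (\<rho> j') (U j') (?L (glue g h) (j # js) K)" using h unfolding ev_def by simp
          then show "rich (\<rho> j') (U j') (?L h js ?K')" unfolding Lc .
        qed
        ultimately show "h \<in> ev js ?K' (k - 1)" unfolding ev_def mem_Collect_eq by (intro conjI) (linarith, assumption)
      qed
      show ?thesis
      proof (cases "k = 0")
        case True
        then have "{h. glue g h \<in> ev (j # js) K k} = {}" by (simp add: ev_def)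
        then show ?thesis by simp
      next
        case False
        have "?q g \<le> bprob ?B \<mu> (ev js ?K' (k - 1))" using sub by (rule bprob_mono)
        also have "\<dots> \<le> 2 ^ (k - 1) * (7 / 8) ^ ?c" by (rule IH)
        also have "(2::real) ^ (k - 1) = 2 ^ k / 2" using False by (cases k) auto
        finally show ?thesis using True by simp
      qed
    next
      case False
      then have K': "?K' = K" by (auto simp: dr_def)
      have "{h. glue g h \<in> ev (j # js) K k} \<subseteq> ev js ?K' k"
      proof
        fix h assume h: "h \<in> {h. glue g h \<in> ev (j # js) K k}"
        have "drops K (?\<beta> (glue g h)) (j # js) = drops ?K' (?\<beta> h) js"
          using False K' unfolding dr_def by (simp add: dcong bj)
        moreover have "drops K (?\<beta> (glue g h)) (j # js) < k" using h unfolding ev_def by blast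
        moreover have "\<forall>j'\<in>D \<inter> set js. rich (\<rho> j') (U j') (?L h js ?K')"
        proof
          fix j' assume "j' \<in> D \<inter> set js"
          then have "rich (\<rho> j') (U j') (?L (glue g h) (j # js) K)" using h unfolding ev_def by simp
          then show "rich (\<rho> j') (U j') (?L h js ?K')" unfolding Lc .
        qed
        ultimately show "h \<in> ev js ?K' k" unfolding ev_def mem_Collect_eq by (intro conjI) (linarith, assumption)
      qed
      then have "?q g \<le> bprob ?B \<mu> (ev js ?K' k)" by (rule bprob_mono)
      also have "\<dots> \<le> 2 ^ k * (7 / 8) ^ ?c" by (rule IH)
      finally show ?thesis using False by simp
    qed
  qed
  have tot: "bprob (S \<times> set (j # js)) \<mu> (ev (j # js) K k) = bexp ?A \<mu> ?q"
    unfolding un glue_def by (rule bprob_union[OF fin])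
  have "bexp ?A \<mu> ?q \<le> 2 ^ k * (7 / 8) ^ (?e + ?c)"
  proof (cases "j \<in> D")
    case False
    have "bexp ?A \<mu> ?q \<le> bexp ?A \<mu> (\<lambda>g. 2 ^ k * (7 / 8) ^ ?c)"
      by (rule bexp_mono[OF fin(1)]) (rule order_trans[OF q1], simp)
    then show ?thesis using False by simp
  next
    case True
    show ?thesis
    proof (cases "rich (\<rho> j) (U j) K")
      case nr: False
      \<comment> \<open>The surviving space is contained in \<open>K\<close>, so if \<open>K\<close>
        is not rich now, it cannot be rich at the end.\<close>
      have emp: "{h. glue g h \<in> ev (j # js) K k} = {}" for g
      proof -
        have "\<not> rich (\<rho> j) (U j) (?L (glue g h) (j # js) K)" for h
          using nr rich_mono[of "\<rho> j" "U j" "?L (glue g h) (j # js) K" K] by blast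
        then show ?thesis using True unfolding ev_def by auto
      qed
      show ?thesis unfolding emp by simp
    next
      case rc: True
      then obtain y where y: "y \<in> K" "\<rho> j * real (card {i \<in> U j. y i \<noteq> 0}) \<ge> 1" by (auto simp: rich_def)
      let ?p = "bprob ?A \<mu> {g. \<not> dr g}"
      have p: "?p \<le> 3 / 4"
      proof -
        have eq: "(\<Sum>x\<in>?A. of_bool (g x) * y (fst x)) = ?\<beta> g j y" for g
        proof -
          have "?A = (\<lambda>i. (i, j)) ` S" by auto
          then show ?thesis by (simp add: ip_def sum.reindex inj_on_def)
        qed
        have "{g. \<not> dr g} \<subseteq> {g. (\<Sum>x\<in>?A. of_bool (g x) * y (fst x)) = 0}"
          unfolding eq using y(1) by (auto simp: dr_def)
        then have "?p \<le> bprob ?A \<mu> {g. (\<Sum>x\<in>?A. of_bool (g x) * y (fst x)) = 0}" by (rule bprob_mono)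
        also have "\<dots> \<le> 3 / 4"
        proof (rule weighted_bits_nonzero[OF fin(1)])
          show "0 \<le> \<mu> x \<and> \<mu> x \<le> 1 / 2" for x by (rule \<mu>)
          show "U j \<times> {j} \<subseteq> ?A" using U[OF True] by auto
          show "\<rho> j \<le> \<mu> x" if "x \<in> U j \<times> {j}" for x using U[OF True] that by auto
          have "{x \<in> U j \<times> {j}. y (fst x) \<noteq> 0} = (\<lambda>i. (i, j)) ` {i \<in> U j. y i \<noteq> 0}" by auto
          then have "card {x \<in> U j \<times> {j}. y (fst x) \<noteq> 0} = card {i \<in> U j. y i \<noteq> 0}"
            by (simp add: card_image inj_on_def)
          then show "1 \<le> \<rho> j * real (card {x \<in> U j \<times> {j}. y (fst x) \<noteq> 0})" using y(2) by simp
        qed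
        finally show ?thesis .
      qed
      let ?b = "2 ^ k * (7 / 8) ^ ?c :: real"
      \<comment> \<open>A drop uses up one of the remaining drops and so halves
        \<open>2 ^ k\<close>; no drop happens with probability at most \<open>3 / 4\<close>. The
        average factor is \<open>1 / 2 + 1 / 2 * 3 / 4 = 7 / 8\<close>.\<close>
      have "bexp ?A \<mu> ?q \<le> bexp ?A \<mu> (\<lambda>g. ?b / 2 + ?b / 2 * of_bool (g \<in> {g. \<not> dr g}))"
        by (rule bexp_mono[OF fin(1)]) (rule order_trans[OF q1], auto)
      also have "\<dots> = ?b / 2 + ?b / 2 * ?p"
        unfolding bprob_eq_bexp using fin(1) by simp
      also have "\<dots> \<le> ?b / 2 + ?b / 2 * (3 / 4)" using p by (intro add_left_mono mult_left_mono) auto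
      also have "\<dots> = ?b * (7 / 8)" by simp
      finally show ?thesis using True by simp
    qed
  qed
  then show ?case unfolding card tot[symmetric] by (simp only: ev_def)
qed

text \<open>Condition on the columns outside \<open>Q\<close>. They determine
  \<open>upper_space\<close>, the tie limits the drops caused by \<open>Q\<close>, and the columns
  of \<open>Q\<close> are still independent and can be revealed in any order.\<close>

lemma prob_tie:
  fixes U :: "nat \<Rightarrow> nat set" and \<mu> :: "nat \<times> nat \<Rightarrow> real"
  assumes S: "finite S" and J: "finite J" "Q \<subseteq> J" and k: "0 < k"
    and \<mu>: "\<And>e. 0 \<le> \<mu> e \<and> \<mu> e \<le> 1 / 2"
    and U: "D \<subseteq> Q" "\<And>j. j \<in> D \<Longrightarrow> U j \<subseteq> S \<and> (\<forall>i\<in>U j. \<rho> j \<le> \<mu> (i, j))"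
  shows "bprob (S \<times> J) \<mu> {g. tied S J (bmat g) k (card Q) \<and>
      (\<forall>j\<in>D. rich (\<rho> j) (U j) (tie_space S J (bmat g) k Q))} \<le> 2 ^ k * (7 / 8) ^ card D"
proof -
  have fQ: "finite Q" using J finite_subset by blast
  obtain js where js: "set js = Q" "distinct js" using finite_distinct_list[OF fQ] by blast
  let ?A = "S \<times> (J - Q)" and ?B = "S \<times> Q"
  let ?E = "{g. tied S J (bmat g) k (card Q) \<and> (\<forall>j\<in>D. rich (\<rho> j) (U j) (tie_space S J (bmat g) k Q))}"
  have fin: "finite ?A" "finite ?B" "?A \<inter> ?B = {}" using S J fQ by auto
  have un: "S \<times> J = ?A \<union> ?B" using J by auto
  define glue where "glue g h = (\<lambda>x. if x \<in> ?A then g x else h x)" for g h :: "nat \<times> nat \<Rightarrow> bool"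
  define K where "K g = upper_space S (gram (J - Q) (bmat g)) k" for g
  have "bprob ?B \<mu> {h. glue g h \<in> ?E} \<le> 2 ^ k * (7 / 8) ^ card D" for g
  proof -
    have ipc: "ip S (\<lambda>i. bmat (glue g h) i j) = ip S (\<lambda>i. bmat h i j)" if "j \<in> Q" for h j
      using that by (intro ext) (simp add: ip_def glue_def)
    have upc: "K (glue g h) = K g" for h
    proof -
      have "evec S (gram (J - Q) (bmat (glue g h))) = evec S (gram (J - Q) (bmat g)) \<and>
          evalue S (gram (J - Q) (bmat (glue g h))) = evalue S (gram (J - Q) (bmat g))"
      proof -
        have "app S (gram (J - Q) (bmat (glue g h))) y i = app S (gram (J - Q) (bmat g)) y i" if "i \<in> S" for y i
          unfolding app_def gram_def by (intro sum.cong refl arg_cong2[where f = times]) (use that in \<open>auto simp: glue_def\<close>)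
        then have "eigenbasis S (gram (J - Q) (bmat (glue g h))) = eigenbasis S (gram (J - Q) (bmat g))"
          by (intro ext) (simp add: eigenbasis_def)
        then show ?thesis by (simp add: evec_def evalue_def)
      qed
      then show ?thesis by (simp add: K_def upper_space_def)
    qed
    have "{h. glue g h \<in> ?E} \<subseteq> {h. drops (K g) (\<lambda>j. ip S (\<lambda>i. bmat h i j)) js < k \<and>
      (\<forall>j\<in>D \<inter> set js. rich (\<rho> j) (U j) {y \<in> K g. \<forall>j\<in>set js. ip S (\<lambda>i. bmat h i j) y = 0})}"
    proof (safe)
      fix h assume t: "tied S J (bmat (glue g h)) k (card Q)"
        and r: "\<forall>j\<in>D. rich (\<rho> j) (U j) (tie_space S J (bmat (glue g h)) k Q)"
      have "drops (K (glue g h)) (\<lambda>j. ip S (\<lambda>i. bmat (glue g h) i j)) js < k"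
        unfolding K_def js(1)[symmetric] by (rule drops_lt[OF S J(1) _ k]) (use t js J in auto)
      moreover have "drops (K g) (\<lambda>j. ip S (\<lambda>i. bmat (glue g h) i j)) js = drops (K g) (\<lambda>j. ip S (\<lambda>i. bmat h i j)) js"
        by (rule drops_cong) (simp add: ipc js)
      ultimately show "drops (K g) (\<lambda>j. ip S (\<lambda>i. bmat h i j)) js < k" by (simp add: upc)
      fix j assume "j \<in> D"
      have "tie_space S J (bmat (glue g h)) k Q \<subseteq> {y \<in> K (glue g h). \<forall>j\<in>Q. ip S (\<lambda>i. bmat (glue g h) i j) y = 0}"
        unfolding K_def by (rule tie_space_subset_upper[OF S J k t])
      also have "\<dots> = {y \<in> K g. \<forall>j\<in>set js. ip S (\<lambda>i. bmat h i j) y = 0}"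
        using ipc by (auto simp: upc js)
      finally show "rich (\<rho> j) (U j) {y \<in> K g. \<forall>j\<in>set js. ip S (\<lambda>i. bmat h i j) y = 0}"
        using r \<open>j \<in> D\<close> rich_mono by blast
    qed
    then have "bprob ?B \<mu> {h. glue g h \<in> ?E} \<le> bprob (S \<times> set js) \<mu> {h. drops (K g) (\<lambda>j. ip S (\<lambda>i. bmat h i j)) js < k \<and>
      (\<forall>j\<in>D \<inter> set js. rich (\<rho> j) (U j) {y \<in> K g. \<forall>j\<in>set js. ip S (\<lambda>i. bmat h i j) y = 0})}"
      unfolding js(1) by (rule bprob_mono)
    also have "\<dots> \<le> 2 ^ k * (7 / 8) ^ card (D \<inter> set js)"
      by (rule prob_few_drops[OF S \<mu> U(2) js(2)])
    also have "D \<inter> set js = D" using U js by auto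
    finally show ?thesis .
  qed
  then have "bexp ?A \<mu> (\<lambda>g. bprob ?B \<mu> {h. glue g h \<in> ?E}) \<le> bexp ?A \<mu> (\<lambda>g. 2 ^ k * (7 / 8) ^ card D)"
    by (intro bexp_mono[OF fin(1)])
  then show ?thesis unfolding un bprob_union[OF fin] glue_def by simp
qed

text \<open>Over an infinite field one vector of a subspace realises the union of all supports: to
  repair a coordinate, add a multiple of a witness that avoids finitely many bad ratios. It turns a
  bound on the support of every single vector into one exceptional set for the whole space.\<close>

lemma generic_vector:
  fixes W :: "('a \<Rightarrow> real) set"
  assumes S: "finite S" and W: "W \<noteq> {}" "\<And>x y t. x \<in> W \<Longrightarrow> y \<in> W \<Longrightarrow> (\<lambda>i. x i + t * y i) \<in> W"
  shows "\<exists>y\<in>W. \<forall>i\<in>S. (\<exists>y'\<in>W. y' i \<noteq> 0) \<longrightarrow> y i \<noteq> 0"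
  using S
proof (induction S rule: finite_induct)
  case empty
  then show ?case using W by auto
next
  case (insert a S)
  then obtain y where y: "y \<in> W" "\<And>i y'. i \<in> S \<Longrightarrow> y' \<in> W \<Longrightarrow> y' i \<noteq> 0 \<Longrightarrow> y i \<noteq> 0" by blast
  show ?case
  proof (cases "(\<exists>y'\<in>W. y' a \<noteq> 0) \<and> y a = 0")
    case False
    then show ?thesis using y by (intro bexI[of _ y]) auto
  next
    case True
    then obtain z where z: "z \<in> W" "z a \<noteq> 0" and ya: "y a = 0" by blast
    have "finite ((\<lambda>i. - y i / z i) ` S \<union> {0})" using insert.hyps by simp
    then obtain t where t: "t \<notin> (\<lambda>i. - y i / z i) ` S \<union> {0}"
      using ex_new_if_finite[OF infinite_UNIV_char_0[where 'a = real]] by blast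
    have "y i + t * z i \<noteq> 0" if "i \<in> insert a S" "y' \<in> W" "y' i \<noteq> 0" for i y'
    proof (cases "i = a")
      case True
      then show ?thesis using t z ya by simp
    next
      case False
      then have i: "i \<in> S" using that by simp
      then have "y i \<noteq> 0" using y(2) that by blast
      moreover have "t \<noteq> - y i / z i" using t i by blast
      ultimately show ?thesis by (cases "z i = 0") (auto simp: field_simps)
    qed
    then show ?thesis using W(2)[OF y(1) z(1), of t] by (intro bexI[of _ "\<lambda>i. y i + t * z i"]) auto
  qed
qed

text \<open>Restricted to \<open>Z\<close>, a vector of \<open>W\<close> is determined by the values
  of the functionals, so the restriction has dimension at most their number. Spanning vectors are
  found by eliminating one functional at a time.\<close>

lemma span_of_kernel_zero:
  fixes W :: "('a \<Rightarrow> real) set" and \<beta> :: "'b \<Rightarrow> ('a \<Rightarrow> real) \<Rightarrow> real"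
  assumes lin: "\<And>j x y t. \<beta> j (\<lambda>i. x i + t * y i) = \<beta> j x + t * \<beta> j y"
    and W: "\<And>x y t. x \<in> W \<Longrightarrow> y \<in> W \<Longrightarrow> (\<lambda>i. x i + t * y i) \<in> W"
    and ker: "\<And>y i. y \<in> W \<Longrightarrow> \<forall>j\<in>set js. \<beta> j y = 0 \<Longrightarrow> i \<in> Z \<Longrightarrow> y i = 0"
  shows "\<exists>e. \<forall>y\<in>W. \<exists>c. \<forall>i\<in>Z. y i = (\<Sum>d<length js. c d * e d i :: real)"
  using W ker
proof (induction js arbitrary: W)
  case Nil
  then show ?case by auto
next
  case (Cons j js)
  let ?W' = "{y \<in> W. \<beta> j y = 0}"
  have "\<exists>e. \<forall>y\<in>?W'. \<exists>c. \<forall>i\<in>Z. y i = (\<Sum>d<length js. c d * e d i :: real)"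
  proof (rule Cons.IH)
    fix x y t assume "x \<in> ?W'" "y \<in> ?W'"
    then show "(\<lambda>i. x i + t * y i) \<in> ?W'" using Cons.prems(1) by (simp add: lin)
  next
    fix y i assume "y \<in> ?W'" "\<forall>j\<in>set js. \<beta> j y = 0" "i \<in> Z"
    then show "y i = 0" using Cons.prems(2) by simp
  qed
  then obtain e where e: "\<And>y. y \<in> ?W' \<Longrightarrow> \<exists>c. \<forall>i\<in>Z. y i = (\<Sum>d<length js. c d * e d i)" by blast
  show ?case
  proof (cases "\<exists>z\<in>W. \<beta> j z \<noteq> 0")
    case False
    have "\<exists>c. \<forall>i\<in>Z. y i = (\<Sum>d<length (j # js). c d * (e(length js := (\<lambda>_. 0))) d i)" if "y \<in> W" for y
      using e[of y] that False by auto
    then show ?thesis by blast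
  next
    case True
    then obtain z where z: "z \<in> W" "\<beta> j z \<noteq> 0" by blast
    have "\<exists>c. \<forall>i\<in>Z. y i = (\<Sum>d<length (j # js). c d * (e(length js := z)) d i)" if y: "y \<in> W" for y
    proof -
      define t where "t = \<beta> j y / \<beta> j z"
      have "\<beta> j (\<lambda>i. y i + - t * z i) = 0" unfolding lin using z(2) by (simp add: t_def)
      then have "(\<lambda>i. y i + - t * z i) \<in> ?W'" using Cons.prems(1)[OF y z(1), of "- t"] by simp
      then obtain c where c: "\<And>i. i \<in> Z \<Longrightarrow> y i + - t * z i = (\<Sum>d<length js. c d * e d i)" using e by blast
      show ?thesis
      proof (intro exI[of _ "c(length js := t)"] ballI)
        fix i assume "i \<in> Z"
        then show "y i = (\<Sum>d<length (j # js). (c(length js := t)) d * (e(length js := z)) d i)"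
          using c[of i] by simp
      qed
    qed
    then show ?thesis by blast
  qed
qed

section \<open>Choosing columns that serve all clusters\<close>

lemma tied_mono:
  assumes "finite S" "tied S J B k q" "q' \<le> q" "0 < k"
  shows "tied S J B k q'"
proof -
  have eb: "eigenbasis S (gram J B) (evec S (gram J B)) (evalue S (gram J B))" by (rule eigenbasis_gram) fact
  have "k - 1 + q < card S" using assms by (auto simp: tied_def)
  then have "evalue S (gram J B) (k - 1 + q) \<le> evalue S (gram J B) (k - 1 + q')"
    "evalue S (gram J B) (k - 1 + q') \<le> evalue S (gram J B) (k - 1)"
    using eb assms unfolding eigenbasis_def by auto
  then show ?thesis using assms by (simp add: tied_def)
qed

lemma disjoint_choice:
  assumes "finite R" "\<And>r. r \<in> R \<Longrightarrow> finite (X r) \<and> card R * t \<le> card (X r)"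
  shows "\<exists>C. (\<forall>r\<in>R. C r \<subseteq> X r \<and> card (C r) = t) \<and> disjoint_family_on C R"
proof -
  have "\<exists>C. (\<forall>r\<in>R'. C r \<subseteq> X r \<and> card (C r) = t) \<and> disjoint_family_on C R'" if "finite R'" "R' \<subseteq> R" for R'
    using that
  proof (induction R' rule: finite_induct)
    case empty
    then show ?case by (simp add: disjoint_family_on_def)
  next
    case (insert a R')
    then obtain C where C: "\<And>r. r \<in> R' \<Longrightarrow> C r \<subseteq> X r \<and> card (C r) = t" "disjoint_family_on C R'" by auto
    let ?u = "\<Union>r\<in>R'. C r"
    have "card ?u \<le> card R' * t"
      using card_UN_le[OF insert.hyps(1), of C] C(1) by simp
    moreover have "card (insert a R') * t \<le> card R * t"
      using card_mono[OF assms(1) insert.prems] by simp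
    moreover have "card R * t \<le> card (X a)" using assms(2) insert.prems by auto
    moreover have "card (X a) - card ?u \<le> card (X a - ?u)"
    proof (rule diff_card_le_card_Diff)
      have "finite (C r)" if "r \<in> R'" for r
        using C(1)[OF that] assms(2)[of r] insert.prems that by (auto intro: finite_subset)
      then show "finite ?u" using insert.hyps by simp
    qed
    ultimately have "t \<le> card (X a - ?u)" using insert.hyps by simp
    then obtain A where A: "A \<subseteq> X a - ?u" "card A = t" by (meson obtain_subset_with_card_n)
    have "disjoint_family_on (C(a := A)) (insert a R')"
    proof -
      have "A \<inter> C r = {}" if "r \<in> R'" for r using A(1) that by blast
      then show ?thesis using C(2) insert.hyps by (auto simp: disjoint_family_on_def)
    qed
    moreover have "\<forall>r\<in>insert a R'. (C(a := A)) r \<subseteq> X r \<and> card ((C(a := A)) r) = t"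
      using C(1) A insert.hyps by auto
    ultimately show ?case by blast
  qed
  then show ?thesis using assms(1) by blast
qed

text \<open>\<open>W\<close> can only become false when columns are added, so whatever a round
  settles stays settled. The unsettled set shrinks below half in each round, and \<open>L\<close>
  rounds exhaust fewer than \<open>2 ^ L\<close> elements.\<close>

lemma halving_rounds:
  fixes W :: "'r \<Rightarrow> 'c set \<Rightarrow> bool"
  assumes anti: "\<And>r Q Q'. Q \<subseteq> Q' \<Longrightarrow> W r Q' \<Longrightarrow> W r Q"
    and R: "finite R" "card R < 2 ^ L" and Q: "\<And>R'. R' \<subseteq> R \<Longrightarrow> R' \<noteq> {} \<Longrightarrow> Q R' \<subseteq> J \<and> card (Q R') \<le> q \<and> 2 * card {r \<in> R'. W r (Q R')} < card R'"
  shows "\<exists>Q'. Q' \<subseteq> J \<and> card Q' \<le> L * q \<and> (\<forall>r\<in>R. \<not> W r Q')"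
  using R Q
proof (induction L arbitrary: R)
  case 0
  then show ?case by auto
next
  case (Suc L)
  show ?case
  proof (cases "R = {}")
    case True
    then show ?thesis by auto
  next
    case False
    let ?R' = "{r \<in> R. W r (Q R)}"
    have h: "Q R \<subseteq> J" "card (Q R) \<le> q" "2 * card ?R' < card R" using Suc.prems(3)[of R] False by auto
    have "\<exists>Q'. Q' \<subseteq> J \<and> card Q' \<le> L * q \<and> (\<forall>r\<in>?R'. \<not> W r Q')"
    proof (rule Suc.IH)
      show "finite ?R'" "card ?R' < 2 ^ L" using Suc.prems h by auto
      fix R'' assume "R'' \<subseteq> ?R'" "R'' \<noteq> {}"
      then show "Q R'' \<subseteq> J \<and> card (Q R'') \<le> q \<and> 2 * card {r \<in> R''. W r (Q R'')} < card R''"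
        using Suc.prems(3)[of R''] by blast
    qed
    then obtain Q' where Q': "Q' \<subseteq> J" "card Q' \<le> L * q" "\<And>r. r \<in> ?R' \<Longrightarrow> \<not> W r Q'" by blast
    have "card (Q R \<union> Q') \<le> Suc L * q" using card_Un_le[of "Q R" Q'] h Q' by simp
    moreover have "\<not> W r (Q R \<union> Q')" if "r \<in> R" for r
      using anti[of "Q R" "Q R \<union> Q'" r] anti[of Q' "Q R \<union> Q'" r] Q'(3)[of r] that by auto
    ultimately show ?thesis using h Q' by (intro exI[of _ "Q R \<union> Q'"]) auto
  qed
qed

text \<open>In each round every cluster of the current set \<open>R\<close> is served by about \<open>2 * T / card R\<close> columns of its own, so
  if at least half of the clusters stay rich, then \<open>T\<close> columns have failed. Halving \<open>R\<close> keeps the total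
  number of columns of order \<open>T\<close>, up to a logarithm, instead of \<open>k * T\<close>.\<close>

lemma prob_tied_eigenvectors_rich:
  fixes \<mu> :: "nat \<times> nat \<Rightarrow> real"
  assumes S: "finite S" and k: "0 < k" "k < 2 ^ L"
    and \<mu>: "\<And>e. 0 \<le> \<mu> e \<and> \<mu> e \<le> 1 / 2"
    and U: "\<And>r. r < k \<Longrightarrow> U r \<subseteq> S"
    and top: "\<And>r. r < k \<Longrightarrow> X r \<subseteq> {..<n} \<and> 2 * T + k \<le> card (X r) \<and> (\<forall>i\<in>U r. \<forall>j\<in>X r. \<rho> r \<le> \<mu> (i, j))"
  shows "bprob (S \<times> {..<n}) \<mu> {g. tied S {..<n} (bmat g) k (L * (2 * T + k)) \<and>
      \<not> (\<exists>Q\<subseteq>{..<n}. card Q \<le> L * (2 * T + k) \<and> (\<forall>r<k. \<not> rich (\<rho> r) (U r) (tie_space S {..<n} (bmat g) k Q)))}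
    \<le> 8 ^ k * (7 / 8) ^ T"
proof -
  \<comment> \<open>The quotient is \<open>2 * T / card R\<close> rounded up: all of
    \<open>R\<close> receives at least \<open>2 * T\<close> columns, and rounding adds fewer than
    \<open>card R\<close>.\<close>
  have "\<exists>C. (\<forall>r\<in>R. C r \<subseteq> X r \<and> card (C r) = (2 * T + card R - 1) div card R) \<and> disjoint_family_on C R" if R: "R \<subseteq> {..<k}" for R
  proof (rule disjoint_choice)
    show fR: "finite R" using R finite_subset by blast
    fix r assume r: "r \<in> R"
    then have rk: "r < k" using R by auto
    have "card R * ((2 * T + card R - 1) div card R) \<le> 2 * T + card R - 1" by simp
    also have "\<dots> \<le> 2 * T + k" using card_mono[OF finite_lessThan R] by simp
    finally have "card R * ((2 * T + card R - 1) div card R) \<le> card (X r)"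
      using top[OF rk] by (meson le_trans)
    then show "finite (X r) \<and> card R * ((2 * T + card R - 1) div card R) \<le> card (X r)"
      using top[OF rk] finite_subset by blast
  qed
  then obtain C where C: "\<And>R r. R \<subseteq> {..<k} \<Longrightarrow> r \<in> R \<Longrightarrow> C R r \<subseteq> X r \<and> card (C R r) = (2 * T + card R - 1) div card R"
    "\<And>R. R \<subseteq> {..<k} \<Longrightarrow> disjoint_family_on (C R) R" by metis
  define Q where "Q R = (\<Union>r\<in>R. C R r)" for R
  let ?q = "2 * T + k"
  have CX: "C R r \<subseteq> {..<n}" if "R \<subseteq> {..<k}" "r \<in> R" for R r
    using C(1)[OF that] top[of r] that by blast
  have finC: "finite (C R r)" if "R \<subseteq> {..<k}" "r \<in> R" for R r using CX[OF that] finite_subset by blast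
  have cardD: "card (\<Union>r\<in>R'. C R r) = card R' * ((2 * T + card R - 1) div card R)" if "R \<subseteq> {..<k}" "R' \<subseteq> R" for R R'
  proof -
    have "disjoint_family_on (C R) R'" using C(2)[OF that(1)] that(2) by (auto simp: disjoint_family_on_def)
    then have "card (\<Union>r\<in>R'. C R r) = (\<Sum>r\<in>R'. card (C R r))"
      using that finC by (intro card_UN_disjoint') (auto intro: finite_subset)
    then show ?thesis using C(1)[OF that(1)] that(2) by (simp add: subset_iff)
  qed
  let ?F = "\<lambda>g Q. tie_space S {..<n} (bmat g) k Q"
  define bad where "bad R R' = {g. tied S {..<n} (bmat g) k (card (Q R)) \<and> (\<forall>r\<in>R'. rich (\<rho> r) (U r) (?F g (Q R)))}" for R R'
  \<comment> \<open>A failing round is a set \<open>R\<close> and a half \<open>R'\<close> of it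
    that stayed rich. There are at most \<open>4 ^ k\<close> such pairs, which turns
    \<open>2 ^ k\<close> into \<open>8 ^ k\<close>.\<close>
  define PP where "PP = {(R, R'). R' \<subseteq> R \<and> R \<subseteq> {..<k} \<and> R \<noteq> {} \<and> card R \<le> 2 * card R'}"
  have PPs: "PP \<subseteq> Pow {..<k} \<times> Pow {..<k}" by (auto simp: PP_def)
  have QJ: "Q R \<subseteq> {..<n} \<and> card (Q R) \<le> ?q" if "R \<subseteq> {..<k}" for R
  proof
    show "Q R \<subseteq> {..<n}" using CX[OF that] by (auto simp: Q_def)
    have "card (Q R) = card R * ((2 * T + card R - 1) div card R)" using cardD[OF that, of R] by (simp add: Q_def)
    also have "\<dots> \<le> 2 * T + card R - 1" by simp
    finally show "card (Q R) \<le> ?q" using card_mono[OF finite_lessThan that] by simp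
  qed
  have pb: "bprob (S \<times> {..<n}) \<mu> (bad R R') \<le> 2 ^ k * (7 / 8) ^ T" if PP: "(R, R') \<in> PP" for R R'
  proof -
    have h: "R' \<subseteq> R" "R \<subseteq> {..<k}" "R \<noteq> {}" "card R \<le> 2 * card R'" using PP by (auto simp: PP_def)
    define D where "D = (\<Union>r\<in>R'. C R r)"
    define own where "own j = (THE r. r \<in> R \<and> j \<in> C R r)" for j
    have own: "own j = r" if "r \<in> R" "j \<in> C R r" for j r
      unfolding own_def
    proof (rule the_equality)
      fix r' assume r': "r' \<in> R \<and> j \<in> C R r'"
      show "r' = r"
      proof (rule ccontr)
        assume "r' \<noteq> r"
        then have "C R r' \<inter> C R r = {}" using C(2)[OF h(2)] r' that(1) unfolding disjoint_family_on_def by blast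
        then show False using r' that by blast
      qed
    qed (use that in simp)
    have D: "own j \<in> R' \<and> j \<in> X (own j)" if "j \<in> D" for j
    proof -
      obtain r where r: "r \<in> R'" "j \<in> C R r" using \<open>j \<in> D\<close> by (auto simp: D_def)
      then have "own j = r" using own h by auto
      moreover have "j \<in> X r" using C(1)[OF h(2), of r] r h by blast
      ultimately show ?thesis using r by simp
    qed
    have "2 * T \<le> card R * ((2 * T + card R - 1) div card R)"
    proof -
      have c: "card R > 0" using h finite_subset[OF h(2)] by (simp add: card_gt_0_iff)
      have "2 * T + card R - 1 = card R * ((2 * T + card R - 1) div card R) + (2 * T + card R - 1) mod card R" by simp
      moreover have "(2 * T + card R - 1) mod card R < card R" using c by simp
      ultimately show ?thesis by linarith
    qed
    also have "\<dots> \<le> 2 * card R' * ((2 * T + card R - 1) div card R)" by (intro mult_le_mono1 h(4))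
    finally have "T \<le> card D" using cardD[OF h(2,1)] by (simp add: D_def)
    have "bad R R' \<subseteq> {g. tied S {..<n} (bmat g) k (card (Q R)) \<and>
       (\<forall>j\<in>D. rich ((\<rho> \<circ> own) j) ((U \<circ> own) j) (tie_space S {..<n} (bmat g) k (Q R)))}"
      using D by (auto simp: bad_def)
    then have "bprob (S \<times> {..<n}) \<mu> (bad R R') \<le> bprob (S \<times> {..<n}) \<mu> \<dots>" by (rule bprob_mono)
    also have "\<dots> \<le> 2 ^ k * (7 / 8) ^ card D"
    proof (rule prob_tie[OF S finite_lessThan _ k(1) \<mu>])
      show "Q R \<subseteq> {..<n}" using QJ[OF h(2)] by simp
      show "D \<subseteq> Q R" using h by (auto simp: D_def Q_def)
      fix j assume "j \<in> D"
      then have o: "own j \<in> R'" "j \<in> X (own j)" using D by auto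
      then have "own j < k" using h by auto
      then show "(U \<circ> own) j \<subseteq> S \<and> (\<forall>i\<in>(U \<circ> own) j. (\<rho> \<circ> own) j \<le> \<mu> (i, j))"
        using U[of "own j"] top[of "own j"] o(2) by (simp only: comp_apply) blast
    qed
    also have "\<dots> \<le> 2 ^ k * (7 / 8) ^ T"
      using \<open>T \<le> card D\<close> by (intro mult_left_mono power_decreasing) auto
    finally show ?thesis .
  qed
  have "{g. tied S {..<n} (bmat g) k (L * ?q) \<and>
      \<not> (\<exists>Q\<subseteq>{..<n}. card Q \<le> L * ?q \<and> (\<forall>r<k. \<not> rich (\<rho> r) (U r) (?F g Q)))} \<subseteq> (\<Union>z\<in>PP. bad (fst z) (snd z))" (is "?E \<subseteq> _")
  proof (rule subsetI, rule ccontr)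
    fix g assume g: "g \<in> ?E" and nb: "g \<notin> (\<Union>z\<in>PP. bad (fst z) (snd z))"
    have L: "L > 0" using k by (cases L) auto
    have "\<exists>Q'. Q' \<subseteq> {..<n} \<and> card Q' \<le> L * ?q \<and> (\<forall>r\<in>{..<k}. \<not> rich (\<rho> r) (U r) (?F g Q'))"
    proof (rule halving_rounds)
      show "rich (\<rho> r) (U r) (?F g Q)" if "Q \<subseteq> Q'" "rich (\<rho> r) (U r) (?F g Q')" for r Q Q'
        using that(2) by (rule rich_mono) (use that(1) in \<open>auto simp: tie_space_def\<close>)
      show "finite {..<k}" "card {..<k} < 2 ^ L" using k by auto
      fix R assume R: "R \<subseteq> {..<k}" "R \<noteq> {}"
      let ?R' = "{r \<in> R. rich (\<rho> r) (U r) (?F g (Q R))}"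
      have "\<not> (card R \<le> 2 * card ?R')"
      proof
        assume "card R \<le> 2 * card ?R'"
        then have "(R, ?R') \<in> PP" using R by (auto simp: PP_def)
        moreover have "g \<in> bad R ?R'"
        proof -
          have "card (Q R) \<le> 1 * ?q" using QJ[OF R(1)] by simp
          also have "\<dots> \<le> L * ?q" using L by (intro mult_le_mono1) simp
          finally have le: "card (Q R) \<le> L * ?q" .
          have "tied S {..<n} (bmat g) k (L * ?q)" using g by simp
          from tied_mono[OF S this le k(1)] have "tied S {..<n} (bmat g) k (card (Q R))" .
          then show ?thesis unfolding bad_def by (intro CollectI conjI ballI) (assumption, drule CollectD, elim conjE, assumption)
        qed
        ultimately have "g \<in> (\<Union>z\<in>PP. bad (fst z) (snd z))"
          by (intro UN_I[where a = "(R, ?R')"]) (simp_all only: fst_conv snd_conv)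
        then show False using nb by (rule notE[rotated])
      qed
      then show "Q R \<subseteq> {..<n} \<and> card (Q R) \<le> ?q \<and> 2 * card ?R' < card R" using QJ[OF R(1)] by simp
    qed
    then show False using g by auto
  qed
  then have "bprob (S \<times> {..<n}) \<mu> ?E \<le> bprob (S \<times> {..<n}) \<mu> (\<Union>z\<in>PP. bad (fst z) (snd z))" by (rule bprob_mono)
  also have "\<dots> \<le> (\<Sum>z\<in>PP. bprob (S \<times> {..<n}) \<mu> (bad (fst z) (snd z)))"
    by (rule bprob_union_bound) (rule finite_subset[OF PPs], simp)
  also have "\<dots> \<le> (\<Sum>z\<in>PP. 2 ^ k * (7 / 8) ^ T)" by (rule sum_mono, rule pb) (simp only: prod.collapse)
  also have "\<dots> = real (card PP) * (2 ^ k * (7 / 8) ^ T)" by simp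
  also have "\<dots> \<le> (2 ^ k * 2 ^ k) * (2 ^ k * (7 / 8) ^ T)"
  proof (rule mult_right_mono)
    have "card PP \<le> card (Pow {..<k} \<times> Pow {..<k})" by (rule card_mono[OF _ PPs]) simp
    also have "\<dots> = 2 ^ k * 2 ^ k" by (simp add: card_cartesian_product card_Pow)
    finally have "real (card PP) \<le> real (2 ^ k * 2 ^ k)" by (rule of_nat_mono)
    then show "real (card PP) \<le> 2 ^ k * 2 ^ k" by simp
  qed simp
  also have "\<dots> = 8 ^ k * (7 / 8) ^ T"
  proof -
    have "(2::real) ^ k * 2 ^ k * 2 ^ k = (2 * 2 * 2) ^ k" by (simp only: power_mult_distrib)
    also have "(2 * 2 * 2 :: real) = 8" by simp
    finally show ?thesis by (metis mult.assoc)
  qed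
  finally show ?thesis .
qed

lemma sum_lessThan_add: "(\<Sum>d<k + q. f d) = (\<Sum>d<k. f d) + (\<Sum>d<(q::nat). f (k + d) :: real)"
  by (induction q) (auto simp: add.assoc)

text \<open>Without a tie of length \<open>q\<close> the first \<open>k + q\<close> eigenvectors
  suffice and no row is exceptional. With such a tie, let \<open>I\<close> be the support of a
  generic vector of the tied eigenspace that is orthogonal to the columns of \<open>Q\<close>. Off
  \<open>I\<close> the tied eigenspace has dimension at most \<open>card Q\<close>, because its
  vectors orthogonal to \<open>Q\<close> vanish there.\<close>

lemma columns_span:
  fixes B :: "nat \<Rightarrow> nat \<Rightarrow> real"
  assumes S: "finite S" and k: "0 < k"
    and tie: "tied S {..<n} B k q \<Longrightarrow> \<exists>Q\<subseteq>{..<n}. card Q \<le> q \<and> (\<forall>r<k. \<not> rich (\<rho> r) (U r) (tie_space S {..<n} B k Q))"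
    and U: "\<And>r. r < k \<Longrightarrow> U r \<subseteq> S"
  shows "\<exists>I e. I \<subseteq> S \<and> (\<forall>r<k. \<rho> r * real (card (I \<inter> U r)) \<le> 1) \<and>
    (\<forall>X. best_approx S n k B X \<longrightarrow> (\<forall>j<n. \<exists>c. \<forall>i\<in>S - I. X i j = (\<Sum>d<k + q. c d * e d i :: real)))"
proof -
  let ?H = "gram {..<n} B"
  let ?u = "evec S ?H" and ?l = "evalue S ?H"
  note eb = eigenbasis_gram[OF S, of "{..<n}" B]
  have on: "orthonormal S (card S) ?u" using eb by (simp add: eigenbasis_def)
  have sorted: "?l b' \<le> ?l b" if "b \<le> b'" "b' < card S" for b b' using eb that unfolding eigenbasis_def by blast
  have exp: "X i j = (\<Sum>b<card S. ip S (\<lambda>i. X i j) (?u b) * ?u b i)" if "i \<in> S" for X :: "nat \<Rightarrow> nat \<Rightarrow> real" and i j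
    by (rule eigenbasis_expand[OF S on that])
  show ?thesis
  proof (cases "tied S {..<n} B k q")
    case False
    define e where "e d = (if d < card S then ?u d else (\<lambda>_. 0))" for d
    have "\<exists>c. \<forall>i\<in>S - {}. X i j = (\<Sum>d<k + q. c d * e d i)" if X: "best_approx S n k B X" and j: "j < n" for X j
    proof -
      let ?c = "\<lambda>b. ip S (\<lambda>i. X i j) (?u b)"
      have z: "?c b = 0" if b: "b < card S" "k + q \<le> b" for b
      proof (rule best_approx_columns[OF S X k _ eb b(1) _ j])
        show "k \<le> card S" using b by simp
        have "k - 1 + q \<le> b" "k + q \<le> card S" using b by auto
        then have "?l b \<le> ?l (k - 1 + q)" "?l (k - 1 + q) \<le> ?l (k - 1)" using sorted b k by auto
        then show "?l b < ?l (k - 1)" using False \<open>k + q \<le> card S\<close> by (auto simp: tied_def)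
      qed
      show ?thesis
      proof (intro exI[of _ ?c] ballI)
        fix i assume i: "i \<in> S - {}"
        have "(\<Sum>b<card S. ?c b * ?u b i) = (\<Sum>b<card S + (k + q). ?c b * e b i)"
          by (rule sum.mono_neutral_cong_left) (auto simp: e_def)
        also have "\<dots> = (\<Sum>d<k + q. ?c d * e d i)"
          by (rule sum.mono_neutral_cong_right) (use z in \<open>auto simp: e_def\<close>)
        finally show "X i j = (\<Sum>d<k + q. ?c d * e d i)" using exp[of i X j] i by simp
      qed
    qed
    then show ?thesis by (intro exI[of _ "{}"] exI[of _ e]) auto
  next
    case True
    then obtain Q where Q: "Q \<subseteq> {..<n}" "card Q \<le> q" "\<And>r. r < k \<Longrightarrow> \<not> rich (\<rho> r) (U r) (tie_space S {..<n} B k Q)"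
      using tie by blast
    define F where "F = {y. \<forall>i\<in>S. app S ?H y i = ?l (k - 1) * y i}"
    let ?W = "tie_space S {..<n} B k Q"
    have WF: "?W = {y \<in> F. \<forall>j\<in>Q. ip S (\<lambda>i. B i j) y = 0}" by (auto simp: tie_space_def F_def)
    have Fc: "(\<lambda>i. x i + t * y i) \<in> F" if "x \<in> F" "y \<in> F" for x y t
      using that by (simp add: F_def app_add app_scale algebra_simps)
    have lin: "ip S z (\<lambda>i. x i + t * y i) = ip S z x + t * ip S z y" for z x t y
      by (simp only: ip_add_right ip_scale_right)
    have Wc: "(\<lambda>i. x i + t * y i) \<in> ?W" if "x \<in> ?W" "y \<in> ?W" for x y t
      using that Fc unfolding WF by (simp add: lin)
    have "(\<lambda>_. 0) \<in> ?W" by (simp add: tie_space_def app_def ip_def)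
    then have "\<exists>y\<in>?W. \<forall>i\<in>S. (\<exists>y'\<in>?W. y' i \<noteq> 0) \<longrightarrow> y i \<noteq> 0"
      using generic_vector[OF S _ Wc] by blast
    then obtain y where y: "y \<in> ?W" "\<And>i y'. i \<in> S \<Longrightarrow> y' \<in> ?W \<Longrightarrow> y' i \<noteq> 0 \<Longrightarrow> y i \<noteq> 0" by blast
    define I where "I = {i \<in> S. y i \<noteq> 0}"
    have I: "\<rho> r * real (card (I \<inter> U r)) \<le> 1" if "r < k" for r
    proof -
      have "I \<inter> U r = {i \<in> U r. y i \<noteq> 0}" using U[OF that] by (auto simp: I_def)
      then show ?thesis using Q(3)[OF that] y(1) by (auto simp: rich_def not_le)
    qed
    obtain js where js: "set js = Q" "length js = card Q"
      using finite_distinct_list[of Q] Q(1) distinct_card finite_subset by (metis finite_lessThan)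
    have "\<exists>e. \<forall>y\<in>F. \<exists>c. \<forall>i\<in>S - I. y i = (\<Sum>d<length js. c d * e d i :: real)"
      by (rule span_of_kernel_zero[where \<beta> = "\<lambda>j. ip S (\<lambda>i. B i j)", OF lin Fc])
        (use y(2) in \<open>auto simp: I_def WF js\<close>)
    then obtain e0 where e0: "\<And>y. y \<in> F \<Longrightarrow> \<exists>c. \<forall>i\<in>S - I. y i = (\<Sum>d<card Q. c d * e0 d i)"
      unfolding js(2) by blast
    \<comment> \<open>The first \<open>k\<close> places hold the eigenvectors strictly above the
      tie, of which there are at most \<open>k - 1\<close>; the other \<open>q\<close> places span
      the tied eigenspace off \<open>I\<close>.\<close>
    define e where "e d = (if d < k then (if d < k - 1 \<and> ?l d > ?l (k - 1) then ?u d else (\<lambda>_. 0)) else e0 (d - k))" for d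
    have kS: "k + q \<le> card S" using True by (simp add: tied_def)
    have "\<exists>c. \<forall>i\<in>S - I. X i j = (\<Sum>d<k + q. c d * e d i)" if X: "best_approx S n k B X" and j: "j < n" for X j
    proof -
      let ?c = "\<lambda>b. ip S (\<lambda>i. X i j) (?u b)"
      let ?hi = "{b. b < card S \<and> ?l b > ?l (k - 1)}" and ?eq = "{b. b < card S \<and> ?l b = ?l (k - 1)}"
      have z: "?c b = 0" if "b < card S" "?l b < ?l (k - 1)" for b
        by (rule best_approx_columns[OF S X k _ eb that j]) (use kS in simp)
      define v where "v i = (\<Sum>b\<in>?eq. ?c b * ?u b i)" for i
      have vF: "v \<in> F"
      proof -
        have "app S ?H v i = ?l (k - 1) * v i" if i: "i \<in> S" for i
        proof -
          have "app S ?H v i = (\<Sum>b\<in>?eq. ?c b * app S ?H (?u b) i)"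
            unfolding app_def v_def sum_distrib_left by (subst sum.swap) (simp add: mult_ac)
          also have "\<dots> = (\<Sum>b\<in>?eq. ?c b * (?l (k - 1) * ?u b i))"
            using eb i by (intro sum.cong refl) (auto simp: eigenbasis_def)
          finally show ?thesis by (simp add: v_def sum_distrib_left mult_ac)
        qed
        then show ?thesis by (simp add: F_def)
      qed
      then obtain c0 where c0: "\<And>i. i \<in> S - I \<Longrightarrow> v i = (\<Sum>d<card Q. c0 d * e0 d i)" using e0 by blast
      define c where "c d = (if d < k then ?c d else if d - k < card Q then c0 (d - k) else 0)" for d
      show ?thesis
      proof (intro exI[of _ c] ballI)
        fix i assume i: "i \<in> S - I"
        have hik: "b < k - 1" if "b \<in> ?hi" for b using that sorted[of "k - 1" b] by (auto simp: not_less[symmetric])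
        have "X i j = (\<Sum>b<card S. ?c b * ?u b i)" using exp i by simp
        also have "\<dots> = (\<Sum>b\<in>?hi \<union> ?eq. ?c b * ?u b i)"
          by (rule sum.mono_neutral_right) (use z in \<open>auto simp: neq_iff\<close>)
        also have "\<dots> = (\<Sum>b\<in>?hi. ?c b * ?u b i) + v i"
          unfolding v_def by (rule sum.union_disjoint) auto
        also have "(\<Sum>b\<in>?hi. ?c b * ?u b i) = (\<Sum>d<k. c d * e d i)"
        proof (rule sum.mono_neutral_cong_left)
          show "?hi \<subseteq> {..<k}" using hik by fastforce
          show "\<forall>d\<in>{..<k} - ?hi. c d * e d i = 0" using kS by (auto simp: e_def)
          show "?c b * ?u b i = c b * e b i" if "b \<in> ?hi" for b
            using hik[OF that] that by (simp add: c_def e_def)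
        qed simp
        also have "v i = (\<Sum>d<q. c (k + d) * e (k + d) i)"
          unfolding c0[OF i] by (rule sum.mono_neutral_cong_left) (use Q(2) in \<open>auto simp: c_def e_def\<close>)
        also have "(\<Sum>d<k. c d * e d i) + \<dots> = (\<Sum>d<k + q. c d * e d i)"
          by (rule sum_lessThan_add[symmetric])
        finally show "X i j = (\<Sum>d<k + q. c d * e d i)" .
      qed
    qed
    moreover have "I \<subseteq> S" by (auto simp: I_def)
    ultimately show ?thesis using I by (intro exI[of _ I] exI[of _ e]) blast
  qed
qed

section \<open>Counting halfspaces\<close>

definition shatters :: "'a set set \<Rightarrow> 'a set \<Rightarrow> bool" where
  "shatters F A \<longleftrightarrow> (\<forall>B\<subseteq>A. \<exists>T\<in>F. T \<inter> A = B)"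

text \<open>Split the family by membership of \<open>a\<close> and project to the remaining points.
  A set shattered by both parts is counted twice, and the full family shatters it both with and
  without \<open>a\<close>.\<close>

lemma pajor:
  assumes "finite S" "F \<subseteq> Pow S"
  shows "card F \<le> card {A. A \<subseteq> S \<and> shatters F A}"
  using assms
proof (induction S arbitrary: F rule: finite_induct)
  case empty
  show ?case
  proof (cases "F = {}")
    case False
    then have F: "F = {{}}" using empty by auto
    then have "{A. A \<subseteq> {} \<and> shatters F A} = {{}}" by (auto simp: shatters_def)
    then show ?thesis by (simp add: F)
  qed simp
next
  case (insert a S)
  define F0 where "F0 = {T \<in> F. a \<notin> T}"
  define F1 where "F1 = (\<lambda>T. T - {a}) ` {T \<in> F. a \<in> T}"
  let ?sh = "\<lambda>F S. {A. A \<subseteq> S \<and> shatters F A}"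
  have finF: "finite F" using insert.prems insert.hyps finite_subset by (metis finite_Pow_iff finite_insert)
  have fs: "finite (?sh G S)" for G using insert.hyps by simp
  have F0S: "F0 \<subseteq> Pow S" and F1S: "F1 \<subseteq> Pow S" using insert.prems by (auto simp: F0_def F1_def)
  have "card F = card F0 + card {T \<in> F. a \<in> T}"
  proof -
    have "F = F0 \<union> {T \<in> F. a \<in> T}" "F0 \<inter> {T \<in> F. a \<in> T} = {}" by (auto simp: F0_def)
    then show ?thesis using finF by (metis card_Un_disjoint finite_Un)
  qed
  also have "card {T \<in> F. a \<in> T} = card F1"
    unfolding F1_def by (rule card_image[symmetric]) (auto simp: inj_on_def)
  also have "card F0 + card F1 \<le> card (?sh F0 S) + card (?sh F1 S)"
    by (intro add_mono insert.IH F0S F1S)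
  also have "\<dots> = card (?sh F0 S \<union> ?sh F1 S) + card (?sh F0 S \<inter> ?sh F1 S)"
    by (rule card_Un_Int[OF fs fs])
  also have "card (?sh F0 S \<inter> ?sh F1 S) = card (insert a ` (?sh F0 S \<inter> ?sh F1 S))"
    by (rule card_image[symmetric]) (use insert.hyps in \<open>auto simp: inj_on_def\<close>)
  also have "card (?sh F0 S \<union> ?sh F1 S) + \<dots> = card ((?sh F0 S \<union> ?sh F1 S) \<union> insert a ` (?sh F0 S \<inter> ?sh F1 S))"
    by (rule card_Un_disjoint[symmetric]) (use fs insert.hyps in auto)
  also have "\<dots> \<le> card (?sh F (insert a S))"
  proof (rule card_mono)
    show "finite (?sh F (insert a S))" using insert.hyps by simp
    have 0: "shatters F A" if A: "A \<subseteq> S" "shatters F0 A" for A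
      using A(2) unfolding shatters_def F0_def by blast
    have 1: "shatters F A" if A: "A \<subseteq> S" "shatters F1 A" for A
      unfolding shatters_def
    proof (intro allI impI)
      fix B assume "B \<subseteq> A"
      then obtain T where T: "T \<in> F" "a \<in> T" "(T - {a}) \<inter> A = B" using A(2) unfolding shatters_def F1_def by blast
      then have "T \<inter> A = B" using A(1) insert.hyps by auto
      then show "\<exists>T\<in>F. T \<inter> A = B" using T by blast
    qed
    have 2: "shatters F (insert a A)" if A: "A \<subseteq> S" "shatters F0 A" "shatters F1 A" for A
      unfolding shatters_def
    proof (intro allI impI)
      fix B assume B: "B \<subseteq> insert a A"
      then have B': "B - {a} \<subseteq> A" by blast
      show "\<exists>T\<in>F. T \<inter> insert a A = B"
      proof (cases "a \<in> B")
        case True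
        obtain T where T: "T \<in> F" "a \<in> T" "(T - {a}) \<inter> A = B - {a}"
          using A(3) B' unfolding shatters_def F1_def by blast
        then have "T \<inter> insert a A = B" using True A(1) insert.hyps by auto
        then show ?thesis using T by blast
      next
        case False
        obtain T where T: "T \<in> F" "a \<notin> T" "T \<inter> A = B - {a}"
          using A(2) B' unfolding shatters_def F0_def by blast
        then have "T \<inter> insert a A = B" using False by auto
        then show ?thesis using T by blast
      qed
    qed
    show "?sh F0 S \<union> ?sh F1 S \<union> insert a ` (?sh F0 S \<inter> ?sh F1 S) \<subseteq> ?sh F (insert a S)"
      using 0 1 2 by auto
  qed
  finally show ?case .
qed

lemma card_small_subsets:
  assumes "finite S"
  shows "card {A. A \<subseteq> S \<and> card A \<le> D} \<le> (card S + 1) ^ D"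
proof (induction D)
  case 0
  have "{A. A \<subseteq> S \<and> card A \<le> 0} = {{}}" using assms by (auto dest: finite_subset)
  then show ?case by simp
next
  case (Suc D)
  let ?X = "\<lambda>D. {A. A \<subseteq> S \<and> card A \<le> D}"
  let ?f = "\<lambda>(x, A). case x of None \<Rightarrow> A | Some a \<Rightarrow> insert a A"
  let ?O = "insert None (Some ` S)"
  have fin: "finite (?X D)" for D using assms by simp
  have "?X (Suc D) \<subseteq> ?f ` (?O \<times> ?X D)"
  proof
    fix A assume A: "A \<in> ?X (Suc D)"
    show "A \<in> ?f ` (?O \<times> ?X D)"
    proof (cases "A = {}")
      case True
      then show ?thesis by (intro image_eqI[of _ _ "(None, {})"]) auto
    next
      case False
      then obtain a where a: "a \<in> A" by blast
      have "finite A" using A assms finite_subset by blast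
      then have "card (A - {a}) = card A - 1" using a by (simp add: card_Diff_singleton)
      moreover have "card A \<le> Suc D" using A by simp
      ultimately have "card (A - {a}) \<le> D" by linarith
      then show ?thesis using A a by (intro image_eqI[of _ _ "(Some a, A - {a})"]) (auto simp: insert_absorb)
    qed
  qed
  then have "card (?X (Suc D)) \<le> card (?O \<times> ?X D)"
    using fin assms by (meson card_image_le card_mono finite_SigmaI finite_imageI finite_insert le_trans)
  also have "\<dots> = (card S + 1) * card (?X D)"
    using assms by (simp add: card_cartesian_product card_image)
  also have "\<dots> \<le> (card S + 1) * (card S + 1) ^ D" using Suc by (rule mult_le_mono2)
  finally show ?case by simp
qed

definition halfspaces :: "'a set \<Rightarrow> nat \<Rightarrow> (nat \<Rightarrow> 'a \<Rightarrow> real) \<Rightarrow> 'a set set" where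
  "halfspaces S D e = {{i \<in> S. (\<Sum>d<D. c d * e d i) > 0} | c. True}"

text \<open>More than \<open>D\<close> points carry a linear relation \<open>c\<close> among their
  coordinate vectors. A halfspace cutting out exactly the points with positive \<open>c\<close>
  would make the sum of \<open>c i * g i\<close> positive, although the relation makes it 0. If
  \<open>c\<close> has no positive entry, use \<open>- c\<close>.\<close>

lemma shattered_by_halfspaces:
  assumes S: "finite S" "A \<subseteq> S" and sh: "shatters (halfspaces S D e) A"
  shows "card A \<le> D"
proof (rule ccontr)
  assume "\<not> card A \<le> D"
  have fA: "finite A" using S finite_subset by blast
  obtain c where c: "\<exists>i\<in>A. c i \<noteq> 0" "\<And>d. d < D \<Longrightarrow> (\<Sum>i\<in>A. e d i * c i) = 0"
  proof -
    have "card {..<D} < card A" using \<open>\<not> card A \<le> D\<close> by simp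
    from homogeneous_solution[OF finite_lessThan fA this, of "\<lambda>d i. e d i"] show ?thesis using that by blast
  qed
  have contra: False if c: "\<exists>i\<in>A. c i > 0" "\<And>d. d < D \<Longrightarrow> (\<Sum>i\<in>A. e d i * c i) = 0" for c :: "_ \<Rightarrow> real"
  proof -
    obtain T where T: "T \<in> halfspaces S D e" "T \<inter> A = {i \<in> A. c i > 0}"
      using sh[unfolded shatters_def, rule_format, of "{i \<in> A. c i > 0}"] by blast
    then obtain b where b: "T = {i \<in> S. (\<Sum>d<D. b d * e d i) > 0}" by (auto simp: halfspaces_def)
    define g where "g i = (\<Sum>d<D. b d * e d i)" for i
    have gp: "g i > 0 \<longleftrightarrow> c i > 0" if "i \<in> A" for i using T(2) that S(2) unfolding b g_def by blast
    obtain i0 where i0: "i0 \<in> A" "c i0 > 0" using c(1) by blast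
    have "(\<Sum>i\<in>A. c i * g i) = (\<Sum>d<D. b d * (\<Sum>i\<in>A. e d i * c i))"
      unfolding g_def sum_distrib_left by (subst sum.swap) (simp add: mult_ac)
    also have "\<dots> = 0" using c(2) by simp
    finally have z: "(\<Sum>i\<in>A. c i * g i) = 0" .
    have nn: "c i * g i \<ge> 0" if "i \<in> A" for i
      using gp[OF that] by (cases "c i > 0") (auto simp: not_less intro: mult_nonpos_nonpos)
    have "c i0 * g i0 > 0" using gp[OF i0(1)] i0 by simp
    moreover have "c i0 * g i0 \<le> (\<Sum>i\<in>A. c i * g i)"
      using member_le_sum[of i0 A "\<lambda>i. c i * g i"] i0(1) fA nn by blast
    ultimately show False using z by simp
  qed
  obtain i where i: "i \<in> A" "c i \<noteq> 0" using c(1) by blast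
  show False
  proof (cases "c i > 0")
    case True
    then show False using contra[of c] i c(2) by blast
  next
    case False
    have "(\<Sum>i\<in>A. e d i * - c i) = 0" if "d < D" for d using c(2)[OF that] by (simp add: sum_negf)
    moreover have "- c i > 0" using False i by simp
    ultimately show False using contra[of "\<lambda>i. - c i"] i by blast
  qed
qed

lemma card_halfspaces:
  assumes "finite S"
  shows "finite (halfspaces S D e)" "card (halfspaces S D e) \<le> (card S + 1) ^ D"
proof -
  have sub: "halfspaces S D e \<subseteq> Pow S" by (auto simp: halfspaces_def)
  then show "finite (halfspaces S D e)" using assms finite_subset by blast
  have "card (halfspaces S D e) \<le> card {A. A \<subseteq> S \<and> shatters (halfspaces S D e) A}"
    by (rule pajor[OF assms sub])
  also have "\<dots> \<le> card {A. A \<subseteq> S \<and> card A \<le> D}"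
  proof (rule card_mono)
    show "{A. A \<subseteq> S \<and> shatters (halfspaces S D e) A} \<subseteq> {A. A \<subseteq> S \<and> card A \<le> D}"
      using shattered_by_halfspaces[OF assms] by blast
  qed (use assms in simp)
  also have "\<dots> \<le> (card S + 1) ^ D" by (rule card_small_subsets[OF assms])
  finally show "card (halfspaces S D e) \<le> (card S + 1) ^ D" .
qed

section \<open>Optimal clusterings\<close>

abbreviation dst :: "nat \<Rightarrow> (nat \<Rightarrow> real) \<Rightarrow> (nat \<Rightarrow> real) \<Rightarrow> real" where
  "dst n x y \<equiv> L2_set (\<lambda>j. x j - y j) {..<n}"

lemma dst_sq: "(dst n x y)\<^sup>2 = (\<Sum>j<n. (x j - y j)\<^sup>2)"
  by (simp add: L2_set_def sum_nonneg)

lemma dst_commute: "dst n x y = dst n y x"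
  by (simp add: L2_set_def power2_commute)

lemma dst_triangle: "dst n x z \<le> dst n x y + dst n y z"
  using L2_set_triangle_ineq[of "\<lambda>j. x j - y j" "\<lambda>j. y j - z j" "{..<n}"] by simp

lemma dst_cong: "(\<And>j. j < n \<Longrightarrow> x j = x' j) \<Longrightarrow> (\<And>j. j < n \<Longrightarrow> y j = y' j) \<Longrightarrow> dst n x y = dst n x' y'"
  by (rule L2_set_cong) auto

lemma dst_sq_add_le: "(dst n x z)\<^sup>2 \<le> 2 * (dst n x y)\<^sup>2 + 2 * (dst n y z)\<^sup>2"
proof -
  have "(dst n x z)\<^sup>2 \<le> (dst n x y + dst n y z)\<^sup>2" by (intro power_mono dst_triangle) auto
  also have "\<dots> \<le> 2 * (dst n x y)\<^sup>2 + 2 * (dst n y z)\<^sup>2"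
    using zero_le_power2[of "dst n x y - dst n y z"] by (simp add: power2_eq_square algebra_simps)
  finally show ?thesis .
qed

definition avg :: "('a \<Rightarrow> nat \<Rightarrow> real) \<Rightarrow> 'a set \<Rightarrow> nat \<Rightarrow> real" where
  "avg X C j = (\<Sum>i\<in>C. X i j) / real (card C)"

lemma sum_dst_avg:
  assumes "finite C"
  shows "(\<Sum>i\<in>C. (dst n (X i) v)\<^sup>2) = (\<Sum>i\<in>C. (dst n (X i) (avg X C))\<^sup>2) + real (card C) * (dst n (avg X C) v)\<^sup>2"
proof (cases "C = {}")
  case False
  then have c: "real (card C) > 0" using assms by (simp add: card_gt_0_iff)
  have "(\<Sum>i\<in>C. (X i j - v j)\<^sup>2) = (\<Sum>i\<in>C. (X i j - avg X C j)\<^sup>2) + real (card C) * (avg X C j - v j)\<^sup>2" for j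
  proof -
    let ?m = "avg X C j"
    have m: "(\<Sum>i\<in>C. X i j) = real (card C) * ?m" using c by (simp add: avg_def)
    have z: "(\<Sum>i\<in>C. X i j - ?m) = 0" by (simp add: sum_subtractf m)
    have "(\<Sum>i\<in>C. (X i j - v j)\<^sup>2) = (\<Sum>i\<in>C. (X i j - ?m)\<^sup>2 + 2 * (?m - v j) * (X i j - ?m) + (?m - v j)\<^sup>2)"
      by (rule sum.cong) (auto simp: power2_eq_square algebra_simps)
    also have "\<dots> = (\<Sum>i\<in>C. (X i j - ?m)\<^sup>2) + 2 * (?m - v j) * (\<Sum>i\<in>C. X i j - ?m) + real (card C) * (?m - v j)\<^sup>2"
      by (simp only: sum.distrib sum_distrib_left sum_constant)
    finally show ?thesis by (simp only: z mult_zero_right add_0_right)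
  qed
  then have "(\<Sum>j<n. \<Sum>i\<in>C. (X i j - v j)\<^sup>2) =
      (\<Sum>j<n. \<Sum>i\<in>C. (X i j - avg X C j)\<^sup>2) + real (card C) * (\<Sum>j<n. (avg X C j - v j)\<^sup>2)"
    by (simp only: sum.distrib sum_distrib_left)
  then show ?thesis unfolding dst_sq by (subst (1 2) sum.swap) simp
qed simp

definition km_cost :: "'a set \<Rightarrow> nat \<Rightarrow> ('a \<Rightarrow> nat \<Rightarrow> real) \<Rightarrow> ('a \<Rightarrow> nat) \<Rightarrow> real" where
  "km_cost S n X l = (\<Sum>i\<in>S. (dst n (X i) (avg X {i' \<in> S. l i' = l i}))\<^sup>2)"

definition km_opt :: "'a set \<Rightarrow> nat \<Rightarrow> nat \<Rightarrow> ('a \<Rightarrow> nat \<Rightarrow> real) \<Rightarrow> ('a \<Rightarrow> nat) \<Rightarrow> bool" where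
  "km_opt S n k X l \<longleftrightarrow> (\<forall>i\<in>S. l i < k) \<and> (\<forall>l'. (\<forall>i\<in>S. l' i < k) \<longrightarrow> km_cost S n X l \<le> km_cost S n X l')"

lemma km_cost_centres:
  assumes S: "finite S" and l: "\<And>i. i \<in> S \<Longrightarrow> l i < k"
  shows "(\<Sum>i\<in>S. (dst n (X i) (v (l i)))\<^sup>2) = km_cost S n X l +
    (\<Sum>s<k. real (card {i \<in> S. l i = s}) * (dst n (avg X {i \<in> S. l i = s}) (v s))\<^sup>2)"
proof -
  let ?C = "\<lambda>s. {i \<in> S. l i = s}"
  have split: "(\<Sum>i\<in>S. f i) = (\<Sum>s<k. \<Sum>i\<in>?C s. f i)" for f :: "_ \<Rightarrow> real"
    by (rule sum.group[symmetric]) (use S l in auto)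
  have "(\<Sum>i\<in>?C s. (dst n (X i) (v (l i)))\<^sup>2) = (\<Sum>i\<in>?C s. (dst n (X i) (avg X {i' \<in> S. l i' = l i}))\<^sup>2)
      + real (card (?C s)) * (dst n (avg X (?C s)) (v s))\<^sup>2" for s
    using sum_dst_avg[of "?C s" X "v s" n] S by simp
  then show ?thesis unfolding km_cost_def by (subst (1 2) split) (simp only: sum.distrib)
qed

lemma km_cost_le:
  assumes "finite S" "\<And>i. i \<in> S \<Longrightarrow> l i < (k :: nat)"
  shows "km_cost S n X l \<le> (\<Sum>i\<in>S. (dst n (X i) (v (l i)))\<^sup>2)"
  using km_cost_centres[where k = k and n = n and X = X and v = v, OF assms] by (simp add: sum_nonneg)

text \<open>Moving one point to another cluster cannot help; if the two centres were equally close, it would help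
  because the centre of the receiving cluster would then no longer be its mean.\<close>

lemma km_opt_nearest:
  assumes S: "finite S" and opt: "km_opt S n k X l" and i: "i \<in> S" and s: "s < k" "s \<noteq> l i"
    and sep: "dst n (avg X {i' \<in> S. l i' = l i}) (avg X {i' \<in> S. l i' = s}) > 0"
  shows "dst n (X i) (avg X {i' \<in> S. l i' = l i}) < dst n (X i) (avg X {i' \<in> S. l i' = s})"
proof (rule ccontr)
  let ?\<nu> = "\<lambda>s. avg X {i' \<in> S. l i' = s}"
  assume "\<not> ?thesis"
  then have le: "dst n (X i) (?\<nu> s) \<le> dst n (X i) (?\<nu> (l i))" by simp
  define l' where "l' = l(i := s)"
  have l: "l i' < k" if "i' \<in> S" for i' using opt that by (auto simp: km_opt_def)
  have l': "l' i' < k" if "i' \<in> S" for i' using l that s by (simp add: l'_def)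
  let ?C' = "{i' \<in> S. l' i' = s}"
  have C': "?C' = insert i {i' \<in> S. l i' = s}" using i s by (auto simp: l'_def)
  have "(\<Sum>i'\<in>S. (dst n (X i') (?\<nu> (l' i')))\<^sup>2) = (dst n (X i) (?\<nu> s))\<^sup>2 + (\<Sum>i'\<in>S - {i}. (dst n (X i') (?\<nu> (l i')))\<^sup>2)"
    by (subst sum.remove[OF S i]) (auto simp: l'_def)
  also have "\<dots> \<le> (dst n (X i) (?\<nu> (l i)))\<^sup>2 + (\<Sum>i'\<in>S - {i}. (dst n (X i') (?\<nu> (l i')))\<^sup>2)"
    using le by (intro add_right_mono power_mono) auto
  also have "\<dots> = km_cost S n X l" unfolding km_cost_def by (rule sum.remove[OF S i, symmetric])
  also have "\<dots> \<le> km_cost S n X l'" using opt l' by (simp add: km_opt_def)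
  \<comment> \<open>With the old centres the move costs nothing, so optimality leaves no room for
    the new means to gain: the mean of the receiving cluster is unchanged, and therefore
    \<open>X i\<close> lies at it. For an empty cluster the old centre is 0, and the computation is
    the same.\<close>
  finally have "(\<Sum>s<k. real (card {i \<in> S. l' i = s}) * (dst n (avg X {i \<in> S. l' i = s}) (?\<nu> s))\<^sup>2) \<le> 0"
    using km_cost_centres[where l = l' and k = k and n = n and X = X and v = ?\<nu>, OF S l'] by simp
  moreover have "real (card ?C') * (dst n (avg X ?C') (?\<nu> s))\<^sup>2 \<le>
      (\<Sum>s<k. real (card {i \<in> S. l' i = s}) * (dst n (avg X {i \<in> S. l' i = s}) (?\<nu> s))\<^sup>2)"
    by (rule member_le_sum[where f = "\<lambda>s. real (card {i \<in> S. l' i = s}) * (dst n (avg X {i \<in> S. l' i = s}) (?\<nu> s))\<^sup>2"]) (use s in auto)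
  ultimately have "real (card ?C') * (dst n (avg X ?C') (?\<nu> s))\<^sup>2 \<le> 0" by (rule order_trans[rotated])
  moreover have cC: "card ?C' = Suc (card {i' \<in> S. l i' = s})"
    unfolding C' using S s by (subst card_insert_disjoint) auto
  ultimately have "(dst n (avg X ?C') (?\<nu> s))\<^sup>2 = 0"
    using zero_le_power2[of "dst n (avg X ?C') (?\<nu> s)"] by (simp add: mult_le_0_iff)
  then have eq: "\<And>j. j < n \<Longrightarrow> avg X ?C' j = ?\<nu> s j" unfolding dst_sq by (simp add: sum_nonneg_eq_0_iff)
  have "X i j = ?\<nu> s j" if j: "j < n" for j
  proof -
    let ?N = "card {i' \<in> S. l i' = s}"
    have "real (Suc ?N) * avg X ?C' j = (\<Sum>i'\<in>?C'. X i' j)" unfolding avg_def cC by simp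
    also have "\<dots> = X i j + (\<Sum>i'\<in>{i' \<in> S. l i' = s}. X i' j)"
      unfolding C' using S s by (subst sum.insert) auto
    also have "(\<Sum>i'\<in>{i' \<in> S. l i' = s}. X i' j) = real ?N * ?\<nu> s j"
    proof (cases "?N = 0")
      case True
      then have "{i' \<in> S. l i' = s} = {}" using S by simp
      then show ?thesis by (simp only: sum.empty card.empty of_nat_0 mult_zero_left)
    qed (simp add: avg_def)
    finally show ?thesis using eq[OF j] by (simp add: algebra_simps)
  qed
  then have "dst n (X i) (?\<nu> s) = 0" by (simp add: L2_set_def)
  moreover have "dst n (X i) (?\<nu> (l i)) \<le> dst n (X i) (?\<nu> s)"
  proof -
    have "(\<Sum>i'\<in>S. (dst n (X i') (?\<nu> (l i')))\<^sup>2) = km_cost S n X l" by (simp add: km_cost_def)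
    also have "\<dots> \<le> km_cost S n X l'" using opt l' by (simp add: km_opt_def)
    also have "\<dots> \<le> (\<Sum>i'\<in>S. (dst n (X i') (?\<nu> (l' i')))\<^sup>2)" by (rule km_cost_le[where k = k, OF S l'])
    also have "\<dots> = (dst n (X i) (?\<nu> s))\<^sup>2 + (\<Sum>i'\<in>S - {i}. (dst n (X i') (?\<nu> (l i')))\<^sup>2)"
      by (subst sum.remove[OF S i]) (auto simp: l'_def)
    finally have "(dst n (X i) (?\<nu> (l i)))\<^sup>2 \<le> (dst n (X i) (?\<nu> s))\<^sup>2"
      by (subst (asm) sum.remove[OF S i]) simp
    then show ?thesis by (rule power2_le_imp_le) simp
  qed
  ultimately have "dst n (X i) (?\<nu> s) = 0" "dst n (X i) (?\<nu> (l i)) = 0"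
    using L2_set_nonneg[of "\<lambda>j. X i j - ?\<nu> (l i) j" "{..<n}"] by linarith+
  then show False using sep dst_triangle[of "?\<nu> (l i)" "?\<nu> s" n "X i"] dst_commute[of "?\<nu> (l i)" "X i" n] by simp
qed

text \<open>The cells are indexed by the true labels: the unknown relabelling is absorbed into
  \<open>C\<close>.\<close>

definition near_partition :: "nat set \<Rightarrow> nat \<Rightarrow> nat \<Rightarrow> (nat \<Rightarrow> nat) \<Rightarrow> (nat \<Rightarrow> nat \<Rightarrow> real) \<Rightarrow> real \<Rightarrow> real \<Rightarrow>
    (nat \<Rightarrow> nat \<Rightarrow> real) \<Rightarrow> (nat \<Rightarrow> nat set) \<Rightarrow> bool" where
  "near_partition S n k c \<mu> D E X C \<longleftrightarrow>
     (\<Union>b<k. C b) = S \<and> disjoint_family_on C {..<k} \<and>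
     (\<forall>b<k. dst n (avg X (C b)) (\<mu> b) \<le> D / 100) \<and>
     (\<forall>b<k. \<forall>i\<in>C b. \<forall>s<k. s \<noteq> b \<longrightarrow> dst n (X i) (avg X (C b)) < dst n (X i) (avg X (C s))) \<and>
     (\<forall>b<k. D\<^sup>2 * real (card (C b - {i \<in> S. c i = b})) \<le> 5 * E \<and> card {i \<in> S. c i = b} \<le> 2 * card (C b))"

text \<open>The true labels are a competitor, so replacing rows by their true means costs at most
  \<open>4 * E\<close> with the estimated centres. A true mean with no estimated centre within
  \<open>D / 100\<close> would make its whole cluster pay more, whence
  \<open>40000 = 4 * 100^2\<close>. Separation makes the assignment of centres injective, and every
  misplaced row pays at least \<open>(99 / 100 * D)^2\<close>, whence \<open>5 * E\<close>.\<close>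

theorem km_opt_recovers:
  fixes \<mu> :: "nat \<Rightarrow> nat \<Rightarrow> real"
  assumes S: "finite S" and c: "\<And>i. i \<in> S \<Longrightarrow> c i < k"
    and XM: "(\<Sum>i\<in>S. (dst n (X i) (\<mu> (c i)))\<^sup>2) \<le> E"
    and D: "D > 0" and sep: "\<And>r s. r < k \<Longrightarrow> s < k \<Longrightarrow> r \<noteq> s \<Longrightarrow> D \<le> dst n (\<mu> r) (\<mu> s)"
    and E: "\<And>r. r < k \<Longrightarrow> 40000 * E \<le> D\<^sup>2 * real (card {i \<in> S. c i = r})" "\<And>r. r < k \<Longrightarrow> {i \<in> S. c i = r} \<noteq> {}"
    and opt: "km_opt S n k X l"
  shows "\<exists>\<phi>. bij_betw \<phi> {..<k} {..<k} \<and> near_partition S n k c \<mu> D E X (\<lambda>b. {i \<in> S. l i = \<phi> b})"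
proof -
  let ?\<nu> = "\<lambda>s. avg X {i \<in> S. l i = s}" and ?U = "\<lambda>r. {i \<in> S. c i = r}"
  have l: "l i < k" if "i \<in> S" for i using opt that by (auto simp: km_opt_def)
  have cost: "(\<Sum>i\<in>S. (dst n (\<mu> (c i)) (?\<nu> (l i)))\<^sup>2) \<le> 4 * E"
  proof -
    have "(\<Sum>i\<in>S. (dst n (\<mu> (c i)) (?\<nu> (l i)))\<^sup>2) \<le>
        (\<Sum>i\<in>S. 2 * (dst n (X i) (\<mu> (c i)))\<^sup>2 + 2 * (dst n (X i) (?\<nu> (l i)))\<^sup>2)"
    proof (rule sum_mono)
      fix i
      show "(dst n (\<mu> (c i)) (?\<nu> (l i)))\<^sup>2 \<le> 2 * (dst n (X i) (\<mu> (c i)))\<^sup>2 + 2 * (dst n (X i) (?\<nu> (l i)))\<^sup>2"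
        using dst_sq_add_le[of "\<mu> (c i)" "?\<nu> (l i)" n "X i"] unfolding dst_commute[of "\<mu> (c i)" "X i" n] .
    qed
    also have "\<dots> = 2 * (\<Sum>i\<in>S. (dst n (X i) (\<mu> (c i)))\<^sup>2) + 2 * km_cost S n X l"
      by (simp only: sum.distrib sum_distrib_left km_cost_def)
    also have "km_cost S n X l \<le> km_cost S n X c" using opt c by (simp add: km_opt_def)
    also have "\<dots> \<le> (\<Sum>i\<in>S. (dst n (X i) (\<mu> (c i)))\<^sup>2)" by (rule km_cost_le[where k = k, OF S c])
    finally show ?thesis using XM by simp
  qed
  have "\<exists>s<k. dst n (\<mu> r) (?\<nu> s) \<le> D / 100" if r: "r < k" for r
  proof -
    obtain i where i: "i \<in> ?U r" "\<And>i'. i' \<in> ?U r \<Longrightarrow> (dst n (\<mu> r) (?\<nu> (l i)))\<^sup>2 \<le> (dst n (\<mu> r) (?\<nu> (l i')))\<^sup>2"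
      using ex_min_finite[of "?U r" "\<lambda>i. (dst n (\<mu> r) (?\<nu> (l i)))\<^sup>2"] S E(2)[OF r] by auto
    have "real (card (?U r)) * (dst n (\<mu> r) (?\<nu> (l i)))\<^sup>2 \<le> (\<Sum>i'\<in>?U r. (dst n (\<mu> (c i')) (?\<nu> (l i')))\<^sup>2)"
    proof -
      have "(\<Sum>i'\<in>?U r. (dst n (\<mu> r) (?\<nu> (l i)))\<^sup>2) \<le> (\<Sum>i'\<in>?U r. (dst n (\<mu> (c i')) (?\<nu> (l i')))\<^sup>2)"
      proof (rule sum_mono)
        fix i' assume i': "i' \<in> ?U r"
        then have "c i' = r" by simp
        then show "(dst n (\<mu> r) (?\<nu> (l i)))\<^sup>2 \<le> (dst n (\<mu> (c i')) (?\<nu> (l i')))\<^sup>2" using i(2)[OF i'] by simp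
      qed
      then show ?thesis by simp
    qed
    also have "\<dots> \<le> (\<Sum>i\<in>S. (dst n (\<mu> (c i)) (?\<nu> (l i)))\<^sup>2)" by (rule sum_mono2) (use S in auto)
    also have "\<dots> \<le> 4 * E" by (rule cost)
    finally have "real (card (?U r)) * (dst n (\<mu> r) (?\<nu> (l i)))\<^sup>2 \<le> real (card (?U r)) * (D / 100)\<^sup>2"
      using E(1)[OF r] by (simp add: power_divide field_simps)
    moreover have "real (card (?U r)) > 0" using S E(2)[OF r] by (simp add: card_gt_0_iff)
    ultimately have "(dst n (\<mu> r) (?\<nu> (l i)))\<^sup>2 \<le> (D / 100)\<^sup>2" by (rule mult_left_le_imp_le)
    then have "dst n (\<mu> r) (?\<nu> (l i)) \<le> D / 100" by (rule power2_le_imp_le) (use D in simp)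
    then show ?thesis using l i(1) by blast
  qed
  then obtain \<phi> where \<phi>: "\<And>r. r < k \<Longrightarrow> \<phi> r < k" "\<And>r. r < k \<Longrightarrow> dst n (\<mu> r) (?\<nu> (\<phi> r)) \<le> D / 100" by metis
  have tri: "D - D / 100 - D / 100 \<le> dst n (?\<nu> (\<phi> r)) (?\<nu> (\<phi> s))" if "r < k" "s < k" "r \<noteq> s" for r s
    using dst_triangle[of "\<mu> r" "\<mu> s" n "?\<nu> (\<phi> r)"] dst_triangle[of "?\<nu> (\<phi> r)" "\<mu> s" n "?\<nu> (\<phi> s)"]
      sep[OF that] \<phi>(2)[OF that(1)] \<phi>(2)[OF that(2)] dst_commute[of "?\<nu> (\<phi> s)" "\<mu> s" n] by linarith
  have "inj_on \<phi> {..<k}"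
  proof (rule inj_onI, rule ccontr)
    fix r s assume h: "r \<in> {..<k}" "s \<in> {..<k}" "\<phi> r = \<phi> s" "r \<noteq> s"
    then have "D - D / 100 - D / 100 \<le> 0" using tri[of r s] by (simp add: L2_set_def)
    then show False using D by simp
  qed
  then have bij: "bij_betw \<phi> {..<k} {..<k}"
    using \<phi>(1) unfolding bij_betw_def by (intro conjI endo_inj_surj) auto
  define C where "C b = {i \<in> S. l i = \<phi> b}" for b
  have mis: "D\<^sup>2 * real (card {i \<in> S. l i \<noteq> \<phi> (c i)}) \<le> 5 * E"
  proof -
    let ?B = "{i \<in> S. l i \<noteq> \<phi> (c i)}"
    have b: "(99 / 100 * D)\<^sup>2 \<le> (dst n (\<mu> (c i)) (?\<nu> (l i)))\<^sup>2" if i: "i \<in> ?B" for i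
    proof -
      obtain s where s: "s < k" "l i = \<phi> s" using bij l[of i] i unfolding bij_betw_def by blast
      then have ns: "s \<noteq> c i" using i by auto
      have ck: "c i < k" using c i by simp
      have "99 / 100 * D \<le> dst n (\<mu> (c i)) (?\<nu> (l i))"
        using dst_triangle[of "\<mu> (c i)" "\<mu> s" n "?\<nu> (l i)"] sep[OF ck s(1)] ns \<phi>(2)[OF s(1)]
          dst_commute[of "?\<nu> (\<phi> s)" "\<mu> s" n] s(2) by auto
      then show ?thesis by (rule power_mono) (use D in simp)
    qed
    have "real (card ?B) * (99 / 100 * D)\<^sup>2 \<le> (\<Sum>i\<in>?B. (dst n (\<mu> (c i)) (?\<nu> (l i)))\<^sup>2)"
      using sum_mono[where K = ?B, OF b] by simp
    also have "\<dots> \<le> (\<Sum>i\<in>S. (dst n (\<mu> (c i)) (?\<nu> (l i)))\<^sup>2)" by (rule sum_mono2) (use S in auto)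
    also have "\<dots> \<le> 4 * E" by (rule cost)
    finally have "9801 / 10000 * (D\<^sup>2 * real (card ?B)) \<le> 4 * E" by (simp add: power_mult_distrib power_divide algebra_simps)
    moreover have "D\<^sup>2 * real (card ?B) \<ge> 0" by simp
    ultimately show ?thesis by linarith
  qed
  have "near_partition S n k c \<mu> D E X C"
    unfolding near_partition_def
  proof (intro conjI allI impI ballI)
    show "(\<Union>b<k. C b) = S"
    proof
      show "S \<subseteq> (\<Union>b<k. C b)"
      proof
        fix i assume i: "i \<in> S"
        obtain s where s: "s < k" "l i = \<phi> s" using bij l[OF i] unfolding bij_betw_def by blast
        then show "i \<in> (\<Union>b<k. C b)" using i by (auto simp: C_def)
      qed
    qed (auto simp: C_def)
    show "disjoint_family_on C {..<k}"
      unfolding disjoint_family_on_def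
    proof (intro ballI impI)
      fix r s assume rs: "r \<in> {..<k}" "s \<in> {..<k}" "r \<noteq> s"
      then have "\<phi> r \<noteq> \<phi> s" using bij by (meson bij_betw_def inj_on_def)
      then show "C r \<inter> C s = {}" by (auto simp: C_def)
    qed
  next
    fix b assume b: "b < k"
    show "dst n (avg X (C b)) (\<mu> b) \<le> D / 100" using \<phi>(2)[OF b] dst_commute[of "?\<nu> (\<phi> b)" "\<mu> b" n] by (simp add: C_def)
    have "D\<^sup>2 * real (card (C b - ?U b)) \<le> D\<^sup>2 * real (card {i \<in> S. l i \<noteq> \<phi> (c i)})"
    proof (intro mult_left_mono of_nat_mono card_mono)
      show "C b - ?U b \<subseteq> {i \<in> S. l i \<noteq> \<phi> (c i)}"
      proof
        fix i assume i: "i \<in> C b - ?U b"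
        then have "c i \<in> {..<k}" "c i \<noteq> b" "i \<in> S" "l i = \<phi> b" using c by (auto simp: C_def)
        moreover then have "\<phi> (c i) \<noteq> \<phi> b" using bij b by (meson bij_betw_def inj_on_def lessThan_iff)
        ultimately show "i \<in> {i \<in> S. l i \<noteq> \<phi> (c i)}" by simp
      qed
    qed (use S in auto)
    then show "D\<^sup>2 * real (card (C b - ?U b)) \<le> 5 * E" using mis by simp
    have "?U b \<subseteq> C b \<union> {i \<in> S. l i \<noteq> \<phi> (c i)}" by (auto simp: C_def)
    then have "card (?U b) \<le> card (C b \<union> {i \<in> S. l i \<noteq> \<phi> (c i)})" by (rule card_mono[rotated]) (use S in \<open>auto simp: C_def\<close>)
    also have "\<dots> \<le> card (C b) + card {i \<in> S. l i \<noteq> \<phi> (c i)}" by (rule card_Un_le)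
    finally have 1: "real (card (?U b)) \<le> real (card (C b)) + real (card {i \<in> S. l i \<noteq> \<phi> (c i)})"
      by (simp flip: of_nat_add)
    have "D\<^sup>2 * (2 * real (card {i \<in> S. l i \<noteq> \<phi> (c i)})) \<le> D\<^sup>2 * real (card (?U b))"
    proof -
      have "0 \<le> (\<Sum>i\<in>S. (dst n (X i) (\<mu> (c i)))\<^sup>2)" by (simp add: sum_nonneg)
      then have "E \<ge> 0" using XM by simp
      then show ?thesis using mis E(1)[OF b] by simp
    qed
    then have "2 * real (card {i \<in> S. l i \<noteq> \<phi> (c i)}) \<le> real (card (?U b))"
      by (rule mult_left_le_imp_le) (use D in simp)
    then have "real (card (?U b)) \<le> real (2 * card (C b))" using 1 by simp
    then show "card (?U b) \<le> 2 * card (C b)" by (simp only: of_nat_le_iff)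
  next
    fix b i s assume h: "b < k" "i \<in> C b" "s < k" "s \<noteq> b"
    have li: "l i = \<phi> b" "i \<in> S" using h by (auto simp: C_def)
    have "0 < D - D / 100 - D / 100" using D by simp
    also have "\<dots> \<le> dst n (?\<nu> (\<phi> b)) (?\<nu> (\<phi> s))" using tri h by auto
    finally have p: "0 < dst n (?\<nu> (\<phi> b)) (?\<nu> (\<phi> s))" .
    have ne: "\<phi> s \<noteq> \<phi> b" using bij h by (meson bij_betw_def inj_on_def lessThan_iff)
    show "dst n (X i) (avg X (C b)) < dst n (X i) (avg X (C s))"
      using km_opt_nearest[OF S opt li(2) \<phi>(1)[OF h(3)]] p ne unfolding li(1) C_def by simp
  qed
  then show ?thesis using bij unfolding C_def by blast
qed

section \<open>Classification of a fresh row\<close>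

text \<open>In the difference of two squared distances the square of \<open>X i\<close> cancels,
  leaving an affine function of \<open>X i\<close>. The constant function in place \<open>K\<close>
  makes it linear.\<close>

lemma halfspace_closer:
  fixes X :: "'a \<Rightarrow> nat \<Rightarrow> real"
  assumes X: "\<And>j. j < n \<Longrightarrow> \<exists>c. \<forall>i\<in>Z. X i j = (\<Sum>d<K. c d * e d i)"
  shows "{i \<in> Z. dst n (X i) y < dst n (X i) z} \<in> halfspaces Z (Suc K) (e(K := (\<lambda>_. 1)))"
proof -
  obtain cf where cf: "\<And>j i. j < n \<Longrightarrow> i \<in> Z \<Longrightarrow> X i j = (\<Sum>d<K. cf j d * e d i)" using X by metis
  define b where "b d = (if d < K then \<Sum>j<n. 2 * (y j - z j) * cf j d else \<Sum>j<n. (z j)\<^sup>2 - (y j)\<^sup>2)" for d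
  have eq: "(dst n (X i) z)\<^sup>2 - (dst n (X i) y)\<^sup>2 = (\<Sum>d<Suc K. b d * (e(K := (\<lambda>_. 1))) d i)" if i: "i \<in> Z" for i
  proof -
    have "(dst n (X i) z)\<^sup>2 - (dst n (X i) y)\<^sup>2 = (\<Sum>j<n. 2 * (y j - z j) * X i j + ((z j)\<^sup>2 - (y j)\<^sup>2))"
      unfolding dst_sq sum_subtractf[symmetric] by (rule sum.cong) (auto simp: power2_eq_square algebra_simps)
    also have "\<dots> = (\<Sum>j<n. \<Sum>d<K. 2 * (y j - z j) * cf j d * e d i) + b K"
    proof -
      have "2 * (y j - z j) * X i j = (\<Sum>d<K. 2 * (y j - z j) * cf j d * e d i)" if "j < n" for j
        unfolding cf[OF that i] sum_distrib_left by (simp add: mult.assoc)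
      then show ?thesis by (simp add: sum.distrib b_def)
    qed
    also have "(\<Sum>j<n. \<Sum>d<K. 2 * (y j - z j) * cf j d * e d i) = (\<Sum>d<K. b d * e d i)"
      by (subst sum.swap) (simp add: b_def sum_distrib_right)
    finally show ?thesis by simp
  qed
  have "dst n (X i) y < dst n (X i) z \<longleftrightarrow> (\<Sum>d<Suc K. b d * (e(K := (\<lambda>_. 1))) d i) > 0" if "i \<in> Z" for i
    unfolding eq[OF that, symmetric]
    using power2_less_imp_less[of "dst n (X i) y" "dst n (X i) z"]
      power_strict_mono[of "dst n (X i) y" "dst n (X i) z" 2] by auto
  then show ?thesis unfolding halfspaces_def by blast
qed

lemma halfspace_all: "Z \<in> halfspaces Z (Suc K) (e(K := (\<lambda>_. 1)))"
proof -
  have "Z = {i \<in> Z. 0 < (\<Sum>d<Suc K. (if d = K then 1 else 0) * (e(K := (\<lambda>_. 1))) d i)}" by simp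
  then show ?thesis unfolding halfspaces_def
    by (intro CollectI exI[of _ "\<lambda>d. if d = K then 1 else 0"] conjI TrueI)
qed

lemma sum_sq_le_card:
  fixes f :: "'a \<Rightarrow> real"
  shows "(\<Sum>i\<in>A. f i)\<^sup>2 \<le> real (card A) * (\<Sum>i\<in>A. (f i)\<^sup>2)"
  using Cauchy_Schwarz_ip[of A "\<lambda>_. 1" f] by (simp add: ip_def power2_eq_square)

text \<open>Exceeding \<open>h\<close> means deviating from \<open>s j\<close> by at least
  \<open>h / 2\<close>, so the linear excess is dominated by the squared deviation, which the
  operator norm controls.\<close>

lemma sum_pos_part_le:
  fixes t :: "'b \<Rightarrow> real"
  assumes h: "h > 0" and s: "\<And>j. j \<in> J \<Longrightarrow> 0 \<le> s j \<and> s j \<le> h / 2"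
  shows "(\<Sum>j\<in>J. max 0 (t j - h)) \<le> 2 / h * (\<Sum>j\<in>J. (t j - s j)\<^sup>2)"
  unfolding sum_distrib_left
proof (rule sum_mono)
  fix j assume j: "j \<in> J"
  show "max 0 (t j - h) \<le> 2 / h * (t j - s j)\<^sup>2"
  proof (cases "t j \<le> h")
    case True
    then show ?thesis using h by simp
  next
    case False
    then have "h / 2 \<le> t j - s j" "t j - h \<le> t j - s j" using s[OF j] h by auto
    then have "(h / 2) * (t j - h) \<le> (t j - s j) * (t j - s j)" using False h by (intro mult_mono) auto
    then show ?thesis using h False by (simp add: field_simps power2_eq_square)
  qed
qed

text \<open>
  The first half of the rows is \<open>S\<close>, with centres \<open>\<mu> r\<close> and realised bits \<open>B\<close>. Off the exceptional
  rows \<open>I\<close>, the columns of every best approximation lie in the span of \<open>e 0, \<dots>, e (K - 1)\<close>. The rows of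
  cluster \<open>r\<close> are sparse at rate \<open>\<rho> r\<close> except in the at most \<open>T\<close> columns \<open>H r\<close>; exceptional rows may
  be numerous only where \<open>\<rho> r\<close> is small. Probabilities are measured in units of \<open>exp (- x)\<close>.
\<close>

locale sampled_half =
  fixes S I :: "nat set" and n k K T :: nat and c :: "nat \<Rightarrow> nat" and \<mu> B :: "nat \<Rightarrow> nat \<Rightarrow> real"
    and P R D x lo :: real and \<rho> :: "nat \<Rightarrow> real" and H :: "nat \<Rightarrow> nat set" and e :: "nat \<Rightarrow> nat \<Rightarrow> real"
  assumes S: "finite S" "I \<subseteq> S" and k: "0 < k" and c: "\<And>i. i \<in> S \<Longrightarrow> c i < k"
    and \<mu>: "\<And>r j. r < k \<Longrightarrow> 0 \<le> \<mu> r j \<and> \<mu> r j \<le> P" and P: "0 < P" "P \<le> 1"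
    and B01: "\<And>i j. 0 \<le> B i j \<and> B i j \<le> 1"
    and op: "op_bound R S {..<n} (\<lambda>i j. B i j - \<mu> (c i) j)" and R: "R > 0"
    and D: "D > 0" "\<And>r s. r < k \<Longrightarrow> s < k \<Longrightarrow> r \<noteq> s \<Longrightarrow> D \<le> dst n (\<mu> r) (\<mu> s)"
    and lo: "lo > 0" "\<And>r. r < k \<Longrightarrow> lo \<le> real (card {i \<in> S. c i = r})"
    and \<rho>: "\<And>r. r < k \<Longrightarrow> 0 \<le> \<rho> r \<and> \<rho> r * real (card (I \<inter> {i \<in> S. c i = r})) \<le> 1"
    and H: "\<And>r. r < k \<Longrightarrow> H r \<subseteq> {..<n} \<and> card (H r) \<le> T"
    and H\<rho>: "\<And>r j. r < k \<Longrightarrow> j < n \<Longrightarrow> j \<notin> H r \<Longrightarrow> \<mu> r j \<le> \<rho> r"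
    and coldeg: "\<And>r j. r < k \<Longrightarrow> j < n \<Longrightarrow> (\<Sum>i\<in>{i \<in> S. c i = r}. B i j) \<le> 4 * P * real (card {i \<in> S. c i = r})"
    and rowdeg: "\<And>i. i \<in> S \<Longrightarrow> (\<Sum>j<n. B i j) \<le> 2 * (\<Sum>j<n. \<mu> (c i) j) + 2 * x"
    and span: "\<And>X j. best_approx S n k B X \<Longrightarrow> j < n \<Longrightarrow> \<exists>b. \<forall>i\<in>S - I. X i j = (\<Sum>d<K. b d * e d i)"
    and x: "x \<ge> 1" "real (card S) + 1 \<le> exp x" "real k \<le> exp x"
    and N0: "320000 * real k * R \<le> D\<^sup>2 * lo"
    and N1: "20 * (3 * P * (2 * real n * real k + real (card S) * (2 * real T + 2 * x)) + 4 * P * real (card S) * x) \<le> D\<^sup>2 * lo"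
    and N2: "8 * real n * (real k)\<^sup>2 / lo\<^sup>2 + 2 * P\<^sup>2 * real T \<le> D\<^sup>2 / 10000"
    and N3: "40 * (200 * real k * real (K + 1) * x) * P \<le> D\<^sup>2"
    and N4: "320 * real k * R * P * (200 * real k * real (K + 1) * x) \<le> lo * D ^ 4"
    and N5: "25600 * (real k)\<^sup>2 * P * R\<^sup>2 * (200 * real k * real (K + 1) * x) \<le> lo\<^sup>2 * D ^ 6"
    and N6: "160 * P * real (card S) * (real (K + 5) * x) \<le> D\<^sup>2 * lo"
begin

definition U :: "nat \<Rightarrow> nat set" where "U r = {i \<in> S. c i = r}"

text \<open>The entropy constant. Pairs of cells number at most
  \<open>exp (2 * k * (K + 1) * x)\<close>, and \<open>kap / 20\<close> is five times this exponent,
  enough for the remaining choices as well. Clipping at \<open>gap a b / kap\<close> makes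
  Bernstein's inequality deliver \<open>exp (- kap / 20)\<close>.\<close>

definition kap :: real where "kap = 200 * real k * real (K + 1) * x"

text \<open>The squared error of the low-rank approximation is at most \<open>8 * k * R\<close>, and
  a row on the side of a foreign centre contributes at least \<open>(48 / 100 * D)^2\<close> to it;
  \<open>tau\<close> bounds the number of such rows.\<close>

definition tau :: real where "tau = 40 * real k * R / D\<^sup>2"

definition HS :: "nat set set" where "HS = halfspaces (S - I) (Suc K) (e(K := (\<lambda>_. 1)))"

definition cells :: "nat set set" where "cells = (\<lambda>G. \<Inter>s\<in>{..<k}. G s) ` ({..<k} \<rightarrow>\<^sub>E HS)"

definition csum :: "nat set \<Rightarrow> nat \<Rightarrow> real" where "csum Z j = (\<Sum>i\<in>Z. B i j)"

definition mcol :: "nat set \<Rightarrow> nat \<Rightarrow> real" where "mcol Z j = (\<Sum>i\<in>Z. \<mu> (c i) j)"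

definition gap :: "nat \<Rightarrow> nat \<Rightarrow> real" where "gap a b = (dst n (\<mu> a) (\<mu> b))\<^sup>2"

text \<open>The difference of two estimated centres is \<open>wfun\<close>, where the first one is clipped at level \<open>q\<close>, plus the
  excess over \<open>q\<close>, which is dominated by a sum of functions \<open>zfun\<close>, one for each foreign cluster. The
  factor \<open>card V / (2 * tau)\<close> distributes the level over these clusters.\<close>

definition wfun :: "real \<Rightarrow> nat set \<Rightarrow> nat \<Rightarrow> nat set \<Rightarrow> nat \<Rightarrow> nat \<Rightarrow> real" where
  "wfun q Z N Z' N' j = min (csum Z j / real N) q - csum Z' j / real N'"

definition zfun :: "real \<Rightarrow> nat \<Rightarrow> nat set \<Rightarrow> nat \<Rightarrow> real" where
  "zfun q N V j = max 0 (csum V j - real N * q * real (card V) / (2 * tau))"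

text \<open>The conditions treat the exceptional rows, the excess over the clipping level, and the
  clipped difference of centres. They refer to all halfspaces and cells, not to a selected
  clustering, so given the first half they form a fixed event for the fresh row. \<open>N\<close>
  and \<open>N'\<close> vary separately because a centre is divided by the size of its full cell,
  exceptional rows included.\<close>

definition row_ok :: "nat \<Rightarrow> (nat \<Rightarrow> real) \<Rightarrow> bool" where
  "row_ok a v \<longleftrightarrow>
    (\<Sum>j<n. v j * csum I j) < 2 * (\<Sum>j<n. \<mu> a j * csum I j) + 4 * P * real (card S) * x \<and>
    (\<forall>b<k. b \<noteq> a \<longrightarrow> (\<forall>N\<le>card S. \<forall>r<k. \<forall>Z\<in>HS.
       (\<Sum>j<n. v j * zfun (gap a b / kap) N (Z \<inter> U r) j) <
         2 * (\<Sum>j<n. \<mu> a j * zfun (gap a b / kap) N (Z \<inter> U r) j) + 4 * P * real (card (U r)) * (real (K + 5) * x))) \<and>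
    (\<forall>b<k. b \<noteq> a \<longrightarrow> (\<forall>Z\<in>cells. \<forall>Z'\<in>cells. \<forall>N\<le>card S. \<forall>N'\<le>card S.
       (\<forall>j<n. \<bar>wfun (gap a b / kap) Z N Z' N' j\<bar> \<le> 1) \<and> (\<Sum>j<n. (wfun (gap a b / kap) Z N Z' N' j)\<^sup>2) \<le> 2 * gap a b \<longrightarrow>
       (\<Sum>j<n. (v j - \<mu> a j) * wfun (gap a b / kap) Z N Z' N' j) < gap a b / 10))"

lemma U_sub: "U r \<subseteq> S" "finite (U r)" using S by (auto simp: U_def)

lemma sum_U: "Z \<subseteq> S \<Longrightarrow> (\<Sum>i\<in>Z. f i :: real) = (\<Sum>r<k. \<Sum>i\<in>Z \<inter> U r. f i)"
proof -
  assume Z: "Z \<subseteq> S"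
  have "(\<Sum>i\<in>Z. f i) = (\<Sum>r<k. \<Sum>i\<in>{i \<in> Z. c i = r}. f i)"
    by (rule sum.group[symmetric]) (use Z S c in \<open>auto intro: finite_subset\<close>)
  moreover have "{i \<in> Z. c i = r} = Z \<inter> U r" for r using Z by (auto simp: U_def)
  ultimately show ?thesis by simp
qed

lemma x0: "x > 0" and kap_pos: "kap > 0" and tau_pos: "tau > 0"
  using x k R D by (auto simp: kap_def tau_def)

lemma csum_nonneg: "0 \<le> csum Z j" using B01 by (simp add: csum_def sum_nonneg)

lemma csum_le_card: "finite Z \<Longrightarrow> csum Z j \<le> real (card Z)"
  using sum_bounded_above[of Z "\<lambda>i. B i j" 1] B01 by (simp add: csum_def)

lemma csum_mono: "finite Z' \<Longrightarrow> Z \<subseteq> Z' \<Longrightarrow> csum Z j \<le> csum Z' j"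
  unfolding csum_def by (rule sum_mono2) (use B01 in auto)

lemma mcol_nonneg: "Z \<subseteq> S \<Longrightarrow> 0 \<le> mcol Z j"
  unfolding mcol_def by (rule sum_nonneg) (use \<mu> c in auto)

lemma mcol_le: "Z \<subseteq> S \<Longrightarrow> mcol Z j \<le> real (card Z) * P"
  unfolding mcol_def by (rule sum_bounded_above) (use \<mu> c in auto)

text \<open>The operator bound tested on an indicator: it holds for every set of rows simultaneously
  and so needs no union bound.\<close>

lemma dst_csum_mcol:
  assumes Z: "Z \<subseteq> S"
  shows "(\<Sum>j<n. (csum Z j - mcol Z j)\<^sup>2) \<le> R * real (card Z)"
proof -
  let ?x = "\<lambda>i. of_bool (i \<in> Z) :: real"
  have fin: "finite Z" using Z S finite_subset by blast
  have s: "(\<Sum>i\<in>S. ?x i * f i) = (\<Sum>i\<in>Z. f i)" for f :: "nat \<Rightarrow> real"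
  proof -
    have "(\<Sum>i\<in>Z. f i) = (\<Sum>i\<in>Z. ?x i * f i)" by simp
    also have "\<dots> = (\<Sum>i\<in>S. ?x i * f i)" by (rule sum.mono_neutral_left) (use Z S in auto)
    finally show ?thesis by simp
  qed
  have "ip {..<n} (\<lambda>j. \<Sum>i\<in>S. ?x i * (B i j - \<mu> (c i) j)) (\<lambda>j. \<Sum>i\<in>S. ?x i * (B i j - \<mu> (c i) j)) \<le> R * ip S ?x ?x"
    by (rule op_bound_right[OF op])
  moreover have "ip S ?x ?x = real (card Z)" unfolding ip_def s by simp
  moreover have "(\<Sum>i\<in>S. ?x i * (B i j - \<mu> (c i) j)) = csum Z j - mcol Z j" for j
    unfolding s by (simp add: csum_def mcol_def sum_subtractf)
  ultimately show ?thesis by (simp add: ip_def power2_eq_square)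
qed

lemma dst_csum_mcol_scaled:
  assumes Z: "Z \<subseteq> S" "card Z \<le> N" and N: "lo / 2 \<le> real N"
  shows "dst n (\<lambda>j. csum Z j / real N) (\<lambda>j. mcol Z j / real N) \<le> D / 100"
proof (rule power2_le_imp_le)
  have N0': "real N > 0" using N lo by simp
  have "(dst n (\<lambda>j. csum Z j / real N) (\<lambda>j. mcol Z j / real N))\<^sup>2 = (\<Sum>j<n. (csum Z j - mcol Z j)\<^sup>2) / (real N)\<^sup>2"
    unfolding dst_sq by (simp add: diff_divide_distrib[symmetric] power_divide sum_divide_distrib)
  also have "\<dots> \<le> R * real (card Z) / (real N)\<^sup>2" by (intro divide_right_mono dst_csum_mcol Z) simp
  also have "\<dots> \<le> R * real N / (real N)\<^sup>2" using Z R by (intro divide_right_mono mult_left_mono) auto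
  also have "\<dots> = R / real N" using N0' by (simp add: power2_eq_square)
  also have "\<dots> \<le> (D / 100)\<^sup>2"
  proof -
    have "R \<le> real k * R" using k R by simp
    then have "20000 * R \<le> D\<^sup>2 * lo" using N0 R by linarith
    also have "\<dots> \<le> D\<^sup>2 * (2 * real N)" using N by (intro mult_left_mono) auto
    finally show ?thesis using N0' by (simp add: field_simps power_divide)
  qed
  finally show "(dst n (\<lambda>j. csum Z j / real N) (\<lambda>j. mcol Z j / real N))\<^sup>2 \<le> (D / 100)\<^sup>2" .
qed (use D in simp)

text \<open>In a given column, a cluster that is sparse there contributes at most 1, since its
  exceptional rows number at most \<open>1 / \<rho> r\<close> if the rate is positive, and their
  means vanish if it is 0. The clusters dense there are counted by \<open>hit\<close>, and every row
  is hit in at most \<open>T\<close> columns. \<open>N2\<close> makes both parts small.\<close>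

lemma mcol_exceptional:
  assumes Z: "Z \<subseteq> I" "card Z \<le> N" and N: "lo / 2 \<le> real N"
  shows "(\<Sum>j<n. (mcol Z j / real N)\<^sup>2) \<le> (D / 100)\<^sup>2"
proof -
  have N0': "real N > 0" using N lo by simp
  have ZS: "Z \<subseteq> S" using Z S by blast
  define hit where "hit j = (\<Sum>r<k. real (card (Z \<inter> U r)) * of_bool (j \<in> H r))" for j
  have card_sum: "(\<Sum>r<k. real (card (Z \<inter> U r))) = real (card Z)"
    using sum_U[OF ZS, of "\<lambda>_. 1"] by simp
  have hit0: "0 \<le> hit j" "hit j \<le> real N" for j
  proof -
    show "0 \<le> hit j" by (simp add: hit_def sum_nonneg)
    have "hit j \<le> (\<Sum>r<k. real (card (Z \<inter> U r)))" unfolding hit_def by (intro sum_mono) simp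
    then show "hit j \<le> real N" using card_sum Z by simp
  qed
  have ptw: "mcol Z j \<le> real k + P * hit j" if j: "j < n" for j
  proof -
    have "mcol Z j = (\<Sum>r<k. real (card (Z \<inter> U r)) * \<mu> r j)"
    proof -
      have "(\<Sum>i\<in>Z \<inter> U r. \<mu> (c i) j) = (\<Sum>i\<in>Z \<inter> U r. \<mu> r j)" for r by (rule sum.cong) (auto simp: U_def)
      then show ?thesis unfolding mcol_def sum_U[OF ZS] by simp
    qed
    also have "\<dots> \<le> (\<Sum>r<k. 1 + P * (real (card (Z \<inter> U r)) * of_bool (j \<in> H r)))"
    proof (rule sum_mono)
      fix r assume "r \<in> {..<k}"
      then have r: "r < k" by simp
      show "real (card (Z \<inter> U r)) * \<mu> r j \<le> 1 + P * (real (card (Z \<inter> U r)) * of_bool (j \<in> H r))"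
      proof (cases "j \<in> H r")
        case True
        have "real (card (Z \<inter> U r)) * \<mu> r j \<le> real (card (Z \<inter> U r)) * P" using \<mu>[OF r] by (intro mult_left_mono) auto
        then show ?thesis using True by (simp add: mult.commute)
      next
        case False
        have "card (Z \<inter> U r) \<le> card (I \<inter> U r)" using Z S U_sub by (intro card_mono) (auto intro: finite_subset)
        then have "real (card (Z \<inter> U r)) * \<mu> r j \<le> real (card (I \<inter> U r)) * \<rho> r"
          using H\<rho>[OF r j False] \<mu>[OF r] by (intro mult_mono) auto
        also have "\<dots> \<le> 1" using \<rho>[OF r] by (simp add: U_def mult.commute)
        finally show ?thesis using False by simp
      qed
    qed
    also have "\<dots> = real k + P * hit j" unfolding hit_def sum.distrib sum_distrib_left[symmetric] by simp
    finally show ?thesis .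
  qed
  have "(\<Sum>j<n. (mcol Z j)\<^sup>2) \<le> (\<Sum>j<n. 2 * (real k)\<^sup>2 + 2 * P\<^sup>2 * (real N * hit j))"
  proof (rule sum_mono)
    fix j assume "j \<in> {..<n}"
    then have "(mcol Z j)\<^sup>2 \<le> (real k + P * hit j)\<^sup>2" using ptw mcol_nonneg[OF ZS] by (intro power_mono) auto
    also have "\<dots> \<le> 2 * (real k)\<^sup>2 + 2 * (P * hit j)\<^sup>2"
      using zero_le_power2[of "real k - P * hit j"] by (simp add: power2_eq_square algebra_simps)
    also have "(P * hit j)\<^sup>2 \<le> P\<^sup>2 * (real N * hit j)"
      unfolding power_mult_distrib power2_eq_square[of "hit j"] using hit0 by (intro mult_left_mono mult_right_mono) auto
    finally show "(mcol Z j)\<^sup>2 \<le> 2 * (real k)\<^sup>2 + 2 * P\<^sup>2 * (real N * hit j)" by simp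
  qed
  also have "\<dots> = 2 * real n * (real k)\<^sup>2 + 2 * P\<^sup>2 * (real N * (\<Sum>j<n. hit j))"
    by (simp add: sum.distrib sum_distrib_left)
  also have "(\<Sum>j<n. hit j) \<le> real N * real T"
  proof -
    have "(\<Sum>j<n. hit j) = (\<Sum>r<k. real (card (Z \<inter> U r)) * (\<Sum>j<n. of_bool (j \<in> H r)))"
      unfolding hit_def by (subst sum.swap) (simp only: sum_distrib_left)
    also have "\<dots> \<le> (\<Sum>r<k. real (card (Z \<inter> U r)) * real T)"
    proof (intro sum_mono mult_left_mono)
      fix r assume "r \<in> {..<k}"
      then have r: "H r \<subseteq> {..<n}" "card (H r) \<le> T" using H by auto
      have "(\<Sum>j<n. of_bool (j \<in> H r) :: real) = real (card (H r))"
        using r(1) by (simp add: Int_absorb1)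
      then show "(\<Sum>j<n. of_bool (j \<in> H r)) \<le> real T" using r by simp
    qed simp
    also have "\<dots> = real (card Z) * real T" by (simp add: sum_distrib_right[symmetric] card_sum)
    also have "\<dots> \<le> real N * real T" using Z by (intro mult_right_mono) auto
    finally show ?thesis .
  qed
  finally have "(\<Sum>j<n. (mcol Z j)\<^sup>2) \<le> 2 * real n * (real k)\<^sup>2 + 2 * P\<^sup>2 * (real N * (real N * real T))"
    using N0' by (simp add: mult_left_mono)
  then have "(\<Sum>j<n. (mcol Z j / real N)\<^sup>2) \<le> (2 * real n * (real k)\<^sup>2 + 2 * P\<^sup>2 * (real N * (real N * real T))) / (real N)\<^sup>2"
    unfolding power_divide sum_divide_distrib[symmetric] by (intro divide_right_mono) auto
  also have "\<dots> = 2 * real n * (real k)\<^sup>2 / (real N)\<^sup>2 + 2 * P\<^sup>2 * real T"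
    using N0' by (simp add: add_divide_distrib power2_eq_square)
  also have "2 * real n * (real k)\<^sup>2 / (real N)\<^sup>2 \<le> 2 * real n * (real k)\<^sup>2 / (lo / 2)\<^sup>2"
    using N lo by (intro divide_left_mono power_mono mult_pos_pos zero_less_power) auto
  also have "\<dots> = 8 * real n * (real k)\<^sup>2 / lo\<^sup>2" by (simp add: power_divide)
  finally show ?thesis using N2 by (simp add: power_divide)
qed

end

text \<open>If \<open>s \<le> q\<close>, clipping moves \<open>u\<close> towards \<open>s\<close>.
  Otherwise \<open>s\<close> itself lies above the level, and its distance to \<open>q\<close> is at
  most its distance to the mean \<open>\<nu>\<close>.\<close>

lemma clip_sq_le:
  fixes u s \<nu> q :: real
  assumes "0 \<le> \<nu>" "\<nu> \<le> q"
  shows "(min u q - s)\<^sup>2 \<le> (u - s)\<^sup>2 + (s - \<nu>)\<^sup>2"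
proof (cases "u \<le> q")
  case True
  then show ?thesis by simp
next
  case False
  show ?thesis
  proof (cases "s \<le> q")
    case True
    have "(q - s)\<^sup>2 \<le> (u - s)\<^sup>2" using True False by (intro power_mono) auto
    then show ?thesis using False by (simp add: add_increasing2)
  next
    case s: False
    have "(s - q)\<^sup>2 \<le> (s - \<nu>)\<^sup>2" using s assms by (intro power_mono) auto
    then show ?thesis using False by (simp add: add_increasing power2_commute[of q s])
  qed
qed

context sampled_half
begin

lemma sum_card_U: "(\<Sum>r<k. real (card (U r))) = real (card S)"
proof -
  have "(\<Sum>r<k. \<Sum>i\<in>S \<inter> U r. 1 :: real) = (\<Sum>i\<in>S. 1)" by (rule sum_U[symmetric]) simp
  moreover have "S \<inter> U r = U r" for r using U_sub by blast
  ultimately show ?thesis by simp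
qed

lemma D2_le_gap: "a < k \<Longrightarrow> b < k \<Longrightarrow> b \<noteq> a \<Longrightarrow> D\<^sup>2 \<le> gap a b"
  unfolding gap_def using D by (intro power_mono) auto

text \<open>Count the edges at exceptional rows by row degrees. A row of cluster \<open>r\<close>
  has degree about \<open>n * \<rho> r\<close> plus at most \<open>T\<close> dense columns, and the
  rates summed over all exceptional rows give at most \<open>k\<close>.\<close>

lemma exceptional_edges:
  assumes a: "a < k"
  shows "(\<Sum>j<n. \<mu> a j * csum I j) \<le> P * (2 * real n * real k + real (card S) * (2 * real T + 2 * x))"
proof -
  have fI: "finite I" using S finite_subset by blast
  have "(\<Sum>j<n. \<mu> a j * csum I j) \<le> (\<Sum>j<n. P * csum I j)"
    using \<mu>[OF a] csum_nonneg by (intro sum_mono mult_right_mono) auto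
  also have "\<dots> = P * (\<Sum>i\<in>I. \<Sum>j<n. B i j)" unfolding csum_def sum_distrib_left[symmetric] by (subst sum.swap) simp
  also have "\<dots> \<le> P * (2 * real n * real k + real (card S) * (2 * real T + 2 * x))"
  proof (rule mult_left_mono)
    have row: "(\<Sum>j<n. \<mu> r j) \<le> real n * \<rho> r + real T" if r: "r < k" for r
    proof -
      have "(\<Sum>j<n. \<mu> r j) \<le> (\<Sum>j<n. \<rho> r + of_bool (j \<in> H r))"
      proof (rule sum_mono)
        fix j assume "j \<in> {..<n}"
        then show "\<mu> r j \<le> \<rho> r + of_bool (j \<in> H r)"
          using H\<rho>[OF r, of j] \<mu>[OF r, of j] P \<rho>[OF r] by (cases "j \<in> H r") auto
      qed
      also have "\<dots> = real n * \<rho> r + real (card (H r))" using H[OF r] by (simp add: sum.distrib Int_absorb1)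
      finally show ?thesis using H[OF r] by simp
    qed
    have "(\<Sum>i\<in>I. \<Sum>j<n. B i j) \<le> (\<Sum>i\<in>I. 2 * (real n * \<rho> (c i)) + (2 * real T + 2 * x))"
    proof (rule sum_mono)
      fix i assume "i \<in> I"
      then have i: "i \<in> S" using S by blast
      show "(\<Sum>j<n. B i j) \<le> 2 * (real n * \<rho> (c i)) + (2 * real T + 2 * x)"
        using rowdeg[OF i] row[OF c[OF i]] by linarith
    qed
    also have "\<dots> = 2 * real n * (\<Sum>i\<in>I. \<rho> (c i)) + real (card I) * (2 * real T + 2 * x)"
      by (simp add: sum.distrib sum_distrib_left mult_ac)
    also have "(\<Sum>i\<in>I. \<rho> (c i)) \<le> real k"
    proof -
      have "(\<Sum>i\<in>I. \<rho> (c i)) = (\<Sum>r<k. \<Sum>i\<in>I \<inter> U r. \<rho> (c i))" by (rule sum_U) (use S in simp)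
      also have "\<dots> = (\<Sum>r<k. real (card (I \<inter> U r)) * \<rho> r)"
      proof (rule sum.cong[OF refl])
        fix r
        have "(\<Sum>i\<in>I \<inter> U r. \<rho> (c i)) = (\<Sum>i\<in>I \<inter> U r. \<rho> r)" by (rule sum.cong) (auto simp: U_def)
        then show "(\<Sum>i\<in>I \<inter> U r. \<rho> (c i)) = real (card (I \<inter> U r)) * \<rho> r" by simp
      qed
      also have "\<dots> \<le> (\<Sum>r<k. 1)" by (intro sum_mono) (use \<rho> in \<open>auto simp: U_def mult.commute\<close>)
      finally show ?thesis by simp
    qed
    also have "real (card I) \<le> real (card S)" using S by (simp add: card_mono)
    finally show "(\<Sum>i\<in>I. \<Sum>j<n. B i j) \<le> 2 * real n * real k + real (card S) * (2 * real T + 2 * x)"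
      using x0 by (simp add: mult_left_mono mult_right_mono)
  qed (use P in simp)
  finally show ?thesis .
qed

text \<open>The level allotted to \<open>V\<close> is proportional to \<open>card V\<close>, and so
  is the operator bound, hence \<open>card V\<close> cancels. \<open>N4\<close> puts the mean of
  \<open>V\<close> below half of its level.\<close>

lemma zfun_mean_le:
  assumes a: "a < k" and V: "V \<subseteq> S" and N: "lo / 2 \<le> real N" and q: "D\<^sup>2 / kap \<le> q"
  shows "(\<Sum>j<n. \<mu> a j * zfun q N V j) \<le> 4 * P * R * tau / (real N * q)"
proof -
  have N0': "real N > 0" using N lo by simp
  have "D\<^sup>2 / kap > 0" using D kap_pos by simp
  then have q0: "q > 0" using q by simp
  have z0: "0 \<le> zfun q N V j" for j by (simp add: zfun_def)
  have fV: "finite V" using V S finite_subset by blast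
  define h where "h = real N * q * real (card V) / (2 * tau)"
  have "(\<Sum>j<n. \<mu> a j * zfun q N V j) \<le> (\<Sum>j<n. P * zfun q N V j)"
    using \<mu>[OF a] z0 by (intro sum_mono mult_right_mono) auto
  also have "\<dots> = P * (\<Sum>j<n. zfun q N V j)" by (simp add: sum_distrib_left)
  also have "\<dots> \<le> P * (4 * R * tau / (real N * q))"
  proof (intro mult_left_mono)
    show "(\<Sum>j<n. zfun q N V j) \<le> 4 * R * tau / (real N * q)"
    proof (cases "V = {}")
      case True
      then have "zfun q N V j = 0" for j by (simp add: zfun_def csum_def)
      then show ?thesis using R tau_pos N0' q0 by simp
    next
      case False
      then have v: "real (card V) > 0" using fV by (simp add: card_gt_0_iff)
      have h: "h > 0" using v N0' q0 tau_pos by (simp add: h_def)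
      have Ph: "real (card V) * P \<le> h / 2"
      proof -
        have "320 * real k * R * P * kap \<le> lo * D ^ 4" using N4 by (simp add: kap_def)
        then have "4 * tau * P \<le> lo / 2 * (D\<^sup>2 / kap)"
          using D kap_pos by (simp add: tau_def field_simps power2_eq_square eval_nat_numeral)
        also have "\<dots> \<le> real N * q" using N q lo D kap_pos by (intro mult_mono) auto
        finally have "real (card V) * (4 * tau * P) \<le> real (card V) * (real N * q)" by (intro mult_left_mono) auto
        then show ?thesis using tau_pos by (simp add: h_def field_simps)
      qed
      have "(\<Sum>j<n. zfun q N V j) = (\<Sum>j<n. max 0 (csum V j - h))" by (simp add: zfun_def h_def)
      also have "\<dots> \<le> 2 / h * (\<Sum>j<n. (csum V j - mcol V j)\<^sup>2)"
        by (rule sum_pos_part_le[OF h]) (use mcol_nonneg[OF V] mcol_le[OF V] Ph order_trans in blast)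
      also have "\<dots> \<le> 2 / h * (R * real (card V))" using h by (intro mult_left_mono dst_csum_mcol V) auto
      also have "\<dots> = 4 * R * tau / (real N * q)" using v N0' q0 tau_pos by (simp add: h_def field_simps)
      finally show ?thesis .
    qed
  qed (use P in simp)
  finally show ?thesis by (simp add: mult_ac)
qed

end

section \<open>The centres of one optimal clustering\<close>

locale clustered_half = sampled_half +
  fixes X :: "nat \<Rightarrow> nat \<Rightarrow> real" and C :: "nat \<Rightarrow> nat set"
  assumes X: "best_approx S n k B X" and XM: "(\<Sum>i\<in>S. (dst n (X i) (\<mu> (c i)))\<^sup>2) \<le> 8 * real k * R"
    and C: "near_partition S n k c \<mu> D (8 * real k * R) X C"
begin

lemma C_sub: "b < k \<Longrightarrow> C b \<subseteq> S" and finC: "b < k \<Longrightarrow> finite (C b)"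
proof -
  show "C b \<subseteq> S" if "b < k" for b using C that unfolding near_partition_def by blast
  then show "finite (C b)" if "b < k" for b using that S finite_subset by blast
qed

lemma C_lower: "b < k \<Longrightarrow> lo / 2 \<le> real (card (C b))"
proof -
  assume b: "b < k"
  then have "card {i \<in> S. c i = b} \<le> 2 * card (C b)" using C by (simp add: near_partition_def)
  then have "real (card {i \<in> S. c i = b}) \<le> 2 * real (card (C b))" by linarith
  then show ?thesis using lo(2)[OF b] by simp
qed

lemma C_pos: "b < k \<Longrightarrow> real (card (C b)) > 0" using C_lower lo(1) by fastforce

lemma card_C_le: "b < k \<Longrightarrow> card (C b) \<le> card S" using C_sub S by (simp add: card_mono)

lemma avg_mean_near: "b < k \<Longrightarrow> dst n (avg (\<lambda>i. \<mu> (c i)) (C b)) (\<mu> b) \<le> D / 50"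
proof -
  assume b: "b < k"
  let ?N = "real (card (C b))"
  have "dst n (avg (\<lambda>i. \<mu> (c i)) (C b)) (avg X (C b)) \<le> D / 100"
  proof (rule power2_le_imp_le)
    have eq: "avg (\<lambda>i. \<mu> (c i)) (C b) j - avg X (C b) j = (\<Sum>i\<in>C b. \<mu> (c i) j - X i j) / ?N" for j
      by (simp add: avg_def diff_divide_distrib sum_subtractf)
    have "(dst n (avg (\<lambda>i. \<mu> (c i)) (C b)) (avg X (C b)))\<^sup>2 = (\<Sum>j<n. (\<Sum>i\<in>C b. \<mu> (c i) j - X i j)\<^sup>2) / ?N\<^sup>2"
      by (simp only: dst_sq) (simp only: eq power_divide sum_divide_distrib[symmetric])
    also have "\<dots> \<le> (\<Sum>j<n. ?N * (\<Sum>i\<in>C b. (\<mu> (c i) j - X i j)\<^sup>2)) / ?N\<^sup>2"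
      by (intro divide_right_mono sum_mono sum_sq_le_card) simp
    also have "\<dots> = ?N * (\<Sum>i\<in>C b. (dst n (X i) (\<mu> (c i)))\<^sup>2) / ?N\<^sup>2"
      unfolding dst_sq sum_distrib_left[symmetric] by (subst sum.swap) (simp add: power2_commute)
    also have "\<dots> = (\<Sum>i\<in>C b. (dst n (X i) (\<mu> (c i)))\<^sup>2) / ?N" using C_pos[OF b] by (simp add: power2_eq_square)
    also have "\<dots> \<le> 8 * real k * R / ?N"
    proof (rule divide_right_mono)
      have "(\<Sum>i\<in>C b. (dst n (X i) (\<mu> (c i)))\<^sup>2) \<le> (\<Sum>i\<in>S. (dst n (X i) (\<mu> (c i)))\<^sup>2)"
        by (rule sum_mono2) (use C_sub[OF b] S in auto)
      then show "(\<Sum>i\<in>C b. (dst n (X i) (\<mu> (c i)))\<^sup>2) \<le> 8 * real k * R" using XM by simp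
    qed simp
    also have "\<dots> \<le> (D / 100)\<^sup>2"
    proof -
      have "320000 * real k * R \<le> D\<^sup>2 * (2 * ?N)"
        using N0 C_lower[OF b] by (intro order_trans[OF N0] mult_left_mono) auto
      moreover have "0 \<le> real k * R" using R by simp
      ultimately have "8 * real k * R \<le> D\<^sup>2 / 10000 * ?N" by linarith
      then show ?thesis using C_pos[OF b] by (simp add: pos_divide_le_eq power_divide)
    qed
    finally show "(dst n (avg (\<lambda>i. \<mu> (c i)) (C b)) (avg X (C b)))\<^sup>2 \<le> (D / 100)\<^sup>2" .
  qed (use D in simp)
  moreover have "dst n (avg X (C b)) (\<mu> b) \<le> D / 100" using C b by (simp add: near_partition_def)
  ultimately show ?thesis using dst_triangle[of "avg (\<lambda>i. \<mu> (c i)) (C b)" "\<mu> b" n "avg X (C b)"] by linarith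
qed

lemma avg_eq_csum: "avg B Z = (\<lambda>j. csum Z j / real (card Z))" "avg (\<lambda>i. \<mu> (c i)) Z = (\<lambda>j. mcol Z j / real (card Z))"
  by (auto simp: avg_def csum_def mcol_def)

lemma centre_near: "b < k \<Longrightarrow> dst n (avg B (C b)) (\<mu> b) \<le> 3 / 100 * D"
  using dst_csum_mcol_scaled[OF C_sub order_refl C_lower, of b] avg_mean_near[of b]
    dst_triangle[of "avg B (C b)" "\<mu> b" n "avg (\<lambda>i. \<mu> (c i)) (C b)"] unfolding avg_eq_csum by simp

text \<open>The centre with the exceptional rows removed from the sum but not from the denominator,
  so that the removed part is an additive nonnegative term.\<close>

definition cen :: "nat \<Rightarrow> nat \<Rightarrow> real" where "cen b j = csum (C b - I) j / real (card (C b))"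

definition mcen :: "nat \<Rightarrow> nat \<Rightarrow> real" where "mcen b j = mcol (C b - I) j / real (card (C b))"

lemma cen_mcen: "b < k \<Longrightarrow> dst n (cen b) (mcen b) \<le> D / 100"
proof -
  assume b: "b < k"
  have "C b - I \<subseteq> S" "card (C b - I) \<le> card (C b)" using C_sub[OF b] finC[OF b] by (auto intro: card_mono)
  then show ?thesis unfolding cen_def mcen_def by (rule dst_csum_mcol_scaled) (rule C_lower[OF b])
qed

lemma mcen_near: "b < k \<Longrightarrow> dst n (mcen b) (\<mu> b) \<le> 3 / 100 * D"
proof -
  assume b: "b < k"
  let ?N = "real (card (C b))"
  have eq: "mcen b j - avg (\<lambda>i. \<mu> (c i)) (C b) j = - (mcol (C b \<inter> I) j / ?N)" for j
  proof -
    have "mcol (C b) j = mcol (C b - I) j + mcol (C b \<inter> I) j"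
      unfolding mcol_def using sum.Int_Diff[OF finC[OF b], of "\<lambda>i. \<mu> (c i) j" I] by simp
    then show ?thesis unfolding mcen_def avg_eq_csum by (simp add: add_divide_distrib)
  qed
  have "(dst n (mcen b) (avg (\<lambda>i. \<mu> (c i)) (C b)))\<^sup>2 = (\<Sum>j<n. (mcol (C b \<inter> I) j / ?N)\<^sup>2)"
    by (simp only: dst_sq) (simp only: eq power2_minus)
  also have "\<dots> \<le> (D / 100)\<^sup>2"
    by (rule mcol_exceptional) (use finC[OF b] C_lower[OF b] in \<open>auto intro: card_mono\<close>)
  finally have "dst n (mcen b) (avg (\<lambda>i. \<mu> (c i)) (C b)) \<le> D / 100" by (rule power2_le_imp_le) (use D in simp)
  then show ?thesis
    using avg_mean_near[OF b] dst_triangle[of "mcen b" "\<mu> b" n "avg (\<lambda>i. \<mu> (c i)) (C b)"] by simp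
qed

lemma cen_bounds: "b < k \<Longrightarrow> 0 \<le> cen b j \<and> cen b j \<le> 1"
proof -
  assume b: "b < k"
  have "csum (C b - I) j \<le> csum (C b) j" by (rule csum_mono[OF finC[OF b]]) auto
  also have "\<dots> \<le> real (card (C b))" by (rule csum_le_card[OF finC[OF b]])
  finally show ?thesis using C_pos[OF b] csum_nonneg[of "C b - I" j] by (simp add: cen_def)
qed

lemma mcen_bounds: "b < k \<Longrightarrow> 0 \<le> mcen b j \<and> mcen b j \<le> P"
proof -
  assume b: "b < k"
  have s: "C b - I \<subseteq> S" using C_sub[OF b] by blast
  have "mcol (C b - I) j \<le> real (card (C b - I)) * P" by (rule mcol_le[OF s])
  also have "\<dots> \<le> real (card (C b)) * P" using P finC[OF b] by (intro mult_right_mono) (auto intro: card_mono)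
  finally show ?thesis using C_pos[OF b] mcol_nonneg[OF s, of j] by (simp add: mcen_def field_simps)
qed

text \<open>The clipping level lies well above all edge probabilities, so clipping only affects
  columns where a cell average is atypically large.\<close>

lemma P_le_gap: "a < k \<Longrightarrow> b < k \<Longrightarrow> b \<noteq> a \<Longrightarrow> 40 * P \<le> gap a b / kap"
proof -
  assume h: "a < k" "b < k" "b \<noteq> a"
  have "40 * P * kap \<le> D\<^sup>2" using N3 by (simp add: kap_def mult_ac)
  also have "\<dots> \<le> gap a b" by (rule D2_le_gap[OF h])
  finally show ?thesis using kap_pos by (simp add: field_simps)
qed

text \<open>Since the mean of the unclipped centre lies below the level, clipping the other centre
  raises the squared norm by at most the noise of the unclipped one. Both corrected centres are
  within \<open>4 / 100 * D\<close> of their means, whence the factor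
  \<open>27 / 25\<close>.\<close>

lemma wfun_admissible:
  assumes h: "a < k" "b < k" "b \<noteq> a"
  defines "w \<equiv> wfun (gap a b / kap) (C b - I) (card (C b)) (C a - I) (card (C a))"
  shows "w j = min (cen b j) (gap a b / kap) - cen a j" "\<bar>w j\<bar> \<le> 1" "(\<Sum>j<n. (w j)\<^sup>2) \<le> 2 * gap a b"
proof -
  let ?q = "gap a b / kap"
  have q: "40 * P \<le> ?q" by (rule P_le_gap[OF h])
  show w: "w j = min (cen b j) ?q - cen a j" for j by (simp add: w_def wfun_def cen_def)
  show "\<bar>w j\<bar> \<le> 1" unfolding w using cen_bounds[OF h(1), of j] cen_bounds[OF h(2), of j] q P by (auto simp: min_def)
  have "(\<Sum>j<n. (w j)\<^sup>2) \<le> (\<Sum>j<n. (cen b j - cen a j)\<^sup>2 + (cen a j - mcen a j)\<^sup>2)"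
  proof (rule sum_mono)
    fix j
    have "0 \<le> mcen a j" "mcen a j \<le> ?q" using mcen_bounds[OF h(1), of j] q P by linarith+
    then show "(w j)\<^sup>2 \<le> (cen b j - cen a j)\<^sup>2 + (cen a j - mcen a j)\<^sup>2" unfolding w by (rule clip_sq_le)
  qed
  also have "\<dots> = (dst n (cen b) (cen a))\<^sup>2 + (dst n (cen a) (mcen a))\<^sup>2" by (simp add: dst_sq sum.distrib)
  also have "\<dots> \<le> (27 / 25 * dst n (\<mu> a) (\<mu> b))\<^sup>2 + (1 / 100 * dst n (\<mu> a) (\<mu> b))\<^sup>2"
  proof (intro add_mono power_mono)
    have g: "D \<le> dst n (\<mu> a) (\<mu> b)" using D(2) h by simp
    have ca: "dst n (cen a) (\<mu> a) \<le> 4 / 100 * D" "dst n (cen b) (\<mu> b) \<le> 4 / 100 * D"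
      using cen_mcen[OF h(1)] mcen_near[OF h(1)] dst_triangle[of "cen a" "\<mu> a" n "mcen a"]
        cen_mcen[OF h(2)] mcen_near[OF h(2)] dst_triangle[of "cen b" "\<mu> b" n "mcen b"] by linarith+
    show "dst n (cen b) (cen a) \<le> 27 / 25 * dst n (\<mu> a) (\<mu> b)"
      using ca g dst_triangle[of "cen b" "cen a" n "\<mu> b"] dst_triangle[of "\<mu> b" "cen a" n "\<mu> a"]
        dst_commute[of "\<mu> a" "\<mu> b" n] dst_commute[of "\<mu> a" "cen a" n] by linarith
    show "dst n (cen a) (mcen a) \<le> 1 / 100 * dst n (\<mu> a) (\<mu> b)" using cen_mcen[OF h(1)] g by linarith
  qed auto
  also have "\<dots> \<le> 2 * gap a b" by (simp add: gap_def power_mult_distrib power_divide)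
  finally show "(\<Sum>j<n. (w j)\<^sup>2) \<le> 2 * gap a b" .
qed

definition closer :: "nat \<Rightarrow> nat \<Rightarrow> nat set" where
  "closer b r = {i \<in> S - I. dst n (X i) (avg X (C b)) < dst n (X i) (avg X (C r))}"

lemma closer_HS: "closer b r \<in> HS"
  unfolding closer_def HS_def by (rule halfspace_closer) (rule span[OF X])

lemma C_closer: "b < k \<Longrightarrow> r < k \<Longrightarrow> r \<noteq> b \<Longrightarrow> C b - I \<subseteq> closer b r"
  using C C_sub[of b] unfolding near_partition_def closer_def by blast

text \<open>Strictness of the nearest-centre property makes the cell equal to the intersection of
  its bisector halfspaces: a row of another cell \<open>s\<close> lies strictly on the other side of
  one of them. The index \<open>b\<close> is filled with the whole of \<open>S - I\<close>, which is
  itself a halfspace.\<close>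

lemma C_cells: "b < k \<Longrightarrow> C b - I \<in> cells"
proof -
  assume b: "b < k"
  define G where "G = restrict (\<lambda>s. if s = b then S - I else closer b s) {..<k}"
  have "S - I \<in> HS" unfolding HS_def by (rule halfspace_all)
  then have G: "G \<in> {..<k} \<rightarrow>\<^sub>E HS" using closer_HS by (auto simp: G_def)
  have "C b - I = (\<Inter>s\<in>{..<k}. G s)"
  proof
    show "C b - I \<subseteq> (\<Inter>s\<in>{..<k}. G s)" using C_closer[OF b] C_sub[OF b] by (auto simp: G_def)
    show "(\<Inter>s\<in>{..<k}. G s) \<subseteq> C b - I"
    proof
      fix i assume i: "i \<in> (\<Inter>s\<in>{..<k}. G s)"
      then have "i \<in> G b" using b by blast
      then have iS: "i \<in> S" "i \<notin> I" using b by (auto simp: G_def)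
      have "(\<Union>s<k. C s) = S" using C by (simp add: near_partition_def)
      then obtain s where s: "s < k" "i \<in> C s" using iS by blast
      have "s = b"
      proof (rule ccontr)
        assume ne: "s \<noteq> b"
        have "i \<in> G s" using i s by blast
        then have "i \<in> closer b s" using ne s by (simp add: G_def)
        moreover have "i \<in> closer s b" using C_closer[OF s(1) b] ne s(2) iS by blast
        ultimately show False by (simp add: closer_def)
      qed
      then show "i \<in> C b - I" using s iS by simp
    qed
  qed
  then show ?thesis unfolding cells_def using G by blast
qed

text \<open>A row of cluster \<open>r\<close> on the side of centre \<open>b\<close> is at least
  \<open>48 / 100 * D\<close> away from its own mean. Intersecting the \<open>r\<close>-th halfspace
  with \<open>U r\<close> keeps the contributions of different \<open>r\<close> disjoint, so all of
  them share the single error budget \<open>8 * k * R\<close>.\<close>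

lemma closer_few:
  assumes b: "b < k"
  shows "(\<Sum>r\<in>{..<k} - {b}. real (card (closer b r \<inter> U r))) \<le> tau"
proof -
  let ?V = "\<lambda>r. closer b r \<inter> U r"
  have far: "(48 / 100 * D)\<^sup>2 \<le> (dst n (X i) (\<mu> (c i)))\<^sup>2" if r: "r < k" "r \<noteq> b" and i: "i \<in> ?V r" for r i
  proof -
    have ci: "c i = r" and lt: "dst n (X i) (avg X (C b)) < dst n (X i) (avg X (C r))"
      using i by (auto simp: closer_def U_def)
    have nb: "dst n (avg X (C b)) (\<mu> b) \<le> D / 100" "dst n (avg X (C r)) (\<mu> r) \<le> D / 100"
      using C r b by (auto simp: near_partition_def)
    have g: "D \<le> dst n (\<mu> r) (\<mu> b)" using D(2) r b by simp
    have "48 / 100 * D \<le> dst n (X i) (\<mu> r)"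
      using D(1) lt nb g dst_triangle[of "\<mu> r" "\<mu> b" n "X i"] dst_triangle[of "X i" "\<mu> b" n "avg X (C b)"]
        dst_triangle[of "X i" "avg X (C r)" n "\<mu> r"] dst_commute[of "\<mu> r" "X i" n] dst_commute[of "\<mu> r" "avg X (C r)" n]
      by linarith
    then show ?thesis unfolding ci by (rule power_mono) (use D in simp)
  qed
  have "(\<Sum>r\<in>{..<k} - {b}. real (card (?V r))) * (48 / 100 * D)\<^sup>2 = (\<Sum>r\<in>{..<k} - {b}. \<Sum>i\<in>?V r. (48 / 100 * D)\<^sup>2)"
    by (simp add: sum_distrib_right)
  also have "\<dots> \<le> (\<Sum>r\<in>{..<k} - {b}. \<Sum>i\<in>?V r. (dst n (X i) (\<mu> (c i)))\<^sup>2)"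
    by (intro sum_mono far) auto
  also have "\<dots> \<le> (\<Sum>r<k. \<Sum>i\<in>S \<inter> U r. (dst n (X i) (\<mu> (c i)))\<^sup>2)"
  proof (rule order_trans[OF sum_mono sum_mono2])
    show "(\<Sum>i\<in>?V r. (dst n (X i) (\<mu> (c i)))\<^sup>2) \<le> (\<Sum>i\<in>S \<inter> U r. (dst n (X i) (\<mu> (c i)))\<^sup>2)" for r
      by (rule sum_mono2) (use S in \<open>auto simp: closer_def\<close>)
  qed (auto intro: sum_nonneg)
  also have "\<dots> = (\<Sum>i\<in>S. (dst n (X i) (\<mu> (c i)))\<^sup>2)" by (rule sum_U[symmetric]) simp
  also have "\<dots> \<le> 8 * real k * R" by (rule XM)
  finally have "(\<Sum>r\<in>{..<k} - {b}. real (card (?V r))) * (48 / 100 * D)\<^sup>2 \<le> 8 * real k * R" .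
  then have "2304 / 10000 * ((\<Sum>r\<in>{..<k} - {b}. real (card (?V r))) * D\<^sup>2) \<le> 8 * real k * R"
    by (simp add: power_mult_distrib power_divide mult_ac)
  then have "(\<Sum>r\<in>{..<k} - {b}. real (card (?V r))) * D\<^sup>2 \<le> 40 * real k * R"
  proof -
    have "0 \<le> real k * R" using R by simp
    then show ?thesis using \<open>2304 / 10000 * _ \<le> _\<close> by linarith
  qed
  then show ?thesis unfolding tau_def using D by (simp add: pos_le_divide_eq)
qed

text \<open>The cluster \<open>b\<close> itself uses at most half of the level, by the column
  degrees. The other half is divided among the foreign clusters in proportion to
  \<open>card V\<close>, of total at most \<open>tau\<close>. Monotonicity replaces the foreign rows
  of the cell by those in one halfspace, which keeps the family of functions small.\<close>

lemma excess_le_zfun: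
  assumes h: "a < k" "b < k" "b \<noteq> a" and j: "j < n"
  defines "q \<equiv> gap a b / kap"
  shows "real (card (C b)) * (cen b j - min (cen b j) q) \<le> (\<Sum>r\<in>{..<k} - {b}. zfun q (card (C b)) (closer b r \<inter> U r) j)"
proof -
  let ?N = "real (card (C b))" and ?V = "\<lambda>r. closer b r \<inter> U r" and ?J = "{..<k} - {b}"
  have Np: "?N > 0" by (rule C_pos[OF h(2)])
  have q: "40 * P \<le> q" unfolding q_def by (rule P_le_gap[OF h])
  have fV: "finite (?V r)" for r using U_sub by simp
  have "csum (C b - I) j = (\<Sum>r<k. csum ((C b - I) \<inter> U r) j)"
    unfolding csum_def by (rule sum_U) (use C_sub[OF h(2)] in blast)
  also have "\<dots> = csum ((C b - I) \<inter> U b) j + (\<Sum>r\<in>?J. csum ((C b - I) \<inter> U r) j)"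
    using h by (subst sum.remove[of _ b]) auto
  also have "\<dots> \<le> ?N * q / 2 + (\<Sum>r\<in>?J. csum (?V r) j)"
  proof (intro add_mono sum_mono)
    have "csum ((C b - I) \<inter> U b) j \<le> csum (U b) j" using U_sub by (intro csum_mono) auto
    also have "\<dots> \<le> 4 * P * real (card (U b))" unfolding csum_def U_def by (rule coldeg[OF h(2) j])
    also have "\<dots> \<le> 4 * P * (2 * ?N)"
    proof (rule mult_left_mono)
      have "card (U b) \<le> 2 * card (C b)" using C h by (simp add: near_partition_def U_def)
      then show "real (card (U b)) \<le> 2 * ?N" by linarith
    qed (use P in simp)
    also have "\<dots> = ?N * (8 * P)" by simp
    also have "\<dots> \<le> ?N * (q / 2)" using q P by (intro mult_left_mono) auto
    finally show "csum ((C b - I) \<inter> U b) j \<le> ?N * q / 2" by simp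
    show "csum ((C b - I) \<inter> U r) j \<le> csum (?V r) j" if "r \<in> ?J" for r
      using C_closer[OF h(2), of r] that by (intro csum_mono fV) auto
  qed
  also have "\<dots> \<le> ?N * q / 2 + (\<Sum>r\<in>?J. zfun q (card (C b)) (?V r) j + ?N * q * real (card (?V r)) / (2 * tau))"
    by (intro add_left_mono sum_mono) (simp add: zfun_def)
  also have "\<dots> = ?N * q / 2 + (\<Sum>r\<in>?J. zfun q (card (C b)) (?V r) j) + ?N * q / (2 * tau) * (\<Sum>r\<in>?J. real (card (?V r)))"
    by (simp add: sum.distrib sum_distrib_left)
  also have "\<dots> \<le> ?N * q / 2 + (\<Sum>r\<in>?J. zfun q (card (C b)) (?V r) j) + ?N * q / (2 * tau) * tau"
    using q P tau_pos by (intro add_left_mono mult_left_mono closer_few[OF h(2)]) auto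
  also have "\<dots> = ?N * q + (\<Sum>r\<in>?J. zfun q (card (C b)) (?V r) j)" using tau_pos by simp
  finally have main: "?N * cen b j \<le> ?N * q + (\<Sum>r\<in>?J. zfun q (card (C b)) (?V r) j)"
    using Np by (simp add: cen_def)
  have "0 \<le> (\<Sum>r\<in>?J. zfun q (card (C b)) (?V r) j)" by (intro sum_nonneg) (simp add: zfun_def)
  then show ?thesis using main by (cases "cen b j \<le> q") (auto simp: min_def right_diff_distrib)
qed

end

lemma (in sampled_half) row_ok_zfun:
  assumes "row_ok a v" "b < k" "b \<noteq> a" "N \<le> card S" "r < k" "Z \<in> HS"
  shows "(\<Sum>j<n. v j * zfun (gap a b / kap) N (Z \<inter> U r) j) <
    2 * (\<Sum>j<n. \<mu> a j * zfun (gap a b / kap) N (Z \<inter> U r) j) + 4 * P * real (card (U r)) * (real (K + 5) * x)"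
  using assms(1)[unfolded row_ok_def, THEN conjunct2, THEN conjunct1, rule_format, OF assms(2-6)] .

lemma (in sampled_half) row_ok_wfun:
  assumes "row_ok a v" "b < k" "b \<noteq> a" "Z \<in> cells" "Z' \<in> cells" "N \<le> card S" "N' \<le> card S"
    and "(\<forall>j<n. \<bar>wfun (gap a b / kap) Z N Z' N' j\<bar> \<le> 1) \<and> (\<Sum>j<n. (wfun (gap a b / kap) Z N Z' N' j)\<^sup>2) \<le> 2 * gap a b"
  shows "(\<Sum>j<n. (v j - \<mu> a j) * wfun (gap a b / kap) Z N Z' N' j) < gap a b / 10"
  by (rule assms(1)[unfolded row_ok_def, THEN conjunct2, THEN conjunct2, THEN spec, THEN mp, OF assms(2), THEN mp,
    OF assms(3), THEN bspec, OF assms(4), THEN bspec, OF assms(5), THEN spec, THEN mp, OF assms(6), THEN spec, THEN mp,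
    OF assms(7), THEN mp, OF assms(8)])

context clustered_half
begin

text \<open>Twice the mean of the excess and its fluctuation each receive
  \<open>gap a b / 20\<close>, by \<open>N5\<close> and \<open>N6\<close> respectively. The
  fluctuation is proportional to \<open>card (U r)\<close>, so summing over all foreign clusters
  costs no factor \<open>k\<close>.\<close>

lemma excess_row_sum:
  assumes h: "a < k" "b < k" "b \<noteq> a" and v: "\<And>j. 0 \<le> v j" and ok: "row_ok a v"
  defines "q \<equiv> gap a b / kap"
  shows "(\<Sum>j<n. v j * (cen b j - min (cen b j) q)) \<le> gap a b / 10"
proof -
  let ?N = "real (card (C b))" and ?J = "{..<k} - {b}"
  let ?z = "\<lambda>r. zfun q (card (C b)) (closer b r \<inter> U r)"
  define y where "y = real (K + 5) * x"
  have N6y: "160 * P * real (card S) * y \<le> D\<^sup>2 * lo" using N6 by (simp only: y_def)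
  have y0: "y \<ge> 0" using x0 by (simp add: y_def)
  have Np: "?N > 0" by (rule C_pos[OF h(2)])
  have g: "D\<^sup>2 \<le> gap a b" by (rule D2_le_gap[OF h])
  have g0: "gap a b > 0" using g D by (meson less_le_trans zero_less_power)
  have q: "D\<^sup>2 / kap \<le> q" unfolding q_def using g kap_pos by (simp add: divide_right_mono)
  have q0: "q > 0" using g0 kap_pos by (simp add: q_def)
  have Q4: "(D\<^sup>2)\<^sup>2 \<le> (gap a b)\<^sup>2" using g by (intro power_mono) auto
  have "?N * (\<Sum>j<n. v j * (cen b j - min (cen b j) q)) = (\<Sum>j<n. v j * (?N * (cen b j - min (cen b j) q)))"
    by (simp add: sum_distrib_left mult_ac)
  also have "\<dots> \<le> (\<Sum>j<n. v j * (\<Sum>r\<in>?J. ?z r j))"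
    by (intro sum_mono mult_left_mono v) (use excess_le_zfun[OF h] in \<open>auto simp: q_def\<close>)
  also have "\<dots> = (\<Sum>r\<in>?J. \<Sum>j<n. v j * ?z r j)" unfolding sum_distrib_left by (rule sum.swap)
  also have "\<dots> \<le> (\<Sum>r\<in>?J. 2 * (4 * P * R * tau / (?N * q)) + 4 * P * real (card (U r)) * y)"
  proof (rule sum_mono)
    fix r assume "r \<in> ?J"
    then have r: "r < k" by simp
    have "(\<Sum>j<n. v j * ?z r j) < 2 * (\<Sum>j<n. \<mu> a j * ?z r j) + 4 * P * real (card (U r)) * y"
      unfolding q_def y_def by (rule row_ok_zfun[OF ok h(2,3) card_C_le[OF h(2)] r closer_HS])
    moreover have "(\<Sum>j<n. \<mu> a j * ?z r j) \<le> 4 * P * R * tau / (?N * q)"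
      by (rule zfun_mean_le[OF h(1) _ C_lower[OF h(2)] q]) (use U_sub in blast)
    ultimately show "(\<Sum>j<n. v j * ?z r j) \<le> 2 * (4 * P * R * tau / (?N * q)) + 4 * P * real (card (U r)) * y"
      by linarith
  qed
  also have "\<dots> \<le> (\<Sum>r<k. 2 * (4 * P * R * tau / (?N * q)) + 4 * P * real (card (U r)) * y)"
    using P R tau_pos Np q0 y0 by (intro sum_mono2) auto
  also have "\<dots> = 8 * real k * P * R * tau / (?N * q) + 4 * P * y * (\<Sum>r<k. real (card (U r)))"
  proof -
    have "(\<Sum>r<k. 4 * P * real (card (U r)) * y) = 4 * P * y * (\<Sum>r<k. real (card (U r)))"
      by (simp add: sum_distrib_left mult_ac)
    then show ?thesis unfolding sum.distrib by simp
  qed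
  also have "\<dots> = 8 * real k * P * R * tau / (?N * q) + 4 * P * real (card S) * y"
    by (simp add: sum_card_U)
  also have "\<dots> \<le> ?N * (gap a b / 20) + ?N * (gap a b / 20)"
  proof (rule add_mono)
    have NN: "lo\<^sup>2 / 4 \<le> ?N * ?N"
      using C_lower[OF h(2)] lo(1) mult_mono[of "lo / 2" ?N "lo / 2" ?N] by (simp add: power2_eq_square)
    have "25600 * (real k)\<^sup>2 * P * R\<^sup>2 * kap \<le> lo\<^sup>2 * D ^ 6" using N5 by (simp add: kap_def)
    then have "640 * real k * P * R * tau * kap \<le> lo\<^sup>2 * (D\<^sup>2)\<^sup>2"
      using D(1) by (simp add: tau_def field_simps power2_eq_square eval_nat_numeral)
    also have "\<dots> \<le> lo\<^sup>2 * (gap a b)\<^sup>2" using Q4 by (intro mult_left_mono) auto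
    also have "\<dots> \<le> 4 * (?N * ?N) * (gap a b)\<^sup>2" using NN by (intro mult_right_mono) auto
    finally have "160 * real k * P * R * tau * kap \<le> ?N * ?N * (gap a b)\<^sup>2" by linarith
    then show "8 * real k * P * R * tau / (?N * q) \<le> ?N * (gap a b / 20)"
      using Np g0 kap_pos unfolding q_def by (simp add: field_simps power2_eq_square)
    have "160 * P * real (card S) * y \<le> D\<^sup>2 * lo" by (rule N6y)
    also have "\<dots> \<le> gap a b * (2 * ?N)" using g g0 C_lower[OF h(2)] lo(1) by (intro mult_mono) auto
    finally have "1 / 40 * (160 * P * real (card S) * y) \<le> 1 / 40 * (gap a b * (2 * ?N))" by (rule mult_left_mono) simp
    moreover have "1 / 40 * (160 * P * real (card S) * y) = 4 * P * real (card S) * y"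
      "1 / 40 * (gap a b * (2 * ?N)) = ?N * (gap a b / 20)" by simp_all
    ultimately show "4 * P * real (card S) * y \<le> ?N * (gap a b / 20)" by (simp only:)
  qed
  also have "\<dots> = ?N * (gap a b / 10)" by simp
  finally show ?thesis using Np by simp
qed

lemma exceptional_row_sum:
  assumes h: "a < k" "b < k" "b \<noteq> a" and v: "\<And>j. 0 \<le> v j" and ok: "row_ok a v"
  shows "(\<Sum>j<n. v j * csum (C b \<inter> I) j) / real (card (C b)) + (\<Sum>j<n. \<mu> a j * csum (C a \<inter> I) j) / real (card (C a)) \<le> gap a b / 10"
proof -
  let ?M = "\<Sum>j<n. \<mu> a j * csum I j" and ?V = "\<Sum>j<n. v j * csum I j"
  have fI: "finite I" using S finite_subset by blast
  have le: "csum (C b' \<inter> I) j \<le> csum I j" for b' j by (rule csum_mono[OF fI]) auto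
  have bd: "Y / real (card (C b')) \<le> Z / (lo / 2)" if "b' < k" "Y \<le> Z" "0 \<le> Z" for b' Y Z
  proof -
    have "Y / real (card (C b')) \<le> Z / real (card (C b'))" using that by (intro divide_right_mono) auto
    also have "\<dots> \<le> Z / (lo / 2)"
      using that C_lower[OF that(1)] C_pos[OF that(1)] lo(1) by (intro divide_left_mono) auto
    finally show ?thesis .
  qed
  have nn: "0 \<le> ?V" "0 \<le> ?M" using v \<mu>[OF h(1)] csum_nonneg by (simp_all add: sum_nonneg)
  have "(\<Sum>j<n. v j * csum (C b \<inter> I) j) / real (card (C b)) \<le> ?V / (lo / 2)"
    by (intro bd h nn sum_mono mult_left_mono le v)
  moreover have "(\<Sum>j<n. \<mu> a j * csum (C a \<inter> I) j) / real (card (C a)) \<le> ?M / (lo / 2)"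
    by (intro bd h nn sum_mono mult_left_mono le) (use \<mu>[OF h(1)] in auto)
  moreover have "?V \<le> 2 * ?M + 4 * P * real (card S) * x" using ok by (simp add: row_ok_def)
  then have "?V / (lo / 2) + ?M / (lo / 2) \<le> (3 * ?M + 4 * P * real (card S) * x) / (lo / 2)"
    using lo(1) unfolding add_divide_distrib[symmetric] by (intro divide_right_mono) auto
  moreover have "(3 * ?M + 4 * P * real (card S) * x) / (lo / 2) \<le> gap a b / 10"
  proof -
    have "20 * (3 * ?M + 4 * P * real (card S) * x) \<le> D\<^sup>2 * lo"
      using exceptional_edges[OF h(1)] N1 by argo
    also have "\<dots> \<le> gap a b * lo" using D2_le_gap[OF h] lo(1) by (intro mult_right_mono) auto
    finally show ?thesis using lo(1) by (simp add: field_simps)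
  qed
  ultimately show ?thesis by linarith
qed

text \<open>Expanding the squares separates a deterministic part from twice the noise in the
  direction of the difference of centres. Errors of \<open>3 / 100 * D\<close> in the centres leave
  at least \<open>94 / 100\<close> of the gap, while the three noise terms take
  \<open>1 / 10\<close> each before doubling.\<close>

theorem row_classified:
  assumes h: "a < k" "b < k" "b \<noteq> a" and v: "\<And>j. 0 \<le> v j" and ok: "row_ok a v"
  shows "dst n v (avg B (C a)) < dst n v (avg B (C b))"
proof -
  define q where "q = gap a b / kap"
  define w where "w = wfun q (C b - I) (card (C b)) (C a - I) (card (C a))"
  define dif where "dif j = avg B (C b) j - avg B (C a) j" for j
  let ?m = "\<mu> a"
  have g: "D\<^sup>2 \<le> gap a b" by (rule D2_le_gap[OF h])
  have g0: "gap a b > 0" using g D by (meson less_le_trans zero_less_power)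
  have weq: "w j = min (cen b j) q - cen a j" for j
    using wfun_admissible(1)[OF h] unfolding w_def q_def by simp
  have "(\<forall>j<n. \<bar>w j\<bar> \<le> 1) \<and> (\<Sum>j<n. (w j)\<^sup>2) \<le> 2 * gap a b"
    using wfun_admissible(2,3)[OF h] unfolding w_def q_def by simp
  then have t1: "(\<Sum>j<n. (v j - ?m j) * w j) < gap a b / 10"
    unfolding w_def q_def
    by (rule row_ok_wfun[OF ok h(2,3) C_cells[OF h(2)] C_cells[OF h(1)] card_C_le[OF h(2)] card_C_le[OF h(1)]])
  have split: "avg B (C b') j = cen b' j + csum (C b' \<inter> I) j / real (card (C b'))" if "b' < k" for b' j
  proof -
    have "csum (C b') j = csum (C b' - I) j + csum (C b' \<inter> I) j"
      unfolding csum_def using sum.Int_Diff[OF finC[OF that], of "\<lambda>i. B i j" I] by simp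
    then show ?thesis unfolding cen_def avg_eq_csum by (simp add: add_divide_distrib)
  qed
  \<comment> \<open>Only the clipped part needs the cancellation in \<open>v j - ?m j\<close>. In
    the nonnegative remainders it is bounded by \<open>v j\<close>, and its negative by
    \<open>?m j\<close>.\<close>
  have "(v j - ?m j) * dif j \<le> (v j - ?m j) * w j + v j * (cen b j - min (cen b j) q)
      + v j * (csum (C b \<inter> I) j / real (card (C b))) + ?m j * (csum (C a \<inter> I) j / real (card (C a)))" for j
  proof -
    let ?ib = "csum (C b \<inter> I) j / real (card (C b))" and ?ia = "csum (C a \<inter> I) j / real (card (C a))"
    have nn: "0 \<le> ?ib" "0 \<le> ?ia" "0 \<le> cen b j - min (cen b j) q" "0 \<le> ?m j" "0 \<le> v j"
      using csum_nonneg v \<mu>[OF h(1)] by auto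
    have "(v j - ?m j) * dif j = (v j - ?m j) * w j + (v j - ?m j) * (cen b j - min (cen b j) q) + (v j - ?m j) * ?ib - (v j - ?m j) * ?ia"
      unfolding dif_def split[OF h(1)] split[OF h(2)] weq by (simp add: algebra_simps)
    moreover have "(v j - ?m j) * (cen b j - min (cen b j) q) \<le> v j * (cen b j - min (cen b j) q)"
      "(v j - ?m j) * ?ib \<le> v j * ?ib" using nn by (intro mult_right_mono; simp)+
    moreover have "- (v j - ?m j) * ?ia \<le> ?m j * ?ia" using nn by (intro mult_right_mono) auto
    ultimately show ?thesis by linarith
  qed
  then have "(\<Sum>j<n. (v j - ?m j) * dif j) \<le> (\<Sum>j<n. (v j - ?m j) * w j + v j * (cen b j - min (cen b j) q)
      + v j * (csum (C b \<inter> I) j / real (card (C b))) + ?m j * (csum (C a \<inter> I) j / real (card (C a))))"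
    by (intro sum_mono)
  also have "\<dots> = (\<Sum>j<n. (v j - ?m j) * w j) + (\<Sum>j<n. v j * (cen b j - min (cen b j) q))
      + ((\<Sum>j<n. v j * csum (C b \<inter> I) j) / real (card (C b)) + (\<Sum>j<n. ?m j * csum (C a \<inter> I) j) / real (card (C a)))"
    by (simp only: sum.distrib sum_divide_distrib add.assoc times_divide_eq_right)
  finally have cross: "(\<Sum>j<n. (v j - ?m j) * dif j) < 3 / 10 * gap a b"
    using t1 excess_row_sum[OF h v ok] exceptional_row_sum[OF h v ok] unfolding q_def by linarith
  have "(dst n v (avg B (C b)))\<^sup>2 - (dst n v (avg B (C a)))\<^sup>2 =
      (dst n ?m (avg B (C b)))\<^sup>2 - (dst n ?m (avg B (C a)))\<^sup>2 - 2 * (\<Sum>j<n. (v j - ?m j) * dif j)"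
    unfolding dst_sq sum_distrib_left sum_subtractf[symmetric] dif_def
    by (rule sum.cong) (auto simp: power2_eq_square algebra_simps)
  moreover have "94 / 100 * gap a b \<le> (dst n ?m (avg B (C b)))\<^sup>2 - (dst n ?m (avg B (C a)))\<^sup>2"
  proof -
    let ?g = "dst n ?m (\<mu> b)"
    have gD: "D \<le> ?g" using D(2) h by simp
    have 1: "?g - 3 / 100 * D \<le> dst n ?m (avg B (C b))"
      using centre_near[OF h(2)] dst_triangle[of ?m "\<mu> b" n "avg B (C b)"] by linarith
    have "(?g - 3 / 100 * D)\<^sup>2 \<le> (dst n ?m (avg B (C b)))\<^sup>2" using 1 gD D(1) by (intro power_mono) auto
    moreover have "(dst n ?m (avg B (C a)))\<^sup>2 \<le> (3 / 100 * D)\<^sup>2"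
      using centre_near[OF h(1)] dst_commute[of ?m "avg B (C a)" n] by (intro power_mono) auto
    moreover have "?g * D \<le> ?g * ?g" using gD by (intro mult_left_mono) auto
    ultimately show ?thesis unfolding gap_def by (simp add: power2_eq_square algebra_simps)
  qed
  ultimately have "(dst n v (avg B (C a)))\<^sup>2 < (dst n v (avg B (C b)))\<^sup>2" using cross g0 by linarith
  then show ?thesis by (rule power_less_imp_less_base) simp
qed

end

section \<open>The union bound for a fresh row\<close>

lemma row_sum_of_pairs:
  fixes \<phi> :: "nat \<times> nat \<Rightarrow> real"
  assumes "finite S2" "i \<in> S2"
  shows "(\<Sum>y\<in>S2 \<times> {..<n}. \<phi> y * (if fst y = i then f (snd y) else 0)) = (\<Sum>j<n. \<phi> (i, j) * f j)"
proof -
  have "(\<Sum>y\<in>S2 \<times> {..<n}. \<phi> y * (if fst y = i then f (snd y) else 0)) =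
      (\<Sum>y\<in>{i} \<times> {..<n}. \<phi> y * (if fst y = i then f (snd y) else 0))"
    by (rule sum.mono_neutral_right) (use assms in auto)
  also have "{i} \<times> {..<n} = Pair i ` {..<n}" by auto
  also have "(\<Sum>y\<in>\<dots>. \<phi> y * (if fst y = i then f (snd y) else 0)) = (\<Sum>j<n. \<phi> (i, j) * f j)"
    by (simp add: sum.reindex inj_on_def)
  finally show ?thesis .
qed

lemma row_upper_tail:
  fixes \<mu> :: "nat \<times> nat \<Rightarrow> real"
  assumes "finite S2" "i \<in> S2" and \<mu>: "\<And>y. 0 \<le> \<mu> y \<and> \<mu> y \<le> 1" and f: "\<And>j. j < n \<Longrightarrow> 0 \<le> f j \<and> f j \<le> F" "F > 0"
  shows "bprob (S2 \<times> {..<n}) \<mu> {g. \<not> (\<Sum>j<n. bmat g i j * f j) < 2 * (\<Sum>j<n. \<mu> (i, j) * f j) + F * y} \<le> exp (- y)"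
proof -
  let ?f = "\<lambda>y. if fst y = i then f (snd y) else 0"
  have "bprob (S2 \<times> {..<n}) \<mu> {g. 2 * (\<Sum>y\<in>S2 \<times> {..<n}. \<mu> y * ?f y) + F * y \<le> (\<Sum>y\<in>S2 \<times> {..<n}. of_bool (g y) * ?f y)} \<le> exp (- y)"
    by (rule weighted_bits_upper_tail) (use assms in auto)
  moreover have "(\<Sum>y\<in>S2 \<times> {..<n}. of_bool (g y) * ?f y) = (\<Sum>j<n. bmat g i j * f j)" for g
    by (rule row_sum_of_pairs[OF assms(1,2)])
  ultimately show ?thesis unfolding row_sum_of_pairs[OF assms(1,2)] not_less by (simp only:)
qed

lemma row_centred_tail:
  fixes \<mu> :: "nat \<times> nat \<Rightarrow> real"
  assumes "finite S2" "i \<in> S2" and \<mu>: "\<And>y. 0 \<le> \<mu> y \<and> \<mu> y \<le> P" and P: "P \<le> 1" "P \<le> h" "h > 0"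
    and w: "\<And>j. j < n \<Longrightarrow> w j \<le> h \<and> \<bar>w j\<bar> \<le> 1"
  shows "bprob (S2 \<times> {..<n}) \<mu> {g. \<not> (\<Sum>j<n. (bmat g i j - \<mu> (i, j)) * w j) < t} \<le> exp (P * (\<Sum>j<n. (w j)\<^sup>2) / h\<^sup>2 - t / h)"
proof -
  let ?w = "\<lambda>y. if fst y = i then w (snd y) else 0"
  have "bprob (S2 \<times> {..<n}) \<mu> {g. t \<le> (\<Sum>y\<in>S2 \<times> {..<n}. cbit \<mu> g y * ?w y)} \<le>
      exp (P * (\<Sum>y\<in>S2 \<times> {..<n}. (?w y)\<^sup>2) / h\<^sup>2 - t / h)"
    by (rule centred_bits_upper_tail) (use assms in auto)
  moreover have "(\<Sum>y\<in>S2 \<times> {..<n}. (?w y)\<^sup>2) = (\<Sum>j<n. (w j)\<^sup>2)"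
  proof -
    have "(?w y)\<^sup>2 = 1 * (if fst y = i then (w (snd y))\<^sup>2 else 0)" for y by simp
    then show ?thesis using row_sum_of_pairs[OF assms(1,2), where \<phi> = "\<lambda>_. 1" and f = "\<lambda>j. (w j)\<^sup>2" and n = n] by simp
  qed
  moreover have "(\<Sum>y\<in>S2 \<times> {..<n}. cbit \<mu> g y * ?w y) = (\<Sum>j<n. cbit \<mu> g (i, j) * w j)" for g
    by (rule row_sum_of_pairs[OF assms(1,2)])
  ultimately show ?thesis unfolding not_less by (simp only:)
qed

context sampled_half
begin

lemma card_HS: "finite HS" "real (card HS) \<le> exp (real (K + 1) * x)"
proof -
  have f: "finite (S - I)" using S by simp
  show "finite HS" unfolding HS_def by (rule card_halfspaces(1)[OF f])
  have "card HS \<le> (card (S - I) + 1) ^ Suc K" unfolding HS_def by (rule card_halfspaces(2)[OF f])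
  also have "\<dots> \<le> (card S + 1) ^ Suc K" using S by (intro power_mono) (auto intro: card_mono)
  finally have "real (card HS) \<le> (real (card S) + 1) ^ Suc K"
    by (metis of_nat_Suc of_nat_le_iff of_nat_power Suc_eq_plus1 add.commute)
  also have "\<dots> \<le> exp x ^ Suc K" using x(2) by (intro power_mono) auto
  also have "\<dots> = exp (real (K + 1) * x)" by (simp only: exp_of_nat_mult[symmetric] Suc_eq_plus1)
  finally show "real (card HS) \<le> exp (real (K + 1) * x)" .
qed

lemma card_cells: "finite cells" "real (card cells) \<le> exp (real k * real (K + 1) * x)"
proof -
  have f: "finite ({..<k} \<rightarrow>\<^sub>E HS)" using card_HS(1) by (intro finite_PiE) auto
  then show "finite cells" unfolding cells_def by simp
  have "card cells \<le> card ({..<k} \<rightarrow>\<^sub>E HS)" unfolding cells_def by (rule card_image_le[OF f])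
  also have "\<dots> = card HS ^ k" by (simp add: card_PiE)
  finally have "real (card cells) \<le> real (card HS) ^ k" by (metis of_nat_le_iff of_nat_power)
  also have "\<dots> \<le> exp (real (K + 1) * x) ^ k" using card_HS(2) by (intro power_mono) auto
  also have "\<dots> = exp (real k * real (K + 1) * x)" by (simp add: exp_of_nat_mult[symmetric] mult_ac)
  finally show "real (card cells) \<le> exp (real k * real (K + 1) * x)" .
qed

lemma csum_S_le: "j < n \<Longrightarrow> csum S j \<le> 4 * P * real (card S)"
proof -
  assume j: "j < n"
  have "csum S j = (\<Sum>r<k. \<Sum>i\<in>S \<inter> U r. B i j)" unfolding csum_def by (rule sum_U) simp
  also have "\<dots> \<le> (\<Sum>r<k. 4 * P * real (card (U r)))"
  proof (rule sum_mono)
    fix r assume "r \<in> {..<k}"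
    then show "(\<Sum>i\<in>S \<inter> U r. B i j) \<le> 4 * P * real (card (U r))"
      using coldeg[of r j] j U_sub[of r] by (simp add: U_def Int_absorb1)
  qed
  also have "\<dots> = 4 * P * real (card S)" by (simp add: sum_card_U sum_distrib_left[symmetric])
  finally show ?thesis .
qed

lemma U_pos: "r < k \<Longrightarrow> real (card (U r)) > 0"
  using lo unfolding U_def by (meson less_le_trans)

text \<open>Each of the three families fails with probability at most \<open>exp (- x)\<close>. A
  halfspace costs \<open>(K + 1) * x\<close>, and the foreign label, the size and the cluster cost
  \<open>x\<close> each, one less than the tail \<open>(K + 5) * x\<close>. Pairs of cells are paid
  for by \<open>kap\<close>, where \<open>N3\<close> keeps the variance term at half of the linear
  term in Bernstein's exponent.\<close>

theorem prob_row_bad: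
  fixes M :: "nat \<times> nat \<Rightarrow> real"
  assumes S2: "finite S2" "i \<in> S2" and a: "a < k" and M: "\<And>y. 0 \<le> M y \<and> M y \<le> P" "\<And>j. M (i, j) = \<mu> a j"
  shows "bprob (S2 \<times> {..<n}) M {g. \<not> row_ok a (bmat g i)} \<le> 3 * exp (- x)"
proof -
  let ?pr = "bprob (S2 \<times> {..<n}) M"
  have M1: "\<And>y. 0 \<le> M y \<and> M y \<le> 1" using M P by (meson order_trans)
  have cS: "real (card S) > 0"
  proof -
    have "S \<noteq> {}" using U_pos[of 0] k U_sub[of 0] by auto
    then show ?thesis using S by (simp add: card_gt_0_iff)
  qed
  define E1 where "E1 = {g. \<not> (\<Sum>j<n. bmat g i j * csum I j) < 2 * (\<Sum>j<n. \<mu> a j * csum I j) + 4 * P * real (card S) * x}"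
  define z where "z t = zfun (gap a (fst t) / kap) (fst (snd t)) (snd (snd (snd t)) \<inter> U (fst (snd (snd t))))" for t :: "nat \<times> nat \<times> nat \<times> nat set"
  define E2 where "E2 t = {g. \<not> (\<Sum>j<n. bmat g i j * z t j) < 2 * (\<Sum>j<n. \<mu> a j * z t j) + 4 * P * real (card (U (fst (snd (snd t))))) * (real (K + 5) * x)}" for t
  define T2 where "T2 = ({..<k} - {a}) \<times> {..card S} \<times> {..<k} \<times> HS"
  define w where "w t = wfun (gap a (fst t) / kap) (fst (snd t)) (fst (snd (snd (snd t)))) (fst (snd (snd t))) (snd (snd (snd (snd t))))"
    for t :: "nat \<times> nat set \<times> nat set \<times> nat \<times> nat"
  define adm where "adm t \<longleftrightarrow> (\<forall>j<n. \<bar>w t j\<bar> \<le> 1) \<and> (\<Sum>j<n. (w t j)\<^sup>2) \<le> 2 * gap a (fst t)" for t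
  define E3 where "E3 t = {g. adm t \<and> \<not> (\<Sum>j<n. (bmat g i j - \<mu> a j) * w t j) < gap a (fst t) / 10}" for t
  define T3 where "T3 = ({..<k} - {a}) \<times> cells \<times> cells \<times> {..card S} \<times> {..card S}"
  have fT: "finite T2" "finite T3" using card_HS card_cells by (auto simp: T2_def T3_def)
  have sub: "{g. \<not> row_ok a (bmat g i)} \<subseteq> E1 \<union> (\<Union>t\<in>T2. E2 t) \<union> (\<Union>t\<in>T3. E3 t)"
  proof (rule subsetI, rule ccontr)
    fix g assume g: "g \<in> {g. \<not> row_ok a (bmat g i)}" and no: "g \<notin> E1 \<union> (\<Union>t\<in>T2. E2 t) \<union> (\<Union>t\<in>T3. E3 t)"
    have "row_ok a (bmat g i)"
      unfolding row_ok_def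
    proof (intro conjI allI impI ballI)
      show "(\<Sum>j<n. bmat g i j * csum I j) < 2 * (\<Sum>j<n. \<mu> a j * csum I j) + 4 * P * real (card S) * x"
        using no by (simp add: E1_def)
    next
      fix b N r Z assume h: "b < k" "b \<noteq> a" "N \<le> card S" "r < k" "Z \<in> HS"
      then have "(b, N, r, Z) \<in> T2" by (simp add: T2_def)
      then have "g \<notin> E2 (b, N, r, Z)" using no by blast
      then show "(\<Sum>j<n. bmat g i j * zfun (gap a b / kap) N (Z \<inter> U r) j) <
         2 * (\<Sum>j<n. \<mu> a j * zfun (gap a b / kap) N (Z \<inter> U r) j) + 4 * P * real (card (U r)) * (real (K + 5) * x)"
        by (simp add: E2_def z_def)
    next
      fix b Z Z' N N' assume h: "b < k" "b \<noteq> a" "Z \<in> cells" "Z' \<in> cells" "N \<le> card S" "N' \<le> card S"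
        and ad: "(\<forall>j<n. \<bar>wfun (gap a b / kap) Z N Z' N' j\<bar> \<le> 1) \<and> (\<Sum>j<n. (wfun (gap a b / kap) Z N Z' N' j)\<^sup>2) \<le> 2 * gap a b"
      then have "(b, Z, Z', N, N') \<in> T3" by (simp add: T3_def)
      then have "g \<notin> E3 (b, Z, Z', N, N')" using no by blast
      moreover have "adm (b, Z, Z', N, N')" using ad by (simp add: adm_def w_def)
      ultimately show "(\<Sum>j<n. (bmat g i j - \<mu> a j) * wfun (gap a b / kap) Z N Z' N' j) < gap a b / 10"
        by (simp add: E3_def w_def)
    qed
    then show False using g by simp
  qed
  have p1: "?pr E1 \<le> exp (- x)"
  proof -
    have "0 \<le> csum I j \<and> csum I j \<le> 4 * P * real (card S)" if "j < n" for j
      using csum_nonneg csum_mono[OF S] csum_S_le[OF that] order_trans by blast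
    then show ?thesis unfolding E1_def M(2)[symmetric]
      by (intro row_upper_tail[OF S2 M1]) (use P cS in auto)
  qed
  have p2: "?pr (E2 t) \<le> exp (- (real (K + 5) * x))" if t: "t \<in> T2" for t
  proof -
    obtain b N r Z where tt: "t = (b, N, r, Z)" by (metis prod.collapse)
    have h: "b < k" "b \<noteq> a" "r < k" using t by (auto simp: T2_def tt)
    have "0 \<le> z t j \<and> z t j \<le> 4 * P * real (card (U r))" if j: "j < n" for j
    proof -
      have "csum (Z \<inter> U r) j \<le> csum (U r) j" using U_sub by (intro csum_mono) auto
      also have "\<dots> \<le> 4 * P * real (card (U r))" unfolding csum_def U_def by (rule coldeg[OF h(3) j])
      finally have c: "csum (Z \<inter> U r) j \<le> 4 * P * real (card (U r))" .
      have "0 \<le> real N * (gap a b / kap) * real (card (Z \<inter> U r)) / (2 * tau)"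
        using kap_pos tau_pos by (simp add: gap_def)
      then show ?thesis using c P by (simp add: z_def zfun_def tt)
    qed
    then show ?thesis unfolding E2_def M(2)[symmetric] tt fst_conv snd_conv
      by (intro row_upper_tail[OF S2 M1]) (use P U_pos[OF h(3)] in \<open>auto simp: tt\<close>)
  qed
  have p3: "?pr (E3 t) \<le> exp (- (kap / 20))" if t: "t \<in> T3" for t
  proof (cases "adm t")
    case False
    then show ?thesis by (simp add: E3_def)
  next
    case True
    obtain b Z Z' N N' where tt: "t = (b, Z, Z', N, N')" by (metis prod.collapse)
    have h: "b < k" "b \<noteq> a" using t by (auto simp: T3_def tt)
    let ?q = "gap a b / kap"
    have g: "D\<^sup>2 \<le> gap a b" by (rule D2_le_gap[OF a h])
    have g0: "gap a b > 0" using g D by (meson less_le_trans zero_less_power)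
    have kP: "40 * kap * P \<le> gap a b" using N3 g by (simp add: kap_def)
    have q: "P \<le> ?q" "?q > 0"
    proof -
      have "0 \<le> P * kap" using P kap_pos by simp
      moreover have "40 * (P * kap) \<le> gap a b" using kP by (simp add: mult_ac)
      ultimately have "P * kap \<le> gap a b" by linarith
      then show "P \<le> ?q" using kap_pos by (simp add: field_simps)
      show "?q > 0" using g0 kap_pos by simp
    qed
    have "?pr (E3 t) \<le> ?pr {g. \<not> (\<Sum>j<n. (bmat g i j - M (i, j)) * w t j) < gap a b / 10}"
      unfolding M(2) by (rule bprob_mono) (auto simp: E3_def tt)
    also have "\<dots> \<le> exp (P * (\<Sum>j<n. (w t j)\<^sup>2) / ?q\<^sup>2 - gap a b / 10 / ?q)"
    proof (rule row_centred_tail[OF S2 M(1) P(2) q])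
      fix j assume j: "j < n"
      have "0 \<le> csum Z' j / real N'" using csum_nonneg by simp
      then have "w t j \<le> ?q" by (simp add: w_def wfun_def tt min_def)
      then show "w t j \<le> ?q \<and> \<bar>w t j\<bar> \<le> 1" using True j by (simp add: adm_def)
    qed
    also have "\<dots> \<le> exp (- (kap / 20))"
    proof -
      have "P * (\<Sum>j<n. (w t j)\<^sup>2) / ?q\<^sup>2 \<le> P * (2 * gap a b) / ?q\<^sup>2"
        using True P by (intro divide_right_mono mult_left_mono) (auto simp: adm_def tt)
      also have "\<dots> = 2 * P * kap\<^sup>2 / gap a b" using g0 kap_pos by (simp add: field_simps power2_eq_square)
      also have "\<dots> \<le> kap / 20"
      proof -
        have "(40 * kap * P) * kap \<le> gap a b * kap" using kP kap_pos by (intro mult_right_mono) auto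
        then show ?thesis using g0 by (simp add: field_simps power2_eq_square)
      qed
      finally have "P * (\<Sum>j<n. (w t j)\<^sup>2) / ?q\<^sup>2 \<le> kap / 20" .
      moreover have "gap a b / 10 / ?q = kap / 10" using g0 kap_pos by simp
      ultimately show ?thesis unfolding exp_le_cancel_iff by linarith
    qed
    finally show ?thesis .
  qed
  have cardT2: "real (card T2) \<le> exp (real (K + 4) * x)"
  proof -
    have "card ({..<k} - {a}) \<le> k" by (rule order_trans[OF card_mono[of "{..<k}"]]) auto
    then have "real (card ({..<k} - {a})) \<le> exp x" using x(3) by linarith
    then have "real (card T2) \<le> exp x * (exp x * (exp x * exp (real (K + 1) * x)))"
      unfolding T2_def card_cartesian_product of_nat_mult
      using x(2,3) card_HS(2) by (intro mult_mono) (auto simp: add.commute)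
    also have "\<dots> = exp (real (K + 4) * x)" by (simp add: exp_add[symmetric] algebra_simps)
    finally show ?thesis .
  qed
  have cardT3: "real (card T3) \<le> exp (kap / 20 - x)"
  proof -
    have "card ({..<k} - {a}) \<le> k" by (rule order_trans[OF card_mono[of "{..<k}"]]) auto
    then have "real (card ({..<k} - {a})) \<le> exp x" using x(3) by linarith
    then have "real (card T3) \<le> exp x * (exp (real k * real (K + 1) * x) * (exp (real k * real (K + 1) * x) * (exp x * exp x)))"
      unfolding T3_def card_cartesian_product of_nat_mult
      using x(2,3) card_cells(2) by (intro mult_mono) (auto simp: add.commute)
    also have "\<dots> = exp (2 * (real k * real (K + 1) * x) + 3 * x)" by (simp add: exp_add[symmetric] algebra_simps)
    also have "\<dots> \<le> exp (kap / 20 - x)"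
    proof -
      have "1 * 1 \<le> real k * real (K + 1)" using k by (intro mult_mono) auto
      then have "1 * x \<le> real k * real (K + 1) * x" using x0 by (intro mult_right_mono) auto
      moreover have "kap = 200 * (real k * real (K + 1) * x)" by (simp only: kap_def mult.assoc)
      ultimately show ?thesis unfolding exp_le_cancel_iff using x0 by linarith
    qed
    finally show ?thesis .
  qed
  have "?pr {g. \<not> row_ok a (bmat g i)} \<le> ?pr (E1 \<union> (\<Union>t\<in>T2. E2 t) \<union> (\<Union>t\<in>T3. E3 t))"
    by (rule bprob_mono[OF sub])
  also have "\<dots> \<le> ?pr E1 + ?pr (\<Union>t\<in>T2. E2 t) + ?pr (\<Union>t\<in>T3. E3 t)"
    by (intro order_trans[OF measure_Un_le] add_right_mono measure_Un_le) auto
  also have "\<dots> \<le> exp (- x) + exp (- x) + exp (- x)"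
  proof (intro add_mono p1)
    have "?pr (\<Union>t\<in>T2. E2 t) \<le> (\<Sum>t\<in>T2. ?pr (E2 t))" by (rule bprob_union_bound[OF fT(1)])
    also have "\<dots> \<le> real (card T2) * exp (- (real (K + 5) * x))" by (rule sum_bounded_above[OF p2])
    also have "\<dots> \<le> exp (real (K + 4) * x) * exp (- (real (K + 5) * x))" using cardT2 by (intro mult_right_mono) auto
    also have "\<dots> = exp (- x)" by (simp add: exp_add[symmetric] algebra_simps)
    finally show "?pr (\<Union>t\<in>T2. E2 t) \<le> exp (- x)" .
    have "?pr (\<Union>t\<in>T3. E3 t) \<le> (\<Sum>t\<in>T3. ?pr (E3 t))" by (rule bprob_union_bound[OF fT(2)])
    also have "\<dots> \<le> real (card T3) * exp (- (kap / 20))" by (rule sum_bounded_above[OF p3])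
    also have "\<dots> \<le> exp (kap / 20 - x) * exp (- (kap / 20))" using cardT3 by (intro mult_right_mono) auto
    also have "\<dots> = exp (- x)" by (simp add: exp_add[symmetric])
    finally show "?pr (\<Union>t\<in>T3. E3 t) \<le> exp (- x)" .
  qed
  also have "\<dots> = 3 * exp (- x)" by simp
  finally show ?thesis .
qed

end

section \<open>One half of the rows\<close>

lemma sum_column_of_pairs:
  fixes \<phi> :: "nat \<times> nat \<Rightarrow> real"
  assumes "finite S" "U \<subseteq> S" "j < n"
  shows "(\<Sum>y\<in>S \<times> {..<n}. \<phi> y * of_bool (fst y \<in> U \<and> snd y = j)) = (\<Sum>i\<in>U. \<phi> (i, j))"
proof -
  have "(\<Sum>y\<in>S \<times> {..<n}. \<phi> y * of_bool (fst y \<in> U \<and> snd y = j)) = (\<Sum>y\<in>U \<times> {j}. \<phi> y * of_bool (fst y \<in> U \<and> snd y = j))"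
    by (rule sum.mono_neutral_right) (use assms in auto)
  also have "U \<times> {j} = (\<lambda>i. (i, j)) ` U" by auto
  also have "(\<Sum>y\<in>\<dots>. \<phi> y * of_bool (fst y \<in> U \<and> snd y = j)) = (\<Sum>i\<in>U. \<phi> (i, j))"
    by (simp add: sum.reindex inj_on_def)
  finally show ?thesis .
qed

lemma column_upper_tail:
  fixes \<mu> :: "nat \<times> nat \<Rightarrow> real"
  assumes "finite S" "U \<subseteq> S" "j < n" and \<mu>: "\<And>y. 0 \<le> \<mu> y \<and> \<mu> y \<le> 1"
  shows "bprob (S \<times> {..<n}) \<mu> {g. 2 * (\<Sum>i\<in>U. \<mu> (i, j)) + y \<le> (\<Sum>i\<in>U. bmat g i j)} \<le> exp (- y)"
proof -
  let ?f = "\<lambda>y. of_bool (fst y \<in> U \<and> snd y = j) :: real"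
  have "bprob (S \<times> {..<n}) \<mu> {g. 2 * (\<Sum>y\<in>S \<times> {..<n}. \<mu> y * ?f y) + 1 * y \<le> (\<Sum>y\<in>S \<times> {..<n}. of_bool (g y) * ?f y)} \<le> exp (- y)"
    by (rule weighted_bits_upper_tail) (use assms in auto)
  moreover have "(\<Sum>y\<in>S \<times> {..<n}. of_bool (g y) * ?f y) = (\<Sum>i\<in>U. bmat g i j)" for g
    by (rule sum_column_of_pairs[OF assms(1-3)])
  ultimately show ?thesis unfolding sum_column_of_pairs[OF assms(1-3)] by (simp only: mult_1)
qed

text \<open>\<open>lo\<close> bounds the cluster sizes within this half, while \<open>N\<close>
  bounds rows plus columns and is the same for both halves. \<open>H1\<close> to \<open>H3\<close>
  are the signal condition with all logarithms collected in \<open>x ^ 3\<close>.\<close>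

locale half_model =
  fixes S :: "nat set" and n k N :: nat and c :: "nat \<Rightarrow> nat" and V :: "nat \<Rightarrow> nat set" and p q D x lo :: real
  assumes S: "finite S" and k: "0 < k" and c: "\<And>i. i \<in> S \<Longrightarrow> c i < k"
    and pq: "0 \<le> p" "p \<le> 1 / 2" "0 \<le> q" "q \<le> 1 / 2"
    and D: "D > 0" "\<And>r s. r < k \<Longrightarrow> s < k \<Longrightarrow> r \<noteq> s \<Longrightarrow>
        D \<le> dst n (\<lambda>j. if j \<in> V r then p else q) (\<lambda>j. if j \<in> V s then p else q)"
    and lo: "lo > 0" "\<And>r. r < k \<Longrightarrow> lo \<le> real (card {i \<in> S. c i = r})"
    and N: "card S + n \<le> N" "real N + 1 \<le> exp x" and x: "x \<ge> 1"
    and H1: "2 * 10 ^ 8 * x ^ 3 * max p q * real k * real N \<le> D\<^sup>2 * lo"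
    and H2: "2 * 10 ^ 8 * x ^ 3 * real k \<le> max p q * lo"
    and H3: "2 * 10 ^ 8 * x ^ 3 * real k \<le> real n"
begin

definition P :: real where "P = max p q"
definition \<mu> :: "nat \<Rightarrow> nat \<Rightarrow> real" where "\<mu> r j = (if j \<in> V r then p else q)"
definition M :: "nat \<times> nat \<Rightarrow> real" where "M y = \<mu> (c (fst y)) (snd y)"
text \<open>The operator bound is used at \<open>y = 2 * x\<close>, whence
  \<open>512 = 128 * 2^2\<close>. \<open>tn\<close> is \<open>2 * T + k\<close> for
  \<open>T = 16 * k + 9 * nat \<lceil>x\<rceil>\<close>, the number of columns that one halving
  round may consume. \<open>rk\<close> is \<open>k\<close> plus the columns of
  \<open>nat \<lceil>2 * x\<rceil>\<close> rounds, enough because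
  \<open>k \<le> exp x\<close>.\<close>

definition R :: real where "R = 512 * x\<^sup>2 * (real N * P)"
definition tn :: nat where "tn = 33 * k + 18 * nat \<lceil>x\<rceil>"
definition rk :: nat where "rk = k + nat \<lceil>2 * x\<rceil> * tn"
definition hi :: "nat \<Rightarrow> nat set" where "hi r = {j. j < n \<and> \<mu> r j = P}"
text \<open>Richness is measured at the rate of the columns that will test it: the dense ones if
  there are at least \<open>tn\<close> of them, all columns otherwise. In the second case the few
  dense columns form \<open>H r\<close>. If \<open>min p q\<close> is 0, arbitrarily many rows of
  that cluster may be exceptional, but their means vanish off \<open>H r\<close>.\<close>

definition \<rho> :: "nat \<Rightarrow> real" where "\<rho> r = (if tn \<le> card (hi r) then P else min p q)"
definition H :: "nat \<Rightarrow> nat set" where "H r = (if tn \<le> card (hi r) then {} else hi r)"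

lemma mu_bounds: "0 \<le> \<mu> r j \<and> \<mu> r j \<le> P" and P_half: "P \<le> 1 / 2" and M_bounds: "0 \<le> M y \<and> M y \<le> P"
  using pq by (auto simp: \<mu>_def P_def M_def)

lemma x3: "1 \<le> x ^ 3" "x \<le> x ^ 3" "x\<^sup>2 \<le> x ^ 3"
  using x power_increasing[of 1 3 x] power_increasing[of 2 3 x] by (auto simp: one_le_power)

lemma k1: "1 \<le> real k" using k by simp

lemma sum_sizes: "(\<Sum>r<k. real (card {i \<in> S. c i = r})) = real (card S)"
proof -
  have "(\<Sum>r<k. card {i \<in> S. c i = r}) = card S"
    using sum.group[of S "{..<k}" c "\<lambda>_. 1 :: nat"] S c by auto
  then show ?thesis by (metis of_nat_sum)
qed

lemma k_lo: "real k * lo \<le> real N"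
proof -
  have "real k * lo = (\<Sum>r<k. lo)" by simp
  also have "\<dots> \<le> (\<Sum>r<k. real (card {i \<in> S. c i = r}))" by (intro sum_mono) (use lo in auto)
  also have "\<dots> \<le> real N" using sum_sizes N by simp
  finally show ?thesis .
qed

lemma lo_N: "lo \<le> real N"
proof -
  have "1 * lo \<le> real k * lo" using k1 lo(1) by (intro mult_right_mono) auto
  then show ?thesis using k_lo by linarith
qed

lemma Plo: "2 * 10 ^ 8 * x ^ 3 * real k \<le> P * lo" using H2 by (simp add: P_def)

lemma Ppos: "P > 0"
proof -
  have "0 < 2 * 10 ^ 8 * x ^ 3 * real k" using x k by simp
  then have "0 < P * lo" using Plo by linarith
  then show ?thesis using lo by (simp add: zero_less_mult_iff)
qed

lemma G1: "2 * 10 ^ 8 * x ^ 3 * (P * real k * real N) \<le> D\<^sup>2 * lo" using H1 by (simp add: P_def mult_ac)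

lemma tn_le: "real tn \<le> 69 * (real k * x)"
proof -
  have "real (nat \<lceil>x\<rceil>) \<le> 2 * x" using x by linarith
  then have "real tn \<le> 33 * real k + 36 * x" by (simp add: tn_def)
  moreover have "real k * 1 \<le> real k * x" "1 * x \<le> real k * x" using k1 x by (intro mult_left_mono mult_right_mono; simp)+
  ultimately show ?thesis by linarith
qed

lemma rk_le: "real (rk + 5) \<le> 214 * (real k * x\<^sup>2)"
proof -
  have "real (nat \<lceil>2 * x\<rceil>) \<le> 3 * x" using x by linarith
  then have "real (nat \<lceil>2 * x\<rceil>) * real tn \<le> 3 * x * (69 * (real k * x))" using tn_le x by (intro mult_mono) auto
  then have "real rk \<le> real k + 207 * (real k * x\<^sup>2)" by (simp add: rk_def power2_eq_square mult_ac)
  moreover have "1 * 1 \<le> real k * x\<^sup>2" using k1 x by (intro mult_mono) (auto simp: one_le_power)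
  moreover have "real k * 1 \<le> real k * x\<^sup>2" using x by (intro mult_left_mono) (auto simp: one_le_power)
  ultimately show ?thesis by simp
qed

lemma tn_n: "tn \<le> n"
proof -
  have "69 * (real k * x) \<le> 69 * (real k * x ^ 3)" using x3 by (intro mult_left_mono) auto
  also have "\<dots> \<le> real n" using H3 x k by (simp add: mult_ac)
  finally show ?thesis using tn_le by simp
qed

lemma R_pos: "R > 0"
proof -
  have "real N > 0" using lo_N lo by linarith
  then show ?thesis using Ppos x by (simp add: R_def)
qed

section \<open>The numerical conditions \<open>N0\<close> to \<open>N6\<close>\<close>

lemma num0: "320000 * real k * R \<le> D\<^sup>2 * lo"
proof -
  have "320000 * real k * R = 163840000 * (x\<^sup>2 * (P * real k * real N))" by (simp add: R_def)
  also have "\<dots> \<le> 163840000 * (x ^ 3 * (P * real k * real N))"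
    using x3 Ppos by (intro mult_left_mono mult_right_mono) auto
  also have "\<dots> \<le> 2 * 10 ^ 8 * x ^ 3 * (P * real k * real N)" using x Ppos by simp
  finally show ?thesis using G1 by linarith
qed

lemma num1: "20 * (3 * P * (2 * real n * real k + real (card S) * (2 * real tn + 2 * x)) + 4 * P * real (card S) * x) \<le> D\<^sup>2 * lo"
proof -
  have kx: "real k * 1 \<le> real k * x" "1 * x \<le> real k * x" using k1 x by (intro mult_left_mono mult_right_mono; simp)+
  have a: "real n * real k \<le> real N * (real k * x)" using kx N by (intro mult_mono) auto
  have b: "real (card S) * (2 * real tn + 2 * x) \<le> real N * (140 * (real k * x))"
  proof (rule mult_mono)
    show "2 * real tn + 2 * x \<le> 140 * (real k * x)" using tn_le kx by linarith
  qed (use N x in auto)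
  have d: "real (card S) * x \<le> real N * (real k * x)" using N kx x by (intro mult_mono) auto
  have "20 * (3 * P * (2 * real n * real k + real (card S) * (2 * real tn + 2 * x)) + 4 * P * real (card S) * x) =
      P * (120 * (real n * real k) + 60 * (real (card S) * (2 * real tn + 2 * x)) + 80 * (real (card S) * x))"
    by (simp add: algebra_simps)
  also have "\<dots> \<le> P * (8600 * (real N * (real k * x)))"
    using a b d Ppos by (intro mult_left_mono) auto
  also have "\<dots> = 8600 * (x * (P * real k * real N))" by simp
  also have "\<dots> \<le> 8600 * (x ^ 3 * (P * real k * real N))"
    using x3 Ppos by (intro mult_left_mono mult_right_mono) auto
  also have "\<dots> \<le> 2 * 10 ^ 8 * x ^ 3 * (P * real k * real N)" using x Ppos by simp
  finally show ?thesis using G1 by linarith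
qed

lemma num2: "8 * real n * (real k)\<^sup>2 / lo\<^sup>2 + 2 * P\<^sup>2 * real tn \<le> D\<^sup>2 / 10000"
proof -
  have A: "10 ^ 8 * (real k)\<^sup>2 \<le> P * lo * real k"
  proof -
    have "10 ^ 8 * 1 * real k \<le> 2 * 10 ^ 8 * x ^ 3 * real k" using x3 by (intro mult_right_mono mult_mono) auto
    then have "10 ^ 8 * real k \<le> P * lo" using Plo by linarith
    then have "10 ^ 8 * real k * real k \<le> P * lo * real k" by (intro mult_right_mono) auto
    then show ?thesis by (simp add: power2_eq_square)
  qed
  have "10 ^ 8 * (real k)\<^sup>2 * real n \<le> P * lo * real k * real N"
    by (rule mult_mono[OF A]) (use N Ppos lo in auto)
  also have "\<dots> = lo * (P * real k * real N)" by simp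
  also have "\<dots> \<le> lo * (2 * 10 ^ 8 * x ^ 3 * (P * real k * real N))"
  proof (rule mult_left_mono)
    have "1 * (P * real k * real N) \<le> 2 * 10 ^ 8 * x ^ 3 * (P * real k * real N)"
      using x3(1) Ppos by (intro mult_right_mono) auto
    then show "P * real k * real N \<le> 2 * 10 ^ 8 * x ^ 3 * (P * real k * real N)" by simp
  qed (use lo in simp)
  also have "\<dots> \<le> lo * (D\<^sup>2 * lo)" using G1 lo by (intro mult_left_mono) auto
  finally have "10 ^ 8 * ((real k)\<^sup>2 * real n) \<le> lo * (D\<^sup>2 * lo)" by (simp only: mult.assoc)
  moreover have "160000 * ((real k)\<^sup>2 * real n) \<le> 10 ^ 8 * ((real k)\<^sup>2 * real n)" by (rule mult_right_mono) simp_all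
  ultimately have "160000 * ((real k)\<^sup>2 * real n) \<le> lo * (D\<^sup>2 * lo)" by linarith
  then have 1: "8 * real n * (real k)\<^sup>2 / lo\<^sup>2 \<le> D\<^sup>2 / 20000"
    using lo(1) by (simp add: field_simps power2_eq_square)
  have F: "2 * P\<^sup>2 * real tn \<le> 2 * (P * 1) * (69 * (real k * x))"
    unfolding power2_eq_square using Ppos P_half tn_le by (intro mult_mono) auto
  have "2 * P\<^sup>2 * real tn * lo \<le> 2 * (P * 1) * (69 * (real k * x)) * real N"
    by (rule mult_mono[OF F lo_N]) (use lo(1) Ppos x in auto)
  also have "\<dots> = 138 * (x * (P * real k * real N))" by simp
  also have "\<dots> \<le> 138 * (x ^ 3 * (P * real k * real N))"
    using x3 Ppos by (intro mult_left_mono mult_right_mono) auto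
  also have "\<dots> \<le> (2 * 10 ^ 8 * x ^ 3 * (P * real k * real N)) / 20000" using x Ppos by simp
  also have "\<dots> \<le> D\<^sup>2 * lo / 20000" by (rule divide_right_mono[OF G1]) simp
  finally have "2 * P\<^sup>2 * real tn * lo \<le> D\<^sup>2 / 20000 * lo" by simp
  then have "2 * P\<^sup>2 * real tn \<le> D\<^sup>2 / 20000" using lo by (simp only: mult_le_cancel_right_pos)
  then show ?thesis using 1 by simp
qed

lemma kappa_le: "200 * real k * real (rk + 1) * x \<le> 42800 * ((real k)\<^sup>2 * x ^ 3)"
proof -
  have "200 * real k * real (rk + 1) * x \<le> 200 * real k * (214 * (real k * x\<^sup>2)) * x"
    using rk_le x by (intro mult_right_mono mult_left_mono) auto
  then show ?thesis by (simp add: power2_eq_square power3_eq_cube mult_ac)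
qed

lemma num3: "40 * (200 * real k * real (rk + 1) * x) * P \<le> D\<^sup>2"
proof -
  have "40 * (200 * real k * real (rk + 1) * x) * P * lo \<le> 40 * (42800 * ((real k)\<^sup>2 * x ^ 3)) * P * lo"
    using kappa_le Ppos lo by (intro mult_right_mono mult_left_mono) auto
  also have "\<dots> = 1712000 * x ^ 3 * (P * real k * (real k * lo))" by (simp add: power2_eq_square)
  also have "\<dots> \<le> 1712000 * x ^ 3 * (P * real k * real N)" using k_lo Ppos x by (intro mult_left_mono) auto
  also have "\<dots> \<le> 2 * 10 ^ 8 * x ^ 3 * (P * real k * real N)" using x Ppos by simp
  also have "\<dots> \<le> D\<^sup>2 * lo" by (rule G1)
  finally show ?thesis using lo by (simp only: mult_le_cancel_right_pos)
qed

lemma g_lo: "P * real k * (real k * lo) \<le> P * real k * real N" and g_lo0: "0 \<le> P * real k * (real k * lo)"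
  using k_lo Ppos lo(1) by (auto intro: mult_left_mono)

text \<open>After multiplication by \<open>lo\<close> the left side contains
  \<open>P * k * N\<close> and \<open>P * k * (k * lo)\<close>, the latter at most the former
  because the clusters are disjoint. So two copies of \<open>G1\<close> give the claim;
  \<open>num5\<close> works in the same way with three copies.\<close>

lemma num4: "320 * real k * R * P * (200 * real k * real (rk + 1) * x) \<le> lo * D ^ 4"
proof -
  let ?g = "P * real k * real N"
  have g: "0 \<le> ?g" using Ppos by simp
  have "320 * real k * R * P * (200 * real k * real (rk + 1) * x) * lo \<le>
      320 * real k * R * P * (42800 * ((real k)\<^sup>2 * x ^ 3)) * lo"
    using kappa_le Ppos lo R_pos by (intro mult_right_mono mult_left_mono) auto
  also have "\<dots> = 7012352000 * (x\<^sup>2 * x ^ 3) * (?g * (P * real k * (real k * lo)))"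
    by (simp add: R_def power2_eq_square)
  also have "\<dots> \<le> 7012352000 * (x ^ 3 * x ^ 3) * (?g * ?g)"
    by (rule mult_mono[OF mult_left_mono[OF mult_right_mono[OF x3(3)]] mult_left_mono[OF g_lo g]]) (use x g g_lo0 in auto)
  also have "\<dots> = 7012352000 * ((x ^ 3 * ?g) * (x ^ 3 * ?g))" by simp
  also have "\<dots> \<le> 4 * 10 ^ 16 * ((x ^ 3 * ?g) * (x ^ 3 * ?g))" by (rule mult_right_mono) simp_all
  also have "\<dots> = (2 * 10 ^ 8 * x ^ 3 * ?g) * (2 * 10 ^ 8 * x ^ 3 * ?g)" by simp
  also have "\<dots> \<le> (D\<^sup>2 * lo) * (D\<^sup>2 * lo)"
    by (rule mult_mono[OF G1 G1]) (use lo g x in auto)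
  also have "\<dots> = lo * D ^ 4 * lo" by (simp add: eval_nat_numeral mult_ac)
  finally show ?thesis using lo by (simp only: mult_le_cancel_right_pos)
qed

lemma num5: "25600 * (real k)\<^sup>2 * P * R\<^sup>2 * (200 * real k * real (rk + 1) * x) \<le> lo\<^sup>2 * D ^ 6"
proof -
  let ?g = "P * real k * real N"
  have g: "0 \<le> ?g" using Ppos by simp
  have "25600 * (real k)\<^sup>2 * P * R\<^sup>2 * (200 * real k * real (rk + 1) * x) * lo \<le>
      25600 * (real k)\<^sup>2 * P * R\<^sup>2 * (42800 * ((real k)\<^sup>2 * x ^ 3)) * lo"
    using kappa_le Ppos lo R_pos by (intro mult_right_mono mult_left_mono) auto
  also have "\<dots> = 287225937920000 * (x\<^sup>2 * x\<^sup>2 * x ^ 3) * (?g * ?g * (P * real k * (real k * lo)))"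
    by (simp add: R_def power2_eq_square)
  also have "\<dots> \<le> 287225937920000 * (x ^ 3 * x ^ 3 * x ^ 3) * (?g * ?g * ?g)"
    by (rule mult_mono[OF mult_left_mono[OF mult_right_mono[OF mult_mono[OF x3(3) x3(3)]]] mult_left_mono[OF g_lo]])
      (use x g g_lo0 in auto)
  also have "\<dots> = 287225937920000 * ((x ^ 3 * ?g) * (x ^ 3 * ?g) * (x ^ 3 * ?g))" by simp
  also have "\<dots> \<le> 8 * 10 ^ 24 * ((x ^ 3 * ?g) * (x ^ 3 * ?g) * (x ^ 3 * ?g))"
    by (rule mult_right_mono) (use x g in simp_all)
  also have "\<dots> = (2 * 10 ^ 8 * x ^ 3 * ?g) * (2 * 10 ^ 8 * x ^ 3 * ?g) * (2 * 10 ^ 8 * x ^ 3 * ?g)" by simp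
  also have "\<dots> \<le> (D\<^sup>2 * lo) * (D\<^sup>2 * lo) * (D\<^sup>2 * lo)"
    by (rule mult_mono[OF mult_mono[OF G1 G1] G1]) (use lo g x in auto)
  also have "\<dots> = lo\<^sup>2 * D ^ 6 * lo" by (simp add: eval_nat_numeral mult_ac)
  finally show ?thesis using lo by (simp only: mult_le_cancel_right_pos)
qed

lemma num6: "160 * P * real (card S) * (real (rk + 5) * x) \<le> D\<^sup>2 * lo"
proof -
  have "160 * P * real (card S) * (real (rk + 5) * x) \<le> 160 * P * real N * (214 * (real k * x\<^sup>2) * x)"
    using rk_le N Ppos x by (intro mult_mono mult_left_mono mult_right_mono) auto
  also have "\<dots> = 34240 * x ^ 3 * (P * real k * real N)" by (simp add: power2_eq_square power3_eq_cube)
  also have "\<dots> \<le> 2 * 10 ^ 8 * x ^ 3 * (P * real k * real N)" using x Ppos by simp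
  finally show ?thesis using G1 by linarith
qed

lemma exp_bounds: "real (card S) + 1 \<le> exp x" "real k \<le> exp x" "real n \<le> exp x"
proof -
  show s: "real (card S) + 1 \<le> exp x" "real n \<le> exp x" using N by linarith+
  have "real k * 1 \<le> 2 * 10 ^ 8 * x ^ 3 * real k" using x3(1) mult_right_mono[of 1 "2 * 10 ^ 8 * x ^ 3" "real k"] by simp
  then show "real k \<le> exp x" using H3 s by linarith
qed

end

lemma (in sampled_half) half_classified:
  assumes X: "best_approx S n k B X" and l: "km_opt S n k X l"
  shows "\<exists>\<phi>. bij_betw \<phi> {..<k} {..<k} \<and> (\<forall>b<k. dst n (avg B {i \<in> S. l i = \<phi> b}) (\<mu> b) \<le> 3 / 100 * D) \<and>
    (\<forall>a<k. \<forall>v. (\<forall>j. 0 \<le> v j) \<longrightarrow> row_ok a v \<longrightarrow> (\<forall>b<k. b \<noteq> a \<longrightarrow>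
      dst n v (avg B {i \<in> S. l i = \<phi> a}) < dst n v (avg B {i \<in> S. l i = \<phi> b})))"
proof -
  have rank: "rank_le S n k (\<lambda>i j. \<mu> (c i) j)"
    unfolding rank_le_def
  proof (rule exI[of _ "\<lambda>l i. of_bool (c i = l)"], rule exI[of _ \<mu>], intro ballI allI impI)
    fix i j assume "i \<in> S"
    then have "c i < k" by (rule c)
    then show "\<mu> (c i) j = (\<Sum>l<k. of_bool (c i = l) * \<mu> l j)" by simp
  qed
  have "fro S n (\<lambda>i j. X i j - \<mu> (c i) j) \<le> 8 * real k * R" by (rule best_approx_error[OF S(1) X rank op])
  then have XM: "(\<Sum>i\<in>S. (dst n (X i) (\<mu> (c i)))\<^sup>2) \<le> 8 * real k * R" by (simp add: fro_def dst_sq)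
  have E: "40000 * (8 * real k * R) \<le> D\<^sup>2 * real (card {i \<in> S. c i = r})" if r: "r < k" for r
  proof -
    have "40000 * (8 * real k * R) \<le> D\<^sup>2 * lo" using N0 by simp
    also have "\<dots> \<le> D\<^sup>2 * real (card {i \<in> S. c i = r})" by (intro mult_left_mono lo(2)[OF r]) simp
    finally show ?thesis .
  qed
  have ne: "{i \<in> S. c i = r} \<noteq> {}" if "r < k" for r
  proof
    assume e: "{i \<in> S. c i = r} = {}"
    have "lo \<le> real (card {i \<in> S. c i = r})" by (rule lo(2)[OF that])
    then show False using lo(1) unfolding e by simp
  qed
  obtain \<phi> where \<phi>: "bij_betw \<phi> {..<k} {..<k}" "near_partition S n k c \<mu> D (8 * real k * R) X (\<lambda>b. {i \<in> S. l i = \<phi> b})"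
    using km_opt_recovers[OF S(1) c XM D E ne l] by blast
  interpret clustered_half S I n k K T c \<mu> B P R D x lo \<rho> H e X "\<lambda>b. {i \<in> S. l i = \<phi> b}"
    by unfold_locales (rule X XM \<phi>(2))+
  show ?thesis
  proof (intro exI[of _ \<phi>] conjI allI impI)
    show "bij_betw \<phi> {..<k} {..<k}" by (rule \<phi>(1))
    show "dst n (avg B {i \<in> S. l i = \<phi> b}) (\<mu> b) \<le> 3 / 100 * D" if "b < k" for b by (rule centre_near[OF that])
    show "dst n v (avg B {i \<in> S. l i = \<phi> a}) < dst n v (avg B {i \<in> S. l i = \<phi> b})"
      if "a < k" "\<forall>j. 0 \<le> v j" "row_ok a v" "b < k" "b \<noteq> a" for a b v
      using row_classified[OF that(1,4,5) _ that(3)] that(2) by blast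
  qed
qed

text \<open>A property of the matrix alone that covers every way of breaking ties. The tolerance for
  the centres is what the matching of the two sets of labels relies on.\<close>

definition half_ok :: "nat set \<Rightarrow> nat set \<Rightarrow> nat \<Rightarrow> nat \<Rightarrow> (nat \<Rightarrow> nat) \<Rightarrow> (nat \<Rightarrow> nat \<Rightarrow> real) \<Rightarrow> real \<Rightarrow> (nat \<Rightarrow> nat \<Rightarrow> real) \<Rightarrow> bool" where
  "half_ok S S' n k c \<mu> D B \<longleftrightarrow> (\<forall>X l. best_approx S n k B X \<longrightarrow> km_opt S n k X l \<longrightarrow>
     (\<exists>\<phi>. bij_betw \<phi> {..<k} {..<k} \<and> (\<forall>b<k. dst n (avg B {i \<in> S. l i = \<phi> b}) (\<mu> b) \<le> 3 / 100 * D) \<and>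
       (\<forall>i\<in>S'. \<forall>b<k. b \<noteq> c i \<longrightarrow>
          dst n (B i) (avg B {i' \<in> S. l i' = \<phi> (c i)}) < dst n (B i) (avg B {i \<in> S. l i = \<phi> b}))))"

lemma best_approx_cong:
  assumes "\<And>i j. i \<in> S \<Longrightarrow> B i j = B' i j"
  shows "best_approx S n k B X \<longleftrightarrow> best_approx S n k B' X"
proof -
  have "fro S n (\<lambda>i j. B i j - Y i j) = fro S n (\<lambda>i j. B' i j - Y i j)" for Y
    by (rule fro_cong) (use assms in simp)
  then show ?thesis by (simp add: best_approx_def)
qed

lemma avg_cong: "(\<And>i j. i \<in> C \<Longrightarrow> B i j = B' i j) \<Longrightarrow> avg B C = avg B' C"
  by (auto simp: avg_def)

context half_model
begin

lemma exp_lt_power2: "exp x < 2 ^ nat \<lceil>2 * x\<rceil>"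
proof -
  let ?L = "nat \<lceil>2 * x\<rceil>"
  have L: "2 * x \<le> real ?L" "0 < ?L" using x by linarith+
  have h: "exp (1 / 2 :: real) < 2" using exp_le_quadratic[of "1 / 2"] by (simp add: power2_eq_square)
  have "exp x \<le> exp (real ?L * (1 / 2))" unfolding exp_le_cancel_iff using L(1) by linarith
  also have "\<dots> = exp (1 / 2) ^ ?L" by (rule exp_of_nat_mult)
  also have "\<dots> < 2 ^ ?L" using h L by (intro power_strict_mono) auto
  finally show ?thesis .
qed

text \<open>Sixteen factors \<open>7 / 8\<close> absorb one factor 8, and nine more are worth
  \<open>exp (- 1)\<close>; this fixes the constants in \<open>tn\<close>.\<close>

lemma tie_prob_small: "8 ^ k * (7 / 8) ^ (16 * k + 9 * nat \<lceil>x\<rceil>) \<le> exp (- x)"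
proof -
  let ?c = "nat \<lceil>x\<rceil>"
  have c: "x \<le> real ?c" by linarith
  have "(8::real) ^ k * (7 / 8) ^ (16 * k + 9 * ?c) = (8 * (7 / 8) ^ 16) ^ k * ((7 / 8) ^ 9) ^ ?c"
    by (simp add: power_add power_mult power_mult_distrib)
  also have "\<dots> \<le> 1 ^ k * (exp (- 1)) ^ ?c"
  proof (intro mult_mono power_mono)
    have "(7 / 8 :: real) ^ 9 \<le> 1 / 3" by (simp add: power_divide)
    also have "\<dots> \<le> exp (- 1)" using exp_le by (simp add: exp_minus field_simps)
    finally show "(7 / 8 :: real) ^ 9 \<le> exp (- 1)" .
    show "8 * (7 / 8 :: real) ^ 16 \<le> 1" by (simp add: power_divide)
  qed auto
  also have "\<dots> = exp (- real ?c)" by (simp add: exp_of_nat_mult[symmetric])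
  also have "\<dots> \<le> exp (- x)" using c by simp
  finally show ?thesis .
qed

lemma prob_not_sampled:
  "bprob (S \<times> {..<n}) M {g. \<not> (\<exists>I e. sampled_half S I n k rk tn c \<mu> (bmat g) P R D x lo \<rho> H e)} \<le> 4 * exp (- x)"
proof -
  let ?pr = "bprob (S \<times> {..<n}) M" and ?U = "\<lambda>r. {i \<in> S. c i = r}"
  let ?q = "nat \<lceil>2 * x\<rceil> * tn"
  define EO where "EO = {g. \<not> op_bound R S {..<n} (\<lambda>i j. cbit M g (i, j))}"
  \<comment> \<open>The slack is \<open>3 * x\<close> because the union over clusters and columns
    costs up to \<open>2 * x\<close>.\<close>
  define EC where "EC t = {g. 2 * (\<Sum>i\<in>?U (fst t). M (i, snd t)) + 3 * x \<le> (\<Sum>i\<in>?U (fst t). bmat g i (snd t))}" for t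
  define ER where "ER i = {g. \<not> (\<Sum>j<n. bmat g i j * 1) < 2 * (\<Sum>j<n. M (i, j) * 1) + 1 * (2 * x)}" for i
  define ET where "ET = {g. tied S {..<n} (bmat g) k ?q \<and>
      \<not> (\<exists>Q\<subseteq>{..<n}. card Q \<le> ?q \<and> (\<forall>r<k. \<not> rich (\<rho> r) (?U r) (tie_space S {..<n} (bmat g) k Q)))}"
  have Mh: "0 \<le> M y \<and> M y \<le> 1 / 2" "0 \<le> M y \<and> M y \<le> 1" for y using M_bounds[of y] P_half by auto
  have e3: "y * exp (- (z + x)) \<le> exp (- x)" if "y \<le> exp z" for y z :: real
  proof -
    have "y * exp (- (z + x)) \<le> exp z * exp (- (z + x))" using that by (intro mult_right_mono) auto
    also have "\<dots> = exp (- x)" by (simp add: exp_add[symmetric])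
    finally show ?thesis .
  qed
  have tn2: "2 * (16 * k + 9 * nat \<lceil>x\<rceil>) + k = tn" by (simp add: tn_def)
  have pO: "?pr EO \<le> exp (- x)"
  proof -
    have NP: "real N * P \<ge> 1"
    proof -
      have "1 * 1 \<le> x ^ 3 * real k" using x3(1) k1 x by (intro mult_mono) auto
      then have "1 \<le> 2 * 10 ^ 8 * x ^ 3 * real k" by simp
      also have "\<dots> \<le> P * lo" by (rule Plo)
      also have "\<dots> \<le> P * real N" using lo_N Ppos by (intro mult_left_mono) auto
      finally show ?thesis by (simp add: mult.commute)
    qed
    then have N0: "N > 0" by (cases N) auto
    have "?pr {g. \<not> op_bound (128 * (2 * x)\<^sup>2 * (real N * P)) S {..<n} (\<lambda>i j. cbit M g (i, j))} \<le> real N * exp (- (2 * x))"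
      by (rule prob_not_op_bound[OF S finite_lessThan M_bounds _ N0 NP]) (use P_half N x in auto)
    also have "128 * (2 * x)\<^sup>2 * (real N * P) = R" by (simp add: R_def power_mult_distrib)
    also have "real N * exp (- (2 * x)) \<le> exp (- x)" using e3[of "real N" x] N by simp
    finally show ?thesis by (simp add: EO_def)
  qed
  have pC: "?pr (\<Union>t\<in>{..<k} \<times> {..<n}. EC t) \<le> exp (- x)"
  proof -
    have "?pr (\<Union>t\<in>{..<k} \<times> {..<n}. EC t) \<le> (\<Sum>t\<in>{..<k} \<times> {..<n}. ?pr (EC t))" by (rule bprob_union_bound) simp
    also have "\<dots> \<le> real (card ({..<k} \<times> {..<n})) * exp (- (3 * x))"
    proof (rule sum_bounded_above)
      fix t assume "t \<in> {..<k} \<times> {..<n}"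
      then show "?pr (EC t) \<le> exp (- (3 * x))"
        unfolding EC_def by (intro column_upper_tail[OF S _ _ Mh(2)]) auto
    qed
    also have "\<dots> = real k * real n * exp (- (2 * x + x))" by (simp add: card_cartesian_product)
    also have "\<dots> \<le> exp (- x)"
    proof (rule e3)
      have "real k * real n \<le> exp x * exp x" using exp_bounds by (intro mult_mono) auto
      then show "real k * real n \<le> exp (2 * x)" by (simp add: exp_add[symmetric])
    qed
    finally show ?thesis .
  qed
  have pR: "?pr (\<Union>i\<in>S. ER i) \<le> exp (- x)"
  proof -
    have "?pr (\<Union>i\<in>S. ER i) \<le> (\<Sum>i\<in>S. ?pr (ER i))" by (rule bprob_union_bound[OF S])
    also have "\<dots> \<le> real (card S) * exp (- (2 * x))"
    proof (rule sum_bounded_above)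
      fix i assume "i \<in> S"
      then show "?pr (ER i) \<le> exp (- (2 * x))" unfolding ER_def by (intro row_upper_tail[OF S _ Mh(2)]) auto
    qed
    also have "\<dots> \<le> exp (- x)" using e3[of "real (card S)" x] exp_bounds(1) by simp
    finally show ?thesis .
  qed
  have pT: "?pr ET \<le> exp (- x)"
  proof -
    \<comment> \<open>The testing columns of cluster \<open>r\<close>, on all of which its bits have
      probability at least \<open>\<rho> r\<close>.\<close>
    define X where "X r = (if tn \<le> card (hi r) then hi r else {..<n})" for r
    have kL: "k < 2 ^ nat \<lceil>2 * x\<rceil>"
    proof -
      have "real k < 2 ^ nat \<lceil>2 * x\<rceil>" using exp_bounds(2) exp_lt_power2 by linarith
      then show ?thesis by (metis of_nat_less_iff of_nat_numeral of_nat_power)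
    qed
    have "?pr ET \<le> 8 ^ k * (7 / 8) ^ (16 * k + 9 * nat \<lceil>x\<rceil>)"
      unfolding ET_def tn2[symmetric]
    proof (rule prob_tied_eigenvectors_rich[OF S k kL Mh(1), where X = X])
      fix r
      show "?U r \<subseteq> S" by auto
      show "X r \<subseteq> {..<n} \<and> 2 * (16 * k + 9 * nat \<lceil>x\<rceil>) + k \<le> card (X r) \<and> (\<forall>i\<in>?U r. \<forall>j\<in>X r. \<rho> r \<le> M (i, j))"
        unfolding tn2 using tn_n by (auto simp: X_def hi_def \<rho>_def M_def \<mu>_def P_def)
    qed
    then show ?thesis using tie_prob_small by linarith
  qed
  have sub: "{g. \<not> (\<exists>I e. sampled_half S I n k rk tn c \<mu> (bmat g) P R D x lo \<rho> H e)} \<subseteq>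
      EO \<union> (\<Union>t\<in>{..<k} \<times> {..<n}. EC t) \<union> (\<Union>i\<in>S. ER i) \<union> ET"
  proof (rule subsetI, rule ccontr)
    fix g assume g: "g \<in> {g. \<not> (\<exists>I e. sampled_half S I n k rk tn c \<mu> (bmat g) P R D x lo \<rho> H e)}"
      and no: "g \<notin> EO \<union> (\<Union>t\<in>{..<k} \<times> {..<n}. EC t) \<union> (\<Union>i\<in>S. ER i) \<union> ET"
    let ?B = "bmat g"
    have "tied S {..<n} ?B k ?q \<Longrightarrow> \<exists>Q\<subseteq>{..<n}. card Q \<le> ?q \<and> (\<forall>r<k. \<not> rich (\<rho> r) (?U r) (tie_space S {..<n} ?B k Q))"
    proof -
      have "g \<notin> ET" using no by blast
      then show "tied S {..<n} ?B k ?q \<Longrightarrow> \<exists>Q\<subseteq>{..<n}. card Q \<le> ?q \<and> (\<forall>r<k. \<not> rich (\<rho> r) (?U r) (tie_space S {..<n} ?B k Q))"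
        unfolding ET_def by blast
    qed
    from columns_span[OF S k this] obtain I e where Ie: "I \<subseteq> S" "\<And>r. r < k \<Longrightarrow> \<rho> r * real (card (I \<inter> ?U r)) \<le> 1"
      "\<And>X j. best_approx S n k ?B X \<Longrightarrow> j < n \<Longrightarrow> \<exists>b. \<forall>i\<in>S - I. X i j = (\<Sum>d<k + ?q. b d * e d i)"
      by blast
    have "sampled_half S I n k rk tn c \<mu> ?B P R D x lo \<rho> H e"
    proof (rule sampled_half.intro)
      show "op_bound R S {..<n} (\<lambda>i j. ?B i j - \<mu> (c i) j)" using no by (simp add: EO_def M_def)
      show "0 \<le> \<rho> r \<and> \<rho> r * real (card (I \<inter> ?U r)) \<le> 1" if "r < k" for r
        using Ie(2)[OF that] pq Ppos by (auto simp: \<rho>_def)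
      show "H r \<subseteq> {..<n} \<and> card (H r) \<le> tn" for r by (auto simp: H_def hi_def)
      show "\<mu> r j \<le> \<rho> r" if "j < n" "j \<notin> H r" for r j
      proof (cases "tn \<le> card (hi r)")
        case True
        then show ?thesis using mu_bounds by (simp add: \<rho>_def)
      next
        case False
        then have "\<mu> r j \<noteq> P" using that by (simp add: H_def hi_def)
        then have "\<mu> r j \<le> min p q" by (auto simp: \<mu>_def P_def split: if_splits)
        then show ?thesis using False by (simp add: \<rho>_def)
      qed
      show "(\<Sum>i\<in>?U r. ?B i j) \<le> 4 * P * real (card (?U r))" if h: "r < k" "j < n" for r j
      proof -
        have "g \<notin> EC (r, j)" using no h by blast
        then have "(\<Sum>i\<in>?U r. ?B i j) \<le> 2 * (\<Sum>i\<in>?U r. M (i, j)) + 3 * x" by (simp add: EC_def)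
        also have "(\<Sum>i\<in>?U r. M (i, j)) \<le> real (card (?U r)) * P" by (rule sum_bounded_above) (use M_bounds in auto)
        also have "3 * x \<le> 2 * (real (card (?U r)) * P)"
        proof -
          have "x * 1 \<le> x ^ 3 * real k" using x3 k1 x by (intro mult_mono) auto
          then have "3 * x \<le> 2 * (2 * 10 ^ 8 * x ^ 3 * real k)" using x by simp
          also have "\<dots> \<le> 2 * (P * lo)" by (intro mult_left_mono Plo) simp
          also have "\<dots> \<le> 2 * (real (card (?U r)) * P)" using lo(2)[OF h(1)] Ppos by simp
          finally show ?thesis .
        qed
        finally show ?thesis by simp
      qed
      show "(\<Sum>j<n. ?B i j) \<le> 2 * (\<Sum>j<n. \<mu> (c i) j) + 2 * x" if "i \<in> S" for i
      proof -
        have "g \<notin> ER i" using no that by blast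
        then show ?thesis by (simp add: ER_def M_def)
      qed
      show "\<exists>b. \<forall>i\<in>S - I. X i j = (\<Sum>d<rk. b d * e d i)" if "best_approx S n k ?B X" "j < n" for X j
        using Ie(3)[OF that] by (simp add: rk_def)
      show "D \<le> dst n (\<mu> r) (\<mu> s)" if "r < k" "s < k" "r \<noteq> s" for r s
        using D(2)[OF that] by (simp add: \<mu>_def)
      show "P \<le> 1" using P_half by simp
      show "0 \<le> ?B i j \<and> ?B i j \<le> 1" for i j by simp
    qed (use S k c mu_bounds Ppos R_pos D lo x exp_bounds num0 num1 num2 num3 num4 num5 num6 Ie(1) in \<open>simp_all only:\<close>)
    then show False using g by blast
  qed
  have "?pr {g. \<not> (\<exists>I e. sampled_half S I n k rk tn c \<mu> (bmat g) P R D x lo \<rho> H e)} \<le>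
      ?pr (EO \<union> (\<Union>t\<in>{..<k} \<times> {..<n}. EC t) \<union> (\<Union>i\<in>S. ER i) \<union> ET)"
    by (rule bprob_mono[OF sub])
  also have "\<dots> \<le> ?pr EO + ?pr (\<Union>t\<in>{..<k} \<times> {..<n}. EC t) + ?pr (\<Union>i\<in>S. ER i) + ?pr ET"
    by (intro order_trans[OF measure_Un_le] add_right_mono measure_Un_le) auto
  also have "\<dots> \<le> 4 * exp (- x)" using pO pC pR pT by linarith
  finally show ?thesis .
qed

text \<open>Given the bits of \<open>S\<close>, every optimal clustering is handled by the same
  event \<open>row_ok\<close>, so only a union over the fresh rows remains.\<close>

theorem prob_half_fails:
  assumes S': "finite S'" "S \<inter> S' = {}" "\<And>i. i \<in> S' \<Longrightarrow> c i < k"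
  shows "bprob ((S \<union> S') \<times> {..<n}) M {g. \<not> half_ok S S' n k c \<mu> D (bmat g)} \<le> 4 * exp (- x) + 3 * real (card S') * exp (- x)"
proof -
  let ?A = "S \<times> {..<n}" and ?A' = "S' \<times> {..<n}"
  have fin: "finite ?A" "finite ?A'" "?A \<inter> ?A' = {}" using S S' by auto
  define glue where "glue g h = (\<lambda>y. if y \<in> ?A then g y else h y)" for g h :: "nat \<times> nat \<Rightarrow> bool"
  let ?bad = "{g. \<not> half_ok S S' n k c \<mu> D (bmat g)}"
  define good where "good g \<longleftrightarrow> (\<exists>I e. sampled_half S I n k rk tn c \<mu> (bmat g) P R D x lo \<rho> H e)" for g
  have inner: "bprob ?A' M {h. glue g h \<in> ?bad} \<le> 3 * real (card S') * exp (- x)"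
    if g: "good g" "g \<in> set_pmf (bits ?A M)" for g
  proof -
    obtain I e where Ie: "sampled_half S I n k rk tn c \<mu> (bmat g) P R D x lo \<rho> H e" using g(1) good_def by blast
    interpret sampled_half S I n k rk tn c \<mu> "bmat g" P R D x lo \<rho> H e by (rule Ie)
    \<comment> \<open>Configurations are almost surely \<open>False\<close> off their index set.
      Discarding this null set makes the glued and the conditioned matrix agree on \<open>S\<close>
      in all columns, including those beyond \<open>n\<close>.\<close>
    have "{h. glue g h \<in> ?bad} \<subseteq> (\<Union>i\<in>S'. {h. \<not> row_ok (c i) (bmat h i)}) \<union> {h. \<not> (\<forall>y. y \<notin> ?A' \<longrightarrow> \<not> h y)}"
    proof (rule subsetI, rule ccontr)
      fix h assume bad: "h \<in> {h. glue g h \<in> ?bad}"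
        and no: "h \<notin> (\<Union>i\<in>S'. {h. \<not> row_ok (c i) (bmat h i)}) \<union> {h. \<not> (\<forall>y. y \<notin> ?A' \<longrightarrow> \<not> h y)}"
      have h0: "\<not> h y" if "y \<notin> ?A'" for y using no that by blast
      have ok: "row_ok (c i) (bmat h i)" if "i \<in> S'" for i using no that by blast
      have g0: "\<not> g y" if "y \<notin> ?A" for y using set_bits_outside[OF fin(1) g(2) that] .
      have BS: "bmat (glue g h) i j = bmat g i j" if "i \<in> S" for i j
        using that S'(2) g0[of "(i, j)"] h0[of "(i, j)"] by (auto simp: glue_def)
      have BS': "bmat (glue g h) i j = bmat h i j" if "i \<in> S'" for i j
        using that S'(2) by (auto simp: glue_def)
      have "half_ok S S' n k c \<mu> D (bmat (glue g h))"
        unfolding half_ok_def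
      proof (intro allI impI)
        fix X l assume X: "best_approx S n k (bmat (glue g h)) X" and l: "km_opt S n k X l"
        have X': "best_approx S n k (bmat g) X"
          using X best_approx_cong[of S "bmat (glue g h)" "bmat g"] BS by blast
        have av: "avg (bmat (glue g h)) {i \<in> S. l i = s} = avg (bmat g) {i \<in> S. l i = s}" for s
          by (rule avg_cong) (use BS in blast)
        obtain \<phi> where \<phi>: "bij_betw \<phi> {..<k} {..<k}" "\<And>b. b < k \<Longrightarrow> dst n (avg (bmat g) {i \<in> S. l i = \<phi> b}) (\<mu> b) \<le> 3 / 100 * D"
          "\<And>a v b. a < k \<Longrightarrow> \<forall>j. 0 \<le> v j \<Longrightarrow> row_ok a v \<Longrightarrow> b < k \<Longrightarrow> b \<noteq> a \<Longrightarrow>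
            dst n v (avg (bmat g) {i \<in> S. l i = \<phi> a}) < dst n v (avg (bmat g) {i \<in> S. l i = \<phi> b})"
          using half_classified[OF X' l] by blast
        show "\<exists>\<phi>. bij_betw \<phi> {..<k} {..<k} \<and> (\<forall>b<k. dst n (avg (bmat (glue g h)) {i \<in> S. l i = \<phi> b}) (\<mu> b) \<le> 3 / 100 * D) \<and>
           (\<forall>i\<in>S'. \<forall>b<k. b \<noteq> c i \<longrightarrow> dst n (bmat (glue g h) i) (avg (bmat (glue g h)) {i' \<in> S. l i' = \<phi> (c i)})
              < dst n (bmat (glue g h) i) (avg (bmat (glue g h)) {i \<in> S. l i = \<phi> b}))"
          unfolding av
        proof (intro exI[of _ \<phi>] conjI allI impI ballI)
          show "bij_betw \<phi> {..<k} {..<k}" by (rule \<phi>(1))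
          show "dst n (avg (bmat g) {i \<in> S. l i = \<phi> b}) (\<mu> b) \<le> 3 / 100 * D" if "b < k" for b by (rule \<phi>(2)[OF that])
          fix i b assume i: "i \<in> S'" and b: "b < k" "b \<noteq> c i"
          show "dst n (bmat (glue g h) i) (avg (bmat g) {i' \<in> S. l i' = \<phi> (c i)})
              < dst n (bmat (glue g h) i) (avg (bmat g) {i \<in> S. l i = \<phi> b})"
            unfolding BS'[OF i] by (rule \<phi>(3)[OF S'(3)[OF i] _ ok[OF i] b]) simp
        qed
      qed
      then show False using bad by simp
    qed
    then have "bprob ?A' M {h. glue g h \<in> ?bad} \<le> bprob ?A' M ((\<Union>i\<in>S'. {h. \<not> row_ok (c i) (bmat h i)}) \<union> {h. \<not> (\<forall>y. y \<notin> ?A' \<longrightarrow> \<not> h y)})"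
      by (rule bprob_mono)
    also have "\<dots> \<le> bprob ?A' M (\<Union>i\<in>S'. {h. \<not> row_ok (c i) (bmat h i)}) + bprob ?A' M {h. \<not> (\<forall>y. y \<notin> ?A' \<longrightarrow> \<not> h y)}"
      by (rule measure_Un_le) auto
    also have "bprob ?A' M {h. \<not> (\<forall>y. y \<notin> ?A' \<longrightarrow> \<not> h y)} = 0"
      unfolding measure_pmf_zero_iff using set_bits_outside[OF fin(2)] by blast
    also have "bprob ?A' M (\<Union>i\<in>S'. {h. \<not> row_ok (c i) (bmat h i)}) \<le> (\<Sum>i\<in>S'. bprob ?A' M {h. \<not> row_ok (c i) (bmat h i)})"
      by (rule bprob_union_bound[OF S'(1)])
    also have "\<dots> \<le> real (card S') * (3 * exp (- x))"
    proof (rule sum_bounded_above)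
      fix i assume i: "i \<in> S'"
      show "bprob ?A' M {h. \<not> row_ok (c i) (bmat h i)} \<le> 3 * exp (- x)"
        by (rule prob_row_bad[OF S'(1) i S'(3)[OF i] M_bounds]) (simp add: M_def)
    qed
    finally show ?thesis by simp
  qed
  have "bprob (?A \<union> ?A') M ?bad = bexp ?A M (\<lambda>g. bprob ?A' M {h. glue g h \<in> ?bad})"
    unfolding glue_def by (rule bprob_union[OF fin])
  also have "\<dots> \<le> bexp ?A M (\<lambda>g. of_bool (g \<in> {g. \<not> good g}) + 3 * real (card S') * exp (- x))"
  proof (rule bexp_mono[OF fin(1)])
    fix g assume "g \<in> set_pmf (bits ?A M)"
    then show "bprob ?A' M {h. glue g h \<in> ?bad} \<le> of_bool (g \<in> {g. \<not> good g}) + 3 * real (card S') * exp (- x)"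
      using inner[of g] by (cases "good g") (auto intro: add_increasing2)
  qed
  also have "\<dots> = bprob ?A M {g. \<not> good g} + 3 * real (card S') * exp (- x)"
    unfolding bprob_eq_bexp using fin(1) by simp
  also have "bprob ?A M {g. \<not> good g} \<le> 4 * exp (- x)" unfolding good_def by (rule prob_not_sampled)
  also have "?A \<union> ?A' = (S \<union> S') \<times> {..<n}" by auto
  finally show ?thesis by simp
qed

end

section \<open>The random split\<close>

lemma prob_pair_le:
  assumes e: "0 \<le> \<epsilon>" "\<And>S. S \<in> set_pmf q \<Longrightarrow> S \<notin> F \<Longrightarrow> measure_pmf.prob p {a. (a, S) \<in> X} \<le> \<epsilon>"
    and F: "measure_pmf.prob q F \<le> \<delta>"
  shows "measure_pmf.prob (pair_pmf p q) X \<le> \<epsilon> + \<delta>"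
proof -
  have d: "0 \<le> \<delta>" using F measure_nonneg[of q F] by linarith
  have "ennreal (measure_pmf.prob (pair_pmf p q) X) = emeasure (pair_pmf q p) ((\<lambda>(x, y). (y, x)) -` X)"
    unfolding pair_commute_pmf[of p q] by (simp add: measure_pmf.emeasure_eq_measure[symmetric])
  also have "\<dots> = (\<integral>\<^sup>+z. indicator ((\<lambda>(x, y). (y, x)) -` X) z \<partial>pair_pmf q p)" by simp
  also have "\<dots> = (\<integral>\<^sup>+S. \<integral>\<^sup>+a. indicator {a. (a, S) \<in> X} a \<partial>p \<partial>q)"
    unfolding nn_integral_pair_pmf' by (intro nn_integral_cong) (simp add: indicator_def)
  also have "\<dots> = (\<integral>\<^sup>+S. ennreal (measure_pmf.prob p {a. (a, S) \<in> X}) \<partial>q)"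
    by (simp add: measure_pmf.emeasure_eq_measure)
  also have "\<dots> \<le> (\<integral>\<^sup>+S. indicator F S + ennreal \<epsilon> \<partial>q)"
  proof (rule nn_integral_mono_AE, unfold AE_measure_pmf_iff, intro ballI)
    fix S assume S: "S \<in> set_pmf q"
    show "ennreal (measure_pmf.prob p {a. (a, S) \<in> X}) \<le> indicator F S + ennreal \<epsilon>"
    proof (cases "S \<in> F")
      case True
      have "ennreal (measure_pmf.prob p {a. (a, S) \<in> X}) \<le> ennreal 1" by (rule ennreal_leI) simp
      also have "\<dots> \<le> indicator F S + ennreal \<epsilon>" using True by simp
      finally show ?thesis .
    next
      case False
      then show ?thesis using e(2)[OF S False] by (simp add: ennreal_leI)
    qed
  qed
  also have "\<dots> = emeasure q F + ennreal \<epsilon>" by (simp add: nn_integral_add)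
  also have "emeasure q F = ennreal (measure_pmf.prob q F)" by (rule measure_pmf.emeasure_eq_measure)
  also have "\<dots> + ennreal \<epsilon> = ennreal (measure_pmf.prob q F + \<epsilon>)" using e(1) by (simp add: ennreal_plus)
  finally have "ennreal (measure_pmf.prob (pair_pmf p q) X) \<le> ennreal (measure_pmf.prob q F + \<epsilon>)" .
  moreover have "0 \<le> measure_pmf.prob q F + \<epsilon>" using e(1) by simp
  ultimately have "measure_pmf.prob (pair_pmf p q) X \<le> measure_pmf.prob q F + \<epsilon>" by (simp only: ennreal_le_iff)
  then show ?thesis using F by linarith
qed

text \<open>Forbidding one more point multiplies the number of \<open>h\<close>-subsets by
  \<open>(M - h) / M\<close>, a ratio that only decreases as \<open>M\<close> shrinks and is at most
  \<open>\<theta>\<close> at the start.\<close>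

lemma choose_miss:
  assumes "t \<le> m" "h \<le> m" "0 < m" "real (m - h) \<le> \<theta> * real m" "\<theta> \<le> 1"
  shows "real ((m - t) choose h) \<le> \<theta> ^ t * real (m choose h)"
  using assms(1)
proof (induction t)
  case (Suc t)
  let ?M = "m - t"
  have M: "?M > 0" using Suc.prems by simp
  have \<theta>0: "0 \<le> \<theta>" using assms(3,4) by (metis mult_neg_pos not_less of_nat_0_le_iff of_nat_0_less_iff order_trans linorder_not_le)
  have step: "real (?M - h) \<le> \<theta> * real ?M"
  proof -
    have "real (m - h) - real t \<le> \<theta> * real m - \<theta> * real t"
      using assms(4) mult_right_mono[OF assms(5), of "real t"] by simp
    then have "real (m - h) - real t \<le> \<theta> * real ?M" using Suc.prems by (simp add: of_nat_diff right_diff_distrib)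
    moreover have "real (?M - h) \<le> max 0 (real (m - h) - real t)" using assms(2) by linarith
    ultimately show ?thesis using \<theta>0 by (simp add: max_def split: if_splits)
  qed
  have "?M * ((?M - 1) choose h) = (?M - h) * (?M choose h)" by (rule binomial_absorb_comp[symmetric])
  then have "real ?M * real ((?M - 1) choose h) = real (?M - h) * real (?M choose h)" by (metis of_nat_mult)
  also have "\<dots> \<le> (\<theta> * real ?M) * real (?M choose h)" using step by (intro mult_right_mono) auto
  finally have "real ?M * real ((?M - 1) choose h) \<le> real ?M * (\<theta> * real (?M choose h))" by (simp add: mult_ac)
  then have "real ((?M - 1) choose h) \<le> \<theta> * real (?M choose h)" using M by simp
  also have "\<dots> \<le> \<theta> * (\<theta> ^ t * real (m choose h))" using Suc \<theta>0 by (intro mult_left_mono) auto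
  finally show ?case by simp
qed simp

lemma card_avoiding:
  assumes "finite A" "W \<subseteq> A"
  shows "card {S. S \<subseteq> A \<and> card S = h \<and> S \<inter> W = {}} = (card A - card W) choose h"
proof -
  have "{S. S \<subseteq> A \<and> card S = h \<and> S \<inter> W = {}} = {S. S \<subseteq> A - W \<and> card S = h}" by auto
  then show ?thesis using n_subsets[of "A - W" h] assms by (simp add: card_Diff_subset finite_subset)
qed

lemma card_containing:
  assumes "finite A" "W \<subseteq> A" "h \<le> card A"
  shows "card {S. S \<subseteq> A \<and> card S = h \<and> W \<subseteq> S} = (card A - card W) choose (card A - h)"
proof -
  let ?X = "{S. S \<subseteq> A \<and> card S = h \<and> W \<subseteq> S}" and ?Y = "{S. S \<subseteq> A \<and> card S = card A - h \<and> S \<inter> W = {}}"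
  have "bij_betw (\<lambda>S. A - S) ?X ?Y"
  proof (rule bij_betw_byWitness[where f' = "\<lambda>S. A - S"])
    show "(\<lambda>S. A - S) ` ?X \<subseteq> ?Y" using assms by (auto simp: card_Diff_subset finite_subset)
    show "(\<lambda>S. A - S) ` ?Y \<subseteq> ?X" using assms by (auto simp: card_Diff_subset finite_subset)
  qed auto
  then have "card ?X = card ?Y" by (rule bij_betw_same_card)
  then show ?thesis using card_avoiding[OF assms(1,2)] by simp
qed

text \<open>From \<open>m = 3\<close> on, the larger half has at most two thirds of the rows, with
  equality at \<open>m = 3\<close>. Containing \<open>W\<close> means that the complementary half
  misses it, which gives the second bound by symmetry.\<close>

lemma random_split_misses:
  assumes m: "3 \<le> m" and W: "W \<subseteq> {..<m}" "card W = t"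
  shows "measure_pmf.prob (random_split m) {S. S \<inter> W = {}} \<le> (2 / 3) ^ t"
    "measure_pmf.prob (random_split m) {S. W \<subseteq> S} \<le> (2 / 3) ^ t"
proof -
  let ?h = "m div 2" and ?A = "{S. S \<subseteq> {..<m} \<and> card S = m div 2}"
  have tm: "t \<le> m" using card_mono[OF _ W(1)] W(2) by simp
  have cA: "card ?A = m choose ?h" using n_subsets[of "{..<m}" ?h] by simp
  have pos: "0 < real (m choose ?h)" by simp
  have fA: "finite ?A" by (rule finite_subset[of _ "Pow {..<m}"]) auto
  have ne: "?A \<noteq> {}" using cA by (metis card.empty less_irrefl of_nat_0 pos)
  have pr: "measure_pmf.prob (random_split m) E = real (card (?A \<inter> E)) / real (m choose ?h)" for E
    unfolding random_split_def measure_pmf_of_set[OF ne fA] cA ..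
  have "?A \<inter> {S. S \<inter> W = {}} = {S. S \<subseteq> {..<m} \<and> card S = ?h \<and> S \<inter> W = {}}" by auto
  then have "card (?A \<inter> {S. S \<inter> W = {}}) = (m - t) choose ?h" using card_avoiding[of "{..<m}" W ?h] W by simp
  moreover have "real ((m - t) choose ?h) \<le> (2 / 3) ^ t * real (m choose ?h)"
  proof (rule choose_miss[OF tm])
    have "3 * (m - ?h) \<le> 2 * m" using m by presburger
    then have "real (3 * (m - ?h)) \<le> real (2 * m)" by (rule of_nat_mono)
    then show "real (m - ?h) \<le> 2 / 3 * real m" by simp
  qed (use m in auto)
  ultimately show "measure_pmf.prob (random_split m) {S. S \<inter> W = {}} \<le> (2 / 3) ^ t"
    unfolding pr using pos by (simp only: pos_divide_le_eq)
  have "?A \<inter> {S. W \<subseteq> S} = {S. S \<subseteq> {..<m} \<and> card S = ?h \<and> W \<subseteq> S}" by auto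
  then have "card (?A \<inter> {S. W \<subseteq> S}) = (m - t) choose (m - ?h)" using card_containing[of "{..<m}" W ?h] W by simp
  moreover have "real ((m - t) choose (m - ?h)) \<le> (2 / 3) ^ t * real (m choose (m - ?h))"
  proof (rule choose_miss[OF tm])
    have "3 * (m - (m - ?h)) \<le> 2 * m" using m by presburger
    then have "real (3 * (m - (m - ?h))) \<le> real (2 * m)" by (rule of_nat_mono)
    then show "real (m - (m - ?h)) \<le> 2 / 3 * real m" by simp
  qed (use m in auto)
  moreover have "m choose (m - ?h) = m choose ?h" by (rule binomial_symmetric[symmetric]) simp
  ultimately show "measure_pmf.prob (random_split m) {S. W \<subseteq> S} \<le> (2 / 3) ^ t"
    unfolding pr using pos by (simp only: pos_divide_le_eq)
qed

text \<open>A set of at least \<open>t * b\<close> rows contains \<open>b\<close> disjoint blocks of size \<open>t\<close>; with high probability both halves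
  meet every block.\<close>

lemma random_split_balanced:
  assumes m: "3 \<le> m" and U: "\<And>r. r < k \<Longrightarrow> U r \<subseteq> {..<m} \<and> b * t \<le> card (U r)"
  shows "measure_pmf.prob (random_split m) {S. \<exists>r<k. card (U r \<inter> S) < b \<or> card (U r - S) < b}
    \<le> 2 * real (k * b) * (2 / 3) ^ t"
proof -
  let ?pr = "measure_pmf.prob (random_split m)"
  have fU: "finite (U r)" if "r < k" for r using U[OF that] finite_subset by blast
  have "\<exists>C. (\<forall>s\<in>{..<b}. C s \<subseteq> U r \<and> card (C s) = t) \<and> disjoint_family_on C {..<b}" if "r < k" for r
    by (rule disjoint_choice) (use U[OF that] fU[OF that] in auto)
  then obtain C where C: "\<And>r s. r < k \<Longrightarrow> s < b \<Longrightarrow> C r s \<subseteq> U r \<and> card (C r s) = t"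
    "\<And>r. r < k \<Longrightarrow> disjoint_family_on (C r) {..<b}" by (metis lessThan_iff)
  have meet: "b \<le> card (U r \<inter> Y)" if r: "r < k" and Y: "\<And>s. s < b \<Longrightarrow> C r s \<inter> Y \<noteq> {}" for r Y
  proof -
    have fin: "finite (C r s)" if "s < b" for s using C(1)[OF r that] fU[OF r] finite_subset by blast
    have "b = (\<Sum>s<b. 1)" by simp
    also have "\<dots> \<le> (\<Sum>s<b. card (C r s \<inter> Y))"
    proof (rule sum_mono)
      fix s assume "s \<in> {..<b}"
      then have "card (C r s \<inter> Y) > 0" using Y[of s] fin[of s] by (simp add: card_gt_0_iff)
      then show "1 \<le> card (C r s \<inter> Y)" by simp
    qed
    also have "\<dots> = card (\<Union>s<b. C r s \<inter> Y)"
      by (rule card_UN_disjoint[symmetric]) (use C(2)[OF r] fin in \<open>auto simp: disjoint_family_on_def\<close>)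
    also have "\<dots> \<le> card (U r \<inter> Y)" by (rule card_mono) (use fU[OF r] C(1)[OF r] in auto)
    finally show ?thesis .
  qed
  let ?E = "\<lambda>z. {S. S \<inter> C (fst z) (snd z) = {}} \<union> {S. C (fst z) (snd z) \<subseteq> S}"
  have "{S. \<exists>r<k. card (U r \<inter> S) < b \<or> card (U r - S) < b} \<subseteq> (\<Union>z\<in>{..<k} \<times> {..<b}. ?E z)"
  proof
    fix S assume "S \<in> {S. \<exists>r<k. card (U r \<inter> S) < b \<or> card (U r - S) < b}"
    then obtain r where r: "r < k" "card (U r \<inter> S) < b \<or> card (U r \<inter> - S) < b" by (auto simp: Diff_eq)
    then obtain s where "s < b" "C r s \<inter> S = {} \<or> C r s \<inter> - S = {}"
      using meet[OF r(1), of S] meet[OF r(1), of "- S"] by (meson not_le)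
    then show "S \<in> (\<Union>z\<in>{..<k} \<times> {..<b}. ?E z)" using r(1) by (intro UN_I[of "(r, s)"]) auto
  qed
  then have "?pr {S. \<exists>r<k. card (U r \<inter> S) < b \<or> card (U r - S) < b} \<le> ?pr (\<Union>z\<in>{..<k} \<times> {..<b}. ?E z)"
    by (rule measure_pmf.finite_measure_mono) simp
  also have "\<dots> \<le> (\<Sum>z\<in>{..<k} \<times> {..<b}. ?pr (?E z))"
    by (rule measure_pmf.finite_measure_subadditive_finite) auto
  also have "\<dots> \<le> real (card ({..<k} \<times> {..<b})) * (2 * (2 / 3) ^ t)"
  proof (rule sum_bounded_above)
    fix z assume z: "z \<in> {..<k} \<times> {..<b}"
    then have h: "C (fst z) (snd z) \<subseteq> {..<m}" "card (C (fst z) (snd z)) = t"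
    proof -
      have "fst z < k" "snd z < b" using z by auto
      then show "C (fst z) (snd z) \<subseteq> {..<m}" "card (C (fst z) (snd z)) = t"
        using C(1)[of "fst z" "snd z"] U[of "fst z"] by blast+
    qed
    have "?pr (?E z) \<le> ?pr {S. S \<inter> C (fst z) (snd z) = {}} + ?pr {S. C (fst z) (snd z) \<subseteq> S}" by (rule measure_Un_le) auto
    then show "?pr (?E z) \<le> 2 * (2 / 3) ^ t" using random_split_misses[OF m h] by linarith
  qed
  finally show ?thesis by (simp add: card_cartesian_product mult_ac)
qed

section \<open>The algorithm\<close>

lemma pick_bij: "bij_betw (pick S) {..<card S} S" if "finite S"
proof (rule bij_betwI')
  fix a b assume "a \<in> {..<card S}" "b \<in> {..<card S}"
  then show "(pick S a = pick S b) \<longleftrightarrow> a = b" using card_pick_le[of a S] card_pick_le[of b S] by (metis lessThan_iff)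
next
  fix a assume "a \<in> {..<card S}"
  then show "pick S a \<in> S" using pick_in_set_le by simp
next
  fix i assume i: "i \<in> S"
  have "{a \<in> S. a < i} \<subset> S" using i by blast
  then have "card {a \<in> S. a < i} < card S" using that by (rule psubset_card_mono[rotated])
  then show "\<exists>a\<in>{..<card S}. i = pick S a" using pick_card_in_set[OF i] by (intro bexI[of _ "card {a \<in> S. a < i}"]) auto
qed

text \<open>A dictionary between the submatrix, whose rows are renumbered, and arrays indexed by the
  original row numbers. \<open>pos\<close> inverts \<open>pick S\<close>.\<close>

locale row_sample =
  fixes S :: "nat set" and m n :: nat and B :: "nat \<Rightarrow> nat \<Rightarrow> real"
  assumes S: "S \<subseteq> {..<m}"
begin

definition A :: "real mat" where "A = submatrix (mat m n (\<lambda>(i, j). B i j)) S UNIV"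
definition pos :: "nat \<Rightarrow> nat" where "pos i = card {a \<in> S. a < i}"
definition fn :: "real mat \<Rightarrow> nat \<Rightarrow> nat \<Rightarrow> real" where "fn X i j = X $$ (pos i, j)"

lemma finS: "finite S" using S finite_subset by blast

lemma dimA: "dim_row A = card S" "dim_col A = n"
proof -
  have "{i. i < m \<and> i \<in> S} = S" using S by auto
  then show "dim_row A = card S" "dim_col A = n" by (simp_all add: A_def dim_submatrix)
qed

lemma A_index: "t < card S \<Longrightarrow> j < n \<Longrightarrow> A $$ (t, j) = B (pick S t) j"
proof -
  assume h: "t < card S" "j < n"
  have e: "{i. i < m \<and> i \<in> S} = S" using S by auto
  have "pick S t < m" using pick_in_set_le[OF h(1)] S by auto
  then show ?thesis unfolding A_def using h e by (subst submatrix_index) (auto simp: pick_UNIV)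
qed

lemma pos_pick: "t < card S \<Longrightarrow> pos (pick S t) = t"
  unfolding pos_def by (rule card_pick_le)

lemma pick_pos: "i \<in> S \<Longrightarrow> pick S (pos i) = i" and pos_less: "i \<in> S \<Longrightarrow> pos i < card S"
proof -
  assume i: "i \<in> S"
  show "pick S (pos i) = i" unfolding pos_def by (rule pick_card_in_set[OF i])
  obtain t where "t < card S" "i = pick S t" using pick_bij[OF finS] i unfolding bij_betw_def by blast
  then show "pos i < card S" using pos_pick by simp
qed

lemma sum_rows: "(\<Sum>t<card S. f t :: real) = (\<Sum>i\<in>S. f (pos i))"
proof -
  have "(\<Sum>i\<in>S. f (pos i)) = (\<Sum>t<card S. f (pos (pick S t)))"
    by (rule sum.reindex_bij_betw[symmetric]) (rule pick_bij[OF finS])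
  then show ?thesis using pos_pick by simp
qed

lemma frob_fro: "X \<in> carrier_mat (card S) n \<Longrightarrow> (frob_norm (A - X))\<^sup>2 = fro S n (\<lambda>i j. B i j - fn X i j)"
proof -
  assume X: "X \<in> carrier_mat (card S) n"
  have "(frob_norm (A - X))\<^sup>2 = (\<Sum>t<card S. \<Sum>j<n. ((A - X) $$ (t, j))\<^sup>2)"
    using X by (simp add: frob_norm_def sum_nonneg)
  also have "\<dots> = (\<Sum>i\<in>S. \<Sum>j<n. ((A - X) $$ (pos i, j))\<^sup>2)" by (rule sum_rows)
  also have "\<dots> = fro S n (\<lambda>i j. B i j - fn X i j)"
    unfolding fro_def by (intro sum.cong refl) (use X in \<open>simp add: A_index pos_less pick_pos fn_def\<close>)
  finally show ?thesis .
qed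

lemma best_approx_fn:
  assumes "best_rank_approx k A X"
  shows "X \<in> carrier_mat (card S) n" "best_approx S n k B (fn X)"
proof -
  have X: "X \<in> carrier_mat (card S) n" "vec_space.rank (card S) X \<le> k"
    and opt: "\<And>Y. Y \<in> carrier_mat (card S) n \<Longrightarrow> vec_space.rank (card S) Y \<le> k \<Longrightarrow> frob_norm (A - X) \<le> frob_norm (A - Y)"
    using assms unfolding best_rank_approx_def is_arg_min_linorder dimA by auto
  show "X \<in> carrier_mat (card S) n" by (rule X)
  show "best_approx S n k B (fn X)"
    unfolding best_approx_def
  proof (intro conjI allI impI)
    obtain f g :: "nat \<Rightarrow> nat \<Rightarrow> real" where fg: "\<And>i j. i < card S \<Longrightarrow> j < n \<Longrightarrow> X $$ (i, j) = (\<Sum>l<k. f l i * g l j)"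
      by (rule low_rank_factorization[OF X]) blast
    show "rank_le S n k (fn X)"
      unfolding rank_le_def
      by (rule exI[of _ "\<lambda>l i. f l (pos i)"], rule exI[of _ g]) (auto simp: fn_def fg pos_less)
  next
    fix Y assume "rank_le S n k Y"
    then obtain f g where fg: "\<And>i j. i \<in> S \<Longrightarrow> j < n \<Longrightarrow> Y i j = (\<Sum>l<k. f l i * g l j)" unfolding rank_le_def by blast
    let ?Z = "mat (card S) n (\<lambda>(t, j). \<Sum>l<k. f l (pick S t) * g l j)"
    have Z: "?Z \<in> carrier_mat (card S) n" by simp
    have "frob_norm (A - X) \<le> frob_norm (A - ?Z)" by (rule opt[OF Z rank_le_sum_outer])
    then have "(frob_norm (A - X))\<^sup>2 \<le> (frob_norm (A - ?Z))\<^sup>2" by (rule power_mono) (simp add: frob_norm_def sum_nonneg)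
    moreover have "fro S n (\<lambda>i j. B i j - fn ?Z i j) = fro S n (\<lambda>i j. B i j - Y i j)"
      by (rule fro_cong) (simp add: fn_def pos_less pick_pos fg)
    ultimately show "fro S n (\<lambda>i j. B i j - fn X i j) \<le> fro S n (\<lambda>i j. B i j - Y i j)"
      unfolding frob_fro[OF X(1)] frob_fro[OF Z] by simp
  qed
qed

lemma label_mean_avg:
  assumes X: "X \<in> carrier_mat (card S) n" and j: "j < n"
  shows "label_mean X l r $ j = avg (fn X) {i \<in> S. l (pos i) = r} j"
proof -
  let ?T = "{t. t < dim_row X \<and> l t = r}" and ?I = "{i \<in> S. l (pos i) = r}"
  have "bij_betw pos ?I ?T"
    by (rule bij_betw_byWitness[where f' = "pick S"])
      (use X pick_pos pos_less pos_pick pick_in_set_le in \<open>auto\<close>)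
  then have "card ?I = card ?T" "(\<Sum>i\<in>?I. X $$ (pos i, j)) = (\<Sum>t\<in>?T. X $$ (t, j))"
    by (auto dest: bij_betw_same_card sum.reindex_bij_betw[where g = "\<lambda>t. X $$ (t, j)"])
  then show ?thesis using X j by (simp add: label_mean_def row_mean_def avg_def fn_def)
qed

lemma vnorm_dst:
  assumes "dim_vec v = n" "dim_vec w = n"
  shows "vnorm (v - w) = dst n (\<lambda>j. v $ j) (\<lambda>j. w $ j)"
  using assms by (simp add: vnorm_def scalar_prod_def L2_set_def power2_eq_square atLeast0LessThan)

lemma km_cost_fn:
  assumes X: "X \<in> carrier_mat (card S) n"
  shows "kmeans_cost X l = km_cost S n (fn X) (\<lambda>i. l (pos i))"
proof -
  have "kmeans_cost X l = (\<Sum>i\<in>S. (vnorm (row X (pos i) - label_mean X l (l (pos i))))\<^sup>2)"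
    unfolding kmeans_cost_def using X sum_rows[of "\<lambda>t. (vnorm (row X t - label_mean X l (l t)))\<^sup>2"] by simp
  also have "\<dots> = km_cost S n (fn X) (\<lambda>i. l (pos i))"
    unfolding km_cost_def
  proof (rule sum.cong[OF refl])
    fix i assume i: "i \<in> S"
    have "vnorm (row X (pos i) - label_mean X l (l (pos i))) = dst n (\<lambda>j. row X (pos i) $ j) (\<lambda>j. label_mean X l (l (pos i)) $ j)"
      by (rule vnorm_dst) (use X in \<open>auto simp: label_mean_def row_mean_def\<close>)
    also have "\<dots> = dst n (fn X i) (avg (fn X) {i' \<in> S. l (pos i') = l (pos i)})"
      by (rule dst_cong) (use X pos_less[OF i] in \<open>auto simp: fn_def label_mean_avg[OF X]\<close>)
    finally show "(vnorm (row X (pos i) - label_mean X l (l (pos i))))\<^sup>2 =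
        (dst n (fn X i) (avg (fn X) {i' \<in> S. l (pos i') = l (pos i)}))\<^sup>2" by simp
  qed
  finally show ?thesis .
qed

lemma km_cost_cong:
  assumes "\<And>i. i \<in> S \<Longrightarrow> l i = l' i"
  shows "km_cost S n' X l = km_cost S n' X l'"
  unfolding km_cost_def
proof (rule sum.cong[OF refl])
  fix i assume i: "i \<in> S"
  have "{i' \<in> S. l i' = l i} = {i' \<in> S. l' i' = l' i}" using assms i by auto
  then show "(dst n' (X i) (avg X {i' \<in> S. l i' = l i}))\<^sup>2 = (dst n' (X i) (avg X {i' \<in> S. l' i' = l' i}))\<^sup>2" by (simp only:)
qed

lemma km_opt_fn:
  assumes X: "X \<in> carrier_mat (card S) n" and l: "kmeans k X l"
  shows "km_opt S n k (fn X) (\<lambda>i. l (pos i))"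
proof -
  have dX: "dim_row X = card S" using X by simp
  have lk: "\<And>t. t < card S \<Longrightarrow> l t < k" and opt: "\<And>l'. \<forall>t<card S. l' t < k \<Longrightarrow> kmeans_cost X l \<le> kmeans_cost X l'"
    using l unfolding kmeans_def is_arg_min_linorder dX by blast+
  show ?thesis
    unfolding km_opt_def
  proof (intro conjI allI impI ballI)
    show "l (pos i) < k" if "i \<in> S" for i using lk pos_less[OF that] by blast
    fix l' :: "nat \<Rightarrow> nat" assume l': "\<forall>i\<in>S. l' i < k"
    have "kmeans_cost X l \<le> kmeans_cost X (\<lambda>t. l' (pick S t))"
      by (rule opt) (use l' pick_in_set_le in blast)
    also have "\<dots> = km_cost S n (fn X) (\<lambda>i. l' (pick S (pos i)))" by (rule km_cost_fn[OF X])
    also have "\<dots> = km_cost S n (fn X) l'" by (rule km_cost_cong) (simp add: pick_pos)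
    finally show "km_cost S n (fn X) (\<lambda>i. l (pos i)) \<le> km_cost S n (fn X) l'" unfolding km_cost_fn[OF X] .
  qed
qed

lemma fnA: "i \<in> S \<Longrightarrow> j < n \<Longrightarrow> fn A i j = B i j"
  by (simp add: fn_def A_index pos_less pick_pos)

lemma centers_avg:
  assumes "centers k A \<nu>"
  obtains X l where "best_approx S n k B X" "km_opt S n k X l"
    "\<And>s. s < k \<Longrightarrow> dim_vec (\<nu> s) = n" "\<And>s j. s < k \<Longrightarrow> j < n \<Longrightarrow> \<nu> s $ j = avg B {i \<in> S. l i = s} j"
proof -
  obtain X l where X: "best_rank_approx k A X" and l: "kmeans k X l" and \<nu>: "\<And>s. s < k \<Longrightarrow> \<nu> s = label_mean A l s"
    using assms unfolding centers_def by blast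
  note bX = best_approx_fn[OF X]
  have cA: "A \<in> carrier_mat (card S) n" using dimA by (rule carrier_matI)
  have "avg (fn A) {i \<in> S. l (pos i) = s} j = avg B {i \<in> S. l (pos i) = s} j" if "j < n" for s j
    unfolding avg_def using fnA that by simp
  then have "\<nu> s $ j = avg B {i \<in> S. l (pos i) = s} j" if "s < k" "j < n" for s j
    using \<nu>[OF that(1)] label_mean_avg[OF cA that(2)] that(2) by simp
  moreover have "dim_vec (\<nu> s) = n" if "s < k" for s using \<nu>[OF that] dimA by (simp add: label_mean_def row_mean_def)
  ultimately show ?thesis using that[OF bX(2) km_opt_fn[OF bX(1) l]] by blast
qed

end

section \<open>From the two halves to the output\<close>

lemma half_recovers:
  fixes B :: "nat \<Rightarrow> nat \<Rightarrow> real"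
  assumes S: "S \<subseteq> {..<m}" "S' \<subseteq> {..<m}" and ok: "half_ok S S' n k c \<mu> D B" and c: "\<And>i. i \<in> S' \<Longrightarrow> c i < k"
    and \<nu>: "centers k (submatrix (mat m n (\<lambda>(i, j). B i j)) S UNIV) \<nu>"
  shows "\<exists>\<phi>. bij_betw \<phi> {..<k} {..<k} \<and> (\<forall>s<k. dim_vec (\<nu> s) = n) \<and>
    (\<forall>b<k. dst n (\<lambda>j. \<nu> (\<phi> b) $ j) (\<mu> b) \<le> 3 / 100 * D) \<and>
    (\<forall>l. assignment k (submatrix (mat m n (\<lambda>(i, j). B i j)) S' UNIV) \<nu> l \<longrightarrow> (\<forall>t<card S'. l t = \<phi> (c (pick S' t))))"
proof -
  interpret h: row_sample S m n B by unfold_locales (rule S)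
  interpret h': row_sample S' m n B by unfold_locales (rule S)
  obtain X l where X: "best_approx S n k B X" and l: "km_opt S n k X l" and dim: "\<And>s. s < k \<Longrightarrow> dim_vec (\<nu> s) = n"
    and av: "\<And>s j. s < k \<Longrightarrow> j < n \<Longrightarrow> \<nu> s $ j = avg B {i \<in> S. l i = s} j"
    using h.centers_avg[of k \<nu>] \<nu> unfolding h.A_def by blast
  obtain \<phi> where \<phi>: "bij_betw \<phi> {..<k} {..<k}" "\<And>b. b < k \<Longrightarrow> dst n (avg B {i \<in> S. l i = \<phi> b}) (\<mu> b) \<le> 3 / 100 * D"
    "\<And>i b. i \<in> S' \<Longrightarrow> b < k \<Longrightarrow> b \<noteq> c i \<Longrightarrow> dst n (B i) (avg B {i' \<in> S. l i' = \<phi> (c i)}) < dst n (B i) (avg B {i \<in> S. l i = \<phi> b})"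
    using ok X l unfolding half_ok_def by blast
  have \<phi>k: "\<phi> b < k" if "b < k" for b using \<phi>(1) that by (auto simp: bij_betw_def)
  have eq: "dst n (\<lambda>j. \<nu> s $ j) z = dst n (avg B {i \<in> S. l i = s}) z" if "s < k" for s z
    by (rule dst_cong) (use av[OF that] in auto)
  have asg: "l' t = \<phi> (c (pick S' t))" if a: "assignment k (submatrix (mat m n (\<lambda>(i, j). B i j)) S' UNIV) \<nu> l'" and t: "t < card S'" for l' t
  proof -
    let ?i = "pick S' t"
    have i: "?i \<in> S'" by (rule pick_in_set_le[OF t])
    have near: "nearest k \<nu> (row h'.A t) (l' t)"
      using a t h'.dimA unfolding assignment_def h'.A_def[symmetric] by simp
    have vn: "vnorm (row h'.A t - \<nu> s) = dst n (B ?i) (avg B {i \<in> S. l i = s})" if s: "s < k" for s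
    proof -
      have "vnorm (row h'.A t - \<nu> s) = dst n (\<lambda>j. row h'.A t $ j) (\<lambda>j. \<nu> s $ j)"
        by (rule h.vnorm_dst) (use h'.dimA dim[OF s] in auto)
      also have "\<dots> = dst n (B ?i) (avg B {i \<in> S. l i = s})"
        by (rule dst_cong) (use h'.dimA t h'.A_index[OF t] av[OF s] in auto)
      finally show ?thesis .
    qed
    have lk: "l' t < k" and min: "\<And>s. s < k \<Longrightarrow> vnorm (row h'.A t - \<nu> (l' t)) \<le> vnorm (row h'.A t - \<nu> s)"
      using near unfolding nearest_def is_arg_min_linorder by auto
    obtain b where b: "b < k" "l' t = \<phi> b" using \<phi>(1) lk unfolding bij_betw_def by blast
    show ?thesis
    proof (rule ccontr)
      assume "l' t \<noteq> \<phi> (c ?i)"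
      then have "b \<noteq> c ?i" using b by auto
      from \<phi>(3)[OF i b(1) this] have "dst n (B ?i) (avg B {i \<in> S. l i = \<phi> (c ?i)}) < dst n (B ?i) (avg B {i \<in> S. l i = l' t})"
        unfolding b(2) .
      moreover have ck: "\<phi> (c ?i) < k" using \<phi>k c[OF i] by blast
      ultimately show False using min[OF ck] unfolding vn[OF lk] vn[OF ck] by simp
    qed
  qed
  show ?thesis
  proof (intro exI[of _ \<phi>] conjI allI impI)
    show "bij_betw \<phi> {..<k} {..<k}" by (rule \<phi>(1))
    show "dim_vec (\<nu> s) = n" if "s < k" for s by (rule dim[OF that])
    show "dst n (\<lambda>j. \<nu> (\<phi> b) $ j) (\<mu> b) \<le> 3 / 100 * D" if "b < k" for b
      unfolding eq[OF \<phi>k[OF that]] by (rule \<phi>(2)[OF that])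
  qed (use asg in blast)
qed

theorem clustering_exact:
  fixes B :: "nat \<Rightarrow> nat \<Rightarrow> real"
  assumes S: "S \<subseteq> {..<m}" and ok: "half_ok S ({..<m} - S) n k c \<mu> D B" "half_ok ({..<m} - S) S n k c \<mu> D B"
    and c: "\<And>i. i < m \<Longrightarrow> c i < k"
    and D: "D > 0" "\<And>r s. r < k \<Longrightarrow> s < k \<Longrightarrow> r \<noteq> s \<Longrightarrow> D \<le> dst n (\<mu> r) (\<mu> s)"
    and cl: "clustering k (mat m n (\<lambda>(i, j). B i j)) S c'"
  shows "exact_clustering k m c c'"
proof -
  let ?A = "mat m n (\<lambda>(i, j). B i j)" and ?S' = "{..<m} - S"
  interpret h: row_sample S m n B by unfold_locales (rule S)
  interpret h': row_sample ?S' m n B by unfold_locales auto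
  obtain \<nu>1 \<nu>2 l1 l2 \<pi> where cen1: "centers k (submatrix ?A S UNIV) \<nu>1" and as2: "assignment k (submatrix ?A ?S' UNIV) \<nu>1 l2"
    and cen2: "centers k (submatrix ?A ?S' UNIV) \<nu>2" and as1: "assignment k (submatrix ?A S UNIV) \<nu>2 l1"
    and \<pi>: "\<And>s. s < k \<Longrightarrow> nearest k \<nu>1 (\<nu>2 s) (\<pi> s)"
    and c1: "\<And>t. t < dim_row (submatrix ?A S UNIV) \<Longrightarrow> c' (pick S t) = \<pi> (l1 t)"
    and c2: "\<And>t. t < dim_row (submatrix ?A ?S' UNIV) \<Longrightarrow> c' (pick ?S' t) = l2 t"
    using cl unfolding clustering_def Let_def dim_row_mat by blast
  obtain \<phi> where \<phi>: "bij_betw \<phi> {..<k} {..<k}" "\<And>s. s < k \<Longrightarrow> dim_vec (\<nu>1 s) = n"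
    "\<And>b. b < k \<Longrightarrow> dst n (\<lambda>j. \<nu>1 (\<phi> b) $ j) (\<mu> b) \<le> 3 / 100 * D" "\<And>t. t < card ?S' \<Longrightarrow> l2 t = \<phi> (c (pick ?S' t))"
    using half_recovers[OF S _ ok(1) _ cen1] c as2 by auto
  obtain \<psi> where \<psi>: "bij_betw \<psi> {..<k} {..<k}" "\<And>s. s < k \<Longrightarrow> dim_vec (\<nu>2 s) = n"
    "\<And>b. b < k \<Longrightarrow> dst n (\<lambda>j. \<nu>2 (\<psi> b) $ j) (\<mu> b) \<le> 3 / 100 * D" "\<And>t. t < card S \<Longrightarrow> l1 t = \<psi> (c (pick S t))"
    using half_recovers[OF _ S ok(2) _ cen2] c as1 S by (auto simp: subset_iff)
  have \<phi>k: "\<phi> b < k" "\<psi> b < k" if "b < k" for b using \<phi>(1) \<psi>(1) that by (auto simp: bij_betw_def)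
  \<comment> \<open>Estimated centres are within \<open>3 / 100 * D\<close> of the true means. A
    mismatched nearest centre would place two true means within \<open>12 / 100 * D\<close> of each
    other.\<close>
  have match: "\<pi> (\<psi> b) = \<phi> b" if b: "b < k" for b
  proof -
    let ?v = "\<lambda>j. \<nu>2 (\<psi> b) $ j"
    have near: "nearest k \<nu>1 (\<nu>2 (\<psi> b)) (\<pi> (\<psi> b))" by (rule \<pi>[OF \<phi>k(2)[OF b]])
    have vn: "vnorm (\<nu>2 (\<psi> b) - \<nu>1 s) = dst n ?v (\<lambda>j. \<nu>1 s $ j)" if "s < k" for s
      by (rule h.vnorm_dst) (use \<psi>(2)[OF \<phi>k(2)[OF b]] \<phi>(2)[OF that] in auto)
    have lk: "\<pi> (\<psi> b) < k" and min: "vnorm (\<nu>2 (\<psi> b) - \<nu>1 (\<pi> (\<psi> b))) \<le> vnorm (\<nu>2 (\<psi> b) - \<nu>1 (\<phi> b))"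
      using near \<phi>k(1)[OF b] unfolding nearest_def is_arg_min_linorder by auto
    obtain a where a: "a < k" "\<pi> (\<psi> b) = \<phi> a" using \<phi>(1) lk unfolding bij_betw_def by blast
    have le: "dst n ?v (\<lambda>j. \<nu>1 (\<phi> a) $ j) \<le> dst n ?v (\<lambda>j. \<nu>1 (\<phi> b) $ j)"
      using min unfolding a(2) vn[OF \<phi>k(1)[OF a(1)]] vn[OF \<phi>k(1)[OF b]] .
    have "a = b"
    proof (rule ccontr)
      assume "a \<noteq> b"
      then have "D \<le> dst n (\<mu> a) (\<mu> b)" using D(2) a b by simp
      moreover have "dst n (\<mu> a) (\<mu> b) \<le> dst n (\<mu> a) (\<lambda>j. \<nu>1 (\<phi> a) $ j) + dst n (\<lambda>j. \<nu>1 (\<phi> a) $ j) (\<mu> b)" by (rule dst_triangle)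
      moreover have "dst n (\<lambda>j. \<nu>1 (\<phi> a) $ j) (\<mu> b) \<le> dst n (\<lambda>j. \<nu>1 (\<phi> a) $ j) ?v + dst n ?v (\<mu> b)" by (rule dst_triangle)
      moreover have "dst n ?v (\<lambda>j. \<nu>1 (\<phi> b) $ j) \<le> dst n ?v (\<mu> b) + dst n (\<mu> b) (\<lambda>j. \<nu>1 (\<phi> b) $ j)" by (rule dst_triangle)
      ultimately show False
        using le \<phi>(3)[OF a(1)] \<phi>(3)[OF b] \<psi>(3)[OF b] D(1) dst_commute[of "\<mu> a" "\<lambda>j. \<nu>1 (\<phi> a) $ j" n]
          dst_commute[of "\<mu> b" "\<lambda>j. \<nu>1 (\<phi> b) $ j" n] dst_commute[of "\<lambda>j. \<nu>1 (\<phi> a) $ j" ?v n] by linarith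
    qed
    then show ?thesis using a by simp
  qed
  have lab: "c' i = \<phi> (c i)" if i: "i < m" for i
  proof (cases "i \<in> S")
    case True
    have t: "h.pos i < card S" "pick S (h.pos i) = i" using h.pos_less h.pick_pos True by auto
    have "c' (pick S (h.pos i)) = \<pi> (l1 (h.pos i))" by (rule c1) (use t h.dimA in \<open>simp add: h.A_def\<close>)
    then show ?thesis using \<psi>(4)[OF t(1)] match[OF c[OF i]] t by simp
  next
    case False
    then have i': "i \<in> ?S'" using i by simp
    have t: "h'.pos i < card ?S'" "pick ?S' (h'.pos i) = i" using h'.pos_less h'.pick_pos i' by auto
    have "c' (pick ?S' (h'.pos i)) = l2 (h'.pos i)" by (rule c2) (use t h'.dimA in \<open>simp add: h'.A_def\<close>)
    then show ?thesis using \<phi>(4)[OF t(1)] t by simp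
  qed
  \<comment> \<open>\<open>permutes\<close> requires the identity off the label set.\<close>
  define \<sigma> where "\<sigma> r = (if r < k then \<phi> r else r)" for r
  have "bij_betw \<sigma> {..<k} {..<k}" using \<phi>(1) by (rule bij_betw_cong[THEN iffD1, rotated]) (simp add: \<sigma>_def)
  then have "\<sigma> permutes {..<k}" by (rule bij_imp_permutes) (simp add: \<sigma>_def)
  then show ?thesis unfolding exact_clustering_def using lab c by (intro exI[of _ \<sigma>]) (simp add: \<sigma>_def)
qed

section \<open>Both halves together and the signal condition\<close>

lemma dst_blocks:
  assumes "Vr \<subseteq> {..<n}" "Vs \<subseteq> {..<n}"
  shows "(dst n (\<lambda>j. if j \<in> Vr then p else q) (\<lambda>j. if j \<in> Vs then p else q))\<^sup>2 = (p - q)\<^sup>2 * real (card (sym_diff Vr Vs))"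
proof -
  let ?d = "sym_diff Vr Vs"
  have "(dst n (\<lambda>j. if j \<in> Vr then p else q) (\<lambda>j. if j \<in> Vs then p else q))\<^sup>2 = (\<Sum>j<n. if j \<in> ?d then (p - q)\<^sup>2 else 0)"
    unfolding dst_sq by (rule sum.cong) (auto simp: power2_commute)
  also have "\<dots> = (\<Sum>j\<in>?d. (p - q)\<^sup>2)"
    by (rule sum.mono_neutral_cong_right) (use assms in auto)
  finally show ?thesis by simp
qed

lemma (in half_model) bsbm_eq_bits:
  "bsbm m n c V p q = map_pmf (\<lambda>g. mat m n (\<lambda>(i, j). bmat g i j)) (bits ({..<m} \<times> {..<n}) M)"
proof -
  have M: "M y = edge_prob c V p q (fst y) (snd y)" for y
    by (simp add: M_def \<mu>_def edge_prob_def)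
  have "(\<lambda>(i, j). bernoulli_pmf (edge_prob c V p q i j)) = (\<lambda>y. bernoulli_pmf (M y))"
    unfolding M by (simp add: case_prod_unfold)
  moreover have "mat m n (\<lambda>y. of_bool (g y)) = mat m n (\<lambda>(i, j). bmat g i j)" for g by auto
  ultimately show ?thesis unfolding bsbm_def bits_def by simp
qed

text \<open>Blocks of \<open>t\<close> rows with \<open>t\<close> at least \<open>6 * x\<close> are
  missed by a half with probability at most \<open>exp (- 2 * x)\<close>. Meeting every block
  guarantees \<open>b = Nc div t\<close> rows of each cluster in both halves. This loses a factor of
  at most \<open>14 * x\<close>, which turns \<open>2 * 10 ^ 8 * x ^ 3\<close> into
  \<open>28 * 10 ^ 8 * x ^ 4\<close>.\<close>

lemma exact_clustering_whp:
  assumes c: "\<And>i. i < m \<Longrightarrow> c i < k" and k: "0 < k" and pq: "0 \<le> p" "p \<le> 1 / 2" "0 \<le> q" "q \<le> 1 / 2"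
    and D: "D > 0" "\<And>r s. r < k \<Longrightarrow> s < k \<Longrightarrow> r \<noteq> s \<Longrightarrow>
        D \<le> dst n (\<lambda>j. if j \<in> V r then p else q) (\<lambda>j. if j \<in> V s then p else q)"
    and Nc: "\<And>r. r < k \<Longrightarrow> Nc \<le> card (left_cluster m c r)"
    and x: "x \<ge> 1" "real (m + n) + 1 \<le> exp x" and Y: "28 * 10 ^ 8 * x ^ 4 \<le> Y"
    and A1: "Y * (max p q * real k * real (m + n)) \<le> D\<^sup>2 * real Nc"
    and A2: "Y * real k \<le> max p q * real Nc" and A3: "Y * real k \<le> real n"
  shows "measure_pmf.prob (pair_pmf (bsbm m n c V p q) (random_split m))
      {(A, S). \<not> (\<forall>c'. clustering k A S c' \<longrightarrow> exact_clustering k m c c')} \<le> 13 * real m * exp (- x)"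
proof -
  let ?P = "max p q"
  define t where "t = nat \<lceil>6 * x\<rceil>"
  define b where "b = Nc div t"
  define bad where "bad = {(A, S). \<not> (\<forall>c'. clustering k A S c' \<longrightarrow> exact_clustering k m c c')}"
  define F where "F = {S. \<exists>r<k. card (left_cluster m c r \<inter> S) < b \<or> card (left_cluster m c r - S) < b}"
  have x4: "1 \<le> x ^ 4" "x \<le> x ^ 4" using x power_increasing[of 1 4 x] by (auto simp: one_le_power)
  have t: "6 * x \<le> real t" "real t \<le> 7 * x" "0 < t" using x by (simp_all add: t_def) linarith+
  have k1: "1 \<le> real k" using k by simp
  have Y7: "7 * x \<le> Y" "3 \<le> Y" "0 < Y"
  proof -
    have "2800000000 * x ^ 4 \<le> Y" using Y by simp
    then show "7 * x \<le> Y" "3 \<le> Y" "0 < Y" using x4 x by linarith+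
  qed
  have cluster_sum: "(\<Sum>r<k. card (left_cluster m c r)) = m"
  proof -
    have "(\<Sum>r<k. card (left_cluster m c r)) = (\<Sum>r<k. \<Sum>i\<in>{i \<in> {..<m}. c i = r}. 1)" by (simp add: left_cluster_def)
    also have "\<dots> = (\<Sum>i<m. 1)" by (rule sum.group) (use c in auto)
    finally show ?thesis by simp
  qed
  have kNc: "k * Nc \<le> m"
  proof -
    have "k * Nc = (\<Sum>r<k. Nc)" by simp
    also have "\<dots> \<le> (\<Sum>r<k. card (left_cluster m c r))" by (intro sum_mono) (use Nc in simp)
    finally show ?thesis by (simp add: cluster_sum)
  qed
  have NcY: "Y \<le> real Nc"
  proof -
    have "Y * 1 \<le> Y * real k" using k1 Y7 by (intro mult_left_mono) auto
    also have "\<dots> \<le> ?P * real Nc" by (rule A2)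
    also have "\<dots> \<le> 1 * real Nc" using pq by (intro mult_right_mono) auto
    finally show ?thesis by simp
  qed
  have m3: "3 \<le> m"
  proof -
    have "Nc \<le> k * Nc" using k by simp
    then have "real Nc \<le> real m" using kNc by linarith
    then show ?thesis using NcY Y7 by linarith
  qed
  have tNc: "t \<le> Nc" using t NcY Y7 by linarith
  have bt: "b * t \<le> Nc" "real Nc \<le> 14 * x * real b" "0 < b"
  proof -
    show "b * t \<le> Nc" by (simp add: b_def)
    show b0: "0 < b" using tNc t(3) by (simp add: b_def div_greater_zero_iff)
    have "Nc mod t < t" using t(3) by simp
    moreover have "Nc = b * t + Nc mod t" by (simp add: b_def)
    ultimately have "Nc \<le> b * t + 1 * t" by linarith
    also have "\<dots> \<le> b * t + b * t" using b0 by (intro add_left_mono mult_right_mono) auto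
    finally have "real Nc \<le> real (2 * b * t)" by (simp only: of_nat_le_iff mult_2 add_mult_distrib)
    also have "\<dots> = 2 * real b * real t" by simp
    also have "\<dots> \<le> 2 * real b * (7 * x)" using t(2) by (intro mult_left_mono) auto
    also have "\<dots> = 14 * x * real b" by simp
    finally show "real Nc \<le> 14 * x * real b" .
  qed
  have scale: "2 * 10 ^ 8 * x ^ 3 * u \<le> v * real b" if u: "Y * u \<le> v * real Nc" "0 \<le> u" "0 \<le> v" for u v :: real
  proof -
    have "14 * x * (2 * 10 ^ 8 * x ^ 3 * u) = 28 * 10 ^ 8 * x ^ 4 * u" by (simp add: eval_nat_numeral)
    also have "\<dots> \<le> Y * u" using Y u by (intro mult_right_mono) auto
    also have "\<dots> \<le> v * real Nc" by (rule u(1))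
    also have "\<dots> \<le> v * (14 * x * real b)" using bt(2) u by (intro mult_left_mono) auto
    finally have "14 * x * (2 * 10 ^ 8 * x ^ 3 * u) \<le> 14 * x * (v * real b)" by simp
    then show ?thesis using x by (simp only: mult_le_cancel_left_pos)
  qed
  have hm: "half_model S n k (m + n) c V p q D x (real b)"
    if S: "S \<subseteq> {..<m}" and bal: "\<And>r. r < k \<Longrightarrow> b \<le> card {i \<in> S. c i = r}" for S
  proof (rule half_model.intro)
    have fS: "finite S" using S finite_subset by blast
    show "finite S" by (rule fS)
    show "0 < k" by (rule k)
    show "c i < k" if "i \<in> S" for i using c S that by auto
    show "0 \<le> p" "p \<le> 1 / 2" "0 \<le> q" "q \<le> 1 / 2" by (rule pq)+
    show "D > 0" by (rule D)
    show "D \<le> dst n (\<lambda>j. if j \<in> V r then p else q) (\<lambda>j. if j \<in> V s then p else q)" if "r < k" "s < k" "r \<noteq> s" for r s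
      by (rule D(2)[OF that])
    show "real b > 0" using bt(3) by simp
    show "real b \<le> real (card {i \<in> S. c i = r})" if "r < k" for r using bal[OF that] by simp
    show "card S + n \<le> m + n" using card_mono[OF _ S] by simp
    show "real (m + n) + 1 \<le> exp x" "x \<ge> 1" by (rule x)+
    show "2 * 10 ^ 8 * x ^ 3 * max p q * real k * real (m + n) \<le> D\<^sup>2 * real b"
    proof -
      have "2 * 10 ^ 8 * x ^ 3 * (max p q * real k * real (m + n)) \<le> D\<^sup>2 * real b" by (rule scale[OF A1]) (use pq in auto)
      then show ?thesis by (simp only: mult.assoc)
    qed
    show "2 * 10 ^ 8 * x ^ 3 * real k \<le> max p q * real b" using scale[OF A2] pq by simp
    have "2 * 10 ^ 8 * x ^ 3 * real k \<le> Y * real k"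
    proof (rule mult_right_mono)
      have "x ^ 3 \<le> x ^ 4" using x(1) by (intro power_increasing) auto
      then have "2 * 10 ^ 8 * x ^ 3 \<le> 28 * 10 ^ 8 * x ^ 4" using x4 by simp
      then show "2 * 10 ^ 8 * x ^ 3 \<le> Y" using Y by linarith
    qed simp
    then show "2 * 10 ^ 8 * x ^ 3 * real k \<le> real n" using A3 by linarith
  qed
  have fixed: "measure_pmf.prob (bsbm m n c V p q) {A. (A, S) \<in> bad} \<le> 8 * exp (- x) + 3 * real m * exp (- x)"
    if S: "S \<in> set_pmf (random_split m)" "S \<notin> F" for S
  proof -
    let ?S' = "{..<m} - S" and ?M = "half_model.M c V p q" and ?\<mu> = "half_model.\<mu> V p q"
    have Sm: "S \<subseteq> {..<m}"
    proof -
      have fin: "finite {S. S \<subseteq> {..<m} \<and> card S = m div 2}" by (rule finite_subset[of _ "Pow {..<m}"]) auto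
      have "card {S. S \<subseteq> {..<m} \<and> card S = m div 2} = m choose (m div 2)" using n_subsets[of "{..<m}" "m div 2"] by simp
      then have "{S. S \<subseteq> {..<m} \<and> card S = m div 2} \<noteq> {}" by (metis card.empty binomial_eq_0_iff div_le_dividend not_less)
      then show ?thesis using S(1) fin by (simp add: random_split_def)
    qed
    have b1: "b \<le> card {i \<in> S. c i = r}" if "r < k" for r
    proof -
      have "left_cluster m c r \<inter> S = {i \<in> S. c i = r}" using Sm by (auto simp: left_cluster_def)
      moreover have "\<not> card (left_cluster m c r \<inter> S) < b" using S(2) that unfolding F_def by blast
      ultimately show ?thesis by simp
    qed
    have b2: "b \<le> card {i \<in> ?S'. c i = r}" if "r < k" for r
    proof -
      have "left_cluster m c r - S = {i \<in> ?S'. c i = r}" by (auto simp: left_cluster_def)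
      moreover have "\<not> card (left_cluster m c r - S) < b" using S(2) that unfolding F_def by blast
      ultimately show ?thesis by simp
    qed
    interpret h1: half_model S n k "m + n" c V p q D x "real b" by (rule hm[OF Sm b1])
    interpret h2: half_model ?S' n k "m + n" c V p q D x "real b" by (rule hm[OF Diff_subset b2])
    let ?pr = "bprob ({..<m} \<times> {..<n}) ?M"
    have un: "S \<union> ?S' = {..<m}" "?S' \<union> S = {..<m}" using Sm by auto
    have fS: "finite S" using Sm finite_subset by blast
    have p1: "?pr {g. \<not> half_ok S ?S' n k c ?\<mu> D (bmat g)} \<le> 4 * exp (- x) + 3 * real (card ?S') * exp (- x)"
      using h1.prob_half_fails[of ?S'] c un by auto
    have p2: "?pr {g. \<not> half_ok ?S' S n k c ?\<mu> D (bmat g)} \<le> 4 * exp (- x) + 3 * real (card S) * exp (- x)"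
      using h2.prob_half_fails[of S] c un fS Sm by (auto simp: subset_iff)
    have "measure_pmf.prob (bsbm m n c V p q) {A. (A, S) \<in> bad} = ?pr {g. (mat m n (\<lambda>(i, j). bmat g i j), S) \<in> bad}"
      unfolding h1.bsbm_eq_bits measure_map_pmf by (simp add: vimage_def)
    also have "\<dots> \<le> ?pr ({g. \<not> half_ok S ?S' n k c ?\<mu> D (bmat g)} \<union> {g. \<not> half_ok ?S' S n k c ?\<mu> D (bmat g)})"
    proof (rule bprob_mono, rule subsetI, rule ccontr)
      fix g assume g: "g \<in> {g. (mat m n (\<lambda>(i, j). bmat g i j), S) \<in> bad}"
        and no: "g \<notin> {g. \<not> half_ok S ?S' n k c ?\<mu> D (bmat g)} \<union> {g. \<not> half_ok ?S' S n k c ?\<mu> D (bmat g)}"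
      have ok: "half_ok S ?S' n k c ?\<mu> D (bmat g)" "half_ok ?S' S n k c ?\<mu> D (bmat g)" using no by blast+
      have sep: "D \<le> dst n (?\<mu> r) (?\<mu> s)" if "r < k" "s < k" "r \<noteq> s" for r s
        using D(2)[OF that] unfolding h1.\<mu>_def by simp
      have "exact_clustering k m c c'" if "clustering k (mat m n (\<lambda>(i, j). bmat g i j)) S c'" for c'
        by (rule clustering_exact[OF Sm ok c D(1) sep that])
      then have "\<forall>c'. clustering k (mat m n (\<lambda>(i, j). bmat g i j)) S c' \<longrightarrow> exact_clustering k m c c'" by blast
      moreover have "\<not> (\<forall>c'. clustering k (mat m n (\<lambda>(i, j). bmat g i j)) S c' \<longrightarrow> exact_clustering k m c c')"
        using g by (simp add: bad_def)
      ultimately show False by blast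
    qed
    also have "\<dots> \<le> ?pr {g. \<not> half_ok S ?S' n k c ?\<mu> D (bmat g)} + ?pr {g. \<not> half_ok ?S' S n k c ?\<mu> D (bmat g)}"
      by (rule measure_Un_le) auto
    also have "\<dots> \<le> 8 * exp (- x) + 3 * real (card S + card ?S') * exp (- x)" using p1 p2 by (simp add: algebra_simps)
    also have "card S + card ?S' = m"
      using card_Un_disjoint[of S ?S'] fS un by simp
    finally show ?thesis .
  qed
  have split: "measure_pmf.prob (random_split m) F \<le> 2 * exp (- x)"
  proof -
    have "measure_pmf.prob (random_split m) F \<le> 2 * real (k * b) * (2 / 3) ^ t"
      unfolding F_def
    proof (rule random_split_balanced[OF m3])
      fix r assume "r < k"
      then show "left_cluster m c r \<subseteq> {..<m} \<and> b * t \<le> card (left_cluster m c r)"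
        using Nc[of r] bt(1) by (auto simp: left_cluster_def)
    qed
    also have "\<dots> \<le> 2 * exp x * exp (- (2 * x))"
    proof (intro mult_mono)
      have "b \<le> Nc" by (simp add: b_def)
      then have "k * b \<le> m" using kNc mult_le_mono2 le_trans by blast
      then have "real (k * b) \<le> real m" by (rule of_nat_mono)
      then show "real (k * b) \<le> exp x" using x(2) by simp
      have "(2 / 3 :: real) \<le> exp (- (1 / 3))" using exp_ge_add_one_self[of "- (1 / 3) :: real"] by simp
      then have "(2 / 3 :: real) ^ t \<le> exp (- (1 / 3)) ^ t" by (intro power_mono) auto
      also have "\<dots> = exp (real t * - (1 / 3))" by (rule exp_of_nat_mult[symmetric])
      also have "\<dots> \<le> exp (- (2 * x))" unfolding exp_le_cancel_iff using t(1) by linarith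
      finally show "(2 / 3 :: real) ^ t \<le> exp (- (2 * x))" .
    qed auto
    also have "\<dots> = 2 * exp (- x)" by (simp add: exp_add[symmetric] mult.assoc)
    finally show ?thesis .
  qed
  have "measure_pmf.prob (pair_pmf (bsbm m n c V p q) (random_split m)) bad \<le> (8 * exp (- x) + 3 * real m * exp (- x)) + 2 * exp (- x)"
    by (rule prob_pair_le[OF _ fixed split]) auto
  also have "\<dots> = (10 + 3 * real m) * exp (- x)" by (simp add: algebra_simps)
  also have "\<dots> \<le> 13 * real m * exp (- x)" using m3 by (intro mult_right_mono) auto
  finally show ?thesis by (simp add: bad_def)
qed

lemma Delta_V_attained:
  assumes "2 \<le> k"
  obtains r0 s0 where "r0 < k" "s0 < k" "r0 \<noteq> s0" "Delta_V k V = of_nat (card (sym_diff (V r0) (V s0)))"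
    "\<And>r s. r < k \<Longrightarrow> s < k \<Longrightarrow> r \<noteq> s \<Longrightarrow> card (sym_diff (V r0) (V s0)) \<le> card (sym_diff (V r) (V s))"
proof -
  let ?I = "{(r, s). r < k \<and> s < k \<and> r \<noteq> s}" and ?f = "\<lambda>z. card (sym_diff (V (fst z)) (V (snd z)))"
  have "?I \<subseteq> {..<k} \<times> {..<k}" by auto
  then have "finite ?I" by (rule finite_subset) simp
  moreover have "(0, 1) \<in> ?I" using assms by auto
  then have "?I \<noteq> {}" by blast
  ultimately obtain z where z: "z \<in> ?I" "\<And>y. y \<in> ?I \<Longrightarrow> ?f z \<le> ?f y"
    using ex_min_finite[of ?I "\<lambda>z. real (?f z)"] by (metis (no_types, lifting) of_nat_le_iff)
  have "Delta_V k V = (INF y\<in>?I. of_nat (?f y))" unfolding Delta_V_def by (simp add: case_prod_unfold)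
  also have "\<dots> = of_nat (?f z)"
    by (intro antisym INF_lower[OF z(1)] INF_greatest) (use z(2) in simp)
  finally have "Delta_V k V = of_nat (?f z)" .
  then show ?thesis using that[of "fst z" "snd z"] z by auto
qed

text \<open>With one cluster the separation is infinite and the signal condition says nothing, but 0
  is the only available label.\<close>

lemma exact_clustering_single:
  assumes c: "\<And>i. i < m \<Longrightarrow> c i < 1" and A: "dim_row A = m" and S: "S \<subseteq> {..<m}" and cl: "clustering 1 A S c'"
  shows "exact_clustering 1 m c c'"
proof -
  let ?S' = "{..<dim_row A} - S"
  obtain \<nu>1 \<nu>2 l1 l2 \<pi> where as2: "assignment 1 (submatrix A ?S' UNIV) \<nu>1 l2" and as1: "assignment 1 (submatrix A S UNIV) \<nu>2 l1"
    and \<pi>: "\<And>s. s < 1 \<Longrightarrow> nearest 1 \<nu>1 (\<nu>2 s) (\<pi> s)"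
    and c1: "\<And>t. t < dim_row (submatrix A S UNIV) \<Longrightarrow> c' (pick S t) = \<pi> (l1 t)"
    and c2: "\<And>t. t < dim_row (submatrix A ?S' UNIV) \<Longrightarrow> c' (pick ?S' t) = l2 t"
    using cl unfolding clustering_def Let_def by blast
  have near0: "r = 0" if "nearest 1 \<nu> v r" for \<nu> v r using that by (simp add: nearest_def is_arg_min_def)
  have sets: "{i. i < dim_row A \<and> i \<in> S} = S" "{i. i < dim_row A \<and> i \<in> ?S'} = ?S'" using S A by auto
  have dims: "dim_row (submatrix A S UNIV) = card S" "dim_row (submatrix A ?S' UNIV) = card ?S'"
    unfolding dim_submatrix sets by simp_all
  have fS: "finite S" using S finite_subset by blast
  have "c' i = 0" if i: "i < m" for i
  proof (cases "i \<in> S")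
    case True
    then obtain t where t: "t < card S" "i = pick S t" using pick_bij[OF fS] unfolding bij_betw_def by blast
    have "l1 t = 0" using as1 t near0 unfolding assignment_def dims by blast
    then show ?thesis using c1[of t] t near0[OF \<pi>[of 0]] by (simp add: dims)
  next
    case False
    then have "i \<in> ?S'" using i A by simp
    moreover have "finite ?S'" by simp
    ultimately obtain t where t: "t < card ?S'" "i = pick ?S' t" using pick_bij[of ?S'] unfolding bij_betw_def by blast
    have "l2 t = 0" using as2 t near0 unfolding assignment_def dims by blast
    then show ?thesis using c2[of t] t by (simp add: dims)
  qed
  then show ?thesis using c unfolding exact_clustering_def by (intro exI[of _ id]) (simp add: permutes_id)
qed

theorem corollary1:
  fixes C :: real
  assumes "C > 0"
  shows "\<exists>K::real. K > 0 \<and>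
    (\<forall>(m::nat) (n::nat) (k::nat) (c :: nat \<Rightarrow> nat) (V :: nat \<Rightarrow> nat set) (p::real) (q::real).
       m > 0 \<longrightarrow> n > 0 \<longrightarrow>
       (\<forall>i<m. c i < k) \<longrightarrow> (\<forall>r<k. rel_size m c r > 0) \<longrightarrow>
       (\<forall>r<k. V r \<subseteq> {..<n}) \<longrightarrow>
       p \<in> {0..1/2} \<longrightarrow> q \<in> {0..1/2} \<longrightarrow>
       ennreal ((p - q)\<^sup>2 / sigma2 p q) \<ge>
         ennreal (K * ln (real (m + n + 1)) powr K * (real k * real (m + n) / (w_min k m c * real m)))
           / Delta_V k V \<longrightarrow>
       sigma2 p q \<ge> ln (real n) ^ 6 / real n + 1 / real m \<longrightarrow>
       measure_pmf.prob (pair_pmf (bsbm m n c V p q) (random_split m))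
         {(A, S). \<forall>c'. clustering k A S c' \<longrightarrow> exact_clustering k m c c'}
       \<ge> 1 - K * real m powr (- C))"
proof -
  \<comment> \<open>\<open>K\<close> appears as factor and as exponent. The factor supplies
    \<open>28 * 10 ^ 8 * (C + 10) ^ 4\<close>, and as an exponent \<open>K\<close> exceeds the 4
    needed for the logarithm.\<close>
  define K where "K = 28 * 10 ^ 8 * (C + 10) ^ 4"
  have "(1::real) ^ 4 \<le> (C + 10) ^ 4" using assms by (intro power_mono) auto
  then have K13: "13 \<le> K" by (simp add: K_def)
  have main: "1 - K * real m powr (- C) \<le> measure_pmf.prob (pair_pmf (bsbm m n c V p q) (random_split m))
         {(A, S). \<forall>c'. clustering k A S c' \<longrightarrow> exact_clustering k m c c'}"
    if m: "m > 0" and n: "n > 0" and c: "\<forall>i<m. c i < k" and rs: "\<forall>r<k. rel_size m c r > 0" and V: "\<forall>r<k. V r \<subseteq> {..<n}"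
      and p: "p \<in> {0..1/2}" and q: "q \<in> {0..1/2}"
      and hyp: "ennreal ((p - q)\<^sup>2 / sigma2 p q) \<ge>
         ennreal (K * ln (real (m + n + 1)) powr K * (real k * real (m + n) / (w_min k m c * real m))) / Delta_V k V"
      and sg: "sigma2 p q \<ge> ln (real n) ^ 6 / real n + 1 / real m"
    for m n k :: nat and c :: "nat \<Rightarrow> nat" and V :: "nat \<Rightarrow> nat set" and p q :: real
  proof -
    let ?pp = "pair_pmf (bsbm m n c V p q) (random_split m)"
    let ?good = "{(A, S). \<forall>c'. clustering k A S c' \<longrightarrow> exact_clustering k m c c'}"
    have k0: "0 < k" using c m by (metis gr_zeroI not_less_zero)
    have compl: "measure_pmf.prob ?pp ?good = 1 - measure_pmf.prob ?pp {(A, S). \<not> (\<forall>c'. clustering k A S c' \<longrightarrow> exact_clustering k m c c')}"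
    proof -
      have "?good = UNIV - {(A, S). \<not> (\<forall>c'. clustering k A S c' \<longrightarrow> exact_clustering k m c c')}" by auto
      then show ?thesis using measure_pmf.prob_compl[of "{(A, S). \<not> (\<forall>c'. clustering k A S c' \<longrightarrow> exact_clustering k m c c')}" ?pp] by simp
    qed
    show ?thesis
    proof (cases "k = 1")
      case True
      have "measure_pmf.prob ?pp ?good = 1"
      proof -
        have "set_pmf ?pp \<subseteq> ?good"
        proof
          fix z assume z: "z \<in> set_pmf ?pp"
          obtain A S where zz: "z = (A, S)" by (cases z)
          have A: "dim_row A = m" using z by (auto simp: zz bsbm_def)
          have fin: "finite {S. S \<subseteq> {..<m} \<and> card S = m div 2}" by (rule finite_subset[of _ "Pow {..<m}"]) auto
          have "card {S. S \<subseteq> {..<m} \<and> card S = m div 2} = m choose (m div 2)" using n_subsets[of "{..<m}" "m div 2"] by simp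
          then have ne: "{S. S \<subseteq> {..<m} \<and> card S = m div 2} \<noteq> {}" by (metis card.empty binomial_eq_0_iff div_le_dividend not_less)
          have S: "S \<subseteq> {..<m}" using z ne fin by (auto simp: zz random_split_def)
          show "z \<in> ?good" using exact_clustering_single[OF _ A S] c unfolding zz True by blast
        qed
        then show ?thesis by (simp add: measure_pmf.prob_eq_1 AE_measure_pmf_iff subset_iff)
      qed
      then show ?thesis using K13 by simp
    next
      case False
      then have k2: "2 \<le> k" using k0 by simp
      obtain r0 s0 where d0: "r0 < k" "s0 < k" "r0 \<noteq> s0" "Delta_V k V = of_nat (card (sym_diff (V r0) (V s0)))"
        "\<And>r s. r < k \<Longrightarrow> s < k \<Longrightarrow> r \<noteq> s \<Longrightarrow> card (sym_diff (V r0) (V s0)) \<le> card (sym_diff (V r) (V s))"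
        using Delta_V_attained[OF k2, of V] by blast
      define \<Delta> where "\<Delta> = card (sym_diff (V r0) (V s0))"
      have \<Delta>n: "\<Delta> \<le> n"
      proof -
        have "sym_diff (V r0) (V s0) \<subseteq> {..<n}" using V d0 by blast
        then show ?thesis unfolding \<Delta>_def using card_mono[of "{..<n}"] by fastforce
      qed
      obtain r1 where r1: "r1 < k" "\<And>r. r < k \<Longrightarrow> card (left_cluster m c r1) \<le> card (left_cluster m c r)"
        using ex_min_finite[of "{..<k}" "\<lambda>r. real (card (left_cluster m c r))"] k0 by auto
      define Nc where "Nc = card (left_cluster m c r1)"
      have wm: "w_min k m c * real m = real Nc"
      proof -
        have "w_min k m c = rel_size m c r1"
          unfolding w_min_def using r1 m by (intro Min_eqI) (auto simp: rel_size_def divide_right_mono)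
        then show ?thesis using m by (simp add: rel_size_def Nc_def)
      qed
      have Nc0: "0 < Nc" using rs r1(1) m by (auto simp: rel_size_def Nc_def zero_less_divide_iff)
      have Ncm: "Nc \<le> m" using card_mono[of "{..<m}" "left_cluster m c r1"] by (auto simp: Nc_def left_cluster_def)
      define L where "L = ln (real (m + n + 1))"
      have L1: "1 \<le> L"
      proof -
        have "exp 1 \<le> real (m + n + 1)" using exp_le m n by linarith
        then show ?thesis unfolding L_def by (subst ln_ge_iff) auto
      qed
      \<comment> \<open>\<open>exp (- x)\<close> is the power \<open>- (C + 10)\<close> of
        \<open>m + n + 1\<close>, so the factor \<open>m\<close> in the failure probability is
        absorbed with room to spare.\<close>
      define x where "x = (C + 10) * L"
      have x10: "10 \<le> x" using assms L1 mult_mono[of 10 "C + 10" 1 L] by (simp add: x_def)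
      define Y where "Y = K * L powr K"
      have YK: "28 * 10 ^ 8 * x ^ 4 \<le> Y"
      proof -
        have "L ^ 4 = L powr 4" using L1 by simp
        also have "\<dots> \<le> L powr K" using L1 K13 by (intro powr_mono) auto
        finally have "K * L ^ 4 \<le> Y" unfolding Y_def using K13 by (intro mult_left_mono) auto
        then show ?thesis by (simp add: x_def K_def power_mult_distrib mult_ac)
      qed
      have Y0: "0 < Y"
      proof -
        have "0 < 28 * 10 ^ 8 * x ^ 4" using x10 by simp
        then show ?thesis using YK by linarith
      qed
      let ?P = "max p q" and ?s = "sigma2 p q" and ?z = "(p - q)\<^sup>2 / sigma2 p q"
      have pq: "0 \<le> p" "p \<le> 1 / 2" "0 \<le> q" "q \<le> 1 / 2" using p q by auto
      have s0: "0 < ?s"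
      proof -
        have "0 < 1 / real m" using m by simp
        moreover have "0 \<le> ln (real n) ^ 6 / real n" by simp
        ultimately show ?thesis using sg by linarith
      qed
      \<comment> \<open>Since \<open>p\<close> and \<open>q\<close> are at most
        \<open>1 / 2\<close>, each is at most twice its Bernoulli variance.\<close>
      have Ps: "?P \<le> ?s"
      proof -
        have "p \<le> 2 * (p * (1 - p))" "q \<le> 2 * (q * (1 - q))"
          using mult_left_mono[of "1 / 2" "1 - p" p] mult_left_mono[of "1 / 2" "1 - q" q] pq by auto
        then show ?thesis by (auto simp: sigma2_def max_def)
      qed
      have P0: "0 < ?P"
      proof (rule ccontr)
        assume "\<not> 0 < ?P"
        then have "p = 0" "q = 0" using pq by auto
        then show False using s0 by (simp add: sigma2_def)
      qed
      have z0: "0 \<le> ?z" using s0 by simp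
      have zs: "?z * ?s = (p - q)\<^sup>2" using s0 by simp
      define y where "y = Y * (real k * real (m + n) / real Nc)"
      have y0: "0 < y" using Y0 k0 m Nc0 by (simp add: y_def)
      have hyp': "ennreal y / of_nat \<Delta> \<le> ennreal ?z"
        using hyp unfolding y_def Y_def L_def wm d0(4) \<Delta>_def by simp
      \<comment> \<open>If two right clusters coincided, division by 0 in \<open>ennreal\<close>
        would make the lower bound on the signal infinite.\<close>
      have \<Delta>0: "0 < \<Delta>"
      proof (rule ccontr)
        assume "\<not> 0 < \<Delta>"
        then show False using hyp' y0 by (simp add: top_unique split: if_splits)
      qed
      have yz: "y \<le> ?z * real \<Delta>"
      proof -
        have "ennreal y / of_nat \<Delta> = ennreal (y / real \<Delta>)"
          using y0 \<Delta>0 by (simp add: ennreal_of_nat_eq_real_of_nat divide_ennreal)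
        then have "y / real \<Delta> \<le> ?z" using hyp' z0 by simp
        then show ?thesis using \<Delta>0 by (simp add: field_simps)
      qed
      have yN: "y * real Nc = Y * (real k * real (m + n))" using Nc0 by (simp add: y_def)
      \<comment> \<open>The signal-to-noise ratio cannot exceed \<open>max p q\<close>, and the
        separation cannot exceed \<open>n\<close>. Hence the signal condition itself forces the
        clusters and \<open>n\<close> to be large, which is \<open>A2\<close> and
        \<open>A3\<close>.\<close>
      have zP: "?z \<le> ?P"
      proof -
        have "(p - q)\<^sup>2 \<le> ?P\<^sup>2" using pq by (intro power2_le_iff_abs_le[THEN iffD2]) (auto simp: abs_le_iff)
        also have "\<dots> \<le> ?P * ?s" unfolding power2_eq_square using Ps P0 by (intro mult_left_mono) auto
        finally show ?thesis using s0 by (simp add: pos_divide_le_eq)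
      qed
      define D where "D = sqrt ((p - q)\<^sup>2 * real \<Delta>)"
      have D2: "D\<^sup>2 = (p - q)\<^sup>2 * real \<Delta>" by (simp add: D_def)
      have big: "Y * (real k * real (m + n)) \<le> ?P * real n * real Nc"
      proof -
        have "Y * (real k * real (m + n)) \<le> ?z * real \<Delta> * real Nc" unfolding yN[symmetric] using yz by (intro mult_right_mono) auto
        also have "\<dots> \<le> ?P * real n * real Nc" using zP \<Delta>n z0 P0 by (intro mult_right_mono mult_mono) auto
        finally show ?thesis .
      qed
      have A1: "Y * (?P * real k * real (m + n)) \<le> D\<^sup>2 * real Nc"
      proof -
        have "Y * (?P * real k * real (m + n)) = ?P * (y * real Nc)" unfolding yN by (simp add: mult_ac)
        also have "\<dots> \<le> ?s * (?z * real \<Delta> * real Nc)"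
          using Ps P0 yz y0 s0 z0 by (intro mult_mono mult_right_mono) auto
        also have "\<dots> = (?z * ?s) * real \<Delta> * real Nc" by (simp only: mult_ac)
        finally show ?thesis unfolding zs D2 .
      qed
      have A2: "Y * real k \<le> ?P * real Nc"
      proof -
        have "Y * real k * real n \<le> Y * (real k * real (m + n))" using Y0 by (simp add: mult_left_mono mult.assoc)
        also have "\<dots> \<le> ?P * real Nc * real n" using big by (simp only: mult_ac)
        finally show ?thesis using n by (simp only: mult_le_cancel_right_pos of_nat_0_less_iff)
      qed
      have A3: "Y * real k \<le> real n"
      proof -
        have "Y * real k * real m \<le> Y * (real k * real (m + n))" using Y0 by (simp add: mult_left_mono mult.assoc)
        also have "\<dots> \<le> ?P * real n * real Nc" by (rule big)
        also have "\<dots> \<le> 1 * real n * real m" using pq P0 Ncm by (intro mult_mono) auto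
        finally have "Y * real k * real m \<le> real n * real m" by simp
        then show ?thesis using m by (simp only: mult_le_cancel_right_pos of_nat_0_less_iff)
      qed
      have D0: "0 < D"
      proof -
        have "0 < y" by (rule y0)
        then have "0 < ?z * real \<Delta>" using yz by linarith
        then have "p \<noteq> q" by auto
        then show ?thesis using \<Delta>0 by (simp add: D_def)
      qed
      have sep: "D \<le> dst n (\<lambda>j. if j \<in> V r then p else q) (\<lambda>j. if j \<in> V s then p else q)" if rs': "r < k" "s < k" "r \<noteq> s" for r s
      proof (rule power2_le_imp_le)
        have "D\<^sup>2 \<le> (p - q)\<^sup>2 * real (card (sym_diff (V r) (V s)))"
          unfolding D2 \<Delta>_def using d0(5)[OF rs'] by (intro mult_left_mono) auto
        also have "\<dots> = (dst n (\<lambda>j. if j \<in> V r then p else q) (\<lambda>j. if j \<in> V s then p else q))\<^sup>2"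
          by (rule dst_blocks[symmetric]) (use V rs' in auto)
        finally show "D\<^sup>2 \<le> (dst n (\<lambda>j. if j \<in> V r then p else q) (\<lambda>j. if j \<in> V s then p else q))\<^sup>2" .
      qed simp
      have ex: "exp x = real (m + n + 1) powr (C + 10)" unfolding x_def L_def powr_def by simp
      have xe: "real (m + n) + 1 \<le> exp x"
      proof -
        have "real (m + n + 1) powr 1 \<le> real (m + n + 1) powr (C + 10)" using assms by (intro powr_mono) auto
        then show ?thesis unfolding ex by simp
      qed
      have "measure_pmf.prob ?pp {(A, S). \<not> (\<forall>c'. clustering k A S c' \<longrightarrow> exact_clustering k m c c')} \<le> 13 * real m * exp (- x)"
        by (rule exact_clustering_whp[OF _ k0 pq D0 sep _ _ xe YK A1 A2 A3]) (use c r1(2) x10 in \<open>auto simp: Nc_def\<close>)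
      also have "\<dots> \<le> K * real m powr (- C)"
      proof -
        have "real m * exp (- x) = real m * real (m + n + 1) powr (- (C + 10))" unfolding exp_minus ex powr_minus ..
        also have "\<dots> \<le> real m powr 1 * real m powr (- (C + 10))"
          using m assms by (intro mult_mono powr_mono2') auto
        also have "\<dots> = real m powr (1 + - (C + 10))" by (rule powr_add[symmetric])
        also have "\<dots> \<le> real m powr (- C)" using m by (intro powr_mono) auto
        finally have "13 * (real m * exp (- x)) \<le> K * real m powr (- C)" using K13 by (intro mult_mono) auto
        then show ?thesis by simp
      qed
      finally show ?thesis unfolding compl by linarith
    qed
  qed
  show ?thesis using K13 main by (intro exI[of _ K]) auto
qed

end
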